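(* Consider the semiparametric model for independent clusters $(\mathbf X_i,\mathbf T_i,\mathbf Y_i)$, $i=1,\dots,n$, described in the context, with conditional mean $E(\mathbf Y_i\mid \mathbf X_i,\mathbf T_i)=\mu(\mathbf X_i\beta+\theta_+(\mathbf T_i))$, true parameter values $\beta_0\in\mathbb R^K$ and $\theta_{0,+}(\mathbf t)=\sum_{d=1}^D\theta_{0,d}(t_d)$, and joint densities $f_i$ that are smooth, bounded and satisfy $\lim_{|e_{ij}|\to\infty} f_i(\cdot,\cdot,\mathbf e_i)=0$ for all $j=1,\dots,m_i$. The efficient score for $\beta$ has the expression $\ell^*_\beta=(\ell^*_{\beta,1},\dots,\ell^*_{\beta,K})'$ with $$\ell^*_{\beta,k}=\sum_{i=1}^n\bigl(\mathbf X_{i\cdot k}-\psi^*_{k,+}(\mathbf T_i)\bigr)'\,\Delta_{i0}\,\Sigma_i^{-1}\,\bigl[\mathbf Y_i-\mu\bigl(\mathbf X_i\beta_0+\theta_{0,+}(\mathbf T_i)\bigr)\bigr],\qquad k=1,\dots,K,$$ where $\psi^*_{k,+}(\mathbf t)=\sum_{d=1}^D\psi^*_{kd}(t_d)$ satisfies $$\sum_{i=1}^n E\Bigl[\bigl(\mathbf X_{i\cdot k}-\psi^*_{k,+}(\mathbf T_i)\bigr)'\,\Delta_{i0}\,\Sigma_i^{-1}\,\Delta_{i0}\,\psi_d(\mathbf T_{i\cdot d})\Bigr]=0$$ for any $\psi_d\in L_2(\mathcal T_d)$, $d=1,\dots,D$.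
   Context: Data. There are $n$ independent clusters; cluster $i$ has $m_i$ observations, possibly correlated within the cluster. $\mathbf Y_i=(Y_{i1},\dots,Y_{im_i})'$ is the response; $\mathbf X_i$ is the $m_i\times K$ matrix with $j$th row $\mathbf X_{ij}'=(X_{ij1},\dots,X_{ijK})$, and $\mathbf X_{i\cdot k}=(X_{i1k},\dots,X_{im_ik})'$ is its $k$th column; $\mathbf T_i$ is the $m_i\times D$ matrix with $j$th row $\mathbf T_{ij}'=(T_{ij1},\dots,T_{ijD})$, and $\mathbf T_{i\cdot d}=(T_{i1d},\dots,T_{im_id})'$ is its $d$th column. $\mathcal T_d$ is the compact support of $T_{ijd}$, and $L_2(\mathcal T_d)$ is the space of square-integrable functions on $\mathcal T_d$. A multivariate function applied to a matrix is applied to each row, giving a column vector; a univariate function applied to a vector is applied entrywise. Model. $\mu$ is a known link function, $\beta\in\mathbb R^K$ is the Euclidean parameter, and $\theta_+(\mathbf t)=\theta_1(t_1)+\dots+\theta_D(t_D)$ is an unknown additive function with, for identifiability, $\int_{\mathcal T_d}\theta_d(t)\,dt=0$ for each $d$. The joint density of $(\mathbf X_i,\mathbf T_i,\mathbf Y_i)$ is written $f_i(\mathbf x_i,\mathbf t_i,\mathbf y_i-\mu(\mathbf x_i\beta+\theta_+(\mathbf t_i)))$, with $f_i$ unknown; $\mathbf e_i=(e_{i1},\dots,e_{im_i})'=\mathbf Y_i-\mu(\mathbf X_i\beta+\theta_+(\mathbf T_i))$. Apart from the conditional mean restriction and the conditions stated here and in the claim, no distributional assumption (such as normality of errors) is made.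 $\Sigma_i=\operatorname{var}(\mathbf Y_i\mid\mathbf X_i,\mathbf T_i)$ is the true covariance matrix, and $\Delta_{i0}$ is the $m_i\times m_i$ diagonal matrix with $j$th diagonal entry $\mu'(\mathbf X_{ij}'\beta_0+\theta_{0,+}(\mathbf T_{ij}))$. Efficient score. $\dot\ell_\beta$ is the ordinary score for $\beta$ when only $\beta$ is unknown. $\dot{\mathcal P}_f$ and $\dot{\mathcal P}_\theta$ are the tangent spaces of the models in which only $\{f_i\}_{i=1}^n$, respectively only $\theta_+$, is unknown. With $\Pi[\cdot\mid\cdot]$ denoting orthogonal projection and $^\bot$ orthogonal complement, the efficient score is $$\ell^*_\beta=\Pi[\dot\ell_\beta\mid\dot{\mathcal P}_f^\bot]-\Pi\bigl[\Pi(\dot\ell_\beta\mid\dot{\mathcal P}_f^\bot)\,\big|\,\Pi[\dot{\mathcal P}_\theta\mid\dot{\mathcal P}_f^\bot]\bigr].$$ Regularity conditions. (1) The $T_{ijd}$ are bounded uniformly in $i,j,d$; the joint distribution of any pair $T_{ijd}$, $T_{ij'd'}$ has a density with respect to Lebesgue measure that is bounded away from $0$ and infinity, uniformly in $i,j,j',d,d'$. (2) $X_{ij1}\equiv1$; the $X_{ijk}$, $k=2,\dots,K$, are bounded uniformly; the eigenvalues of $E(\mathbf X_{ij}\mathbf X_{ij}'\mid\mathbf T_{ij})$ are bounded away from $0$ uniformly in $i,j$. (3) The eigenvalues of $\Sigma_i$ are bounded away from $0$ and infinity uniformly in $i$. (4) $\mu$ is strictly monotone with continuous second derivative; $\inf_s\mu'(s)>0$;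 $\mu'$ and $\mu''$ are locally bounded around $\mathbf x'\beta_0+\theta_{0,+}(\mathbf t)$; $\mu(\pm v)$ increases slower than $v^L$ as $v\to\infty$ for some $L>0$. (5) At the true parameter values, there are constants $M_0,\sigma_0>0$ with $\max_{i\le n}M_0^2E\{\exp(|\mathbf e_i|^2/M_0^2)-1\mid\mathbf X_i,\mathbf T_i\}\le\sigma_0^2$ a.s. for all $n$.
   Formalization: Adds that the error scores (partial derivatives of f_i in e_ij over f_i) are square integrable, so the scores can be projected in L2; proved both for perturbations and ψ_d ranging over all of L2(T_d) and for both restricted to mean-zero functions. *)

theory Defs
  imports
    "HOL-Probability.Probability"
    "Jordan_Normal_Form.Char_Poly"
    "Jordan_Normal_Form.Gauss_Jordan_Elimination"
begin

(* Both vector libraries claim the same infix for the inner product and for components.  Below,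
   inner belongs to Euclidean spaces and scalar_prod to vectors of variable dimension; the dollar
   sign is component selection in real^'k and real^'d. *)
unbundle no inner_syntax
no_notation scalar_prod (infix \<open>\<bullet>\<close> 70)
no_notation vec_index (infixl \<open>$\<close> 100)


section \<open>Projections and tangent spaces in $L_2$ of a probability measure\<close>

(* Elements of L2 are represented by measurable functions, not by classes modulo null sets. *)
definition L2 :: "'w measure \<Rightarrow> ('w \<Rightarrow> real) set" where
  "L2 P = {g \<in> borel_measurable P. integrable P (\<lambda>\<omega>. (g \<omega>)\<^sup>2)}"

definition L2_closure :: "'w measure \<Rightarrow> ('w \<Rightarrow> real) set \<Rightarrow> ('w \<Rightarrow> real) set" where
  "L2_closure P S = {g \<in> L2 P. \<forall>\<epsilon>>0. \<exists>h\<in>S \<inter> L2 P. (\<integral>\<omega>. (g \<omega> - h \<omega>)\<^sup>2 \<partial>P) < \<epsilon>}"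

definition lin_span :: "('w \<Rightarrow> real) set \<Rightarrow> ('w \<Rightarrow> real) set" where
  "lin_span S = {h. \<exists>F c. finite F \<and> F \<subseteq> S \<and> h = (\<lambda>\<omega>. \<Sum>g\<in>F. c g * g \<omega>)}"

definition tangent_space :: "'w measure \<Rightarrow> ('w \<Rightarrow> real) set \<Rightarrow> ('w \<Rightarrow> real) set" where
  "tangent_space P scores = L2_closure P (lin_span scores)"

definition orth :: "'w measure \<Rightarrow> ('w \<Rightarrow> real) set \<Rightarrow> ('w \<Rightarrow> real) set" where
  "orth P S = {g \<in> L2 P. \<forall>h\<in>S. (\<integral>\<omega>. g \<omega> * h \<omega> \<partial>P) = 0}"

(* Projection onto the closure of a linear subspace S.  It is determined only up to
   P-null sets; proj picks a version. *)
definition is_proj ::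
  "'w measure \<Rightarrow> ('w \<Rightarrow> real) set \<Rightarrow> ('w \<Rightarrow> real) \<Rightarrow> ('w \<Rightarrow> real) \<Rightarrow> bool" where
  "is_proj P S h g \<longleftrightarrow> g \<in> L2_closure P S \<and> (\<lambda>\<omega>. h \<omega> - g \<omega>) \<in> orth P S"

definition proj :: "'w measure \<Rightarrow> ('w \<Rightarrow> real) \<Rightarrow> ('w \<Rightarrow> real) set \<Rightarrow> ('w \<Rightarrow> real)" where
  "proj P h S = (SOME g. is_proj P S h g)"

definition score_along ::
  "'w measure \<Rightarrow> (real \<Rightarrow> 'w \<Rightarrow> real) \<Rightarrow> ('w \<Rightarrow> real) \<Rightarrow> bool" where
  "score_along P loglik_path g \<longleftrightarrow> g \<in> L2 P \<and>
     (AE \<omega> in P. ((\<lambda>s. loglik_path s \<omega>) has_real_derivative g \<omega>) (at 0))"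


section \<open>The law of one cluster\<close>

(* A cluster with m observations is ((x, t), y), where x j, t j, y j are the covariate vectors and
   the response of observation j < m (elements of extensional product spaces over {..<m}). *)
type_synonym ('k, 'd) covs = "(nat \<Rightarrow> real ^ 'k) \<times> (nat \<Rightarrow> real ^ 'd)"
type_synonym ('k, 'd) obs = "('k, 'd) covs \<times> (nat \<Rightarrow> real)"
type_synonym ('k, 'd) err_density = "('k, 'd) covs \<Rightarrow> (nat \<Rightarrow> real) \<Rightarrow> real"

definition cov_space :: "nat \<Rightarrow> ('k::finite, 'd::finite) covs measure" where
  "cov_space m = (\<Pi>\<^sub>M j\<in>{..<m}. borel) \<Otimes>\<^sub>M (\<Pi>\<^sub>M j\<in>{..<m}. borel)"

definition lebesgue_prod :: "nat \<Rightarrow> (nat \<Rightarrow> real) measure" where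
  "lebesgue_prod m = (\<Pi>\<^sub>M j\<in>{..<m}. lborel)"

definition obs_X :: "nat \<Rightarrow> ('k, 'd) obs \<Rightarrow> real ^ 'k" where
  "obs_X j z = fst (fst z) j"

definition obs_T :: "nat \<Rightarrow> 'd \<Rightarrow> ('k, 'd::finite) obs \<Rightarrow> real" where
  "obs_T j d z = snd (fst z) j $ d"

definition obs_Y :: "nat \<Rightarrow> ('k, 'd) obs \<Rightarrow> real" where
  "obs_Y j z = snd z j"

definition additive :: "('d \<Rightarrow> real \<Rightarrow> real) \<Rightarrow> real ^ 'd::finite \<Rightarrow> real" where
  "additive \<theta> t = (\<Sum>d\<in>UNIV. \<theta> d (t $ d))"

definition predictor ::
  "real ^ 'k::finite \<Rightarrow> ('d::finite \<Rightarrow> real \<Rightarrow> real) \<Rightarrow> nat \<Rightarrow> ('k, 'd) obs \<Rightarrow> real" where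
  "predictor \<beta> \<theta> j z = inner (obs_X j z) \<beta> + additive \<theta> (snd (fst z) j)"

definition resid ::
  "nat \<Rightarrow> (real \<Rightarrow> real) \<Rightarrow> real ^ 'k::finite \<Rightarrow> ('d::finite \<Rightarrow> real \<Rightarrow> real) \<Rightarrow> ('k, 'd) obs \<Rightarrow> nat \<Rightarrow> real"
  where "resid m \<mu> \<beta> \<theta> z = (\<lambda>j\<in>{..<m}. obs_Y j z - \<mu> (predictor \<beta> \<theta> j z))"

definition lik ::
  "nat \<Rightarrow> (real \<Rightarrow> real) \<Rightarrow> real ^ 'k::finite \<Rightarrow> ('d::finite \<Rightarrow> real \<Rightarrow> real) \<Rightarrow> ('k, 'd) err_density
    \<Rightarrow> ('k, 'd) obs \<Rightarrow> real" where
  "lik m \<mu> \<beta> \<theta> f z = f (fst z) (resid m \<mu> \<beta> \<theta> z)"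

(* \<nu> dominates the laws of the covariates, which need not be absolutely continuous
   (the first regressor is constant). *)
definition cluster_law ::
  "('k::finite, 'd::finite) covs measure \<Rightarrow> nat \<Rightarrow> (real \<Rightarrow> real) \<Rightarrow> real ^ 'k \<Rightarrow> ('d \<Rightarrow> real \<Rightarrow> real)
    \<Rightarrow> ('k, 'd) err_density \<Rightarrow> ('k, 'd) obs measure" where
  "cluster_law \<nu> m \<mu> \<beta> \<theta> f =
     density (\<nu> \<Otimes>\<^sub>M lebesgue_prod m) (\<lambda>z. ennreal (lik m \<mu> \<beta> \<theta> f z))"

(* The sigma-algebra generated by the covariates of the cluster. *)
definition cov_algebra ::
  "nat \<Rightarrow> ('k::finite, 'd::finite) obs measure \<Rightarrow> ('k, 'd) obs measure" where
  "cov_algebra m P = vimage_algebra (space P) fst (cov_space m)"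

definition partial_deriv :: "((nat \<Rightarrow> real) \<Rightarrow> real) \<Rightarrow> nat \<Rightarrow> (nat \<Rightarrow> real) \<Rightarrow> real" where
  "partial_deriv g j e = deriv (\<lambda>v. g (e(j := v))) (e j)"

(* Smooth (continuously differentiable in the errors), bounded, and vanishing as any one error
   tends to plus or minus infinity. *)
definition smooth_vanishing ::
  "('k::finite, 'd::finite) covs measure \<Rightarrow> nat \<Rightarrow> ('k, 'd) err_density \<Rightarrow> bool" where
  "smooth_vanishing \<nu> m f \<longleftrightarrow>
     (\<forall>c\<in>space \<nu>. continuous_on (space (lebesgue_prod m)) (f c) \<and>
        (\<forall>j<m. (\<forall>e\<in>space (lebesgue_prod m). (\<lambda>v. f c (e(j := v))) differentiable (at (e j))) \<and>
               continuous_on (space (lebesgue_prod m)) (partial_deriv (f c) j))) \<and>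
     (\<exists>B. \<forall>c\<in>space \<nu>. \<forall>e\<in>space (lebesgue_prod m). f c e \<le> B) \<and>
     (\<forall>c\<in>space \<nu>. \<forall>e\<in>space (lebesgue_prod m). \<forall>j<m.
        ((\<lambda>v. f c (e(j := v))) \<longlongrightarrow> 0) at_infinity)"

definition in_model ::
  "('k::finite, 'd::finite) covs measure \<Rightarrow> nat \<Rightarrow> (real \<Rightarrow> real) \<Rightarrow> real ^ 'k \<Rightarrow> ('d \<Rightarrow> real \<Rightarrow> real)
    \<Rightarrow> ('k, 'd) err_density \<Rightarrow> bool" where
  "in_model \<nu> m \<mu> \<beta> \<theta> f \<longleftrightarrow>
     (\<lambda>(c, e). f c e) \<in> borel_measurable (\<nu> \<Otimes>\<^sub>M lebesgue_prod m) \<and>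
     (\<forall>c\<in>space \<nu>. \<forall>e\<in>space (lebesgue_prod m). 0 \<le> f c e) \<and>
     smooth_vanishing \<nu> m f \<and>
     prob_space (cluster_law \<nu> m \<mu> \<beta> \<theta> f) \<and>
     (\<forall>j<m. integrable (cluster_law \<nu> m \<mu> \<beta> \<theta> f) (obs_Y j) \<and>
        (AE z in cluster_law \<nu> m \<mu> \<beta> \<theta> f.
           real_cond_exp (cluster_law \<nu> m \<mu> \<beta> \<theta> f) (cov_algebra m (cluster_law \<nu> m \<mu> \<beta> \<theta> f))
             (obs_Y j) z
           = \<mu> (predictor \<beta> \<theta> j z)))"

(* The conditional covariance matrix of the responses given the covariates, P being the law
   of the cluster. *)
definition Sigma_mat ::
  "nat \<Rightarrow> ('k::finite, 'd::finite) obs measure \<Rightarrow> ('k, 'd) obs \<Rightarrow> real mat" where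
  "Sigma_mat m P z = (let E = real_cond_exp P (cov_algebra m P) in
     mat m m (\<lambda>(j, l). E (\<lambda>z'. (obs_Y j z' - E (obs_Y j) z') * (obs_Y l z' - E (obs_Y l) z')) z))"

definition Sigma_inv ::
  "nat \<Rightarrow> ('k::finite, 'd::finite) obs measure \<Rightarrow> ('k, 'd) obs \<Rightarrow> real mat" where
  "Sigma_inv m P z =
     (case mat_inverse (Sigma_mat m P z) of Some B \<Rightarrow> B | None \<Rightarrow> 0\<^sub>m m m)"

definition Delta_mat ::
  "nat \<Rightarrow> (real \<Rightarrow> real) \<Rightarrow> real ^ 'k::finite \<Rightarrow> ('d::finite \<Rightarrow> real \<Rightarrow> real) \<Rightarrow> ('k, 'd) obs \<Rightarrow> real mat"
  where "Delta_mat m \<mu> \<beta> \<theta> z = mat_diag m (\<lambda>j. deriv \<mu> (predictor \<beta> \<theta> j z))"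

definition XX_mat :: "('k::finite, 'd::finite) obs measure \<Rightarrow> nat \<Rightarrow> ('k, 'd) obs \<Rightarrow> real ^ 'k ^ 'k"
  where
  "XX_mat P j z =
     (\<chi> a b. real_cond_exp P (vimage_algebra (space P) (\<lambda>z'. snd (fst z') j) borel)
                (\<lambda>z'. obs_X j z' $ a * obs_X j z' $ b) z)"


section \<open>The efficient score\<close>

definition data_law ::
  "nat \<Rightarrow> (nat \<Rightarrow> nat) \<Rightarrow> (nat \<Rightarrow> ('k::finite, 'd::finite) covs measure) \<Rightarrow> (real \<Rightarrow> real)
    \<Rightarrow> real ^ 'k \<Rightarrow> ('d \<Rightarrow> real \<Rightarrow> real) \<Rightarrow> (nat \<Rightarrow> ('k, 'd) err_density)
    \<Rightarrow> (nat \<Rightarrow> ('k, 'd) obs) measure" where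
  "data_law n m \<nu> \<mu> \<beta> \<theta> f = (\<Pi>\<^sub>M i\<in>{..<n}. cluster_law (\<nu> i) (m i) \<mu> \<beta> \<theta> (f i))"

definition loglik ::
  "nat \<Rightarrow> (nat \<Rightarrow> nat) \<Rightarrow> (real \<Rightarrow> real) \<Rightarrow> real ^ 'k::finite \<Rightarrow> ('d::finite \<Rightarrow> real \<Rightarrow> real)
    \<Rightarrow> (nat \<Rightarrow> ('k, 'd) err_density) \<Rightarrow> (nat \<Rightarrow> ('k, 'd) obs) \<Rightarrow> real" where
  "loglik n m \<mu> \<beta> \<theta> f \<omega> = (\<Sum>i<n. ln (lik (m i) \<mu> \<beta> \<theta> (f i) (\<omega> i)))"

(* The ordinary score for the k-th coordinate of the Euclidean parameter.  As a derivative it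
   exists, and is unique, up to P-null sets (the likelihood vanishes on such a set). *)
definition beta_score ::
  "nat \<Rightarrow> (nat \<Rightarrow> nat) \<Rightarrow> (nat \<Rightarrow> ('k::finite, 'd::finite) covs measure) \<Rightarrow> (real \<Rightarrow> real)
    \<Rightarrow> real ^ 'k \<Rightarrow> ('d \<Rightarrow> real \<Rightarrow> real) \<Rightarrow> (nat \<Rightarrow> ('k, 'd) err_density)
    \<Rightarrow> 'k \<Rightarrow> (nat \<Rightarrow> ('k, 'd) obs) \<Rightarrow> real" where
  "beta_score n m \<nu> \<mu> \<beta> \<theta> f k =
     (SOME g. score_along (data_law n m \<nu> \<mu> \<beta> \<theta> f)
                (\<lambda>s. loglik n m \<mu> (\<beta> + s *\<^sub>R axis k 1) \<theta> f) g)"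

(* Scores of regular one-dimensional submodels s \<mapsto> F s through the true densities.
   Regularity is the classical requirement that the constraints (total mass, conditional mean)
   may be differentiated under the integral sign, expressed by the dominating function G.
   It cannot be dropped: moving vanishing mass to infinity makes the mean restriction
   invisible to the score. *)
definition f_scores ::
  "nat \<Rightarrow> (nat \<Rightarrow> nat) \<Rightarrow> (nat \<Rightarrow> ('k::finite, 'd::finite) covs measure) \<Rightarrow> (real \<Rightarrow> real)
    \<Rightarrow> real ^ 'k \<Rightarrow> ('d \<Rightarrow> real \<Rightarrow> real) \<Rightarrow> (nat \<Rightarrow> ('k, 'd) err_density)
    \<Rightarrow> ((nat \<Rightarrow> ('k, 'd) obs) \<Rightarrow> real) set" where
  "f_scores n m \<nu> \<mu> \<beta> \<theta> f = {g. \<exists>F G \<epsilon>. \<epsilon> > 0 \<and> F 0 = f \<and>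
     (\<forall>s i. \<bar>s\<bar> < \<epsilon> \<longrightarrow> i < n \<longrightarrow> in_model (\<nu> i) (m i) \<mu> \<beta> \<theta> (F s i) \<and>
        (\<forall>c\<in>space (\<nu> i). \<forall>e\<in>space (lebesgue_prod (m i)).
           (\<lambda>r. F r i c e) differentiable (at s) \<and> \<bar>deriv (\<lambda>r. F r i c e) s\<bar> \<le> G i c e)) \<and>
     (\<forall>i<n. integrable (\<nu> i \<Otimes>\<^sub>M lebesgue_prod (m i))
               (\<lambda>(c, e). (1 + (\<Sum>j<m i. \<bar>e j\<bar>)) * G i c e)) \<and>
     score_along (data_law n m \<nu> \<mu> \<beta> \<theta> f) (\<lambda>s. loglik n m \<mu> \<beta> \<theta> (F s)) g}"

(* Scores of the submodels s \<mapsto> \<theta> + s \<psi>, where V d is the linear space of admissible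
   perturbations of the d-th component function. *)
definition theta_scores ::
  "nat \<Rightarrow> (nat \<Rightarrow> nat) \<Rightarrow> (nat \<Rightarrow> ('k::finite, 'd::finite) covs measure) \<Rightarrow> (real \<Rightarrow> real)
    \<Rightarrow> real ^ 'k \<Rightarrow> ('d \<Rightarrow> real \<Rightarrow> real) \<Rightarrow> (nat \<Rightarrow> ('k, 'd) err_density)
    \<Rightarrow> ('d \<Rightarrow> (real \<Rightarrow> real) set) \<Rightarrow> ((nat \<Rightarrow> ('k, 'd) obs) \<Rightarrow> real) set" where
  "theta_scores n m \<nu> \<mu> \<beta> \<theta> f V = {g. \<exists>\<psi> \<epsilon>. \<epsilon> > 0 \<and> (\<forall>d. \<psi> d \<in> V d) \<and>
     (\<forall>s i. \<bar>s\<bar> < \<epsilon> \<longrightarrow> i < n \<longrightarrow> in_model (\<nu> i) (m i) \<mu> \<beta> (\<lambda>d t. \<theta> d t + s * \<psi> d t) (f i)) \<and>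
     score_along (data_law n m \<nu> \<mu> \<beta> \<theta> f)
       (\<lambda>s. loglik n m \<mu> \<beta> (\<lambda>d t. \<theta> d t + s * \<psi> d t) f) g}"

definition efficient_score ::
  "nat \<Rightarrow> (nat \<Rightarrow> nat) \<Rightarrow> (nat \<Rightarrow> ('k::finite, 'd::finite) covs measure) \<Rightarrow> (real \<Rightarrow> real)
    \<Rightarrow> real ^ 'k \<Rightarrow> ('d \<Rightarrow> real \<Rightarrow> real) \<Rightarrow> (nat \<Rightarrow> ('k, 'd) err_density)
    \<Rightarrow> ('d \<Rightarrow> (real \<Rightarrow> real) set) \<Rightarrow> 'k \<Rightarrow> (nat \<Rightarrow> ('k, 'd) obs) \<Rightarrow> real" where
  "efficient_score n m \<nu> \<mu> \<beta> \<theta> f V k =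
    (let P = data_law n m \<nu> \<mu> \<beta> \<theta> f;
         Pf_orth = orth P (tangent_space P (f_scores n m \<nu> \<mu> \<beta> \<theta> f));
         P\<theta> = tangent_space P (theta_scores n m \<nu> \<mu> \<beta> \<theta> f V);
         a = proj P (beta_score n m \<nu> \<mu> \<beta> \<theta> f k) Pf_orth;
         b = proj P a ((\<lambda>g. proj P g Pf_orth) ` P\<theta>)
     in (\<lambda>\<omega>. a \<omega> - b \<omega>))"


section \<open>Regularity conditions\<close>

definition L2_on :: "real set \<Rightarrow> (real \<Rightarrow> real) set" where
  "L2_on A = {\<psi> \<in> borel_measurable borel. set_integrable lborel A (\<lambda>t. (\<psi> t)\<^sup>2)}"

(* Perturbing \<theta> within L2_centred keeps the normalisation that identifies the components and
   the intercept; within L2_on the normalisation holds at the truth only. *)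
definition L2_centred :: "real set \<Rightarrow> (real \<Rightarrow> real) set" where
  "L2_centred A = {\<psi> \<in> L2_on A. (LINT t:A|lborel. \<psi> t) = 0}"

definition measure_support :: "real measure \<Rightarrow> real set" where
  "measure_support M = {x. \<forall>U. open U \<longrightarrow> x \<in> U \<longrightarrow> emeasure M U \<noteq> 0}"

(* In the conditions below, P i is the true law of cluster i < n. *)

(* The marginal density bound concerns the degenerate pair in which both coordinates coincide;
   it follows from the pairwise bound unless all clusters are singletons and 'd has one element. *)
definition cond_T ::
  "nat \<Rightarrow> (nat \<Rightarrow> nat) \<Rightarrow> ('d::finite \<Rightarrow> real set) \<Rightarrow> (nat \<Rightarrow> ('k::finite, 'd) obs measure) \<Rightarrow> bool" where
  "cond_T n m \<T> P \<longleftrightarrow>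
     (\<forall>d. compact (\<T> d)) \<and>
     (\<forall>i<n. \<forall>j<m i. \<forall>d. measure_support (distr (P i) borel (obs_T j d)) = \<T> d) \<and>
     (\<exists>B. \<forall>i<n. \<forall>j<m i. \<forall>d. AE z in P i. \<bar>obs_T j d z\<bar> \<le> B) \<and>
     (\<exists>c C. 0 < c \<and>
        (\<forall>i<n. \<forall>j<m i. \<forall>d. \<exists>p. distributed (P i) lborel (obs_T j d) p \<and>
           (AE t in lborel. t \<in> \<T> d \<longrightarrow> ennreal c \<le> p t \<and> p t \<le> ennreal C)) \<and>
        (\<forall>i<n. \<forall>j<m i. \<forall>j'<m i. \<forall>d d'. (j, d) \<noteq> (j', d') \<longrightarrow>
           (\<exists>p. distributed (P i) (lborel \<Otimes>\<^sub>M lborel) (\<lambda>z. (obs_T j d z, obs_T j' d' z)) p \<and>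
             (AE q in lborel \<Otimes>\<^sub>M lborel. q \<in> \<T> d \<times> \<T> d' \<longrightarrow> ennreal c \<le> p q \<and> p q \<le> ennreal C))))"

definition cond_X ::
  "nat \<Rightarrow> (nat \<Rightarrow> nat) \<Rightarrow> 'k \<Rightarrow> (nat \<Rightarrow> ('k::finite, 'd::finite) obs measure) \<Rightarrow> bool" where
  "cond_X n m k1 P \<longleftrightarrow>
     (\<forall>i<n. \<forall>j<m i. AE z in P i. obs_X j z $ k1 = 1) \<and>
     (\<exists>B. \<forall>i<n. \<forall>j<m i. \<forall>k. k \<noteq> k1 \<longrightarrow> (AE z in P i. \<bar>obs_X j z $ k\<bar> \<le> B)) \<and>
     (\<exists>c>0. \<forall>i<n. \<forall>j<m i. AE z in P i.
        \<forall>r v. v \<noteq> 0 \<longrightarrow> XX_mat (P i) j z *v v = r *\<^sub>R v \<longrightarrow> c \<le> r)"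

definition cond_Sigma ::
  "nat \<Rightarrow> (nat \<Rightarrow> nat) \<Rightarrow> (nat \<Rightarrow> ('k::finite, 'd::finite) obs measure) \<Rightarrow> bool" where
  "cond_Sigma n m P \<longleftrightarrow>
     (\<exists>c>0. \<exists>C. \<forall>i<n. AE z in P i. \<forall>r. eigenvalue (Sigma_mat (m i) (P i) z) r \<longrightarrow> c \<le> r \<and> r \<le> C)"

definition cond_link ::
  "nat \<Rightarrow> (nat \<Rightarrow> nat) \<Rightarrow> (real \<Rightarrow> real) \<Rightarrow> real ^ 'k \<Rightarrow> ('d \<Rightarrow> real \<Rightarrow> real)
    \<Rightarrow> (nat \<Rightarrow> ('k::finite, 'd::finite) obs measure) \<Rightarrow> bool" where
  "cond_link n m \<mu> \<beta> \<theta> P \<longleftrightarrow>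
     strict_mono \<mu> \<and>
     (\<forall>s. \<mu> differentiable (at s) \<and> deriv \<mu> differentiable (at s)) \<and>
     continuous_on UNIV (deriv (deriv \<mu>)) \<and>
     (\<exists>c>0. \<forall>s. c \<le> deriv \<mu> s) \<and>
     (\<exists>\<delta>>0. \<exists>C. \<forall>i<n. \<forall>j<m i. AE z in P i. \<forall>s. \<bar>s - predictor \<beta> \<theta> j z\<bar> \<le> \<delta> \<longrightarrow>
         \<bar>deriv \<mu> s\<bar> \<le> C \<and> \<bar>deriv (deriv \<mu>) s\<bar> \<le> C) \<and>
     (\<exists>L>0. \<mu> \<in> o[at_top](\<lambda>v. v powr L) \<and> (\<lambda>v. \<mu> (- v)) \<in> o[at_top](\<lambda>v. v powr L))"

(* nn_cond_exp rather than real_cond_exp, which has an uninformative value when the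
   conditional expectation is infinite. *)
definition cond_tail ::
  "nat \<Rightarrow> (nat \<Rightarrow> nat) \<Rightarrow> (real \<Rightarrow> real) \<Rightarrow> real ^ 'k \<Rightarrow> ('d \<Rightarrow> real \<Rightarrow> real)
    \<Rightarrow> (nat \<Rightarrow> ('k::finite, 'd::finite) obs measure) \<Rightarrow> bool" where
  "cond_tail n m \<mu> \<beta> \<theta> P \<longleftrightarrow>
     (\<exists>M0>0. \<exists>\<sigma>0>0. \<forall>i<n. AE z in P i.
        ennreal (M0\<^sup>2) * nn_cond_exp (P i) (cov_algebra (m i) (P i))
          (\<lambda>z'. ennreal (exp ((\<Sum>j<m i. (resid (m i) \<mu> \<beta> \<theta> z' j)\<^sup>2) / M0\<^sup>2) - 1)) z
        \<le> ennreal (\<sigma>0\<^sup>2))"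

(* Square integrability of the error scores, without which the ordinary scores need not lie in L2. *)
definition finite_information ::
  "nat \<Rightarrow> (nat \<Rightarrow> nat) \<Rightarrow> (real \<Rightarrow> real) \<Rightarrow> real ^ 'k \<Rightarrow> ('d \<Rightarrow> real \<Rightarrow> real)
    \<Rightarrow> (nat \<Rightarrow> ('k, 'd) err_density) \<Rightarrow> (nat \<Rightarrow> ('k::finite, 'd::finite) obs measure) \<Rightarrow> bool" where
  "finite_information n m \<mu> \<beta> \<theta> f P \<longleftrightarrow>
     (\<forall>i<n. \<forall>j<m i. integrable (P i) (\<lambda>z.
        (partial_deriv (f i (fst z)) j (resid (m i) \<mu> \<beta> \<theta> z) / lik (m i) \<mu> \<beta> \<theta> (f i) z)\<^sup>2))"

definition X_minus_psi ::
  "nat \<Rightarrow> 'k \<Rightarrow> ('d \<Rightarrow> real \<Rightarrow> real) \<Rightarrow> ('k::finite, 'd::finite) obs \<Rightarrow> real Matrix.vec" where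
  "X_minus_psi m k \<psi> z = Matrix.vec m (\<lambda>j. obs_X j z $ k - additive \<psi> (snd (fst z) j))"

definition psi_of_T :: "nat \<Rightarrow> 'd \<Rightarrow> (real \<Rightarrow> real) \<Rightarrow> ('k::finite, 'd::finite) obs \<Rightarrow> real Matrix.vec" where
  "psi_of_T m d \<psi> z = Matrix.vec m (\<lambda>j. \<psi> (obs_T j d z))"

end

theory Submission imports Defs
begin

text \<open>In the coordinates (covariates, errors) the law of a cluster has density f, and the scores of
  the error densities are, up to L2 closure, the mean-zero functions g with vanishing conditional
  moments E(e_j g | covariates).  Integration by parts shows that the error scores S_j have
  conditional covariances E(S_j e_l | covariates) = 1 if j = l and 0 otherwise, so that the
  projection of a score r'S onto the orthocomplement of that tangent space is r' Sigma^-1 e.  That the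
  remainder lies in the tangent space needs an approximation by bounded smooth functions that satisfy
  the moment constraints exactly, since only those perturb the density within the model.

  The scores of the additive component thus project to the functions A(psi) = r' Sigma^-1 e with
  r_j = mu'(eta_j) psi_+(T_j).  By the two-sided density bounds, the off-diagonal terms of the squared norm
  of A(psi) are compact perturbations of the diagonal ones, which gives a Garding inequality and hence
  closedness of the range of A.  So the least favourable direction is attained, and the
  orthogonality conditions are the normal equations.\<close>

text \<open>An L2 approximation of the remainder meets the moment constraints only approximately.
  The repair cannot use the errors, which are unbounded, so it uses the errors damped by 1 / (1 +
  |e|^2).

  A path theta + s psi with unbounded psi may leave the model or have a score outside L2, whereas r'
  Sigma^-1 e is in L2 for every L2 direction r. Hence the argument runs in the efficient parts, and
  scores are recovered from bounded psi, which are dense.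

  A(psi) need not determine psi: without centring, constants can move between components. So
  closedness of the range cannot come from a lower bound for the norm of A. The kernels of the
  compact terms are approximated by finite sums of rectangles, which gives the lower bound up to
  finitely many integrals of psi over sets, and these functionals are eliminated one at a time. One
  observation is enough for the bound, as all observations share the same psi.

  Projections and conditional expectations are versions chosen up to null sets, so the identities
  between them hold almost everywhere.\<close>

abbreviation "bm M == borel_measurable M"
abbreviation "lborel2 == lborel \<Otimes>\<^sub>M lborel"
abbreviation "errs m == space (lebesgue_prod m)"
abbreviation "aint M A u == \<bar>LINT x|M. indicator A x * (u x :: real)\<bar>"

lemmas bi_integrable_add = Bochner_Integration.integrable_add
  and bi_integrable_bound = Bochner_Integration.integrable_bound
  and bi_integrable_cong = Bochner_Integration.integrable_cong
  and bi_integrable_diff = Bochner_Integration.integrable_diff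
  and bi_integrable_sum = Bochner_Integration.integrable_sum
  and bi_integral_add = Bochner_Integration.integral_add
  and bi_integral_cong = Bochner_Integration.integral_cong
  and bi_integral_sum = Bochner_Integration.integral_sum

section \<open>Hilbert space geometry of square-integrable functions\<close>

lemma L2I: "g : bm M ==> integrable M (%x. (g x)^2) ==> g : L2 M"
  by (simp add: L2_def)

lemma L2D: assumes "g : L2 M"
  shows "g : bm M" "integrable M (%x. (g x)^2)"
  using assms by (auto simp: L2_def)

lemma L2_mult_integrable:
  assumes "f : L2 M" "g : L2 M"
  shows "integrable M (%x. f x * g x)"
proof (rule bi_integrable_bound)
  show "integrable M (%x. (f x)^2 + (g x)^2)" using assms by (auto dest: L2D)
  show "(%x. f x * g x) : bm M" using assms[THEN L2D(1)] by measurable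
  have "\<bar>a * b\<bar> <= a^2 + b^2" for a b :: real
  proof -
    have "0 <= (\<bar>a\<bar> - \<bar>b\<bar>)^2" by simp
    then have "2 * (\<bar>a\<bar> * \<bar>b\<bar>) <= a^2 + b^2" by (simp add: power2_diff)
    moreover have "0 <= \<bar>a\<bar> * \<bar>b\<bar>" by simp
    ultimately show ?thesis unfolding abs_mult by linarith
  qed
  then show "AE x in M. norm (f x * g x) <= norm ((f x)^2 + (g x)^2)" by simp
qed

lemma L2_zero [simp]: "(%x. 0) : L2 M" by (simp add: L2_def)

lemma L2_cmult: assumes "f : L2 M" shows "(%x. c * f x) : L2 M"
  using assms by (auto simp: L2_def power_mult_distrib)

lemma L2_add: assumes "f : L2 M" "g : L2 M" shows "(%x. f x + g x) : L2 M"
proof (rule L2I)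
  show "(%x. f x + g x) : bm M" using assms[THEN L2D(1)] by measurable
  have "(%x. (f x + g x)^2) = (%x. (f x)^2 + (g x)^2 + 2 * (f x * g x))"
    by (auto simp: power2_eq_square algebra_simps)
  then show "integrable M (%x. (f x + g x)^2)" using L2_mult_integrable[OF assms] assms[THEN L2D(2)] by simp
qed

lemma L2_diff: assumes "f : L2 M" "g : L2 M" shows "(%x. f x - g x) : L2 M"
  using L2_add[OF assms(1) L2_cmult[OF assms(2), of "-1"]] by simp

lemma L2_sum: "(!!i. i : I ==> f i : L2 M) ==> (%x. SUM i:I. f i x) : L2 M"
  by (induction I rule: infinite_finite_induct) (auto intro: L2_add)

lemma L2_cong_AE:
  assumes "f : L2 M" "g : bm M" "AE x in M. f x = g x" shows "g : L2 M"
proof (rule L2I)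
  have [measurable]: "f : bm M" using assms L2D by auto
  note assms(2)[measurable]
  have "integrable M (%x. (f x)^2) \<longleftrightarrow> integrable M (%x. (g x)^2)"
    using assms(3) by (intro integrable_cong_AE) auto
  then show "integrable M (%x. (g x)^2)" using assms L2D by auto
qed fact

lemma L2_bound:
  assumes "w : L2 M" "g : bm M" "AE x in M. \<bar>g x\<bar> <= \<bar>w x\<bar>"
  shows "g : L2 M"
proof (rule L2I)
  note assms(2)[measurable]
  show "integrable M (%x. (g x)^2)"
    by (rule bi_integrable_bound[OF L2D(2)[OF assms(1)]])
      (use assms(3) in \<open>auto simp: abs_le_square_iff\<close>)
qed fact

lemma (in finite_measure) L2_bounded:
  assumes "g : bm M" "AE x in M. \<bar>g x\<bar> <= B" shows "g : L2 M"
  by (rule L2_bound[of "%_. B"]) (use assms in \<open>auto intro: L2I\<close>)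

lemma (in finite_measure) L2_integrable:
  assumes "g : L2 M" shows "integrable M g"
  using L2_mult_integrable[OF assms L2_bounded[of "%_. 1" 1]] by simp

section \<open>The L2 norm: Cauchy-Schwarz, triangle inequality, completeness\<close>

definition l2norm :: "'a measure => ('a => real) => real" where
  "l2norm M f = sqrt (LINT x|M. (f x)^2)"

lemma l2norm_nonneg [simp]: "0 <= l2norm M f" by (simp add: l2norm_def)

lemma l2norm_sq: "(l2norm M f)^2 = (LINT x|M. (f x)^2)" by (simp add: l2norm_def)

lemma l2norm_zero [simp]: "l2norm M (%x. 0) = 0" by (simp add: l2norm_def)

lemma l2norm_cmult: "l2norm M (%x. c * f x) = \<bar>c\<bar> * l2norm M f"
  by (simp add: l2norm_def power_mult_distrib real_sqrt_mult)

lemma l2norm_minus_commute: "l2norm M (%x. f x - g x) = l2norm M (%x. g x - f x)"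
  by (simp add: l2norm_def power2_commute)

lemma l2norm_cong_AE:
  assumes "f : bm M" "g : bm M" "AE x in M. f x = g x"
  shows "l2norm M f = l2norm M g"
  unfolding l2norm_def using assms by (intro arg_cong[where f=sqrt] integral_cong_AE) auto

lemma l2norm_eq_0:
  assumes "f : L2 M" "l2norm M f = 0" shows "AE x in M. f x = 0"
proof -
  have "(LINT x|M. (f x)^2) = 0" using assms(2) by (simp add: l2norm_def)
  then show ?thesis using integral_nonneg_eq_0_iff_AE[OF L2D(2)[OF assms(1)]] by simp
qed

lemma L2_Cauchy_Schwarz:
  assumes "f : L2 M" "g : L2 M"
  shows "\<bar>\<integral>x. f x * g x \<partial>M\<bar> <= l2norm M f * l2norm M g"
proof -
  define a where "a = (LINT x|M. (f x)^2)"
  define b where "b = (LINT x|M. f x * g x)"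
  define c where "c = (LINT x|M. (g x)^2)"
  have a0: "0 <= a" and c0: "0 <= c" by (auto simp: a_def c_def)
  have q: "0 <= a - 2 * t * b + t^2 * c" for t
  proof -
    have "0 <= (LINT x|M. (f x - t * g x)^2)" by simp
    also have "... = (LINT x|M. (f x)^2 - 2 * t * (f x * g x) + t^2 * (g x)^2)"
      by (intro arg_cong[where f="integral\<^sup>L M"]) (auto simp: power2_eq_square algebra_simps)
    also have "... = a - 2 * t * b + t^2 * c"
      unfolding a_def b_def c_def using L2_mult_integrable[OF assms] assms[THEN L2D(2)] by simp
    finally show ?thesis .
  qed
  have "b^2 <= a * c"
  proof (cases "c = 0")
    case True
    have "b = 0"
    proof (rule ccontr)
      assume "b ~= 0"
      \<comment> \<open>With c = 0 the quadratic is linear in t, and this t gives it the value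
        -1.\<close>
      then show False using q[of "(a + 1) / (2 * b)"] True by (simp add: field_simps)
    qed
    then show ?thesis using True by simp
  next
    case False
    then have "0 < c" using c0 by simp
    have "0 <= (a - 2 * (b / c) * b + (b / c)^2 * c) * c" using q[of "b / c"] c0 by (intro mult_nonneg_nonneg) auto
    also have "... = a * c - b^2" using \<open>0 < c\<close> by (simp add: field_simps power2_eq_square)
    finally show ?thesis by simp
  qed
  then have "sqrt (b^2) <= sqrt (a * c)" by (rule real_sqrt_le_mono)
  then show ?thesis by (simp add: a_def b_def c_def l2norm_def real_sqrt_mult)
qed

lemma l2norm_triangle:
  assumes "f : L2 M" "g : L2 M"
  shows "l2norm M (%x. f x + g x) <= l2norm M f + l2norm M g"
proof -
  have "(l2norm M (%x. f x + g x))^2 = (LINT x|M. (f x)^2 + 2 * (f x * g x) + (g x)^2)"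
    unfolding l2norm_sq by (intro arg_cong[where f="integral\<^sup>L M"]) (auto simp: power2_eq_square algebra_simps)
  also have "... = (l2norm M f)^2 + 2 * (LINT x|M. f x * g x) + (l2norm M g)^2"
    unfolding l2norm_sq using L2_mult_integrable[OF assms] assms[THEN L2D(2)] by simp
  also have "... <= (l2norm M f)^2 + 2 * (l2norm M f * l2norm M g) + (l2norm M g)^2"
    using L2_Cauchy_Schwarz[OF assms] by (simp add: abs_le_iff)
  also have "... = (l2norm M f + l2norm M g)^2" by (simp add: power2_eq_square algebra_simps)
  finally show ?thesis by (rule power2_le_imp_le) simp
qed

lemma l2norm_triangle3:
  assumes "f : L2 M" "g : L2 M" "h : L2 M"
  shows "l2norm M (%x. f x - h x) <= l2norm M (%x. f x - g x) + l2norm M (%x. g x - h x)"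
  using l2norm_triangle[OF L2_diff[OF assms(1,2)] L2_diff[OF assms(2,3)]] by simp

lemma l2norm_sum_le:
  assumes "!!i. i : I ==> f i : L2 M"
  shows "l2norm M (%x. SUM i:I. f i x) <= (SUM i:I. l2norm M (f i))"
  using assms
proof (induction I rule: infinite_finite_induct)
  case (insert i I)
  then have "l2norm M (%x. f i x + (SUM i:I. f i x)) <= l2norm M (f i) + l2norm M (%x. SUM i:I. f i x)"
    by (intro l2norm_triangle L2_sum) auto
  then show ?case using insert by fastforce
qed auto

lemma l2norm_mono_AE:
  assumes "g : L2 M" "f : bm M" "AE x in M. \<bar>f x\<bar> <= \<bar>g x\<bar>"
  shows "l2norm M f <= l2norm M g"
  unfolding l2norm_def
  by (intro real_sqrt_le_mono integral_mono_AE L2D(2) assms L2_bound[OF assms])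
    (use assms(3) in \<open>auto simp: abs_le_square_iff\<close>)

lemma L2_dominated_tendsto:
  assumes w: "w : L2 M" and s: "!!n. s n : bm M" and g: "g : bm M"
    and lim: "AE x in M. (%n. s n x) \<longlonglongrightarrow> g x" and b: "!!n. AE x in M. \<bar>s n x\<bar> <= \<bar>w x\<bar>"
  shows "g : L2 M" "!!n. s n : L2 M" "(%n. l2norm M (%x. s n x - g x)) \<longlonglongrightarrow> 0"
proof -
  show "!!n. s n : L2 M" using L2_bound[OF w s b] .
  have ball: "AE x in M. ALL n. \<bar>s n x\<bar> <= \<bar>w x\<bar>" using b by (simp add: AE_all_countable)
  then have gb: "AE x in M. \<bar>g x\<bar> <= \<bar>w x\<bar>"
    using lim
  proof eventually_elim
    case (elim x)
    have "(%n. \<bar>s n x\<bar>) \<longlonglongrightarrow> \<bar>g x\<bar>" using elim(2) by (rule tendsto_rabs)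
    then show ?case by (rule LIMSEQ_le_const2) (use elim in auto)
  qed
  show "g : L2 M" using L2_bound[OF w g gb] .
  note s[measurable] g[measurable] w[THEN L2D(1), measurable]
  have "(%n. \<integral>x. (s n x - g x)^2 \<partial>M) \<longlonglongrightarrow> (LINT x|M. 0)"
  proof (rule integral_dominated_convergence)
    show "integrable M (%x. 4 * (w x)^2)" using w L2D by auto
    show "AE x in M. (%n. (s n x - g x)^2) \<longlonglongrightarrow> 0"
      using lim
    proof eventually_elim
      case (elim x)
      have "(%n. (s n x - g x)^2) \<longlonglongrightarrow> (g x - g x)^2" by (intro tendsto_intros elim)
      then show ?case by simp
    qed
    show "AE x in M. norm ((s n x - g x)^2) <= 4 * (w x)^2" for n
      using gb ball
    proof eventually_elim
      case (elim x)
      then have "\<bar>s n x - g x\<bar> <= \<bar>2 * w x\<bar>" using elim(2)[rule_format, of n] by linarith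
      then have "(s n x - g x)^2 <= (2 * w x)^2" by (simp only: abs_le_square_iff)
      then show ?case by (simp add: power_mult_distrib)
    qed
  qed auto
  then show "(%n. l2norm M (%x. s n x - g x)) \<longlonglongrightarrow> 0"
    unfolding l2norm_def using tendsto_real_sqrt by fastforce
qed

text \<open>Along a fast subsequence the increments a satisfy a <= (2^-k + 2^k a^2) / 2, whose right-hand
  side is summable almost everywhere by monotone convergence.\<close>

theorem L2_complete:
  assumes u: "!!n. u n : L2 M"
    and C: "!!ep. ep > 0 ==> EX N. ALL m>=N. ALL n>=N. l2norm M (%x. u m x - u n x) < ep"
  shows "EX g:L2 M. (%n. l2norm M (%x. u n x - g x)) \<longlonglongrightarrow> 0"
proof -
  note [measurable] = u[THEN L2D(1)]
  have "EX N. ALL m>=N. ALL n>=N. l2norm M (%x. u m x - u n x) < (1/2)^k" for k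
    by (rule C) simp
  then obtain N where N: "!!k m n. m >= N k ==> n >= N k ==> l2norm M (%x. u m x - u n x) < (1/2)^k"
    by metis
  \<comment> \<open>Taking maxima makes the index monotone in k, so both \<open>r k\<close> and
    \<open>r (Suc k)\<close> lie beyond \<open>N k\<close>.\<close>
  define r where "r k = Max (N ` {..k})" for k
  have rN: "N j <= r k" if "j <= k" for j k unfolding r_def using that by (intro Max_ge) auto
  have rmono: "r k <= r (Suc k)" for k unfolding r_def by (intro Max_mono) auto
  define v where "v k = u (r k)" for k
  have vL: "v k : L2 M" for k using u v_def by simp
  note [measurable] = vL[THEN L2D(1)]
  have inc: "l2norm M (%x. v (Suc k) x - v k x) < (1/2)^k" for k
    unfolding v_def using rN[of k k] rmono[of k] by (intro N) auto
  define a where "a k x = \<bar>v (Suc k) x - v k x\<bar>" for k x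
  have am[measurable]: "a k : bm M" for k unfolding a_def by measurable
  have nn: "(\<integral>\<^sup>+x. ennreal (2^k * (a k x)^2) \<partial>M) <= ennreal ((1/2)^k)" for k
  proof -
    have I: "integrable M (%x. (v (Suc k) x - v k x)^2)" using L2_diff[OF vL vL] L2D by blast
    have "(\<integral>\<^sup>+x. ennreal (2^k * (a k x)^2) \<partial>M) = ennreal (LINT x|M. 2^k * (a k x)^2)"
      by (rule nn_integral_eq_integral) (use I in \<open>auto simp: a_def\<close>)
    also have "(LINT x|M. 2^k * (a k x)^2) = 2^k * (l2norm M (%x. v (Suc k) x - v k x))^2"
      by (simp add: l2norm_sq a_def)
    also have "... <= 2^k * ((1/2)^k)^2"
      using inc[of k] by (intro mult_left_mono power_mono) auto
    also have "... = (1/2)^k" by (simp add: power2_eq_square field_simps)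
    finally show ?thesis by (simp add: ennreal_leI)
  qed
  have "(\<integral>\<^sup>+x. (\<Sum>k. ennreal (2^k * (a k x)^2)) \<partial>M) = (\<Sum>k. \<integral>\<^sup>+x. ennreal (2^k * (a k x)^2) \<partial>M)"
    by (rule nn_integral_suminf) measurable
  also have "... <= (\<Sum>k. ennreal ((1/2)^k))" by (intro suminf_le nn) auto
  also have "... = ennreal (\<Sum>k. (1/2)^k)" by (intro suminf_ennreal2 summable_geometric) auto
  also have "... < \<infinity>" by simp
  finally have "AE x in M. (\<Sum>k. ennreal (2^k * (a k x)^2)) ~= \<infinity>"
    by (intro nn_integral_PInf_AE) auto
  then have conv: "AE x in M. convergent (%k. v k x)"
  proof eventually_elim
    case (elim x)
    have s1: "summable (%k. 2^k * (a k x)^2)"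
      using elim by (intro summable_suminf_not_top) auto
    have s2: "summable (%k. (1/2)^k + 2^k * (a k x)^2)"
      using s1 by (intro summable_add summable_geometric) auto
    have le: "a k x <= (1/2)^k + 2^k * (a k x)^2" for k
    proof -
      define s where "s = (2::real)^k * a k x"
      have "s <= 1 + s^2"
      proof -
        have "0 <= (s - 1/2)^2 + 3/4" by simp
        then show ?thesis by (simp add: power2_eq_square algebra_simps)
      qed
      then have "s * (1/2)^k <= (1 + s^2) * (1/2)^k" by (intro mult_right_mono) auto
      then show ?thesis by (simp add: s_def power2_eq_square field_simps)
    qed
    have "summable (%k. a k x)"
      by (rule summable_comparison_test'[OF s2, of 0]) (use le in \<open>auto simp: a_def\<close>)
    then have "summable (%k. v (Suc k) x - v k x)" unfolding a_def by (rule summable_rabs_cancel)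
    then have "convergent (%n. SUM k<n. v (Suc k) x - v k x)" by (simp add: summable_iff_convergent)
    then obtain L where "(%n. SUM k<n. v (Suc k) x - v k x) \<longlonglongrightarrow> L" by (auto simp: convergent_def)
    then have "(%n. (v n x - v 0 x) + v 0 x) \<longlonglongrightarrow> L + v 0 x"
      unfolding sum_lessThan_telescope[of "%k. v k x"] by (intro tendsto_intros)
    then show ?case by (auto simp: convergent_def)
  qed
  define g where "g x = lim (%k. v k x)" for x
  have gm[measurable]: "g : bm M" unfolding g_def by measurable
  have lim: "AE x in M. (%k. v k x) \<longlonglongrightarrow> g x"
    using conv unfolding g_def by eventually_elim (simp add: convergent_LIMSEQ_iff)
  \<comment> \<open>Fatou's lemma along the subsequence. The estimate gives both the membership of u
    n - g in L2 and the rate of convergence of the full sequence.\<close>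
  have key: "(\<integral>\<^sup>+x. ennreal ((u n x - g x)^2) \<partial>M) <= ennreal (((1/2)^k)^2)" if n: "n >= N k" for n k
  proof -
    have "(\<integral>\<^sup>+x. ennreal ((u n x - g x)^2) \<partial>M) = (\<integral>\<^sup>+x. liminf (%j. ennreal ((u n x - v j x)^2)) \<partial>M)"
    proof (rule nn_integral_cong_AE, use lim in eventually_elim)
      fix x assume "(%k. v k x) \<longlonglongrightarrow> g x"
      then have "(%j. ennreal ((u n x - v j x)^2)) \<longlonglongrightarrow> ennreal ((u n x - g x)^2)"
        by (intro tendsto_ennrealI tendsto_power tendsto_diff tendsto_const)
      then show "ennreal ((u n x - g x)^2) = liminf (%j. ennreal ((u n x - v j x)^2))"
        by (intro lim_imp_Liminf[symmetric]) auto
    qed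
    also have "... <= liminf (%j. \<integral>\<^sup>+x. ennreal ((u n x - v j x)^2) \<partial>M)"
      by (rule nn_integral_liminf) measurable
    also have "... <= ennreal (((1/2)^k)^2)"
    proof (rule Liminf_le)
      show "\<forall>\<^sub>F j in sequentially. (\<integral>\<^sup>+x. ennreal ((u n x - v j x)^2) \<partial>M) <= ennreal (((1/2)^k)^2)"
      proof (rule eventually_sequentiallyI[of k])
        fix j assume "k <= j"
        have I: "integrable M (%x. (u n x - v j x)^2)" using L2_diff[OF u vL] L2D by blast
        have "(\<integral>\<^sup>+x. ennreal ((u n x - v j x)^2) \<partial>M) = ennreal ((l2norm M (%x. u n x - v j x))^2)"
          unfolding l2norm_sq by (rule nn_integral_eq_integral) (use I in auto)
        also have "... <= ennreal (((1/2)^k)^2)"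
        proof (intro ennreal_leI power_mono)
          show "l2norm M (%x. u n x - v j x) <= (1/2)^k"
            unfolding v_def using N[OF n, of "r j"] rN[OF \<open>k <= j\<close>] by simp
        qed simp
        finally show "(\<integral>\<^sup>+x. ennreal ((u n x - v j x)^2) \<partial>M) <= ennreal (((1/2)^k)^2)" .
      qed
    qed simp
    finally show ?thesis .
  qed
  have dL: "(%x. u n x - g x) : L2 M" if "n >= N k" for n k
  proof (rule L2I)
    show "integrable M (%x. (u n x - g x)^2)"
      by (rule integrableI_nonneg) (use key[OF that] in \<open>auto intro: le_less_trans\<close>)
  qed measurable
  have gL: "g : L2 M"
    using L2_diff[OF u dL[OF order_refl[of "N 0"]], of "N 0"] by simp
  have small: "l2norm M (%x. u n x - g x) <= (1/2)^k" if "n >= N k" for n k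
  proof -
    have "ennreal (LINT x|M. (u n x - g x)^2) = (\<integral>\<^sup>+x. ennreal ((u n x - g x)^2) \<partial>M)"
      by (rule nn_integral_eq_integral[symmetric]) (use dL[OF that] L2D in auto)
    also have "... <= ennreal (((1/2)^k)^2)" by (rule key[OF that])
    finally have "(l2norm M (%x. u n x - g x))^2 <= ((1/2)^k)^2"
      unfolding l2norm_sq by (simp add: ennreal_le_iff)
    then show ?thesis by (rule power2_le_imp_le) simp
  qed
  have "(%n. l2norm M (%x. u n x - g x)) \<longlonglongrightarrow> 0"
  proof (rule LIMSEQ_I)
    fix e :: real assume "0 < e"
    then obtain k where k: "(1/2)^k < e" using real_arch_pow_inv[of e "1/2"] by auto
    show "EX no. ALL n>=no. norm (l2norm M (%x. u n x - g x) - 0) < e"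
      using small[of k] k by (intro exI[of _ "N k"]) (auto intro: le_less_trans)
  qed
  then show ?thesis using gL by blast
qed

section \<open>Linear subspaces, L2 closures and orthogonal projections\<close>

definition lin :: "('a => real) set => bool" where
  "lin S \<longleftrightarrow> (%_. 0) : S & (ALL f:S. ALL g:S. ALL c. (%x. f x + c * g x) : S)"

lemma linD:
  assumes "lin S"
  shows "(%_. 0) : S" "!!f g c. f : S ==> g : S ==> (%x. f x + c * g x) : S"
    "!!f g. f : S ==> g : S ==> (%x. f x + g x) : S" "!!f g. f : S ==> g : S ==> (%x. f x - g x) : S"
    "!!f c. f : S ==> (%x. c * f x) : S"
proof -
  have *: "!!f g c. f : S ==> g : S ==> (%x. f x + c * g x) : S" using assms by (simp add: lin_def)
  show z: "(%_. 0) : S" using assms by (simp add: lin_def)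
  show "!!f g c. f : S ==> g : S ==> (%x. f x + c * g x) : S" by fact
  show "!!f g. f : S ==> g : S ==> (%x. f x + g x) : S" using *[of _ _ 1] by simp
  show "!!f g. f : S ==> g : S ==> (%x. f x - g x) : S" using *[of _ _ "-1"] by simp
  show "!!f c. f : S ==> (%x. c * f x) : S" using *[OF z] by simp
qed

lemma lin_sum: "lin S ==> (!!i. i : I ==> f i : S) ==> (%x. SUM i:I. f i x) : S"
  by (induction I rule: infinite_finite_induct) (auto intro: linD)

lemma lin_lin_span: "lin (lin_span S)"
  unfolding lin_def
proof (intro conjI ballI allI)
  show "(%_. 0) : lin_span S" unfolding lin_span_def by (auto intro!: exI[of _ "{}"])
next
  fix f g :: "'a => real" and c assume "f : lin_span S" "g : lin_span S"
  then obtain F a G b where F: "finite F" "F \<subseteq> S" "f = (%x. SUM h:F. a h * h x)"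
    and G: "finite G" "G \<subseteq> S" "g = (%x. SUM h:G. b h * h x)" unfolding lin_span_def by auto
  \<comment> \<open>Both families of coefficients are extended by 0 to the union, where they
    add.\<close>
  let ?d = "%h. (if h : F then a h else 0) + c * (if h : G then b h else 0)"
  have "(SUM h:F. a h * h x) + c * (SUM h:G. b h * h x) = (SUM h:F Un G. ?d h * h x)" for x
  proof -
    have "(SUM h:F. a h * h x) = (SUM h:F Un G. (if h : F then a h else 0) * h x)"
      using F G by (intro sum.mono_neutral_cong_left) auto
    moreover have "(SUM h:G. b h * h x) = (SUM h:F Un G. (if h : G then b h else 0) * h x)"
      using F G by (intro sum.mono_neutral_cong_left) auto
    ultimately show ?thesis by (simp add: sum_distrib_left sum.distrib[symmetric] algebra_simps)
  qed
  then show "(%x. f x + c * g x) : lin_span S"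
    unfolding lin_span_def using F G by (auto intro!: exI[of _ "F Un G"] exI[of _ ?d])
qed

lemma lin_span_superset: "g : S ==> g : lin_span S"
  unfolding lin_span_def by (auto intro!: exI[of _ "{g}"] exI[of _ "%_. 1"])

lemma lin_span_subset: assumes "lin S'" "S \<subseteq> S'" shows "lin_span S \<subseteq> S'"
proof
  fix h assume "h : lin_span S"
  then obtain F a where F: "finite F" "F \<subseteq> S" "h = (%x. SUM k:F. a k * k x)" unfolding lin_span_def by auto
  have "(%x. SUM k:F. a k * k x) : S'" using F assms by (intro lin_sum linD(5)) auto
  then show "h : S'" using F by simp
qed

text \<open>The definition of \<open>L2_closure\<close> bounds the squared distance; taking square
  roots makes the triangle inequality available.\<close>

lemma L2_closure_iff:
  "g : L2_closure M S \<longleftrightarrow> g : L2 M & (ALL ep>0. EX h:S Int L2 M. l2norm M (%x. g x - h x) < ep)"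
proof -
  have "(ALL ep>0. EX h:S Int L2 M. (LINT x|M. (g x - h x)^2) < ep) \<longleftrightarrow>
      (ALL ep>0. EX h:S Int L2 M. l2norm M (%x. g x - h x) < ep)" (is "?A \<longleftrightarrow> ?B")
  proof
    assume A: ?A
    show ?B
    proof (intro allI impI)
      fix e :: real assume "0 < e"
      then obtain h where "h : S Int L2 M" "(LINT x|M. (g x - h x)^2) < e^2" using A[rule_format, of "e^2"] by auto
      moreover from this(2) have "l2norm M (%x. g x - h x) < e"
        unfolding l2norm_sq[symmetric] using \<open>0 < e\<close> power2_less_imp_less[of "l2norm M (%x. g x - h x)" e] by auto
      ultimately show "EX h:S Int L2 M. l2norm M (%x. g x - h x) < e" by blast
    qed
  next
    assume B: ?B
    show ?A
    proof (intro allI impI)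
      fix e :: real assume "0 < e"
      then obtain h where h: "h : S Int L2 M" "l2norm M (%x. g x - h x) < sqrt e" using B[rule_format, of "sqrt e"] by auto
      then have "(l2norm M (%x. g x - h x))^2 < (sqrt e)^2" by (intro power_strict_mono) auto
      then show "EX h:S Int L2 M. (LINT x|M. (g x - h x)^2) < e" using h \<open>0 < e\<close> unfolding l2norm_sq by auto
    qed
  qed
  then show ?thesis by (simp add: L2_closure_def)
qed

lemma L2_closure_L2: "g : L2_closure M S ==> g : L2 M" by (simp add: L2_closure_def)

lemma L2_closure_superset: "g : S ==> g : L2 M ==> g : L2_closure M S"
  unfolding L2_closure_def by (auto intro!: bexI[of _ g])

lemma L2_closure_closed:
  assumes "g : L2 M" "!!ep. ep > 0 ==> EX h:L2_closure M S. l2norm M (%x. g x - h x) < ep"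
  shows "g : L2_closure M S"
  unfolding L2_closure_iff
proof (intro conjI allI impI)
  fix e :: real assume "0 < e"
  then obtain h where h: "h : L2_closure M S" "l2norm M (%x. g x - h x) < e / 2" using assms(2)[of "e / 2"] by auto
  then obtain k where k: "k : S Int L2 M" "l2norm M (%x. h x - k x) < e / 2"
    using \<open>0 < e\<close> unfolding L2_closure_iff by (meson half_gt_zero)
  have "l2norm M (%x. g x - k x) < e"
    using l2norm_triangle3[OF assms(1) L2_closure_L2[OF h(1)], of k] h k by auto
  then show "EX h:S Int L2 M. l2norm M (%x. g x - h x) < e" using k by blast
qed fact

lemma L2_closure_lim:
  assumes "g : L2 M" "!!n. s n : L2_closure M S" "(%n. l2norm M (%x. s n x - g x)) \<longlonglongrightarrow> 0"
  shows "g : L2_closure M S"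
proof (rule L2_closure_closed[OF assms(1)])
  fix e :: real assume "0 < e"
  from LIMSEQ_D[OF assms(3) this] obtain n where "l2norm M (%x. s n x - g x) < e" by auto
  then show "EX h:L2_closure M S. l2norm M (%x. g x - h x) < e"
    using assms(2)[of n] l2norm_minus_commute[of M "s n" g] by auto
qed

lemma L2_closure_seq:
  assumes "g : L2_closure M S"
  obtains s where "!!n. s n : S" "!!n. s n : L2 M" "(%n. l2norm M (%x. g x - s n x)) \<longlonglongrightarrow> 0"
proof -
  have "ALL n. EX h. h : S Int L2 M & l2norm M (%x. g x - h x) < 1 / real (Suc n)"
    using assms unfolding L2_closure_iff by (meson of_nat_0_less_iff zero_less_Suc zero_less_divide_1_iff)
  then obtain s where s: "!!n. s n : S Int L2 M & l2norm M (%x. g x - s n x) < 1 / real (Suc n)" by metis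
  have "(%n. l2norm M (%x. g x - s n x)) \<longlonglongrightarrow> 0"
  proof (rule tendsto_sandwich[of "%_. 0" _ _ "%n. 1 / real (Suc n)"])
    show "(%n. 1 / real (Suc n)) \<longlonglongrightarrow> 0" using LIMSEQ_inverse_real_of_nat by (simp add: inverse_eq_divide)
  qed (use s in \<open>auto intro!: always_eventually less_imp_le simp del: of_nat_Suc\<close>)
  then show ?thesis using that s by auto
qed

lemma L2_closure_cong_AE:
  assumes "g : L2_closure M S" "g' : bm M" "AE x in M. g x = g' x"
  shows "g' : L2_closure M S"
proof (rule L2_closure_closed)
  show g': "g' : L2 M" using L2_cong_AE[OF L2_closure_L2[OF assms(1)] assms(2,3)] .
  fix e :: real assume "0 < e"
  have "l2norm M (%x. g' x - g x) = l2norm M (%x. 0)"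
    using assms(3) L2_diff[OF g' L2_closure_L2[OF assms(1)], THEN L2D(1)] by (intro l2norm_cong_AE) auto
  then show "EX h:L2_closure M S. l2norm M (%x. g' x - h x) < e" using assms(1) \<open>0 < e\<close> by (intro bexI[of _ g]) auto
qed

lemma lin_L2_closure:
  assumes "lin S" shows "lin (L2_closure M S)"
  unfolding lin_def
proof (intro conjI ballI allI)
  show "(%_. 0) : L2_closure M S" using assms by (auto intro: L2_closure_superset linD)
next
  fix f g and c :: real assume f: "f : L2_closure M S" and g: "g : L2_closure M S"
  note fL = L2_closure_L2[OF f] and gL = L2_closure_L2[OF g]
  show "(%x. f x + c * g x) : L2_closure M S"
    unfolding L2_closure_iff
  proof (intro conjI allI impI)
    show "(%x. f x + c * g x) : L2 M" using fL gL by (intro L2_add L2_cmult)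
    fix e :: real assume e: "0 < e"
    obtain h where h: "h : S" "h : L2 M" "l2norm M (%x. f x - h x) < e / 2"
      using f e unfolding L2_closure_iff by (metis IntE half_gt_zero)
    have "0 < e / (2 * (1 + \<bar>c\<bar>))" using e by (simp add: add_pos_nonneg)
    then obtain k where k: "k : S" "k : L2 M" "l2norm M (%x. g x - k x) < e / (2 * (1 + \<bar>c\<bar>))"
      using g e unfolding L2_closure_iff by (metis IntE)
    have "l2norm M (%x. (f x + c * g x) - (h x + c * k x)) = l2norm M (%x. (f x - h x) + c * (g x - k x))"
      by (intro arg_cong[where f="l2norm M"]) (auto simp: algebra_simps)
    also have "... <= l2norm M (%x. f x - h x) + \<bar>c\<bar> * l2norm M (%x. g x - k x)"
      unfolding l2norm_cmult[symmetric] using fL gL h k by (intro l2norm_triangle L2_diff L2_cmult)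
    also have "\<bar>c\<bar> * l2norm M (%x. g x - k x) <= (1 + \<bar>c\<bar>) * (e / (2 * (1 + \<bar>c\<bar>)))"
      using k by (intro mult_mono) auto
    also have "... = e / 2" by (simp add: field_simps add_nonneg_eq_0_iff)
    finally have "l2norm M (%x. (f x + c * g x) - (h x + c * k x)) < e" using h by simp
    then show "EX h:S Int L2 M. l2norm M (%x. (f x + c * g x) - h x) < e"
      using assms h k L2_add[OF h(2) L2_cmult[OF k(2)]] by (intro bexI[of _ "%x. h x + c * k x"]) (auto intro: linD)
  qed
qed

text \<open>The inner product with u is continuous in the norm, so it vanishes on limits. It is
  tested on the members of S in L2, because \<open>L2_closure\<close> takes limits of such
  members.\<close>

lemma orth_L2_closure:
  assumes u: "u : L2 M" "!!h. h : S ==> h : L2 M ==> (LINT x|M. u x * h x) = 0" and g: "g : L2_closure M S"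
  shows "(LINT x|M. u x * g x) = 0"
proof (rule ccontr)
  assume nz: "(LINT x|M. u x * g x) ~= 0"
  \<comment> \<open>The summand 1 keeps the quotient meaningful when u is null.\<close>
  define e where "e = \<bar>\<integral>x. u x * g x \<partial>M\<bar> / (1 + l2norm M u)"
  have p: "0 < 1 + l2norm M u" using l2norm_nonneg[of M u] by linarith
  have "0 < e" unfolding e_def using nz p by simp
  then obtain h where h: "h : S" "h : L2 M" "l2norm M (%x. g x - h x) < e"
    using g unfolding L2_closure_iff by (metis IntE)
  have gL: "g : L2 M" using g L2_closure_L2 by auto
  have "(LINT x|M. u x * (g x - h x)) = (LINT x|M. u x * g x) - (LINT x|M. u x * h x)"
    using L2_mult_integrable[OF u(1) gL] L2_mult_integrable[OF u(1) h(2)] by (simp add: right_diff_distrib)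
  then have "\<bar>\<integral>x. u x * g x \<partial>M\<bar> = \<bar>\<integral>x. u x * (g x - h x) \<partial>M\<bar>" using u(2)[OF h(1,2)] by simp
  also have "... <= l2norm M u * l2norm M (%x. g x - h x)" by (rule L2_Cauchy_Schwarz[OF u(1) L2_diff[OF gL h(2)]])
  also have "... <= l2norm M u * e" using h by (intro mult_left_mono) auto
  also have "... < (1 + l2norm M u) * e" using \<open>0 < e\<close> by simp
  also have "... = \<bar>\<integral>x. u x * g x \<partial>M\<bar>" unfolding e_def using p by simp
  finally show False by simp
qed

lemma lin_orth: assumes "S \<subseteq> L2 M" shows "lin (orth M S)"
  unfolding lin_def
proof (intro conjI ballI allI)
  fix f g c assume "f : orth M S" "g : orth M S"
  then have f: "f : L2 M" "!!h. h : S ==> (LINT x|M. f x * h x) = 0" and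
    g: "g : L2 M" "!!h. h : S ==> (LINT x|M. g x * h x) = 0" by (auto simp: orth_def)
  have "(LINT x|M. (f x + c * g x) * h x) = 0" if "h : S" for h
  proof -
    have "(LINT x|M. (f x + c * g x) * h x) = (LINT x|M. f x * h x + c * (g x * h x))"
      by (intro arg_cong[where f="integral\<^sup>L M"]) (auto simp: algebra_simps)
    also have "... = 0" using f g that assms by (simp add: L2_mult_integrable subset_iff)
    finally show ?thesis .
  qed
  then show "(%x. f x + c * g x) : orth M S" unfolding orth_def using f g by (auto intro: L2_add L2_cmult)
qed (auto simp: orth_def)

text \<open>The classical minimisation argument. The infimum of the squared distance need not be
  attained in S, so the minimiser is a limit of a minimising sequence and lies in the closure;
  orthogonality to h is the first-order condition along g + t h.\<close>

theorem is_proj_exists: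
  assumes S: "lin S" "S \<subseteq> L2 M" and a: "a : L2 M"
  shows "EX g. is_proj M S a g"
proof -
  define D where "D = (%s. (l2norm M (%x. a x - s x))^2) ` S"
  define d where "d = Inf D"
  have Dne: "D ~= {}" using linD(1)[OF S(1)] D_def by auto
  have bdd: "bdd_below D" unfolding D_def by (auto intro!: bdd_belowI[of _ 0])
  have dle: "d <= (l2norm M (%x. a x - s x))^2" if "s : S" for s
    unfolding d_def using that bdd by (intro cInf_lower) (auto simp: D_def)
  have d0: "0 <= d" unfolding d_def using Dne by (intro cInf_greatest) (auto simp: D_def)
  have "EX s:S. (l2norm M (%x. a x - s x))^2 < d + 1 / real (Suc n)" for n
  proof -
    have "Inf D < d + 1 / real (Suc n)" unfolding d_def by simp
    then show ?thesis using cInf_lessD[OF Dne] unfolding D_def by blast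
  qed
  then obtain s where s: "!!n. s n : S" "!!n. (l2norm M (%x. a x - s n x))^2 < d + 1 / real (Suc n)" by metis
  have sL: "s n : L2 M" for n using s S by auto
  have par: "(l2norm M (%x. s m x - s n x))^2 <= 2 * (1 / real (Suc m)) + 2 * (1 / real (Suc n))" for m n
  proof -
    \<comment> \<open>The midpoint lies in S, so its squared distance to a is at least the infimum,
      and the parallelogram law then bounds the distance between s m and s n.\<close>
    let ?h = "%x. (1/2) * (s m x + s n x)"
    have hS: "?h : S" using s S by (intro linD(5) linD(3)) auto
    have i1: "integrable M (%x. (a x - s m x)^2)" "integrable M (%x. (a x - s n x)^2)" "integrable M (%x. (a x - ?h x)^2)"
      using L2_diff[OF a sL] L2_diff[OF a, of ?h] hS S(2) L2D(2) by blast+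
    have "(l2norm M (%x. s m x - s n x))^2 = (LINT x|M. 2 * (a x - s m x)^2 + 2 * (a x - s n x)^2 - 4 * (a x - ?h x)^2)"
      unfolding l2norm_sq by (intro arg_cong[where f="integral\<^sup>L M"]) (auto simp: power2_eq_square field_simps)
    also have "... = 2 * (l2norm M (%x. a x - s m x))^2 + 2 * (l2norm M (%x. a x - s n x))^2 - 4 * (l2norm M (%x. a x - ?h x))^2"
      unfolding l2norm_sq using i1 by simp
    also have "... <= 2 * (d + 1 / real (Suc m)) + 2 * (d + 1 / real (Suc n)) - 4 * d"
      using less_imp_le[OF s(2)[of m]] less_imp_le[OF s(2)[of n]] dle[OF hS]
      by (intro diff_mono add_mono mult_left_mono) auto
    finally show ?thesis by simp
  qed
  have "EX N. ALL m>=N. ALL n>=N. l2norm M (%x. s m x - s n x) < e" if e: "0 < e" for e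
  proof -
    obtain N where N: "inverse (real (Suc N)) < e^2 / 4" using reals_Archimedean[of "e^2/4"] e by auto
    show ?thesis
    proof (intro exI allI impI)
      fix m n assume "N <= m" "N <= n"
      have "1 / real (Suc m) <= 1 / real (Suc N)" "1 / real (Suc n) <= 1 / real (Suc N)"
        using \<open>N <= m\<close> \<open>N <= n\<close> by (auto simp: field_simps)
      moreover have "1 / real (Suc N) < e^2 / 4" using N by (simp add: inverse_eq_divide)
      ultimately have "(l2norm M (%x. s m x - s n x))^2 < e^2" using par[of m n] by linarith
      then show "l2norm M (%x. s m x - s n x) < e" using e power2_less_imp_less[of "l2norm M (%x. s m x - s n x)" e] by auto
    qed
  qed
  from L2_complete[OF sL this] obtain g where g: "g : L2 M" and lim: "(%n. l2norm M (%x. s n x - g x)) \<longlonglongrightarrow> 0" by blast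
  have gc: "g : L2_closure M S"
    by (rule L2_closure_lim[OF g _ lim]) (use s sL in \<open>auto intro: L2_closure_superset\<close>)
  have agL: "(%x. a x - g x) : L2 M" using a g by (rule L2_diff)
  have up: "(l2norm M (%x. a x - g x))^2 <= d"
  proof -
    have l1: "(%n. (sqrt (d + 1 / real (Suc n)) + l2norm M (%x. s n x - g x))^2) \<longlonglongrightarrow> (sqrt (d + 0) + 0)^2"
      by (intro tendsto_intros lim) (use LIMSEQ_inverse_real_of_nat in \<open>simp add: inverse_eq_divide\<close>)
    have "(l2norm M (%x. a x - g x))^2 <= (sqrt (d + 1 / real (Suc n)) + l2norm M (%x. s n x - g x))^2" for n
    proof (intro power_mono)
      have "l2norm M (%x. a x - s n x) <= sqrt (d + 1 / real (Suc n))"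
        using s(2)[of n] by (intro real_le_rsqrt) simp
      then show "l2norm M (%x. a x - g x) <= sqrt (d + 1 / real (Suc n)) + l2norm M (%x. s n x - g x)"
        using l2norm_triangle3[OF a sL g, of n] by linarith
    qed simp
    then have "(l2norm M (%x. a x - g x))^2 <= (sqrt (d + 0) + 0)^2"
      by (intro LIMSEQ_le_const[OF l1]) auto
    then show ?thesis using d0 by simp
  qed
  have lowc: "d <= (l2norm M (%x. a x - h x))^2" if h: "h : L2_closure M S" for h
  proof -
    obtain k where k: "!!n. k n : S" "!!n. k n : L2 M" "(%n. l2norm M (%x. h x - k n x)) \<longlonglongrightarrow> 0"
      using L2_closure_seq[OF h] by blast
    have "sqrt d <= l2norm M (%x. a x - h x) + l2norm M (%x. h x - k n x)" for n
    proof -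
      have "sqrt d <= l2norm M (%x. a x - k n x)" using dle[OF k(1)] by (intro real_le_lsqrt) auto
      then show ?thesis using l2norm_triangle3[OF a L2_closure_L2[OF h] k(2), of n] by linarith
    qed
    moreover have "(%n. l2norm M (%x. a x - h x) + l2norm M (%x. h x - k n x)) \<longlonglongrightarrow> l2norm M (%x. a x - h x) + 0"
      by (intro tendsto_intros k)
    ultimately have "sqrt d <= l2norm M (%x. a x - h x) + 0" by (intro LIMSEQ_le_const) auto
    then show ?thesis using d0 by (simp add: sqrt_le_D)
  qed
  have "(LINT x|M. (a x - g x) * h x) = 0" if h: "h : S" for h
  proof -
    have hL: "h : L2 M" using h S by auto
    define b where "b = (LINT x|M. (a x - g x) * h x)"
    define c where "c = (LINT x|M. (h x)^2)"
    have c0: "0 <= c" by (simp add: c_def)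
    \<comment> \<open>The minimising t would be b / c; the summand 1 avoids division by zero when h
      is null and still yields b^2 (c + 2) <= 0.\<close>
    define t where "t = b / (c + 1)"
    have th: "(%x. g x + t * h x) : L2_closure M S"
      using linD(2)[OF lin_L2_closure[OF S(1)] gc L2_closure_superset[OF h hL]] .
    have "(l2norm M (%x. a x - (g x + t * h x)))^2 = (LINT x|M. (a x - g x)^2 - 2 * t * ((a x - g x) * h x) + t^2 * (h x)^2)"
      unfolding l2norm_sq by (intro arg_cong[where f="integral\<^sup>L M"]) (auto simp: power2_eq_square field_simps)
    also have "... = (l2norm M (%x. a x - g x))^2 - 2 * t * b + t^2 * c"
      unfolding b_def c_def l2norm_sq using L2D(2)[OF agL] L2D(2)[OF hL] L2_mult_integrable[OF agL hL] by simp
    finally have "0 <= - 2 * t * b + t^2 * c" using lowc[OF th] up by linarith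
    then have "0 <= (- 2 * t * b + t^2 * c) * (c + 1)^2" by simp
    also have "... = - (b^2 * (c + 2))"
    proof -
      have tc: "t * (c + 1) = b" unfolding t_def using c0 by simp
      have "(- 2 * t * b + t^2 * c) * (c + 1)^2 = - 2 * (t * (c + 1)) * b * (c + 1) + (t * (c + 1))^2 * c"
        by (simp add: power2_eq_square algebra_simps)
      also have "... = - (b^2 * (c + 2))" unfolding tc by (simp add: power2_eq_square algebra_simps)
      finally show ?thesis .
    qed
    finally have "b^2 * (c + 2) <= 0" by simp
    then have "b^2 <= 0" using c0 by (simp add: mult_le_0_iff)
    then show ?thesis by (simp add: b_def)
  qed
  then have "(%x. a x - g x) : orth M S" using agL by (auto simp: orth_def)
  then show ?thesis using gc by (auto simp: is_proj_def)
qed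

lemma is_proj_proj: "is_proj M S a g ==> is_proj M S a (proj M a S)"
  unfolding proj_def by (rule someI[of "is_proj M S a"])

text \<open>A Dynkin-system argument: the sets whose indicators can be approximated form a sigma-algebra.\<close>

theorem (in finite_measure) L2_closure_dense:
  assumes G: "Int_stable G" "G \<subseteq> Pow (space M)" "sets M = sigma_sets (space M) G" and S: "lin S"
    and ind: "!!A. A : G ==> (indicator A :: 'a => real) : L2_closure M S"
    and one: "(%_. 1) : L2_closure M S"
  shows "L2 M \<subseteq> L2_closure M S"
proof -
  note lc = lin_L2_closure[OF S, of M]
  have indL: "(indicator A :: 'a => real) : L2 M" if "A : sets M" for A
    by (rule L2_bounded[of _ 1]) (use that in \<open>auto split: split_indicator\<close>)
  have sp: "(indicator (space M) :: 'a => real) : L2_closure M S"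
    by (rule L2_closure_cong_AE[OF one]) auto
  have A: "(indicator A :: 'a => real) : L2_closure M S" if "A : sigma_sets (space M) G" for A
    using G(1,2) that
  proof (induction A rule: sigma_sets_induct_disjoint)
    case (basic A) then show ?case using ind by auto
  next
    case empty then show ?case using linD(1)[OF lc] by (simp add: indicator_def[abs_def])
  next
    case (compl A)
    have Am: "A : sets M" using compl G by auto
    have "(%x. indicator (space M) x - indicator A x :: real) : L2_closure M S" using linD(4)[OF lc sp compl(2)] .
    moreover have "(%x. indicator (space M) x - indicator A x :: real) = indicator (space M - A)"
      using sets.sets_into_space[OF Am] by (auto simp: indicator_def fun_eq_iff)
    ultimately show ?case by simp
  next
    case (union A)
    have Am: "A i : sets M" for i using union G by auto
    define s where "s n x = (SUM i<n. indicator (A i) x :: real)" for n x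
    have sc: "s n : L2_closure M S" for n unfolding s_def using union by (intro lin_sum[OF lc]) auto
    have seq: "s n = indicator (\<Union>i<n. A i)" for n
      unfolding s_def using union(1) by (intro ext indicator_UN_disjoint[symmetric]) (auto simp: disjoint_family_on_def)
    have "(%n. l2norm M (%x. s n x - indicator (\<Union>i. A i) x)) \<longlonglongrightarrow> 0"
    proof (rule L2_dominated_tendsto(3)[of "%_. 1"])
      show "(%_. 1) : L2 M" by (rule L2_bounded[of _ 1]) auto
      show "AE x in M. (%n. s n x) \<longlonglongrightarrow> indicator (\<Union>i. A i) x"
        unfolding seq by (intro always_eventually allI LIMSEQ_indicator_UN)
      show "AE x in M. \<bar>s n x\<bar> <= \<bar>1\<bar>" for n unfolding seq by (auto split: split_indicator)
    qed (use Am in \<open>auto simp: seq\<close>)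
    then show ?case by (intro L2_closure_lim[OF indL sc]) (use Am in auto)
  qed
  show ?thesis
  proof
    fix g assume g: "g : L2 M"
    obtain s where "ALL i. simple_function M (s i)" "ALL x:space M. (%i. s i x) \<longlonglongrightarrow> g x"
      "ALL i. ALL x:space M. dist (s i x) 0 <= 2 * dist (g x) 0"
      using borel_measurable_implies_sequence_metric[OF L2D(1)[OF g], of 0] by blast
    then have s: "!!i. simple_function M (s i)" "!!x. x : space M ==> (%i. s i x) \<longlonglongrightarrow> g x"
      "!!i x. x : space M ==> norm (s i x) <= 2 * norm (g x)" by (auto simp: dist_norm)
    have sm: "s i : bm M" for i using s(1) by (rule borel_measurable_simple_function)
    have lim: "AE x in M. (%i. s i x) \<longlonglongrightarrow> g x" using s(2) by (intro AE_I2) auto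
    have bd: "AE x in M. \<bar>s i x\<bar> <= \<bar>2 * g x\<bar>" for i using s(3) by (intro AE_I2) (auto simp: abs_mult)
    note L = L2_dominated_tendsto[of "%x. 2 * g x", OF L2_cmult[OF g] sm L2D(1)[OF g] lim bd]
    have "s i : L2_closure M S" for i
    proof (rule L2_closure_cong_AE)
      have "s i -` {y} Int space M : sigma_sets (space M) G" for y
        unfolding G(3)[symmetric] by (rule simple_functionD(2)[OF s(1)])
      note iA = A[OF this]
      show "(%x. SUM y:s i ` space M. y * indicator (s i -` {y} Int space M) x) : L2_closure M S"
      proof (rule lin_sum[OF lc])
        fix y
        show "(%x. y * indicator (s i -` {y} Int space M) x) : L2_closure M S"
          by (rule linD(5)[OF lc iA])
      qed
      show "AE x in M. (SUM y:s i ` space M. y * indicator (s i -` {y} Int space M) x) = s i x"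
      proof (rule AE_I2)
        fix x assume x: "x : space M"
        have "(SUM y:s i ` space M. y * indicator (s i -` {y} Int space M) x)
            = (SUM y:s i ` space M. indicator (s i -` {y} Int space M) x *\<^sub>R y)" by (simp add: mult.commute)
        also have "... = s i x" by (rule simple_function_indicator_representation_banach[OF s(1) x, symmetric])
        finally show "(SUM y:s i ` space M. y * indicator (s i -` {y} Int space M) x) = s i x" .
      qed
    qed (rule sm)
    then show "g : L2_closure M S" by (intro L2_closure_lim[OF g _ L(3)])
  qed
qed

section \<open>Symmetric matrices with eigenvalues in an interval\<close>

lemma sum_unit_vector:
  fixes x :: "nat => real" assumes "k < m"
  shows "(SUM i<m. (if i = k then 1 else 0) * x i) = x k" "(SUM i<m. (if k = i then 1 else 0) * x i) = x k"
    "(SUM i<m. x i * (if i = k then 1 else 0)) = x k" "(SUM i<m. x i * (if k = i then 1 else 0)) = x k"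
proof -
  have "(SUM i<m. if i = k then x i else 0) = x k" using assms by simp
  moreover have "(SUM i<m. (if i = k then 1 else 0) * x i) = (SUM i<m. if i = k then x i else 0)"
    "(SUM i<m. (if k = i then 1 else 0) * x i) = (SUM i<m. if i = k then x i else 0)"
    "(SUM i<m. x i * (if i = k then 1 else 0)) = (SUM i<m. if i = k then x i else 0)"
    "(SUM i<m. x i * (if k = i then 1 else 0)) = (SUM i<m. if i = k then x i else 0)"
    by (intro sum.cong refl; simp)+
  ultimately show "(SUM i<m. (if i = k then 1 else 0) * x i) = x k" "(SUM i<m. (if k = i then 1 else 0) * x i) = x k"
    "(SUM i<m. x i * (if i = k then 1 else 0)) = x k" "(SUM i<m. x i * (if k = i then 1 else 0)) = x k" by simp_all
qed

text \<open>Matrices are kept as functions of two indices, since their entries depend on the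
  covariates and have to be measured and integrated. \<open>gmat\<close> passes to the matrix type
  where determinants and eigenvalues are needed.\<close>

definition bform :: "nat => (nat => nat => real) => (nat => real) => (nat => real) => real" where
  "bform m G v w = (SUM j<m. SUM k<m. v j * G j k * w k)"

definition gmat :: "nat => (nat => nat => real) => real mat" where
  "gmat m G = mat m m (%(j, k). G j k)"

lemma gmat_carrier [simp]: "gmat m G : carrier_mat m m" by (simp add: gmat_def)

lemma gmat_mult_vec: "gmat m G *\<^sub>v Matrix.vec m v = Matrix.vec m (%j. SUM k<m. G j k * v k)"
  by (auto simp: gmat_def scalar_prod_def lessThan_atLeast0 intro!: eq_vecI sum.cong)

lemma bform_add_left: "bform m G (%j. v j + t * v' j) w = bform m G v w + t * bform m G v' w"
  by (simp add: bform_def sum.distrib[symmetric] sum_distrib_left algebra_simps)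

lemma bform_add_right: "bform m G v (%j. w j + t * w' j) = bform m G v w + t * bform m G v w'"
  by (simp add: bform_def sum.distrib[symmetric] sum_distrib_left algebra_simps)

lemma bform_sym:
  assumes "!!j k. j < m ==> k < m ==> G j k = G k j"
  shows "bform m G v w = bform m G w v"
  unfolding bform_def
  by (subst sum.swap) (intro sum.cong refl, simp add: assms)

lemma bform_apply: "bform m G v w = (SUM j<m. v j * (SUM k<m. G j k * w k))"
  by (simp add: bform_def sum_distrib_left mult.assoc)

text \<open>A first-order condition: near t = 0 the linear term dominates, so its coefficient must
  vanish. It turns minimality of the Rayleigh quotient into the eigenvector equation.\<close>

lemma quadratic_nonneg_imp_linear_zero:
  assumes "!!t::real. 0 <= 2 * t * b + t^2 * c" shows "b = 0"
proof (rule ccontr)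
  assume b: "b ~= 0"
  define d where "d = \<bar>c\<bar> + 1"
  have d: "d > 0" "c < d" unfolding d_def by auto
  have "0 <= (2 * (- b / d) * b + (- b / d)^2 * c) * d^2" using assms[of "- b / d"] by simp
  also have "... = b^2 * (c - 2 * d)" using d by (simp add: field_simps power2_eq_square)
  finally have "0 <= b^2 * (c - 2 * d)" .
  moreover have "b^2 * (c - 2 * d) < 0" using b d by (intro mult_pos_neg) auto
  ultimately show False by simp
qed

text \<open>A minimiser of the Rayleigh quotient on the unit sphere is an eigenvector.\<close>

lemma Rayleigh_lower:
  assumes sym: "!!j k. j < m ==> k < m ==> G j k = G k j"
    and ev: "!!r. eigenvalue (gmat m G) r ==> a <= r"
  shows "a * (SUM j<m. (v j)^2) <= bform m G v v"
proof (cases "m = 0")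
  case True then show ?thesis by (simp add: bform_def)
next
  case False
  \<comment> \<open>The unit sphere as a subset of all sequences: coordinates from m on are 0 and
    the others lie in [-1, 1], so compactness follows from Tychonoff's theorem.\<close>
  define K where "K = (PiE UNIV (%i. if i < m then {-1..1} else {0::real})) Int {w. (SUM j<m. (w j)^2) = 1}"
  have "compactin (product_topology (%i. euclidean) UNIV) (PiE UNIV (%i::nat. if i < m then {-1..1} else {0::real}))"
    by (subst compactin_PiE) auto
  then have c1: "compact (PiE UNIV (%i::nat. if i < m then {-1..1} else {0::real}))"
    by (simp add: euclidean_product_topology)
  have coord: "continuous_on S (%w::nat => real. w j)" for S j
    using continuous_on_product_coordinates[of j] by (rule continuous_on_subset) auto
  have cl: "closed {w::nat => real. (SUM j<m. (w j)^2) = 1}"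
    by (intro closed_Collect_eq continuous_intros coord)
  have cK: "compact K" unfolding K_def using c1 cl by (rule compact_Int_closed)
  have "(%j. if j = 0 then 1 else 0) : K"
  proof -
    have "(SUM j<m. (if j = 0 then 1 else 0::real)^2) = (SUM j<m. if j = 0 then 1 else 0)" by (intro sum.cong) auto
    then show ?thesis using False unfolding K_def by auto
  qed
  then have Kne: "K ~= {}" by auto
  have "continuous_on K (%w. bform m G w w)"
    unfolding bform_def by (intro continuous_intros coord)
  from continuous_attains_inf[OF cK Kne this] obtain v0 where v0: "v0 : K" "!!w. w : K ==> bform m G v0 v0 <= bform m G w w" by auto
  define l where "l = bform m G v0 v0"
  have n0: "(SUM j<m. (v0 j)^2) = 1" using v0 by (simp add: K_def)
  have low: "l * (SUM j<m. (w j)^2) <= bform m G w w" for w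
  proof (cases "(SUM j<m. (w j)^2) = 0")
    case True
    then have "w j = 0" if "j < m" for j using that by (simp add: sum_nonneg_eq_0_iff)
    then have "bform m G w w = 0" unfolding bform_def by simp
    then show ?thesis using True by simp
  next
    case False
    define s where "s = sqrt (SUM j<m. (w j)^2)"
    have s2: "s^2 = (SUM j<m. (w j)^2)" unfolding s_def by (simp add: sum_nonneg)
    have s: "s > 0" unfolding s_def using False by (simp add: order_less_le sum_nonneg)
    define u where "u j = (if j < m then w j / s else 0)" for j
    have us: "(SUM j<m. (u j)^2) = 1"
    proof -
      have "(SUM j<m. (u j)^2) = (SUM j<m. (w j)^2 / s^2)" unfolding u_def by (intro sum.cong) (auto simp: power_divide)
      also have "... = 1" using s by (simp add: sum_divide_distrib[symmetric] s2[symmetric])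
      finally show ?thesis .
    qed
    have ub: "\<bar>u j\<bar> <= 1" if "j < m" for j
    proof -
      have "(u j)^2 <= (SUM j<m. (u j)^2)" using that by (intro member_le_sum) auto
      then show ?thesis using us by (simp add: abs_square_le_1)
    qed
    have "u i : (if i < m then {-1..1} else {0})" for i
    proof (cases "i < m")
      case True then show ?thesis using ub[OF True] by (simp add: abs_le_iff)
    qed (simp add: u_def)
    then have "u : K" unfolding K_def using us by (simp add: PiE_UNIV_domain)
    then have "l <= bform m G u u" using v0 l_def by simp
    also have "bform m G u u = bform m G w w / s^2"
      unfolding bform_def sum_divide_distrib u_def by (intro sum.cong) (auto simp: power2_eq_square)
    finally have "l <= bform m G w w / s^2" .
    then have "l * s^2 <= bform m G w w" using s by (simp add: pos_le_divide_eq)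
    then show ?thesis using s2 by simp
  qed
  have eq: "(SUM k<m. G i k * v0 k) = l * v0 i" if i: "i < m" for i
  proof -
    define e where "e j = (if j = i then 1 else 0::real)" for j
    have ei: "(SUM j<m. e j * x j) = x i" for x :: "nat => real" unfolding e_def by (rule sum_unit_vector(1)[OF i])
    \<comment> \<open>The homogeneous inequality \<open>low\<close> at v0 + t e_i; the terms without
      t cancel since v0 attains the minimum on the sphere.\<close>
    have "0 <= 2 * t * ((SUM k<m. G i k * v0 k) - l * v0 i) + t^2 * (bform m G e e - l)" for t
    proof -
      have "bform m G (%j. v0 j + t * e j) (%j. v0 j + t * e j) = l + 2 * t * bform m G e v0 + t^2 * bform m G e e"
        unfolding bform_add_left bform_add_right using bform_sym[of m G v0 e, OF sym]
        by (simp add: l_def power2_eq_square algebra_simps)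
      moreover have "bform m G e v0 = (SUM k<m. G i k * v0 k)" unfolding bform_apply ei ..
      moreover have "(SUM j<m. (v0 j + t * e j)^2) = 1 + 2 * t * v0 i + t^2"
      proof -
        have "(SUM j<m. (v0 j + t * e j)^2) = (SUM j<m. (v0 j)^2) + 2 * t * (SUM j<m. e j * v0 j) + t^2 * (SUM j<m. e j * e j)"
          by (simp add: sum_distrib_left sum.distrib[symmetric] power2_eq_square algebra_simps)
        then show ?thesis unfolding ei n0 by (simp add: e_def)
      qed
      ultimately show ?thesis using low[of "%j. v0 j + t * e j"] by (simp add: algebra_simps)
    qed
    then have "(SUM k<m. G i k * v0 k) - l * v0 i = 0" by (rule quadratic_nonneg_imp_linear_zero)
    then show ?thesis by simp
  qed
  have "eigenvector (gmat m G) (Matrix.vec m v0) l"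
    unfolding eigenvector_def
  proof (intro conjI)
    show "Matrix.vec m v0 ~= 0\<^sub>v (dim_row (gmat m G))"
    proof
      assume z: "Matrix.vec m v0 = 0\<^sub>v (dim_row (gmat m G))"
      have "v0 j = 0" if "j < m" for j using arg_cong[OF z, of "%w. vec_index w j"] that by (simp add: gmat_def)
      then show False using n0 by simp
    qed
    show "gmat m G *\<^sub>v Matrix.vec m v0 = l \<cdot>\<^sub>v Matrix.vec m v0"
      unfolding gmat_mult_vec using eq by (intro eq_vecI) auto
  qed (simp add: gmat_def)
  then have "a <= l" using ev by (auto simp: eigenvalue_def)
  then have "a * (SUM j<m. (v j)^2) <= l * (SUM j<m. (v j)^2)" by (intro mult_right_mono) (auto simp: sum_nonneg)
  then show ?thesis using low[of v] by simp
qed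

text \<open>The spectrum of -G is the negative of that of G, so the lower bound applies to
  -G.\<close>

lemma Rayleigh_upper:
  assumes sym: "!!j k. j < m ==> k < m ==> G j k = G k j"
    and ev: "!!r. eigenvalue (gmat m G) r ==> r <= b"
  shows "bform m G v v <= b * (SUM j<m. (v j)^2)"
proof -
  have "- b * (SUM j<m. (v j)^2) <= bform m (%j k. - G j k) v v"
  proof (rule Rayleigh_lower)
    fix r assume "eigenvalue (gmat m (%j k. - G j k)) r"
    then obtain w where w: "w : carrier_vec m" "w ~= 0\<^sub>v m" "gmat m (%j k. - G j k) *\<^sub>v w = r \<cdot>\<^sub>v w"
      unfolding eigenvalue_def eigenvector_def by (auto simp: gmat_def)
    define u where "u = vec_index w"
    have wu: "w = Matrix.vec m u" unfolding u_def using w(1) by (intro eq_vecI) auto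
    have "eigenvector (gmat m G) w (- r)"
      unfolding eigenvector_def
    proof (intro conjI)
      show "gmat m G *\<^sub>v w = - r \<cdot>\<^sub>v w"
      proof (rule eq_vecI)
        fix i assume "i < dim_vec (- r \<cdot>\<^sub>v w)"
        then have i: "i < m" using w by simp
        have "(SUM k<m. - G i k * u k) = r * u i"
          using arg_cong[OF w(3), of "%w. vec_index w i"] i unfolding wu gmat_mult_vec by simp
        then show "vec_index (gmat m G *\<^sub>v w) i = vec_index (- r \<cdot>\<^sub>v w) i"
          unfolding wu gmat_mult_vec using i by (simp add: sum_negf)
      qed (use w in \<open>simp add: gmat_def\<close>)
    qed (use w in \<open>auto simp: gmat_def\<close>)
    then have "- r <= b" using ev by (auto simp: eigenvalue_def)
    then show "- b <= r" by simp
  qed (simp add: sym)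
  moreover have "bform m (%j k. - G j k) v v = - bform m G v v" by (simp add: bform_def sum_negf)
  ultimately show ?thesis by simp
qed

text \<open>The adjugate formula writes the inverse as polynomials in the entries over the
  determinant, so its entries are measurable, and bounded in terms of those of G. The value 0 for
  singular G is the default of \<open>Sigma_inv\<close>.\<close>

definition ginv :: "nat => (nat => nat => real) => nat => nat => real" where
  "ginv m G l k = (if Determinant.det (gmat m G) = 0 then 0 else adj_mat (gmat m G) $$ (l, k) / Determinant.det (gmat m G))"

lemma ginv_mult:
  assumes d: "Determinant.det (gmat m G) ~= 0" and jl: "j < m" "l < m"
  shows "(SUM k<m. G j k * ginv m G k l) = (if j = l then 1 else 0)"
    and "(SUM k<m. ginv m G j k * G k l) = (if j = l then 1 else 0)"
proof -
  let ?A = "gmat m G" let ?B = "adj_mat (gmat m G)"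
  have B: "?B : carrier_mat m m" and AB: "?A * ?B = Determinant.det ?A \<cdot>\<^sub>m 1\<^sub>m m" "?B * ?A = Determinant.det ?A \<cdot>\<^sub>m 1\<^sub>m m"
    using adj_mat[OF gmat_carrier] by auto
  have "(?A * ?B) $$ (j, l) = (SUM k<m. G j k * ?B $$ (k, l))"
    using jl B by (auto simp: scalar_prod_def gmat_def lessThan_atLeast0 intro!: sum.cong)
  then have "(SUM k<m. G j k * ?B $$ (k, l)) = Determinant.det ?A * (if j = l then 1 else 0)"
    unfolding AB using jl by simp
  moreover have "(SUM k<m. G j k * ginv m G k l) = (SUM k<m. G j k * ?B $$ (k, l)) / Determinant.det ?A"
    unfolding ginv_def sum_divide_distrib using d by simp
  ultimately show "(SUM k<m. G j k * ginv m G k l) = (if j = l then 1 else 0)" using d by simp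
  have "(?B * ?A) $$ (j, l) = (SUM k<m. ?B $$ (j, k) * G k l)"
    using jl B by (auto simp: scalar_prod_def gmat_def lessThan_atLeast0 intro!: sum.cong)
  then have "(SUM k<m. ?B $$ (j, k) * G k l) = Determinant.det ?A * (if j = l then 1 else 0)"
    unfolding AB using jl by simp
  moreover have "(SUM k<m. ginv m G j k * G k l) = (SUM k<m. ?B $$ (j, k) * G k l) / Determinant.det ?A"
    unfolding ginv_def sum_divide_distrib using d by simp
  ultimately show "(SUM k<m. ginv m G j k * G k l) = (if j = l then 1 else 0)" using d by simp
qed

text \<open>The left-hand side is the case expression of \<open>Sigma_inv\<close>. For a singular
  matrix both sides are zero; otherwise two inverses of the same matrix agree.\<close>

lemma mat_inverse_gmat:
  "(case mat_inverse (gmat m G) of Some B => B | None => 0\<^sub>m m m) = gmat m (ginv m G)"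
proof (cases "mat_inverse (gmat m G)")
  case None
  have "Determinant.det (gmat m G) = 0"
    using mat_inverse(1)[OF gmat_carrier None, of "()"] det_non_zero_imp_unit[OF gmat_carrier, of m G "()"] by blast
  then show ?thesis using None by (auto simp: gmat_def ginv_def intro!: eq_matI)
next
  case (Some B)
  let ?A = "gmat m G"
  have B: "?A * B = 1\<^sub>m m" "B * ?A = 1\<^sub>m m" "B : carrier_mat m m"
    using mat_inverse(2)[OF gmat_carrier Some] by auto
  have "Determinant.det ?A * Determinant.det B = Determinant.det (1\<^sub>m m)"
    unfolding B(1)[symmetric] by (rule Determinant.det_mult[OF gmat_carrier B(3), symmetric])
  then have d: "Determinant.det ?A ~= 0" by (auto simp: Determinant.det_one)
  have I: "?A * gmat m (ginv m G) = 1\<^sub>m m"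
  proof (rule eq_matI)
    fix i j assume "i < dim_row (1\<^sub>m m)" "j < dim_col (1\<^sub>m m)"
    then show "(?A * gmat m (ginv m G)) $$ (i, j) = 1\<^sub>m m $$ (i, j)"
      using ginv_mult(1)[OF d, of i j] by (auto simp: scalar_prod_def gmat_def lessThan_atLeast0)
  qed (auto simp: gmat_def)
  have "gmat m (ginv m G) = (B * ?A) * gmat m (ginv m G)" unfolding B(2) by (rule left_mult_one_mat[OF gmat_carrier, symmetric])
  also have "... = B * (?A * gmat m (ginv m G))" by (rule assoc_mult_mat[OF B(3) gmat_carrier gmat_carrier])
  also have "... = B" unfolding I by (rule right_mult_one_mat[OF B(3)])
  finally show ?thesis using Some by simp
qed

lemma singular_gmat:
  assumes "Determinant.det (gmat m G) = 0"
  obtains v where "EX i<m. v i ~= 0" "!!j. j < m ==> (SUM k<m. G j k * v k) = 0"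
proof -
  obtain w where w: "w : carrier_vec m" "w ~= 0\<^sub>v m" "gmat m G *\<^sub>v w = 0\<^sub>v m"
    using det_0_iff_vec_prod_zero[OF gmat_carrier, of m G] assms by auto
  define u where "u = vec_index w"
  have wu: "w = Matrix.vec m u" unfolding u_def using w(1) by (intro eq_vecI) auto
  have "EX i<m. u i ~= 0"
  proof (rule ccontr)
    assume "\<not> (EX i<m. u i ~= 0)"
    then have "w = 0\<^sub>v m" unfolding wu by (intro eq_vecI) auto
    then show False using w by simp
  qed
  moreover have "(SUM k<m. G j k * u k) = 0" if "j < m" for j
    using arg_cong[OF w(3), of "%w. vec_index w j"] that unfolding wu gmat_mult_vec by simp
  ultimately show ?thesis using that by blast
qed

lemma det_gmat: "Determinant.det (gmat m G) = (SUM p:{p. p permutes {0..<m}}. signof p * (\<Prod>i=0..<m. G i (p i)))"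
proof -
  have "p i < m" if "p permutes {0..<m}" "i < m" for p i
    using permutes_in_image[OF that(1), of i] that(2) by simp
  then show ?thesis
    by (subst det_def'[OF gmat_carrier]) (auto simp: gmat_def intro!: sum.cong prod.cong)
qed

text \<open>A cofactor is the determinant of a matrix whose row and column indices skip k and l.
  Being again a \<open>gmat\<close>, it inherits measurability and bounds from those of
  determinants.\<close>

lemma adj_gmat:
  assumes "l < m" "k < m"
  shows "adj_mat (gmat m G) $$ (l, k) = (-1) ^ (k + l) * Determinant.det (gmat (m - 1)
     (%i j. G (if i < k then i else Suc i) (if j < l then j else Suc j)))"
proof -
  have "mat_delete (gmat m G) k l = gmat (m - 1) (%i j. G (if i < k then i else Suc i) (if j < l then j else Suc j))"
    using assms by (intro eq_matI) (auto simp: mat_delete_def gmat_def)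
  then show ?thesis using assms by (simp add: adj_mat_def cofactor_def gmat_def)
qed

lemma det_gmat_measurable:
  assumes "!!j k. j < m ==> k < m ==> (%x. G x j k) : bm M"
  shows "(%x. Determinant.det (gmat m (G x))) : bm M"
proof -
  have "p i < m" if "p permutes {0..<m}" "i < m" for p i
    using permutes_in_image[OF that(1), of i] that(2) by simp
  then show ?thesis unfolding det_gmat by (intro borel_measurable_sum borel_measurable_times borel_measurable_prod borel_measurable_const assms) auto
qed

lemma ginv_measurable:
  assumes "!!j k. j < m ==> k < m ==> (%x. G x j k) : bm M" and lk: "l < m" "k < m"
  shows "(%x. ginv m (G x) l k) : bm M"
proof -
  note [measurable] = det_gmat_measurable[OF assms(1)]
  have [measurable]: "(%x. adj_mat (gmat m (G x)) $$ (l, k)) : bm M"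
    unfolding adj_gmat[OF lk]
    by (intro borel_measurable_times borel_measurable_const det_gmat_measurable) (use assms in auto)
  show ?thesis unfolding ginv_def by measurable
qed

lemma det_gmat_bounded:
  assumes "!!j k. j < m ==> k < m ==> \<bar>G j k\<bar> <= N" "0 <= N"
  shows "\<bar>Determinant.det (gmat m G)\<bar> <= fact m * N ^ m"
proof -
  have pm: "p i < m" if "p permutes {0..<m}" "i < m" for p i
    using permutes_in_image[OF that(1), of i] that(2) by simp
  have "\<bar>signof p * (\<Prod>i=0..<m. G i (p i))\<bar> <= N ^ m" if "p permutes {0..<m}" for p
  proof -
    have "\<bar>\<Prod>i=0..<m. G i (p i)\<bar> <= (\<Prod>i=0..<m. N)"
      unfolding abs_prod using assms pm[OF that] by (intro prod_mono) auto
    then show ?thesis by (simp add: abs_mult sign_def)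
  qed
  then have "(SUM p:{p. p permutes {0..<m}}. \<bar>signof p * (\<Prod>i=0..<m. G i (p i))\<bar>) <= (SUM p:{p. p permutes {0..<m}}. N ^ m)"
    by (intro sum_mono) auto
  also have "... = fact m * N ^ m" using card_permutations[of "{0..<m}" m] by simp
  finally show ?thesis unfolding det_gmat by (rule order_trans[OF sum_abs])
qed

text \<open>One constant N bounds the entries and the reciprocal of the determinant; the remaining
  factors bound a minor of size m - 1.\<close>

lemma ginv_bounded:
  assumes G: "!!j k. j < m ==> k < m ==> \<bar>G j k\<bar> <= N" and N: "1 <= N" and d: "1 / N <= \<bar>Determinant.det (gmat m G)\<bar>"
    and lk: "l < m" "k < m"
  shows "\<bar>ginv m G l k\<bar> <= fact (m - 1) * N ^ (m - 1) * N"
proof -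
  have "\<bar>adj_mat (gmat m G) $$ (l, k)\<bar> <= fact (m - 1) * N ^ (m - 1)"
    unfolding adj_gmat[OF lk] abs_mult
    using det_gmat_bounded[of "m - 1" "%i j. G (if i < k then i else Suc i) (if j < l then j else Suc j)" N] G N
    by (simp add: power_abs)
  then have "\<bar>adj_mat (gmat m G) $$ (l, k)\<bar> * (1 / \<bar>Determinant.det (gmat m G)\<bar>) <= (fact (m - 1) * N ^ (m - 1)) * N"
  proof (rule mult_mono)
    have "0 < \<bar>Determinant.det (gmat m G)\<bar>" using d N zero_less_divide_1_iff[of N] by linarith
    then show "1 / \<bar>Determinant.det (gmat m G)\<bar> <= N" using d N by (simp add: field_simps)
  qed (use N in auto)
  moreover have "\<bar>ginv m G l k\<bar> <= \<bar>adj_mat (gmat m G) $$ (l, k)\<bar> * (1 / \<bar>Determinant.det (gmat m G)\<bar>)"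
    by (simp add: ginv_def abs_divide)
  ultimately show ?thesis by linarith
qed

text \<open>Let x = G^-1 v. The lower eigenvalue bound and Cauchy-Schwarz give a |x|^2 <= v' x <=
  |v| |x|, so |x| <= |v| / a. For the lower bound of the inverse form, the form of G is nonnegative
  at x + t v; minimising over t gives |v|^4 <= (v' x) (v' G v) <= (v' x) b |v|^2.\<close>

lemma pos_def_inverse:
  assumes sym: "!!j k. j < m ==> k < m ==> G j k = G k j"
    and ev: "!!r. eigenvalue (gmat m G) r ==> a <= r & r <= b" and a: "a > 0"
  shows "Determinant.det (gmat m G) ~= 0"
    and "!!j k. j < m ==> k < m ==> ginv m G j k = ginv m G k j"
    and "!!v. (SUM j<m. (SUM k<m. ginv m G j k * v k)^2) <= (SUM j<m. (v j)^2) / a^2"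
    and "!!v. (SUM j<m. (v j)^2) <= b * bform m (ginv m G) v v"
    and "!!j k. j < m ==> k < m ==> \<bar>ginv m G j k\<bar> <= 1 / a"
proof -
  have low: "a * (SUM j<m. (v j)^2) <= bform m G v v" for v by (rule Rayleigh_lower[of m G a v]) (use sym ev in auto)
  have up: "bform m G v v <= b * (SUM j<m. (v j)^2)" for v by (rule Rayleigh_upper[of m G b v]) (use sym ev in auto)
  show d: "Determinant.det (gmat m G) ~= 0"
  proof
    assume "Determinant.det (gmat m G) = 0"
    then obtain v where v: "EX i<m. v i ~= 0" "!!j. j < m ==> (SUM k<m. G j k * v k) = 0" using singular_gmat by metis
    have "bform m G v v = 0" unfolding bform_apply using v(2) by simp
    then have "(SUM j<m. (v j)^2) <= 0" using low[of v] a by (simp add: mult_le_0_iff)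
    then have "(SUM j<m. (v j)^2) = 0" using sum_nonneg[of "{..<m}" "%j. (v j)^2"] by simp
    then show False using v(1) by (auto simp: sum_nonneg_eq_0_iff)
  qed
  let ?H = "ginv m G"
  have HT: "?H j k = ?H k j" if jk: "j < m" "k < m" for j k
  proof -
    have "?H j k = (SUM i<m. (if i = k then 1 else 0) * ?H j i)" by (rule sum_unit_vector(1)[OF jk(2), symmetric])
    also have "... = (SUM i<m. (SUM l<m. ?H k l * G l i) * ?H j i)"
      by (intro sum.cong refl) (simp only: ginv_mult(2)[OF d jk(2)] lessThan_iff eq_commute)
    also have "... = (SUM i<m. SUM l<m. ?H k l * (?H j i * G i l))"
      unfolding sum_distrib_right
    proof (intro sum.cong refl)
      fix i l assume "i : {..<m}" "l : {..<m}"
      then have "G l i = G i l" using sym by simp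
      then show "?H k l * G l i * ?H j i = ?H k l * (?H j i * G i l)" by simp
    qed
    also have "... = (SUM l<m. ?H k l * (SUM i<m. ?H j i * G i l))"
      by (subst sum.swap) (simp add: sum_distrib_left)
    also have "... = (SUM l<m. ?H k l * (if j = l then 1 else 0))"
      by (intro sum.cong refl) (simp only: ginv_mult(2)[OF d jk(1)] lessThan_iff)
    also have "... = ?H k j" by (rule sum_unit_vector(4)[OF jk(1)])
    finally show ?thesis .
  qed
  show "!!j k. j < m ==> k < m ==> ginv m G j k = ginv m G k j" by (rule HT)
  have GH: "(SUM k<m. G j k * (SUM l<m. ?H k l * v l)) = v j" if j: "j < m" for j v
  proof -
    have "(SUM k<m. G j k * (SUM l<m. ?H k l * v l)) = (SUM l<m. (SUM k<m. G j k * ?H k l) * v l)"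
      unfolding sum_distrib_left sum_distrib_right by (subst sum.swap) (simp add: mult.assoc)
    also have "... = (SUM l<m. (if j = l then 1 else 0) * v l)"
      by (intro sum.cong refl) (simp only: ginv_mult(1)[OF d j] lessThan_iff)
    also have "... = v j" by (rule sum_unit_vector(2)[OF j])
    finally show ?thesis .
  qed
  have main: "(SUM j<m. (SUM k<m. ?H j k * v k)^2) <= (SUM j<m. (v j)^2) / a^2 & (SUM j<m. (v j)^2) <= b * bform m ?H v v" for v
  proof -
    define x where "x j = (SUM k<m. ?H j k * v k)" for j
    have Gx: "(SUM k<m. G j k * x k) = v j" if "j < m" for j unfolding x_def by (rule GH[OF that])
    define X where "X = (SUM j<m. (x j)^2)"
    define V where "V = (SUM j<m. (v j)^2)"
    define q where "q = (SUM j<m. v j * x j)"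
    have X0: "0 <= X" and V0: "0 <= V" unfolding X_def V_def by (auto simp: sum_nonneg)
    have bq: "bform m ?H v v = q" unfolding bform_apply q_def x_def ..
    have gxx: "bform m G x x = q" unfolding bform_apply q_def using Gx by (intro sum.cong) (auto simp: mult.commute)
    have gvx: "bform m G v x = V" unfolding bform_apply V_def using Gx by (intro sum.cong) (auto simp: power2_eq_square)
    have q1: "a * X <= q" using low[of x] unfolding gxx X_def .
    have CS: "q^2 <= V * X" unfolding q_def V_def X_def using Cauchy_Schwarz_ineq_sum[of v x "{..<m}"] by simp
    have "X <= V / a^2"
    proof (cases "X = 0")
      case False
      then have Xp: "0 < X" using X0 by simp
      have "(a * X)^2 <= q^2" using q1 a X0 by (intro power_mono) auto
      then have "a^2 * X * X <= V * X" using CS by (simp add: power2_eq_square algebra_simps)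
      then have "a^2 * X <= V" using Xp by simp
      then show ?thesis using a by (simp add: field_simps)
    qed (use V0 in auto)
    moreover have "V <= b * q"
    proof (cases "V = 0")
      case True
      then have "v j = 0" if "j < m" for j using that unfolding V_def by (simp add: sum_nonneg_eq_0_iff)
      then have "q = 0" unfolding q_def by simp
      then show ?thesis using True by simp
    next
      case False
      then have Vp: "0 < V" using V0 by simp
      have Q: "bform m G (%j. x j + t * v j) (%j. x j + t * v j) = q + 2 * t * V + t^2 * bform m G v v" for t
        unfolding bform_add_left bform_add_right gxx gvx using gvx bform_sym[of m G x v, OF sym]
        by (simp add: power2_eq_square algebra_simps)
      define B where "B = bform m G v v"
      have Bp: "0 < B" unfolding B_def using low[of v] mult_pos_pos[OF a Vp] unfolding V_def by linarith
      have "0 <= bform m G (%j. x j + (- V / B) * v j) (%j. x j + (- V / B) * v j)"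
        by (rule order_trans[OF _ low[of "%j. x j + (- V / B) * v j"]]) (use a in \<open>auto intro!: mult_nonneg_nonneg sum_nonneg\<close>)
      then have "0 <= (q + 2 * (- V / B) * V + (- V / B)^2 * B) * B"
        unfolding Q B_def[symmetric] using Bp by simp
      also have "... = q * B - V * V"
      proof -
        define s where "s = V / B"
        have sB: "s * B = V" unfolding s_def using Bp by simp
        have "(q + 2 * (- s) * V + (- s)^2 * B) * B = q * B - 2 * (s * B) * V + (s * B) * (s * B)"
          by (simp add: power2_eq_square algebra_simps)
        then show ?thesis unfolding sB unfolding s_def by simp
      qed
      finally have "V * V <= q * B" by simp
      moreover have "0 <= q" using q1 mult_nonneg_nonneg[OF less_imp_le[OF a] X0] by linarith
      moreover have "B <= b * V" using up[of v] B_def V_def by simp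
      ultimately have "V * V <= q * (b * V)" using mult_left_mono[of B "b * V" q] by linarith
      then show ?thesis using Vp by (simp add: algebra_simps)
    qed
    ultimately show ?thesis unfolding bq V_def X_def x_def by simp
  qed
  then show m1: "!!v. (SUM j<m. (SUM k<m. ginv m G j k * v k)^2) <= (SUM j<m. (v j)^2) / a^2"
    and "!!v. (SUM j<m. (v j)^2) <= b * bform m (ginv m G) v v" by blast+
  fix j k assume jk: "j < m" "k < m"
  have e: "(SUM i<m. x i * (if i = k then 1 else 0)) = x k" for x :: "nat => real"
    by (rule sum_unit_vector(3)[OF jk(2)])
  \<comment> \<open>The entry is a coordinate of the image of the k-th unit vector, whose norm is at
    most 1 / a.\<close>
  have "(?H j k)^2 <= (SUM j<m. (?H j k)^2)" using jk by (intro member_le_sum) auto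
  also have "... = (SUM j<m. (SUM i<m. ?H j i * (if i = k then 1 else 0))^2)" unfolding e ..
  also have "... <= (SUM i<m. (if i = k then 1 else 0)^2) / a^2" by (rule m1)
  also have "(SUM i<m. (if i = k then 1 else 0::real)^2) = (SUM i<m. 1 * (if i = k then 1 else 0))" by (intro sum.cong) auto
  also have "... = 1" by (rule e)
  finally have "(?H j k)^2 <= (1 / a)^2" by (simp add: power_divide)
  then have "\<bar>?H j k\<bar> <= \<bar>1 / a\<bar>" by (simp only: abs_le_square_iff)
  then show "\<bar>?H j k\<bar> <= 1 / a" using a by simp
qed

section \<open>Completeness modulo finitely many functionals\<close>

text \<open>Functions are not identified modulo null sets, and the operator studied later may have a
  kernel; so seminorms are used, and limits need not be unique.\<close>

definition seminorm_on :: "('a => real) set => (('a => real) => real) => bool" where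
  "seminorm_on H p \<longleftrightarrow> (ALL f:H. 0 <= p f) &
     (ALL f:H. ALL g:H. p (%x. f x + g x) <= p f + p g) & (ALL f:H. ALL c. p (%x. c * f x) = \<bar>c\<bar> * p f)"

definition linear_on :: "('a => real) set => (('a => real) => real) => bool" where
  "linear_on H l \<longleftrightarrow> (ALL f:H. ALL g:H. ALL c. l (%x. f x + c * g x) = l f + c * l g)"

definition cauchy_for :: "(('a => real) => real) => (nat => 'a => real) => bool" where
  "cauchy_for p u \<longleftrightarrow> (ALL ep>0. EX N. ALL m>=N. ALL n>=N. p (%x. u m x - u n x) < ep)"

definition complete_for :: "('a => real) set => (('a => real) => real) => bool" where
  "complete_for H p \<longleftrightarrow> (ALL u. (ALL n. u n : H) --> cauchy_for p u -->
     (EX g:H. (%n. p (%x. u n x - g x)) \<longlonglongrightarrow> 0))"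

lemma cauchy_for_mono:
  assumes "cauchy_for q u" "!!m n. p (%x. v m x - v n x) <= C * q (%x. u m x - u n x)" "0 <= C"
  shows "cauchy_for p v"
  unfolding cauchy_for_def
proof (intro allI impI)
  fix e :: real assume "0 < e"
  then have e': "0 < e / (C + 1)" using assms(3) by simp
  obtain N where N: "!!m n. m >= N ==> n >= N ==> q (%x. u m x - u n x) < e / (C + 1)"
    using assms(1)[unfolded cauchy_for_def, rule_format, OF e'] by blast
  have "p (%x. v m x - v n x) < e" if "m >= N" "n >= N" for m n
  proof -
    have "C * q (%x. u m x - u n x) <= C * (e / (C + 1))"
      using N[OF that] assms(3) by (intro mult_left_mono) auto
    also have "... < (C + 1) * (e / (C + 1))" using e' by (intro mult_strict_right_mono) auto
    also have "... = e" using assms(3) by simp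
    finally show ?thesis using assms(2)[of m n] by linarith
  qed
  then show "EX N. ALL m>=N. ALL n>=N. p (%x. v m x - v n x) < e" by blast
qed

lemma linear_on_diff: "linear_on H l ==> f : H ==> g : H ==> l (%x. f x - g x) = l f - l g"
  unfolding linear_on_def by (erule ballE[of _ _ f], erule ballE[of _ _ g], erule allE[of _ "-1"]) auto

lemma seminorm_onD:
  assumes "seminorm_on H p" "lin H" "f : H" "g : H"
  shows "0 <= p f" "p (%x. f x + c * g x) <= p f + \<bar>c\<bar> * p g" "p (%x. c * f x) = \<bar>c\<bar> * p f"
    "p (%x. f x - g x) <= p f + p g"
proof -
  have n: "ALL f:H. 0 <= p f" and a: "ALL f:H. ALL g:H. p (%x. f x + g x) <= p f + p g"
    and b: "ALL f:H. ALL c. p (%x. c * f x) = \<bar>c\<bar> * p f" using assms(1) by (simp_all add: seminorm_on_def)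
  have cg: "(%x. c * g x) : H" for c using assms by (intro linD(5))
  have *: "p (%x. f x + c * g x) <= p f + \<bar>c\<bar> * p g" for c
    using bspec[OF bspec[OF a assms(3)] cg[of c]] b assms(4) by simp
  then show "p (%x. f x + c * g x) <= p f + \<bar>c\<bar> * p g" .
  show "p (%x. f x - g x) <= p f + p g" using *[of "-1"] by simp
  show "0 <= p f" "p (%x. c * f x) = \<bar>c\<bar> * p f" using n b assms(3) by simp_all
qed

lemma linear_onD:
  assumes "linear_on H l" "lin H" "f : H"
  shows "l (%x. c * f x) = c * l f"
proof -
  note z = linD(1)[OF assms(2)]
  have "l (%_. 0) = 0" using linear_on_diff[OF assms(1) z z] by simp
  then show ?thesis using assms(1)[unfolded linear_on_def, rule_format, OF z assms(3), of c] by simp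
qed

text \<open>If the last functional separates the kernel of all the others, it can be eliminated by
  restricting to its kernel without changing the range; otherwise it is bounded by the others.\<close>

theorem complete_mod_functionals:
  fixes p q :: "('a => real) => real"
  assumes "lin H" "seminorm_on H p" "seminorm_on H q"
    and "!!f. f : H ==> q f <= C * p f" "0 <= C"
    and "!!l. l : set L ==> linear_on H l" "!!l f. l : set L ==> f : H ==> \<bar>l f\<bar> <= C * p f"
    and "complete_for H p"
    and "!!f. f : H ==> p f <= K * (q f + (\<Sum>l\<leftarrow>L. \<bar>l f\<bar>))" "0 <= K"
  shows "complete_for H q"
  using assms
proof (induction L arbitrary: H K)
  case (Nil H K)
  show ?case
    unfolding complete_for_def
  proof (intro allI impI)
    fix u assume u: "ALL n. u n : H" and c: "cauchy_for q u"
    have dH: "(%x. u m x - u n x) : H" for m n using u Nil.prems(1) by (auto intro: linD)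
    have "cauchy_for p u"
      by (rule cauchy_for_mono[OF c, of p u K]) (use Nil.prems(9)[OF dH] Nil.prems(10) in auto)
    then obtain g where g: "g : H" "(%n. p (%x. u n x - g x)) \<longlonglongrightarrow> 0"
      using Nil.prems(8) u unfolding complete_for_def by blast
    have gd: "(%x. u n x - g x) : H" for n using u g Nil.prems(1) by (auto intro: linD)
    have "(%n. q (%x. u n x - g x)) \<longlonglongrightarrow> 0"
    proof (rule tendsto_sandwich[of "%_. 0" _ _ "%n. C * p (%x. u n x - g x)"])
      show "(%n. C * p (%x. u n x - g x)) \<longlonglongrightarrow> 0" using tendsto_mult_left[OF g(2), of C] by simp
    qed (use Nil.prems(3,4) gd in \<open>auto simp: seminorm_on_def\<close>)
    then show "EX g:H. (%n. q (%x. u n x - g x)) \<longlonglongrightarrow> 0" using g by blast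
  qed
next
  case (Cons l L H K)
  note H = Cons.prems(1) and p = Cons.prems(2) and q = Cons.prems(3) and qC = Cons.prems(4) and C0 = Cons.prems(5)
    and L = Cons.prems(6) and LC = Cons.prems(7) and pc = Cons.prems(8) and pK = Cons.prems(9) and K0 = Cons.prems(10)
  have p0: "0 <= p f" and q0: "0 <= q f" if "f : H" for f using p q that by (auto simp: seminorm_on_def)
  have S0: "0 <= (\<Sum>l\<leftarrow>L. \<bar>l f\<bar>)" for f by (intro sum_list_nonneg) auto
  have ll: "linear_on H l" and lb: "!!f. f : H ==> \<bar>l f\<bar> <= C * p f" using L LC by auto
  show ?case
  proof (cases "EX psi:H. q psi = 0 & (\<Sum>l\<leftarrow>L. \<bar>l psi\<bar>) = 0 & l psi = 1")
    case True
    then obtain psi where psi: "psi : H" "q psi = 0" "l psi = 1" by blast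
    define H' where "H' = {f\<in>H. l f = 0}"
    have sub: "H' \<subseteq> H" by (auto simp: H'_def)
    have l0: "l (%_. 0) = 0"
      using linear_on_diff[OF ll linD(1)[OF H] linD(1)[OF H]] by simp
    have "complete_for H' q"
    proof (rule Cons.IH[of H' K])
      show "lin H'" unfolding lin_def H'_def using linD(1,2)[OF H] l0 ll by (auto simp: linear_on_def)
      show "seminorm_on H' p" "seminorm_on H' q" using p q sub unfolding seminorm_on_def by blast+
      show "q f <= C * p f" if "f : H'" for f using qC that sub by auto
      show "linear_on H' k" if "k : set L" for k using L[of k] that sub unfolding linear_on_def by auto
      show "\<bar>k f\<bar> <= C * p f" if "k : set L" "f : H'" for k f using LC[of k] that sub by auto
      show "complete_for H' p"
        unfolding complete_for_def
      proof (intro allI impI)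
        fix u assume u: "ALL n. u n : H'" and c: "cauchy_for p u"
        then obtain g where g: "g : H" "(%n. p (%x. u n x - g x)) \<longlonglongrightarrow> 0"
          using pc sub unfolding complete_for_def by blast
        have gd: "(%x. u n x - g x) : H" for n using u sub g H by (auto intro: linD)
        have "\<bar>l g\<bar> <= C * p (%x. u n x - g x)" for n
        proof -
          have "l (%x. u n x - g x) = l (u n) - l g" using linear_on_diff[OF ll _ g(1)] u sub by blast
          moreover have "l (u n) = 0" using u by (auto simp: H'_def)
          ultimately show ?thesis using lb[OF gd[of n]] by simp
        qed
        moreover have "(%n. C * p (%x. u n x - g x)) \<longlonglongrightarrow> 0" using tendsto_mult_left[OF g(2), of C] by simp
        ultimately have "\<bar>l g\<bar> <= 0" by (intro LIMSEQ_le_const) auto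
        then have "g : H'" using g by (simp add: H'_def)
        then show "EX g:H'. (%n. p (%x. u n x - g x)) \<longlonglongrightarrow> 0" using g by blast
      qed
      show "p f <= K * (q f + (\<Sum>l\<leftarrow>L. \<bar>l f\<bar>))" if "f : H'" for f
        using pK[of f] that by (simp add: H'_def)
    qed (use C0 K0 in auto)
    show ?thesis
      unfolding complete_for_def
    proof (intro allI impI)
      fix u assume u: "ALL n. u n : H" and c: "cauchy_for q u"
      \<comment> \<open>Subtracting this multiple of psi moves u n into the kernel of l; as q psi =
        0, no distance in q changes.\<close>
      define v where "v n x = u n x + (- l (u n)) * psi x" for n x
      have vH: "v n : H'" for n
      proof -
        have "v n : H" unfolding v_def using u psi by (intro linD(2)[OF H]) auto
        moreover have "l (v n) = l (u n) + (- l (u n)) * l psi"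
          unfolding v_def using ll u psi unfolding linear_on_def by blast
        ultimately show ?thesis using psi by (simp add: H'_def)
      qed
      have eq: "q (%x. f x + c * psi x) <= q f" if "f : H" for f c
        using seminorm_onD(2)[OF q H that psi(1), of c] psi(2) by simp
      have "cauchy_for q v"
      proof (rule cauchy_for_mono[OF c, of q v 1])
        fix m n
        have d: "(%x. u m x - u n x) : H" using u by (intro linD(4)[OF H]) auto
        have "(%x. v m x - v n x) = (%x. (u m x - u n x) + (l (u n) - l (u m)) * psi x)"
          by (auto simp: v_def algebra_simps)
        then show "q (%x. v m x - v n x) <= 1 * q (%x. u m x - u n x)" using eq[OF d] by simp
      qed simp
      then obtain g where g: "g : H'" "(%n. q (%x. v n x - g x)) \<longlonglongrightarrow> 0"
        using \<open>complete_for H' q\<close> vH unfolding complete_for_def by blast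
      have "(%n. q (%x. u n x - g x)) \<longlonglongrightarrow> 0"
      proof (rule tendsto_sandwich[OF _ _ _ g(2), of "%_. 0"])
        have "(%x. u n x - g x) : H" for n using u g sub by (intro linD(4)[OF H]) auto
        then show "\<forall>\<^sub>F n in sequentially. 0 <= q (%x. u n x - g x)" using q0 by simp
        have "q (%x. u n x - g x) <= q (%x. v n x - g x)" for n
        proof -
          have "(%x. v n x - g x) : H" using vH g sub by (intro linD(4)[OF H]) auto
          from eq[OF this, of "l (u n)"] show ?thesis by (simp add: v_def algebra_simps)
        qed
        then show "\<forall>\<^sub>F n in sequentially. q (%x. u n x - g x) <= q (%x. v n x - g x)" by simp
      qed simp
      then show "EX g:H. (%n. q (%x. u n x - g x)) \<longlonglongrightarrow> 0" using g sub by blast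
    qed
  next
    case False
    define S where "S f = q f + (\<Sum>l\<leftarrow>L. \<bar>l f\<bar>)" for f
    have Sn: "0 <= S f" if "f : H" for f unfolding S_def using q0[OF that] S0[of f] by simp
    \<comment> \<open>If l were unbounded relative to S, functions with l = 1 and S tending to 0
      would form a Cauchy sequence for p, and its limit would be a function excluded by the case
      assumption.\<close>
    have "EX K'>=0. ALL f:H. \<bar>l f\<bar> <= K' * S f"
    proof (rule ccontr)
      assume "\<not> ?thesis"
      then have "EX f:H. real (Suc n) * S f < \<bar>l f\<bar>" for n by (metis not_le of_nat_0_le_iff)
      then obtain f where f: "!!n. f n : H" "!!n. real (Suc n) * S (f n) < \<bar>l (f n)\<bar>" by metis
      define g where "g n x = (1 / l (f n)) * f n x" for n x
      have lf: "0 < \<bar>l (f n)\<bar>" for n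
      proof -
        have "0 <= real (Suc n) * S (f n)" using Sn[OF f(1)] by simp
        then show ?thesis using f(2)[of n] by linarith
      qed
      have gH: "g n : H" for n unfolding g_def using f by (intro linD(5)[OF H])
      have lg: "l (g n) = 1" for n
        unfolding g_def linear_onD[OF ll H f(1)] using lf[of n] by simp
      have qg: "q (g n) = \<bar>1 / l (f n)\<bar> * q (f n)" for n unfolding g_def by (rule seminorm_onD(3)[OF q H f(1) f(1)])
      have kg: "k (g n) = (1 / l (f n)) * k (f n)" if "k : set L" for k n
      proof -
        have "linear_on H k" using L that by simp
        from linear_onD[OF this H f(1)] show ?thesis unfolding g_def .
      qed
      have "\<bar>k (g n)\<bar> = \<bar>1 / l (f n)\<bar> * \<bar>k (f n)\<bar>" if "k : set L" for k n
        unfolding kg[OF that] by (rule abs_mult)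
      then have "(\<Sum>k\<leftarrow>L. \<bar>k (g n)\<bar>) = (\<Sum>k\<leftarrow>L. \<bar>1 / l (f n)\<bar> * \<bar>k (f n)\<bar>)" for n
        by (intro arg_cong[where f=sum_list] map_cong refl)
      then have Sg: "S (g n) = \<bar>1 / l (f n)\<bar> * S (f n)" for n
        unfolding S_def qg by (simp only: sum_list_const_mult distrib_left)
      have Sgs: "S (g n) < 1 / real (Suc n)" for n
      proof -
        have "S (g n) = S (f n) / \<bar>l (f n)\<bar>" using Sg[of n] by simp
        also have "... < 1 / real (Suc n)"
          using f(2)[of n] lf[of n] by (simp add: field_simps del: of_nat_Suc)
        finally show ?thesis .
      qed
      have Sg_lim: "(%n. S (g n)) \<longlonglongrightarrow> 0"
      proof (rule tendsto_sandwich[of "%_. 0" _ _ "%n. 1 / real (Suc n)"])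
        show "(%n. 1 / real (Suc n)) \<longlonglongrightarrow> 0" using LIMSEQ_inverse_real_of_nat by (simp add: inverse_eq_divide)
      qed (use Sn[OF gH] Sgs in \<open>auto intro!: always_eventually less_imp_le simp del: of_nat_Suc\<close>)
      have Sd: "S (%x. a x - b x) <= S a + S b" if "a : H" "b : H" for a b
      proof -
        have "\<bar>k (%x. a x - b x)\<bar> <= \<bar>k a\<bar> + \<bar>k b\<bar>" if "k : set L" for k
          using linear_on_diff[OF _ \<open>a : H\<close> \<open>b : H\<close>, of k] L[of k] that by auto
        then have "(\<Sum>k\<leftarrow>L. \<bar>k (%x. a x - b x)\<bar>) <= (\<Sum>k\<leftarrow>L. \<bar>k a\<bar> + \<bar>k b\<bar>)" by (intro sum_list_mono) auto
        then show ?thesis unfolding S_def using seminorm_onD(4)[OF q H that] by (simp add: sum_list_addf)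
      qed
      have pd: "p (%x. g m x - g n x) <= K * (S (g m) + S (g n))" for m n
      proof -
        have d: "(%x. g m x - g n x) : H" using gH by (intro linD(4)[OF H])
        \<comment> \<open>All g n have l = 1, so the term of l drops out of the bound for p.\<close>
        have "l (%x. g m x - g n x) = 0" using linear_on_diff[OF ll gH gH] lg by simp
        then have "p (%x. g m x - g n x) <= K * S (%x. g m x - g n x)"
          using pK[OF d] by (simp add: S_def)
        also have "... <= K * (S (g m) + S (g n))" using Sd[OF gH gH] K0 by (intro mult_left_mono)
        finally show ?thesis .
      qed
      have "cauchy_for p g"
        unfolding cauchy_for_def
      proof (intro allI impI)
        fix e :: real assume "0 < e"
        then have "0 < e / (K + 1) / 2" using K0 by simp
        from LIMSEQ_D[OF Sg_lim this] obtain N where "!!n. n >= N ==> \<bar>S (g n)\<bar> < e / (K + 1) / 2" by auto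
        then have N: "S (g n) < e / (K + 1) / 2" if "n >= N" for n using that by fastforce
        have "p (%x. g m x - g n x) < e" if "m >= N" "n >= N" for m n
        proof -
          have "p (%x. g m x - g n x) <= K * (S (g m) + S (g n))" by (rule pd)
          also have "... <= K * (e / (K + 1))"
          proof (rule mult_left_mono[OF _ K0])
            show "S (g m) + S (g n) <= e / (K + 1)" using N[OF that(1)] N[OF that(2)] by linarith
          qed
          also have "... < (K + 1) * (e / (K + 1))" using \<open>0 < e\<close> K0 by (intro mult_strict_right_mono) auto
          also have "... = e" using K0 by simp
          finally show ?thesis .
        qed
        then show "EX N. ALL m>=N. ALL n>=N. p (%x. g m x - g n x) < e" by blast
      qed
      then obtain h where h: "h : H" "(%n. p (%x. g n x - h x)) \<longlonglongrightarrow> 0"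
        using pc gH unfolding complete_for_def by blast
      have gh: "(%x. g n x - h x) : H" for n using gH h by (intro linD(4)[OF H])
      have Clim: "(%n. C * p (%x. g n x - h x)) \<longlonglongrightarrow> 0" using tendsto_mult_left[OF h(2), of C] by simp
      have "\<bar>1 - l h\<bar> <= C * p (%x. g n x - h x)" for n
        using lb[OF gh[of n]] linear_on_diff[OF ll gH h(1), of n] lg[of n] by simp
      then have "\<bar>1 - l h\<bar> <= 0" by (intro LIMSEQ_le_const[OF Clim]) auto
      then have lh: "l h = 1" by simp
      have "q h <= S (g n) + C * p (%x. g n x - h x)" for n
      proof -
        have "q (%x. g n x - (g n x - h x)) <= q (g n) + q (%x. g n x - h x)" by (rule seminorm_onD(4)[OF q H gH gh])
        moreover have "q (g n) <= S (g n)" unfolding S_def using S0 by simp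
        ultimately show ?thesis using qC[OF gh[of n]] by simp
      qed
      then have "q h <= 0 + 0" by (intro LIMSEQ_le_const[OF tendsto_add[OF Sg_lim Clim]]) auto
      then have qh: "q h = 0" using q0[OF h(1)] by simp
      have "k h = 0" if k: "k : set L" for k
      proof -
        have lk: "linear_on H k" using L k by simp
        have "\<bar>k h\<bar> <= S (g n) + C * p (%x. g n x - h x)" for n
        proof -
          have "\<bar>k (g n)\<bar> <= (\<Sum>k\<leftarrow>L. \<bar>k (g n)\<bar>)" using k by (intro member_le_sum_list) auto
          then have "\<bar>k (g n)\<bar> <= S (g n)" unfolding S_def using q0[OF gH[of n]] by simp
          moreover have "k (%x. g n x - h x) = k (g n) - k h" by (rule linear_on_diff[OF lk gH h(1)])
          moreover have "\<bar>k (%x. g n x - h x)\<bar> <= C * p (%x. g n x - h x)" using LC k gh by auto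
          ultimately show ?thesis by linarith
        qed
        then have "\<bar>k h\<bar> <= 0 + 0" by (intro LIMSEQ_le_const[OF tendsto_add[OF Sg_lim Clim]]) auto
        then show ?thesis by simp
      qed
      then have "(\<Sum>k\<leftarrow>L. \<bar>k h\<bar>) = (\<Sum>k\<leftarrow>L. 0)" by (intro arg_cong[where f=sum_list] map_cong refl) simp
      then have "(\<Sum>k\<leftarrow>L. \<bar>k h\<bar>) = 0" by simp
      then show False using False h(1) lh qh by blast
    qed
    then obtain K' where K': "0 <= K'" "!!f. f : H ==> \<bar>l f\<bar> <= K' * S f" by blast
    show ?thesis
    \<comment> \<open>The functional l is absorbed into q and the other functionals at the price of
      the factor 1 + K'.\<close>
    proof (rule Cons.IH[of H "K * (1 + K')"])
      fix f assume f: "f : H"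
      have "p f <= K * (S f + \<bar>l f\<bar>)" using pK[OF f] by (simp add: S_def add_ac)
      also have "... <= K * (S f + K' * S f)" using K'(2)[OF f] K0 by (intro mult_left_mono) auto
      finally show "p f <= K * (1 + K') * (q f + (\<Sum>l\<leftarrow>L. \<bar>l f\<bar>))" by (simp add: S_def algebra_simps)
    qed (use H p q qC C0 L LC pc K0 K' in auto)
  qed
qed

section \<open>Hilbert--Schmidt approximation\<close>

text \<open>Finite sums of rectangle indicators are dense in L2 of the product measure. On a
  rectangle the bilinear form splits into a product of two integrals, and an L2 error e of the
  kernel costs at most e times the product of the norms, since the norm of a product function u(x)
  v(y) factorises.\<close>

theorem kernel_finite_rank:
  fixes r :: "'a \<times> 'b => real"
  assumes M1: "finite_measure M1" and M2: "finite_measure M2" and r: "r : L2 (M1 \<Otimes>\<^sub>M M2)" and e: "0 < e"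
  shows "EX F C. finite F & F \<subseteq> sets M1 \<times> sets M2 & 0 <= C & (ALL u:L2 M1. ALL v:L2 M2.
     \<bar>\<integral>z. u (fst z) * v (snd z) * r z \<partial>(M1 \<Otimes>\<^sub>M M2)\<bar>
       <= e * l2norm M1 u * l2norm M2 v + C * (\<Sum>(A, B)\<in>F. aint M1 A u * aint M2 B v))"
proof -
  interpret M1: finite_measure M1 by fact
  interpret M2: finite_measure M2 by fact
  interpret pair_sigma_finite M1 M2 ..
  interpret P: finite_measure "M1 \<Otimes>\<^sub>M M2" by (rule finite_measure_pair_measure[OF M2 M1])
  let ?M = "M1 \<Otimes>\<^sub>M M2"
  define ii where "ii A B z = (indicator A (fst z) * indicator B (snd z) :: real)" for A :: "'a set" and B :: "'b set" and z
  define R where "R = (%(A, B). ii A B) ` (sets M1 \<times> sets M2)"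
  have iiL: "ii A B : L2 ?M" if "A : sets M1" "B : sets M2" for A B
    by (rule P.L2_bounded[of _ 1]) (use that in \<open>auto simp: ii_def[abs_def] split: split_indicator\<close>)
  have RL: "R \<subseteq> L2 ?M" using iiL by (auto simp: R_def)
  have iic: "ii A B : L2_closure ?M (lin_span R)" if "A : sets M1" "B : sets M2" for A B
    using that iiL by (intro L2_closure_superset lin_span_superset) (auto simp: R_def)
  have "L2 ?M \<subseteq> L2_closure ?M (lin_span R)"
  proof (rule P.L2_closure_dense[OF Int_stable_pair_measure_generator[of M1 M2]])
    show "{a \<times> b |a b. a : sets M1 & b : sets M2} \<subseteq> Pow (space ?M)"
      unfolding space_pair_measure using sets.space_closed[of M1] sets.space_closed[of M2] by auto
    show "sets ?M = sigma_sets (space ?M) {a \<times> b |a b. a : sets M1 & b : sets M2}"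
      by (simp add: sets_pair_measure space_pair_measure)
    have ieq: "ii A B = indicator (A \<times> B)" for A B by (auto simp: ii_def fun_eq_iff split: split_indicator)
    show "indicator Z : L2_closure ?M (lin_span R)" if "Z : {a \<times> b |a b. a : sets M1 & b : sets M2}" for Z
      using that iic ieq by auto
    show "(%_. 1) : L2_closure ?M (lin_span R)"
      by (rule L2_closure_cong_AE[OF iic[OF sets.top sets.top]]) (auto simp: ii_def space_pair_measure)
  qed (rule lin_lin_span)
  then have "r : L2_closure ?M (lin_span R)" using r by auto
  then obtain h where h: "h : lin_span R" "h : L2 ?M" "l2norm ?M (%z. r z - h z) < e"
    using e unfolding L2_closure_iff by (metis IntE)
  obtain H c where H: "finite H" "H \<subseteq> R" "h = (%z. SUM g:H. c g * g z)" using h(1) unfolding lin_span_def by auto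
  \<comment> \<open>Each function in H is assigned one rectangle; injectivity on F allows the sum
    over functions to be rewritten as a sum over rectangles.\<close>
  obtain F where F: "F \<subseteq> sets M1 \<times> sets M2" "finite F" "H = (%(A, B). ii A B) ` F" "inj_on (%(A, B). ii A B) F"
  proof -
    obtain U where "U \<subseteq> sets M1 \<times> sets M2" "inj_on (%(A, B). ii A B) U" "H = (%(A, B). ii A B) ` U"
      using H(2) unfolding R_def subset_image_inj by blast
    moreover from this have "finite U" using H(1) finite_imageD by blast
    ultimately show ?thesis using that by blast
  qed
  define C where "C = (\<Sum>(A, B)\<in>F. \<bar>c (ii A B)\<bar>)"
  have heq: "h z = (\<Sum>(A, B)\<in>F. c (ii A B) * ii A B z)" for z
    unfolding H(3) F(3) by (subst sum.reindex[OF F(4)]) (auto simp: case_prod_unfold)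
  have "\<bar>\<integral>z. u (fst z) * v (snd z) * r z \<partial>?M\<bar>
       <= e * l2norm M1 u * l2norm M2 v + C * (\<Sum>(A, B)\<in>F. aint M1 A u * aint M2 B v)"
    if u: "u : L2 M1" and v: "v : L2 M2" for u v
  proof -
    note [measurable] = u[THEN L2D(1)] v[THEN L2D(1)]
    have prod: "integrable ?M (%z. a (fst z) * b (snd z)) & (LINT z|?M. a (fst z) * b (snd z)) = (LINT x|M1. a x) * (LINT x|M2. b x)"
      if a: "integrable M1 a" and b: "integrable M2 b" for a :: "'a => real" and b :: "'b => real"
    proof -
      note [measurable] = borel_measurable_integrable[OF a] borel_measurable_integrable[OF b]
      have I: "integrable ?M (%(x, y). a x * b y)"
        by (rule Fubini_integrable) (use a b in \<open>auto simp: abs_mult\<close>)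
      have "(\<integral>x. \<integral>y. a x * b y \<partial>M2 \<partial>M1) = (LINT (x, y)|?M. a x * b y)" by (rule integral_fst[OF I])
      then show ?thesis using I by (simp add: case_prod_unfold)
    qed
    define w where "w z = u (fst z) * v (snd z)" for z
    have w2: "(%z. (w z)^2) = (%z. (u (fst z))^2 * (v (snd z))^2)" by (auto simp: w_def power_mult_distrib)
    have wL: "w : L2 ?M"
    proof (rule L2I)
      show "w : bm ?M" unfolding w_def[abs_def] by measurable
      show "integrable ?M (%z. (w z)^2)" unfolding w2 using prod[OF L2D(2)[OF u] L2D(2)[OF v]] by simp
    qed
    have wn: "l2norm ?M w = l2norm M1 u * l2norm M2 v"
      unfolding l2norm_def w2 using prod[OF L2D(2)[OF u] L2D(2)[OF v]] by (simp add: real_sqrt_mult)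
    have term_eq: "(LINT z|?M. w z * ii A B z) = (LINT x|M1. indicator A x * u x) * (LINT x|M2. indicator B x * v x)"
      if "(A, B) : F" for A B
    proof -
      have A: "A : sets M1" "B : sets M2" using that F(1) by auto
      have "integrable M1 (%x. indicator A x * u x)" "integrable M2 (%x. indicator B x * v x)"
        using integrable_mult_indicator[OF A(1) M1.L2_integrable[OF u]] integrable_mult_indicator[OF A(2) M2.L2_integrable[OF v]] by simp_all
      from prod[OF this] show ?thesis by (simp add: w_def ii_def algebra_simps)
    qed
    have "(LINT z|?M. w z * h z) = (LINT z|?M. (\<Sum>(A, B)\<in>F. c (ii A B) * (w z * ii A B z)))"
      unfolding heq sum_distrib_left by (intro bi_integral_cong refl sum.cong) (auto simp: algebra_simps)
    also have "... = (\<Sum>(A, B)\<in>F. c (ii A B) * (LINT z|?M. w z * ii A B z))"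
      using F(1) L2_mult_integrable[OF wL iiL] unfolding case_prod_unfold
      by (subst bi_integral_sum) (auto intro!: integrable_mult_right)
    finally have hsum: "(LINT z|?M. w z * h z) = (\<Sum>(A, B)\<in>F. c (ii A B) * (LINT z|?M. w z * ii A B z))" .
    have "\<bar>\<integral>z. w z * h z \<partial>?M\<bar> <= (\<Sum>(A, B)\<in>F. C * (aint M1 A u * aint M2 B v))"
      unfolding hsum
    proof (rule order_trans[OF sum_abs sum_mono])
      fix i assume i: "i : F"
      obtain A B where AB: "i = (A, B)" by (cases i)
      have "\<bar>c (ii A B)\<bar> <= C"
        unfolding C_def using member_le_sum[OF i, of "%(A, B). \<bar>c (ii A B)\<bar>"] F(2) AB by auto
      then show "\<bar>case i of (A, B) => c (ii A B) * (LINT z|?M. w z * ii A B z)\<bar>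
        <= (case i of (A, B) => C * (aint M1 A u * aint M2 B v))"
        using i term_eq unfolding AB by (auto simp: abs_mult intro!: mult_right_mono)
    qed
    also have "... = C * (\<Sum>(A, B)\<in>F. aint M1 A u * aint M2 B v)"
      by (simp add: sum_distrib_left case_prod_unfold)
    finally have b1: "\<bar>\<integral>z. w z * h z \<partial>?M\<bar> <= C * (\<Sum>(A, B)\<in>F. aint M1 A u * aint M2 B v)" .
    have "\<bar>\<integral>z. w z * (r z - h z) \<partial>?M\<bar> <= l2norm ?M w * l2norm ?M (%z. r z - h z)"
      by (rule L2_Cauchy_Schwarz[OF wL L2_diff[OF r h(2)]])
    also have "... <= l2norm ?M w * e" using h(3) by (intro mult_left_mono) auto
    finally have b2: "\<bar>\<integral>z. w z * (r z - h z) \<partial>?M\<bar> <= e * l2norm M1 u * l2norm M2 v" unfolding wn by (simp add: algebra_simps)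
    have "(LINT z|?M. w z * (r z - h z)) = (LINT z|?M. w z * r z) - (LINT z|?M. w z * h z)"
      using L2_mult_integrable[OF wL r] L2_mult_integrable[OF wL h(2)] by (simp add: right_diff_distrib)
    then show ?thesis using b1 b2 unfolding w_def by linarith
  qed
  moreover have "0 <= C" unfolding C_def by (auto intro!: sum_nonneg)
  ultimately show ?thesis using F(1,2) by (intro exI[of _ F] exI[of _ C] conjI ballI)
qed

section \<open>Closedness of spaces of additive functions\<close>

text \<open>A density instead of a restricted space: the underlying space remains the whole line, so
  that members of L2 are Borel functions on the reals, as in \<open>L2_on\<close>.\<close>

definition leb_on :: "real set => real measure" where
  "leb_on A = density lborel (indicator A)"

lemma leb_on_simps [simp, measurable_cong]: "space (leb_on A) = UNIV" "sets (leb_on A) = sets borel"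
  by (simp_all add: leb_on_def)

lemma L2_leb_on: assumes [measurable]: "A : sets borel" shows "L2 (leb_on A) = L2_on A"
proof -
  have "integrable (density lborel (%x. ennreal (indicator A x))) (%t. (g t)^2) \<longleftrightarrow> integrable lborel (%t. indicator A t *\<^sub>R (g t)^2)"
    if [measurable]: "g : bm borel" for g :: "real => real"
    by (subst integrable_density) auto
  moreover have "density lborel (%x. ennreal (indicator A x)) = leb_on A"
    unfolding leb_on_def by (intro arg_cong[where f="density lborel"]) (auto simp: indicator_def)
  ultimately have "integrable (leb_on A) (%t. (g t)^2) \<longleftrightarrow> set_integrable lborel A (%t. (g t)^2)"
    if "g : bm borel" for g :: "real => real"
    using that by (simp add: set_integrable_def)
  moreover have "bm (leb_on A) = bm borel" by (intro measurable_cong_sets) auto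
  ultimately show ?thesis unfolding L2_def L2_on_def by auto
qed

lemma integral_leb_on:
  fixes g :: "real => real"
  assumes [measurable]: "A : sets borel" "g : bm borel"
  shows "(LINT x|leb_on A. g x) = (LINT t:A|lborel. g t)"
proof -
  have "density lborel (%x. ennreal (indicator A x)) = leb_on A"
    unfolding leb_on_def by (intro arg_cong[where f="density lborel"]) (auto simp: indicator_def)
  moreover have "(\<integral>x. g x \<partial>density lborel (%x. ennreal (indicator A x))) = (LINT t|lborel. indicator A t *\<^sub>R g t)"
    by (rule integral_density) auto
  ultimately show ?thesis by (simp add: set_lebesgue_integral_def)
qed

lemma finite_leb_on: assumes "compact A" shows "finite_measure (leb_on A)"
proof (rule finite_measureI)
  have [measurable]: "A : sets borel" using assms by (simp add: borel_compact)
  have "emeasure (leb_on A) (space (leb_on A)) = emeasure lborel A"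
    unfolding leb_on_def by (subst emeasure_density) auto
  also have "... < \<infinity>" using assms by (rule emeasure_compact_finite)
  finally show "emeasure (leb_on A) (space (leb_on A)) ~= \<infinity>" by simp
qed

lemma L2_centred_eq:
  assumes "compact A"
  shows "L2_centred A = {psi : L2 (leb_on A). (LINT x|leb_on A. psi x) = 0}"
proof -
  have [measurable]: "A : sets borel" using assms by (simp add: borel_compact)
  have "g : L2 (leb_on A) ==> (LINT x|leb_on A. g x) = (LINT t:A|lborel. g t)" for g
    by (rule integral_leb_on) (auto simp: L2_leb_on L2_on_def)
  then show ?thesis unfolding L2_centred_def L2_leb_on[symmetric, OF \<open>A : sets borel\<close>] by auto
qed

text \<open>The hypotheses control p on B only. Since the law is carried by B, p vanishes off B, and
  truncation at C gives a real density r with respect to the restricted measure that is bounded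
  everywhere. The lower bound is stated as an implication so that the lemma serves marginal and
  joint densities alike.\<close>

lemma density_on_carrier:
  assumes p [measurable]: "p : bm N" and B [measurable]: "B : sets N"
    and carr: "AE x in density N p. x : B" and up: "AE x in N. x : B --> p x <= ennreal C" and C: "0 <= C"
  shows "EX r. density N p = density (density N (indicator B)) (%x. ennreal (r x)) & r : bm N &
    (ALL x. 0 <= r x & r x <= C) & ((AE x in N. x : B --> ennreal c <= p x) --> c <= C --> (AE x in density N (indicator B). c <= r x))"
proof (intro exI conjI allI impI)
  define r where "r x = enn2real (min (p x) (ennreal C))" for x
  show rm [measurable]: "r : bm N" unfolding r_def by measurable
  have fin: "min (p x) (ennreal C) < \<top>" for x by (simp add: min_less_iff_disj)
  show rb: "0 <= r x" for x unfolding r_def by simp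
  show "r x <= C" for x unfolding r_def using C by (auto intro!: enn2real_leI)
  have er: "ennreal (r x) = min (p x) (ennreal C)" for x unfolding r_def using fin by (simp add: ennreal_enn2real)
  have z: "AE x in N. x \<notin> B --> p x = 0"
    using carr by (subst (asm) AE_density) (auto simp: zero_less_iff_neq_zero)
  have "AE x in N. p x = indicator B x * ennreal (r x)"
    using z up unfolding er by eventually_elim (auto simp: min_absorb1 split: split_indicator)
  then have "density N p = density N (%x. indicator B x * ennreal (r x))" by (intro density_cong) auto
  also have "... = density (density N (indicator B)) (%x. ennreal (r x))" by (rule density_density_eq[symmetric]) auto
  finally show "density N p = density (density N (indicator B)) (%x. ennreal (r x))" .
  assume lo: "AE x in N. x : B --> ennreal c <= p x" and cC: "c <= C"
  have "AE x in N. x : B --> c <= r x"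
    using lo
  proof eventually_elim
    case (elim x)
    show ?case
    proof
      assume "x : B"
      then have "ennreal c <= ennreal (r x)" unfolding er using elim cC by (simp add: ennreal_leI)
      then show "c <= r x" using rb[of x] by (simp add: ennreal_le_iff)
    qed
  qed
  then show "AE x in density N (indicator B). c <= r x"
    by (subst AE_density) (auto split: split_indicator)
qed

lemma leb_on_pair:
  assumes A: "compact A" and B: "compact B"
  shows "density (lborel2) (indicator (A \<times> B)) = leb_on A \<Otimes>\<^sub>M leb_on B"
proof -
  have [measurable]: "A : sets borel" "B : sets borel" using A B by (simp_all add: borel_compact)
  interpret b: finite_measure "leb_on B" by (rule finite_leb_on[OF B])
  have sf: "sigma_finite_measure (density lborel (indicator B))"
    using b.sigma_finite_measure_axioms by (simp add: leb_on_def)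
  have "density lborel (indicator A) \<Otimes>\<^sub>M density lborel (indicator B)
      = density (lborel2) (%(x, y). indicator A x * indicator B y)"
    by (rule pair_measure_density[OF _ _ lborel.sigma_finite_measure_axioms sf]) auto
  also have "... = density (lborel2) (indicator (A \<times> B))"
    by (intro arg_cong[where f="density (lborel2)"]) (auto simp: fun_eq_iff split: split_indicator)
  finally show ?thesis by (simp add: leb_on_def)
qed

text \<open>Off-diagonal terms of the squared norm of a sum are compact perturbations of the diagonal ones.\<close>

theorem additive_Garding:
  fixes \<T> :: "'d::finite => real set" and T :: "'d => 'w => real"
  assumes P: "prob_space P" and cT: "!!d. compact (\<T> d)" and Tm: "!!d. T d : bm P"
    and carr: "!!d. AE z in P. T d z : \<T> d" and c: "0 < c" and cC: "c <= C"
    and single: "!!d. EX p. distributed P lborel (T d) p &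
       (AE t in lborel. t : \<T> d --> ennreal c <= p t & p t <= ennreal C)"
    and pair: "!!d d'. d ~= d' ==> EX p. distributed P (lborel2) (%z. (T d z, T d' z)) p &
       (AE q in lborel2. q : \<T> d \<times> \<T> d' --> p q <= ennreal C)"
  shows "!!d psi. psi : L2 (leb_on (\<T> d)) ==> (%z. psi (T d z)) : L2 P"
    and "!!d psi. psi : L2 (leb_on (\<T> d)) ==> l2norm P (%z. psi (T d z)) <= sqrt C * l2norm (leb_on (\<T> d)) psi"
    and "EX F K. finite F & F \<subseteq> UNIV \<times> sets borel & 0 <= K & (ALL psi. (ALL d. psi d : L2 (leb_on (\<T> d))) -->
       (SUM d:UNIV. l2norm (leb_on (\<T> d)) (psi d)) <= K * (l2norm P (%z. SUM d:UNIV. psi d (T d z))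
          + (\<Sum>(d, A)\<in>F. aint (leb_on (\<T> d)) A (psi d))))"
proof -
  interpret prob_space P by fact
  note [measurable] = Tm
  have Tb[measurable]: "\<T> d : sets borel" for d using cT by (simp add: borel_compact)
  let ?L = "%d. leb_on (\<T> d)"
  have C0: "0 < C" using c cC by simp
  have norm: "(%z. psi (T d z)) : L2 P & c * (l2norm (?L d) psi)^2 <= (l2norm P (%z. psi (T d z)))^2 &
      (l2norm P (%z. psi (T d z)))^2 <= C * (l2norm (?L d) psi)^2" if psi: "psi : L2 (?L d)" for psi d
  proof -
    have [measurable]: "psi : bm borel" using L2D(1)[OF psi] by (simp cong: measurable_cong_sets)
    obtain p where p: "distributed P lborel (T d) p" "AE t in lborel. t : \<T> d --> ennreal c <= p t & p t <= ennreal C"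
      using single by blast
    have D: "distr P lborel (T d) = density lborel p" and [measurable]: "p : bm lborel"
      using p(1) by (auto simp: distributed_def)
    have ca: "AE x in density lborel p. x : \<T> d"
      unfolding D[symmetric] by (subst AE_distr_iff) (use carr in auto)
    have up: "AE t in lborel. t : \<T> d --> p t <= ennreal C" and lo: "AE t in lborel. t : \<T> d --> ennreal c <= p t"
      using p(2) by (auto elim: eventually_mono)
    have Bl: "\<T> d : sets lborel" by simp
    from density_on_carrier[OF \<open>p : bm lborel\<close> Bl ca up less_imp_le[OF C0], of c, folded leb_on_def]
    obtain r where dc: "density lborel p = density (?L d) (%x. ennreal (r x))" "r : bm lborel"
      and rb': "ALL x. 0 <= r x & r x <= C"
      and rl': "(AE x in lborel. x : \<T> d --> ennreal c <= p x) --> c <= C --> (AE x in ?L d. c <= r x)"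
      by (elim exE conjE)
    have rb: "!!x. 0 <= r x" "!!x. r x <= C" using rb' by auto
    have rl: "AE x in ?L d. c <= r x" using mp[OF mp[OF rl' lo] cC] .
    have rm[measurable]: "r : bm borel" using dc(2) by simp
    have DL: "distr P lborel (T d) = density (?L d) (%x. ennreal (r x))" unfolding D by (rule dc(1))
    have I: "integrable (?L d) (%x. r x * (psi x)^2)"
      by (rule bi_integrable_bound[OF integrable_mult_right[OF L2D(2)[OF psi], of C]])
        (use rb C0 in \<open>auto simp: abs_mult intro!: mult_right_mono\<close>)
    have I2: "integrable (distr P lborel (T d)) (%x. (psi x)^2)"
      unfolding DL by (subst integrable_density) (use I rb in auto)
    then have L: "(%z. psi (T d z)) : L2 P" by (intro L2I) (auto simp: integrable_distr_eq)
    have e: "(l2norm P (%z. psi (T d z)))^2 = (LINT x|?L d. r x * (psi x)^2)"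
    proof -
      have "(l2norm P (%z. psi (T d z)))^2 = (\<integral>x. (psi x)^2 \<partial>distr P lborel (T d))"
        unfolding l2norm_sq by (subst integral_distr) auto
      also have "... = (LINT x|?L d. r x * (psi x)^2)" unfolding DL by (subst integral_density) (use rb in auto)
      finally show ?thesis .
    qed
    have "(LINT x|?L d. c * (psi x)^2) <= (LINT x|?L d. r x * (psi x)^2)"
      by (rule integral_mono_AE[OF integrable_mult_right[OF L2D(2)[OF psi]] I])
        (use rl in \<open>auto elim!: eventually_mono intro!: mult_right_mono\<close>)
    moreover have "(LINT x|?L d. r x * (psi x)^2) <= (LINT x|?L d. C * (psi x)^2)"
      by (rule integral_mono[OF I integrable_mult_right[OF L2D(2)[OF psi]]]) (use rb in \<open>auto intro!: mult_right_mono\<close>)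
    ultimately show ?thesis using L unfolding e by (simp add: l2norm_sq)
  qed
  show "!!d psi. psi : L2 (leb_on (\<T> d)) ==> (%z. psi (T d z)) : L2 P" using norm by blast
  show "l2norm P (%z. psi (T d z)) <= sqrt C * l2norm (leb_on (\<T> d)) psi" if "psi : L2 (leb_on (\<T> d))" for d psi
  proof (rule power2_le_imp_le)
    show "(l2norm P (%z. psi (T d z)))^2 <= (sqrt C * l2norm (leb_on (\<T> d)) psi)^2"
      using norm[OF that] C0 by (simp add: power_mult_distrib)
  qed (use C0 in simp)
  define D where "D = real CARD('d)"
  have D1: "1 <= D" unfolding D_def by simp
  \<comment> \<open>The off-diagonal errors add up to at most ep (sum a)^2 <= ep D (sum a^2), and
    this ep makes that half of the diagonal lower bound c (sum a^2).\<close>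
  define ep where "ep = c / (2 * D)"
  have eps: "0 < ep" unfolding ep_def using c D1 by simp
  have "EX F K. finite F & F \<subseteq> sets borel \<times> sets borel & 0 <= K & (ALL u:L2 (?L d). ALL v:L2 (?L d').
      \<bar>\<integral>z. u (T d z) * v (T d' z) \<partial>P\<bar> <= ep * l2norm (?L d) u * l2norm (?L d') v
        + K * (\<Sum>(A, B)\<in>F. aint (?L d) A u * aint (?L d') B v))"
    if dd: "d ~= d'" for d d'
  proof -
    obtain p where p: "distributed P (lborel2) (%z. (T d z, T d' z)) p"
       "AE q in lborel2. q : \<T> d \<times> \<T> d' --> p q <= ennreal C" using pair[OF dd] by blast
    have Dp: "distr P (lborel2) (%z. (T d z, T d' z)) = density (lborel2) p"
      and pm: "p : bm (lborel2)" using p(1) by (auto simp: distributed_def)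
    have B: "\<T> d \<times> \<T> d' : sets (lborel2)" by simp
    have ca: "AE x in density (lborel2) p. x : \<T> d \<times> \<T> d'"
      unfolding Dp[symmetric]
    proof (subst AE_distr_iff)
      show "AE x in P. (T d x, T d' x) : \<T> d \<times> \<T> d'" using carr[of d] carr[of d'] by eventually_elim auto
      show "{x : space (lborel2). x : \<T> d \<times> \<T> d'} : sets (lborel2)"
        using sets.Int[OF sets.top B] by (simp add: Int_def)
    qed measurable
    from density_on_carrier[OF pm B ca p(2) less_imp_le[OF C0], of c, unfolded leb_on_pair[OF cT cT]]
    obtain r where dc: "density (lborel2) p = density (?L d \<Otimes>\<^sub>M ?L d') (%x. ennreal (r x))"
      "r : bm (lborel2)" and rb': "ALL x. 0 <= r x & r x <= C"
      by (elim exE conjE)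
    have rb: "!!x. 0 <= r x" "!!x. r x <= C" using rb' by auto
    have ss: "sets (?L d \<Otimes>\<^sub>M ?L d') = sets (lborel2)" by (intro sets_pair_measure_cong) simp_all
    have rm[measurable]: "r : bm (?L d \<Otimes>\<^sub>M ?L d')" by (subst measurable_cong_sets[OF ss refl]) (rule dc(2))
    have fin: "finite_measure (?L d \<Otimes>\<^sub>M ?L d')" by (intro finite_measure_pair_measure finite_leb_on cT)
    have rL: "r : L2 (?L d \<Otimes>\<^sub>M ?L d')" by (rule finite_measure.L2_bounded[OF fin rm, of C]) (use rb in auto)
    have Dr: "distr P (lborel2) (%z. (T d z, T d' z)) = density (?L d \<Otimes>\<^sub>M ?L d') (%x. ennreal (r x))"
      unfolding Dp by (rule dc(1))
    from kernel_finite_rank[OF finite_leb_on[OF cT] finite_leb_on[OF cT] rL eps]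
    obtain F K where F: "finite F" "F \<subseteq> sets (?L d) \<times> sets (?L d')" "0 <= K" and FK: "ALL u:L2 (?L d). ALL v:L2 (?L d').
     \<bar>\<integral>z. u (fst z) * v (snd z) * r z \<partial>(?L d \<Otimes>\<^sub>M ?L d')\<bar>
       <= ep * l2norm (?L d) u * l2norm (?L d') v + K * (\<Sum>(A, B)\<in>F. aint (?L d) A u * aint (?L d') B v)"
      by (elim exE conjE)
    have eq: "(LINT z|P. u (T d z) * v (T d' z)) = (LINT z|(?L d \<Otimes>\<^sub>M ?L d'). u (fst z) * v (snd z) * r z)"
      if "u : L2 (?L d)" "v : L2 (?L d')" for u v
    proof -
      have [measurable]: "u : bm borel" "v : bm borel"
        using that[THEN L2D(1)] by (simp_all cong: measurable_cong_sets)
      have "(LINT z|P. u (T d z) * v (T d' z)) = (\<integral>q. u (fst q) * v (snd q) \<partial>distr P (lborel2) (%z. (T d z, T d' z)))"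
        by (subst integral_distr) auto
      also have "... = (LINT z|(?L d \<Otimes>\<^sub>M ?L d'). r z * (u (fst z) * v (snd z)))"
        unfolding Dr by (subst integral_density) (use rb in auto)
      finally show ?thesis by (simp add: mult.commute)
    qed
    show ?thesis
    proof (intro exI[of _ F] exI[of _ K] conjI ballI)
      show "F \<subseteq> sets borel \<times> sets borel" using F(2) by simp
      fix u v assume u: "u : L2 (?L d)" and v: "v : L2 (?L d')"
      show "\<bar>\<integral>z. u (T d z) * v (T d' z) \<partial>P\<bar> <= ep * l2norm (?L d) u * l2norm (?L d') v
        + K * (\<Sum>(A, B)\<in>F. aint (?L d) A u * aint (?L d') B v)"
        unfolding eq[OF u v] by (rule bspec[OF bspec[OF FK u] v])
    qed (rule F)+
  qed
  note ex = this
  \<comment> \<open>Sets and constant for a pair of components are packed into one object, so that a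
    single choice over the pairs yields both.\<close>
  define W where "W d d' H \<longleftrightarrow> finite (fst H) & fst H \<subseteq> sets borel \<times> sets borel & 0 <= snd H & (ALL u:L2 (?L d). ALL v:L2 (?L d').
      \<bar>\<integral>z. u (T d z) * v (T d' z) \<partial>P\<bar> <= ep * l2norm (?L d) u * l2norm (?L d') v
        + snd H * (\<Sum>(A, B)\<in>fst H. aint (?L d) A u * aint (?L d') B v))" for d d' H
  have "EX H. fst q ~= snd q --> W (fst q) (snd q) H" for q :: "'d \<times> 'd"
  proof (cases "fst q = snd q")
    case False
    from ex[OF this] obtain F K where "W (fst q) (snd q) (F, K)" unfolding W_def fst_conv snd_conv by (elim exE)
    then show ?thesis by blast
  qed simp
  then have "ALL q::'d \<times> 'd. EX H. fst q ~= snd q --> W (fst q) (snd q) H" by (rule allI)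
  from choice[OF this] obtain H where H: "ALL q::'d \<times> 'd. fst q ~= snd q --> W (fst q) (snd q) (H q)" by (elim exE)
  define F where "F d d' = fst (H (d, d'))" for d d'
  define K where "K d d' = snd (H (d, d'))" for d d'
  have "d ~= d' ==> W d d' (F d d', K d d')" for d d' using H[rule_format, of "(d, d')"] by (simp add: F_def K_def)
  note W = this[unfolded W_def fst_conv snd_conv]
  have F: "!!d d'. d ~= d' ==> finite (F d d')" "!!d d'. d ~= d' ==> F d d' \<subseteq> sets borel \<times> sets borel"
     "!!d d'. d ~= d' ==> 0 <= K d d'" and FK: "!!d d' u v. d ~= d' ==> u : L2 (?L d) ==> v : L2 (?L d') ==>
      \<bar>\<integral>z. u (T d z) * v (T d' z) \<partial>P\<bar> <= ep * l2norm (?L d) u * l2norm (?L d') v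
        + K d d' * (\<Sum>(A, B)\<in>F d d'. aint (?L d) A u * aint (?L d') B v)"
    using W by simp_all
  \<comment> \<open>All sets occurring in either factor for some pair, tagged with the component
    they test. Each functional is then at most the total E, and a product of two is at most
    E^2.\<close>
  define G where "G = (\<Union>d. \<Union>d'\<in>-{d}. (%(A, B). (d, A)) ` F d d' Un (%(A, B). (d', B)) ` F d d')"
  have Gf: "finite G" unfolding G_def using F(1) by auto
  have Gs: "G \<subseteq> UNIV \<times> sets borel"
  proof
    fix x assume "x : G"
    then obtain d d' where dd: "d' : -{d}" and x: "x : (%(A, B). (d, A)) ` F d d' Un (%(A, B). (d', B)) ` F d d'"
      unfolding G_def by (elim UN_E)
    have "F d d' \<subseteq> sets borel \<times> sets borel" by (rule F(2)) (use dd in auto)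
    then show "x : UNIV \<times> sets borel" using x by auto
  qed
  define N where "N = (SUM d:UNIV. \<Sum>d'\<in>-{d}. K d d' * real (card (F d d')))"
  have N0: "0 <= N" unfolding N_def using F(3) by (intro sum_nonneg mult_nonneg_nonneg) auto
  \<comment> \<open>The factor of Q + E after taking the square root of (2 D / c) (Q^2 + N
    E^2).\<close>
  define K' where "K' = sqrt (2 * D / c) * (1 + sqrt N)"
  have K'0: "0 <= K'" unfolding K'_def using c D1 N0 by simp
  have main: "(SUM d:UNIV. l2norm (?L d) (psi d)) <= K' * (l2norm P (%z. SUM d:UNIV. psi d (T d z))
          + (\<Sum>(d, A)\<in>G. aint (?L d) A (psi d)))"
    if psi: "!!d. psi d : L2 (?L d)" for psi
  proof -
    define a where "a d = l2norm (?L d) (psi d)" for d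
    define Q where "Q = l2norm P (%z. SUM d:UNIV. psi d (T d z))"
    define E where "E = (\<Sum>(d, A)\<in>G. aint (?L d) A (psi d))"
    define y where "y = (%d z. psi d (T d z))"
    have a0: "0 <= a d" for d unfolding a_def by simp
    have Q0: "0 <= Q" unfolding Q_def by simp
    have E0: "0 <= E" unfolding E_def by (auto intro!: sum_nonneg)
    have yL: "y d : L2 P" for d unfolding y_def using norm[OF psi] by blast
    have Q2: "Q^2 = (SUM d:UNIV. \<Sum>d'\<in>UNIV. \<integral>z. y d z * y d' z \<partial>P)"
    proof -
      have "Q^2 = (LINT z|P. (SUM d:UNIV. \<Sum>d'\<in>UNIV. y d z * y d' z))"
        unfolding Q_def l2norm_sq unfolding y_def power2_eq_square sum_product ..
      also have "... = (SUM d:UNIV. \<Sum>d'\<in>UNIV. \<integral>z. y d z * y d' z \<partial>P)"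
        by (subst bi_integral_sum, intro bi_integrable_sum L2_mult_integrable yL)
          (intro sum.cong refl bi_integral_sum L2_mult_integrable yL)
      finally show ?thesis .
    qed
    have off: "- (ep * a d * a d') - K d d' * real (card (F d d')) * E^2 <= (LINT z|P. y d z * y d' z)" if dd: "d ~= d'" for d d'
    proof -
      have le: "aint (?L d0) A (psi d0) <= E" if "(d0, A) : G" for d0 A
        unfolding E_def using member_le_sum[OF that, of "%(d, A). aint (?L d) A (psi d)"] Gf by auto
      have "(\<Sum>(A, B)\<in>F d d'. aint (?L d) A (psi d) * aint (?L d') B (psi d')) <= (SUM i:F d d'. E * E)"
      proof (rule sum_mono)
        fix i assume i: "i : F d d'"
        obtain A B where AB: "i = (A, B)" by (cases i)
        have "(d, A) : G" "(d', B) : G" unfolding G_def using i dd AB by force+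
        then show "(case i of (A, B) => aint (?L d) A (psi d) * aint (?L d') B (psi d')) <= E * E"
          unfolding AB using le E0 by (auto intro!: mult_mono)
      qed
      also have "... = real (card (F d d')) * E^2" by (simp add: power2_eq_square)
      finally have "K d d' * (\<Sum>(A, B)\<in>F d d'. aint (?L d) A (psi d) * aint (?L d') B (psi d'))
          <= K d d' * (real (card (F d d')) * E^2)" using F(3)[OF dd] by (intro mult_left_mono)
      then show ?thesis using FK[OF dd psi psi] unfolding y_def a_def by (simp only: mult.assoc)
    qed
    have split: "(\<Sum>d'\<in>UNIV. h d') = h d + (\<Sum>d'\<in>-{d}. h d')" for h :: "'d => real" and d
      by (simp add: sum.remove[of UNIV d] Compl_eq_Diff_UNIV)
    have "c * (SUM d:UNIV. (a d)^2) - ep * (SUM d:UNIV. a d)^2 - N * E^2 <= Q^2"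
    proof -
      have "c * (SUM d:UNIV. (a d)^2) - (SUM d:UNIV. \<Sum>d'\<in>-{d}. ep * a d * a d') - N * E^2
          = (SUM d:UNIV. c * (a d)^2 + (\<Sum>d'\<in>-{d}. - (ep * a d * a d') - K d d' * real (card (F d d')) * E^2))"
        unfolding N_def by (simp add: sum.distrib sum_subtractf sum_negf sum_distrib_left sum_distrib_right)
      also have "... <= (SUM d:UNIV. (LINT z|P. y d z * y d z) + (\<Sum>d'\<in>-{d}. \<integral>z. y d z * y d' z \<partial>P))"
      proof (intro sum_mono add_mono off)
        fix d show "c * (a d)^2 <= (LINT z|P. y d z * y d z)"
          using norm[OF psi, of d] unfolding a_def y_def l2norm_sq[of P] by (simp add: power2_eq_square)
      qed auto
      also have "... = Q^2" unfolding Q2 by (intro sum.cong refl) (rule split[symmetric])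
      finally have "c * (SUM d:UNIV. (a d)^2) - (SUM d:UNIV. \<Sum>d'\<in>-{d}. ep * a d * a d') - N * E^2 <= Q^2" .
      moreover have "(SUM d:UNIV. \<Sum>d'\<in>-{d}. ep * a d * a d') <= (SUM d:UNIV. \<Sum>d'\<in>UNIV. ep * a d * a d')"
        using eps a0 by (intro sum_mono sum_mono2) auto
      moreover have "(SUM d:UNIV. \<Sum>d'\<in>UNIV. ep * a d * a d') = ep * (SUM d:UNIV. a d)^2"
        unfolding power2_eq_square sum_product by (simp add: sum_distrib_left mult.assoc)
      ultimately show ?thesis by linarith
    qed
    note lower = this
    define X where "X = (SUM d:UNIV. (a d)^2)"
    have cs: "(SUM d:UNIV. a d)^2 <= D * (SUM d:UNIV. (a d)^2)"
      using Cauchy_Schwarz_ineq_sum[of "%_. 1" a "UNIV :: 'd set"] by (simp add: D_def)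
    have "ep * (SUM d:UNIV. a d)^2 <= ep * (D * X)" using cs eps unfolding X_def by (intro mult_left_mono) auto
    also have "ep * (D * X) = c / 2 * X" unfolding ep_def using D1 by simp
    finally have "c * X - c / 2 * X <= Q^2 + N * E^2" using lower unfolding X_def by linarith
    moreover have "c * X - c / 2 * X = c / 2 * X" by (simp add: field_simps)
    ultimately have "c / 2 * X <= Q^2 + N * E^2" by linarith
    then have "c / 2 * (SUM d:UNIV. (a d)^2) <= Q^2 + N * E^2" unfolding X_def .
    then have "(SUM d:UNIV. (a d)^2) <= (2 / c) * (Q^2 + N * E^2)" using c by (simp add: field_simps)
    then have "D * (SUM d:UNIV. (a d)^2) <= D * ((2 / c) * (Q^2 + N * E^2))" using D1 by (intro mult_left_mono) auto
    then have "(SUM d:UNIV. a d)^2 <= (2 * D / c) * (Q^2 + N * E^2)" using cs by (simp add: mult_ac)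
    also have "... <= (2 * D / c) * ((1 + sqrt N) * (Q + E))^2"
    proof (rule mult_left_mono)
      have "Q^2 + N * E^2 <= (Q + sqrt N * E)^2" using N0 Q0 E0 by (simp add: power2_sum power_mult_distrib)
      also have "... <= ((1 + sqrt N) * (Q + E))^2" using N0 Q0 E0 by (intro power_mono) (auto simp: algebra_simps)
      finally show "Q^2 + N * E^2 <= ((1 + sqrt N) * (Q + E))^2" .
    qed (use c D1 in auto)
    also have "... = (K' * (Q + E))^2" unfolding K'_def using c D1 by (simp add: power_mult_distrib)
    finally have "(SUM d:UNIV. a d) <= K' * (Q + E)" by (rule power2_le_imp_le) (use K'0 Q0 E0 in auto)
    then show ?thesis unfolding a_def Q_def E_def .
  qed
  show "EX F K. finite F & F \<subseteq> UNIV \<times> sets borel & 0 <= K & (ALL psi. (ALL d. psi d : L2 (leb_on (\<T> d))) -->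
       (SUM d:UNIV. l2norm (leb_on (\<T> d)) (psi d)) <= K * (l2norm P (%z. SUM d:UNIV. psi d (T d z))
          + (\<Sum>(d, A)\<in>F. aint (leb_on (\<T> d)) A (psi d))))"
    using Gf Gs K'0 main by blast
qed

section \<open>Lebesgue measure on finite products\<close>

interpretation lebesgue_product: product_sigma_finite "%_::nat. lborel :: real measure"
  by standard

lemma sets_lebesgue_prod [measurable_cong]: "sets (lebesgue_prod m) = sets (\<Pi>\<^sub>M j\<in>{..<m}. borel)"
  unfolding lebesgue_prod_def by (intro sets_PiM_cong) auto

lemma sigma_finite_lebesgue_prod: "sigma_finite_measure (lebesgue_prod m)"
proof -
  interpret finite_product_sigma_finite "%_::nat. lborel :: real measure" "{..<m}" by standard simp
  show ?thesis unfolding lebesgue_prod_def by (rule sigma_finite_measure_axioms)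
qed

interpretation lebesgue_prod: sigma_finite_measure "lebesgue_prod m" for m
  by (rule sigma_finite_lebesgue_prod)

lemma space_lebesgue_prod: "e : errs m \<longleftrightarrow> (ALL i. \<not> i < m --> e i = undefined)"
  by (auto simp: lebesgue_prod_def space_PiM PiE_def extensional_def)

lemma space_lebesgue_prod_upd: "e : errs m ==> j < m ==> e(j := v) : errs m"
  by (auto simp: space_lebesgue_prod)

lemma space_lebesgue_prod_restrict [simp]: "(\<lambda>j\<in>{..<m}. g j) : errs m"
  by (auto simp: space_lebesgue_prod)

lemma measurable_lebesgue_prod_component [measurable]:
  "j < m ==> (%e. e j) : bm (lebesgue_prod m)"
  unfolding lebesgue_prod_def using measurable_component_singleton[of j "{..<m}" "%_. lborel"] by simp

lemma measurable_into_lebesgue_prod: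
  assumes "!!j. j < m ==> (%x. g x j) : bm N"
  shows "(%x. \<lambda>j\<in>{..<m}. g x j) : measurable N (lebesgue_prod m)"
  unfolding lebesgue_prod_def by (rule measurable_restrict) (use assms in auto)

lemma lebesgue_prod_shift:
  "distr (lebesgue_prod m) (lebesgue_prod m) (%e. \<lambda>j\<in>{..<m}. e j - a j) = lebesgue_prod m"
proof -
  have sm: "(%e. \<lambda>j\<in>{..<m}. e j - a j) : measurable (lebesgue_prod m) (lebesgue_prod m)"
    by (rule measurable_into_lebesgue_prod) measurable
  have "distr (lebesgue_prod m) (lebesgue_prod m) (%e. \<lambda>j\<in>{..<m}. e j - a j) = Pi\<^sub>M {..<m} (%_. lborel)"
  proof (rule lebesgue_product.PiM_eqI)
    fix A :: "nat => real set" assume A: "!!i. i : {..<m} ==> A i : sets lborel"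
    have AP: "Pi\<^sub>E {..<m} A : sets (lebesgue_prod m)"
      unfolding lebesgue_prod_def using A by (intro sets_PiM_I_finite) auto
    have "emeasure (distr (lebesgue_prod m) (lebesgue_prod m) (%e. \<lambda>j\<in>{..<m}. e j - a j)) (Pi\<^sub>E {..<m} A)
       = emeasure (lebesgue_prod m) ((%e. \<lambda>j\<in>{..<m}. e j - a j) -` Pi\<^sub>E {..<m} A Int errs m)"
      by (rule emeasure_distr[OF sm AP])
    also have "(%e. \<lambda>j\<in>{..<m}. e j - a j) -` Pi\<^sub>E {..<m} A Int errs m = Pi\<^sub>E {..<m} (%j. (+) (- a j) -` A j)"
      by (auto simp: lebesgue_prod_def space_PiM PiE_iff Pi_iff)
    also have "emeasure (lebesgue_prod m) ... = (\<Prod>j<m. emeasure lborel ((+) (- a j) -` A j))"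
      unfolding lebesgue_prod_def
    proof (rule lebesgue_product.emeasure_PiM)
      fix j assume "j : {..<m}"
      then show "(+) (- a j) -` A j : sets lborel"
        using measurable_sets[of "(+) (- a j)" borel borel "A j"] A by auto
    qed simp
    also have "... = (\<Prod>j<m. emeasure lborel (A j))"
    proof (intro prod.cong refl)
      fix j assume j: "j : {..<m}"
      have "emeasure lborel (A j) = emeasure (distr lborel borel ((+) (- a j))) (A j)" by (subst lborel_distr_plus) simp
      also have "... = emeasure lborel ((+) (- a j) -` A j)" using A[OF j] by (subst emeasure_distr) auto
      finally show "emeasure lborel ((+) (- a j) -` A j) = emeasure lborel (A j)" by simp
    qed
    finally show "emeasure (distr (lebesgue_prod m) (lebesgue_prod m) (%e. \<lambda>j\<in>{..<m}. e j - a j)) (Pi\<^sub>E {..<m} A)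
      = (\<Prod>i\<in>{..<m}. emeasure lborel (A i))" .
  qed (simp_all add: lebesgue_prod_def)
  then show ?thesis by (simp add: lebesgue_prod_def)
qed

lemma pair_shift_measurable:
  assumes a: "!!j. j < m ==> (%c. a c j) : bm N"
  shows "(%z. (fst z, \<lambda>j\<in>{..<m}. snd z j - a (fst z) j)) : measurable (N \<Otimes>\<^sub>M lebesgue_prod m) (N \<Otimes>\<^sub>M lebesgue_prod m)"
proof (rule measurable_Pair)
  show "(%z. \<lambda>j\<in>{..<m}. snd z j - a (fst z) j) : measurable (N \<Otimes>\<^sub>M lebesgue_prod m) (lebesgue_prod m)"
  proof (rule measurable_into_lebesgue_prod)
    fix j assume j: "j < m"
    have [measurable]: "(%z. a (fst z) j) : bm (N \<Otimes>\<^sub>M lebesgue_prod m)"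
      using measurable_compose[OF measurable_fst a[OF j]] .
    have [measurable]: "(%z. snd z j) : bm (N \<Otimes>\<^sub>M lebesgue_prod m)"
      using measurable_compose[OF measurable_snd measurable_lebesgue_prod_component[OF j]] .
    show "(%z. snd z j - a (fst z) j) : bm (N \<Otimes>\<^sub>M lebesgue_prod m)" by measurable
  qed
qed simp

text \<open>Sections at fixed c are translated by a vector depending on c only, and translations
  preserve Lebesgue measure; integration over c gives the claim.\<close>

lemma pair_shift:
  assumes a: "!!j. j < m ==> (%c. a c j) : bm N"
  shows "distr (N \<Otimes>\<^sub>M lebesgue_prod m) (N \<Otimes>\<^sub>M lebesgue_prod m) (%z. (fst z, \<lambda>j\<in>{..<m}. snd z j - a (fst z) j))
    = N \<Otimes>\<^sub>M lebesgue_prod m"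
proof (rule measure_eqI)
  let ?L = "lebesgue_prod m" let ?S = "%z. (fst z, \<lambda>j\<in>{..<m}. snd z j - a (fst z) j)"
  note Sm = pair_shift_measurable[OF a]
  fix A assume "A : sets (distr (N \<Otimes>\<^sub>M ?L) (N \<Otimes>\<^sub>M ?L) ?S)"
  then have A: "A : sets (N \<Otimes>\<^sub>M ?L)" by simp
  have B: "?S -` A Int space (N \<Otimes>\<^sub>M ?L) : sets (N \<Otimes>\<^sub>M ?L)" using measurable_sets[OF Sm A] .
  have "emeasure (distr (N \<Otimes>\<^sub>M ?L) (N \<Otimes>\<^sub>M ?L) ?S) A = emeasure (N \<Otimes>\<^sub>M ?L) (?S -` A Int space (N \<Otimes>\<^sub>M ?L))"
    by (rule emeasure_distr[OF Sm A])
  also have "... = (\<integral>\<^sup>+c. emeasure ?L (Pair c -` (?S -` A Int space (N \<Otimes>\<^sub>M ?L))) \<partial>N)"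
    by (rule lebesgue_prod.emeasure_pair_measure_alt[OF B])
  also have "... = (\<integral>\<^sup>+c. emeasure ?L (Pair c -` A) \<partial>N)"
  proof (rule nn_integral_cong)
    fix c assume c: "c : space N"
    have sm: "(%e. \<lambda>j\<in>{..<m}. e j - a c j) : measurable ?L ?L" by (rule measurable_into_lebesgue_prod) measurable
    have Ac: "Pair c -` A : sets ?L" using A by (rule sets_Pair1)
    have "emeasure ?L (Pair c -` A) = emeasure (distr ?L ?L (%e. \<lambda>j\<in>{..<m}. e j - a c j)) (Pair c -` A)"
      by (simp add: lebesgue_prod_shift)
    also have "... = emeasure ?L ((%e. \<lambda>j\<in>{..<m}. e j - a c j) -` (Pair c -` A) Int space ?L)"
      by (rule emeasure_distr[OF sm Ac])
    also have "(%e. \<lambda>j\<in>{..<m}. e j - a c j) -` (Pair c -` A) Int space ?L = Pair c -` (?S -` A Int space (N \<Otimes>\<^sub>M ?L))"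
      using c by (auto simp: space_pair_measure)
    finally show "emeasure ?L (Pair c -` (?S -` A Int space (N \<Otimes>\<^sub>M ?L))) = emeasure ?L (Pair c -` A)" by simp
  qed
  also have "... = emeasure (N \<Otimes>\<^sub>M ?L) A" by (rule lebesgue_prod.emeasure_pair_measure_alt[OF A, symmetric])
  finally show "emeasure (distr (N \<Otimes>\<^sub>M ?L) (N \<Otimes>\<^sub>M ?L) ?S) A = emeasure (N \<Otimes>\<^sub>M ?L) A" .
qed simp

section \<open>Continuously differentiable functions of the errors\<close>

lemma continuous_on_coordinate: "continuous_on S (%e::nat => real. e j)"
  using continuous_on_product_coordinates[of j] by (rule continuous_on_subset) auto

lemma tendsto_coordinatewise:
  fixes q :: "'b => nat => real"
  assumes "!!i. ((%s. q s i) \<longlongrightarrow> l i) F" shows "(q \<longlongrightarrow> l) F"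
proof -
  have "limitin (product_topology (%i. euclidean) UNIV) q l F"
    unfolding limitin_componentwise using assms by (simp add: limitin_canonical_iff)
  then show ?thesis by (simp add: euclidean_product_topology limitin_canonical_iff)
qed

text \<open>For a fixed value of the covariates this is the smoothness clause of
  \<open>smooth_vanishing\<close>. Functions of the errors live on an extensional product, so
  differentiability is taken one coordinate at a time and continuity in the product
  topology.\<close>

definition C1_fun :: "nat => ((nat => real) => real) => bool" where
  "C1_fun m F \<longleftrightarrow> continuous_on (errs m) F &
     (ALL j<m. (ALL e:errs m. (%v. F (e(j := v))) differentiable (at (e j))) &
            continuous_on (errs m) (partial_deriv F j))"

lemma C1_fun_deriv:
  assumes "C1_fun m F" "j < m" "e : errs m"
  shows "((%v. F (e(j := v))) has_real_derivative partial_deriv F j (e(j := u))) (at u)"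
proof -
  have "(%v. F ((e(j := u))(j := v))) differentiable (at ((e(j := u)) j))"
    using assms space_lebesgue_prod_upd[OF assms(3,2), of u] unfolding C1_fun_def by blast
  then have "(%v. F (e(j := v))) differentiable (at u)" by simp
  then show ?thesis unfolding partial_deriv_def by (simp add: DERIV_deriv_iff_real_differentiable)
qed

lemma C1_fun_deriv':
  assumes "C1_fun m F" "j < m" "e : errs m"
  shows "((%v. F (e(j := v))) has_real_derivative partial_deriv F j e) (at (e j))"
  using C1_fun_deriv[OF assms, of "e j"] by simp

lemma C1_funI:
  assumes "continuous_on (errs m) F"
    and "!!j. j < m ==> continuous_on (errs m) (F' j)"
    and "!!j e. j < m ==> e : errs m ==> ((%v. F (e(j := v))) has_real_derivative F' j e) (at (e j))"
  shows "C1_fun m F"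
  unfolding C1_fun_def
proof (intro conjI allI impI ballI)
  fix j assume j: "j < m"
  have "partial_deriv F j e = F' j e" if "e : errs m" for e
    unfolding partial_deriv_def using assms(3)[OF j that] by (rule DERIV_imp_deriv)
  then show "continuous_on (errs m) (partial_deriv F j)"
    using assms(2)[OF j] by (simp cong: continuous_on_cong)
  fix e assume "e : errs m"
  then show "(%v. F (e(j := v))) differentiable (at (e j))"
    using assms(3)[OF j] real_differentiable_def by blast
qed fact

lemma C1_fun_continuous: "C1_fun m F ==> continuous_on (errs m) F"
  "C1_fun m F ==> j < m ==> continuous_on (errs m) (partial_deriv F j)"
  by (auto simp: C1_fun_def)

lemma C1_fun_const [simp]: "C1_fun m (%_. c)"
  by (rule C1_funI[where F'="%_ _. 0"]) auto

lemma C1_fun_add: assumes "C1_fun m F" "C1_fun m G" shows "C1_fun m (%e. F e + G e)"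
  by (rule C1_funI[where F'="%j e. partial_deriv F j e + partial_deriv G j e"])
    (intro continuous_on_add DERIV_add C1_fun_continuous[OF assms(1)] C1_fun_continuous[OF assms(2)]
      C1_fun_deriv'[OF assms(1)] C1_fun_deriv'[OF assms(2)]; assumption)+

lemma C1_fun_mult: assumes "C1_fun m F" "C1_fun m G" shows "C1_fun m (%e. F e * G e)"
proof (rule C1_funI[where F'="%j e. partial_deriv F j e * G e + partial_deriv G j e * F e"])
  fix j e assume "j < m" "e : errs m"
  then show "((%v. F (e(j := v)) * G (e(j := v))) has_real_derivative partial_deriv F j e * G e + partial_deriv G j e * F e) (at (e j))"
    using DERIV_mult[OF C1_fun_deriv'[OF assms(1), of j e] C1_fun_deriv'[OF assms(2), of j e]] by simp
qed (intro continuous_on_add continuous_on_mult C1_fun_continuous[OF assms(1)] C1_fun_continuous[OF assms(2)]; assumption)+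

lemma C1_fun_inverse:
  assumes "C1_fun m F" "!!e. e : errs m ==> F e ~= 0" shows "C1_fun m (%e. inverse (F e))"
proof (rule C1_funI[where F'="%j e. - (inverse (F e) * partial_deriv F j e * inverse (F e))"])
  fix j e assume je: "j < m" "e : errs m"
  have "((%v. inverse (F (e(j := v)))) has_real_derivative - (inverse (F (e(j := e j))) * partial_deriv F j e * inverse (F (e(j := e j))))) (at (e j))"
    by (rule DERIV_inverse'[OF C1_fun_deriv'[OF assms(1) je]]) (use assms(2) je in auto)
  then show "((%v. inverse (F (e(j := v)))) has_real_derivative - (inverse (F e) * partial_deriv F j e * inverse (F e))) (at (e j))" by simp
next
  have ci: "continuous_on (errs m) (%e. inverse (F e))"
    using C1_fun_continuous(1)[OF assms(1)] assms(2) by (intro continuous_on_inverse) auto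
  then show "continuous_on (errs m) (%e. inverse (F e))" .
  show "continuous_on (errs m) (%e. - (inverse (F e) * partial_deriv F j e * inverse (F e)))" if "j < m" for j
    by (intro continuous_on_minus continuous_on_mult ci C1_fun_continuous(2)[OF assms(1) that])
qed

lemma C1_fun_sum: "(!!i. i : I ==> C1_fun m (F i)) ==> C1_fun m (%e. SUM i:I. F i e)"
  by (induction I rule: infinite_finite_induct) (auto intro: C1_fun_add)

lemma C1_fun_prod: "(!!i. i : I ==> C1_fun m (F i)) ==> C1_fun m (%e. \<Prod>i\<in>I. F i e)"
  by (induction I rule: infinite_finite_induct) (auto intro: C1_fun_mult)

lemma C1_fun_coordinate:
  assumes h: "!!x. (h has_real_derivative h' x) (at x)" and h': "continuous_on UNIV h'"
  shows "C1_fun m (%e. h (e i))"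
proof (rule C1_funI[where F'="%j e. if j = i then h' (e i) else 0"])
  have "continuous_on UNIV h" using h by (meson DERIV_continuous_on UNIV_I has_field_derivative_at_within)
  then show "continuous_on (errs m) (%e. h (e i))"
    by (rule continuous_on_compose2[OF _ continuous_on_coordinate]) auto
  have "continuous_on (errs m) (%e. h' (e i))"
    by (rule continuous_on_compose2[OF h' continuous_on_coordinate]) auto
  then show "continuous_on (errs m) (%e. if j = i then h' (e i) else 0)" for j by (cases "j = i") simp_all
  show "((%v. h ((e(j := v)) i)) has_real_derivative (if j = i then h' (e i) else 0)) (at (e j))" for j e
    using h[of "e i"] by (cases "j = i") auto
qed

lemma C1_fun_proj: "C1_fun m (%e. e i)"
  using C1_fun_coordinate[of "%x. x" "%_. 1" m i] by auto

text \<open>The increments are taken one coordinate at a time, so that the mean value theorem and joint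
  continuity of the partial derivatives apply.\<close>

theorem C1_fun_chain:
  assumes F: "C1_fun m F" and g: "!!j. j < m ==> ((%s. \<gamma> s j) has_real_derivative \<gamma>' j) (at 0)"
  shows "((%s. F (\<lambda>j\<in>{..<m}. \<gamma> s j)) has_real_derivative
    (SUM j<m. partial_deriv F j (\<lambda>j\<in>{..<m}. \<gamma> 0 j) * \<gamma>' j)) (at 0)"
proof -
  define p where "p k s = (\<lambda>j\<in>{..<m}. if j < k then \<gamma> s j else \<gamma> 0 j)" for k s
  define e0 where "e0 = (\<lambda>j\<in>{..<m}. \<gamma> 0 j)"
  have psp: "p k s : errs m" for k s unfolding p_def by simp
  have pS: "p (Suc k) s = (p k s)(k := \<gamma> s k)" and pk: "(p k s)(k := \<gamma> 0 k) = p k s" if "k < m" for k s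
    using that by (auto simp: p_def fun_eq_iff restrict_def)
  have gt: "((%s. \<gamma> s j) \<longlongrightarrow> \<gamma> 0 j) (at 0)" if "j < m" for j
    using DERIV_isCont[OF g[OF that]] by (simp add: isCont_def)
  \<comment> \<open>The non-strict bound on \<xi> covers the case of a zero increment, where the
    mean value theorem has no interval to work on.\<close>
  have mv: "EX \<xi>. \<bar>\<xi> - \<gamma> 0 k\<bar> <= \<bar>\<gamma> s k - \<gamma> 0 k\<bar> &
      F (p (Suc k) s) - F (p k s) = partial_deriv F k ((p k s)(k := \<xi>)) * (\<gamma> s k - \<gamma> 0 k)" if k: "k < m" for k s
  proof -
    define h where "h v = F ((p k s)(k := v))" for v
    have hd: "(h has_real_derivative partial_deriv F k ((p k s)(k := v))) (at v)" for v
      unfolding h_def by (rule C1_fun_deriv[OF F k psp])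
    have hh: "F (p (Suc k) s) - F (p k s) = h (\<gamma> s k) - h (\<gamma> 0 k)"
      unfolding h_def pS[OF k, symmetric] pk[OF k] ..
    consider "\<gamma> s k = \<gamma> 0 k" | "\<gamma> 0 k < \<gamma> s k" | "\<gamma> s k < \<gamma> 0 k" by linarith
    then show ?thesis
    proof cases
      case 1 then show ?thesis unfolding hh by (intro exI[of _ "\<gamma> 0 k"]) simp
    next
      case 2
      from MVT2[OF 2 hd] obtain z where "\<gamma> 0 k < z" "z < \<gamma> s k"
        "h (\<gamma> s k) - h (\<gamma> 0 k) = (\<gamma> s k - \<gamma> 0 k) * partial_deriv F k ((p k s)(k := z))" by blast
      then show ?thesis unfolding hh by (intro exI[of _ z]) (auto simp: mult.commute)
    next
      case 3
      from MVT2[OF 3 hd] obtain z where "\<gamma> s k < z" "z < \<gamma> 0 k"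
        "h (\<gamma> 0 k) - h (\<gamma> s k) = (\<gamma> 0 k - \<gamma> s k) * partial_deriv F k ((p k s)(k := z))" by blast
      then show ?thesis unfolding hh by (intro exI[of _ z]) (auto simp: algebra_simps)
    qed
  qed
  have lim: "((%s. (F (p (Suc k) s) - F (p k s)) / s) \<longlongrightarrow> partial_deriv F k e0 * \<gamma>' k) (at 0)" if k: "k < m" for k
  proof -
    from mv[OF k] obtain \<xi> where xi: "!!s. \<bar>\<xi> s - \<gamma> 0 k\<bar> <= \<bar>\<gamma> s k - \<gamma> 0 k\<bar>"
      "!!s. F (p (Suc k) s) - F (p k s) = partial_deriv F k ((p k s)(k := \<xi> s)) * (\<gamma> s k - \<gamma> 0 k)" by metis
    have "((%s. \<xi> s - \<gamma> 0 k) \<longlongrightarrow> 0) (at 0)"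
    proof (rule Lim_null_comparison)
      show "\<forall>\<^sub>F s in at 0. norm (\<xi> s - \<gamma> 0 k) <= \<bar>\<gamma> s k - \<gamma> 0 k\<bar>" using xi(1) by simp
      have "((%s. \<bar>\<gamma> s k - \<gamma> 0 k\<bar>) \<longlongrightarrow> \<bar>\<gamma> 0 k - \<gamma> 0 k\<bar>) (at 0)" by (intro tendsto_intros gt[OF k])
      then show "((%s. \<bar>\<gamma> s k - \<gamma> 0 k\<bar>) \<longlongrightarrow> 0) (at 0)" by simp
    qed
    then have xl: "(\<xi> \<longlongrightarrow> \<gamma> 0 k) (at 0)" by (simp add: LIM_zero_iff)
    have ql: "((%s. (p k s)(k := \<xi> s)) \<longlongrightarrow> e0) (at 0)"
    proof (rule tendsto_coordinatewise)
      fix i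
      consider "i = k" | "i ~= k" "i < m" "i < k" | "i ~= k" "\<not> (i < m & i < k)" by blast
      then show "((%s. ((p k s)(k := \<xi> s)) i) \<longlongrightarrow> e0 i) (at 0)"
      proof cases
        case 1 then show ?thesis using xl k by (simp add: e0_def)
      next
        case 2 then show ?thesis using gt[of i] by (simp add: p_def e0_def)
      next
        case 3 then show ?thesis by (auto simp: p_def e0_def restrict_def)
      qed
    qed
    have "((%s. partial_deriv F k ((p k s)(k := \<xi> s))) \<longlongrightarrow> partial_deriv F k e0) (at 0)"
      by (rule continuous_on_tendsto_compose[OF C1_fun_continuous(2)[OF F k] ql])
        (simp_all add: e0_def space_lebesgue_prod_upd[OF psp k])
    moreover have "((%s. (\<gamma> s k - \<gamma> 0 k) / s) \<longlongrightarrow> \<gamma>' k) (at 0)"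
      using g[OF k] by (simp add: has_field_derivative_iff)
    ultimately have "((%s. partial_deriv F k ((p k s)(k := \<xi> s)) * ((\<gamma> s k - \<gamma> 0 k) / s)) \<longlongrightarrow> partial_deriv F k e0 * \<gamma>' k) (at 0)"
      by (rule tendsto_mult)
    then show ?thesis by (simp add: xi(2))
  qed
  have tel: "F (p m s) - F (p 0 s) = (SUM k<m. F (p (Suc k) s) - F (p k s))" for s
    using sum_lessThan_telescope[of "%k. F (p k s)" m] by simp
  have pm: "p m s = (\<lambda>j\<in>{..<m}. \<gamma> s j)" and p0: "p 0 s = e0" for s by (auto simp: p_def e0_def fun_eq_iff restrict_def)
  have "((%s. (F (p m s) - F (p 0 s)) / s) \<longlongrightarrow> (SUM k<m. partial_deriv F k e0 * \<gamma>' k)) (at 0)"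
    unfolding tel sum_divide_distrib by (intro tendsto_sum lim) auto
  then show ?thesis
    unfolding pm p0 by (simp add: has_field_derivative_iff e0_def)
qed

section \<open>Integrals of derivatives\<close>

text \<open>The integral over x of h(x+1) - h(x) vanishes, and equals that of h' by Fubini's theorem; no
  behaviour at infinity has to be examined.\<close>

lemma integral_deriv_zero:
  fixes h h' :: "real => real"
  assumes d: "!!x. (h has_real_derivative h' x) (at x)" and c: "continuous_on UNIV h'"
    and h: "integrable lborel h" and h': "integrable lborel h'"
  shows "(LINT x|lborel. h' x) = 0"
proof -
  have hm[measurable]: "h' : bm borel" using c by (rule borel_measurable_continuous_onI)
  define f where "f t x = indicator {0..1} t * h' (t + x)" for t x :: real
  have fm: "case_prod f : bm (lborel2)" unfolding f_def by measurable
  have hs: "integrable lborel (%x. h' (t + x))" "(LINT x|lborel. h' (t + x)) = (LINT x|lborel. h' x)"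
    "(LINT x|lborel. \<bar>h' (t + x)\<bar>) = (LINT x|lborel. \<bar>h' x\<bar>)" for t
    using lborel_integrable_real_affine[OF h', of 1 t] lborel_integral_real_affine[of 1 h' t]
      lborel_integral_real_affine[of 1 "%x. \<bar>h' x\<bar>" t] by auto
  have I: "integrable (lborel2) (case_prod f)"
  proof (rule lborel_pair.Fubini_integrable[OF fm])
    have "(LINT y|lborel. norm (case_prod f (x, y))) = indicator {0..1} x * (LINT x|lborel. \<bar>h' x\<bar>)" for x
      using hs(3)[of x] by (simp add: f_def abs_mult)
    moreover have "integrable lborel (%x. indicator {0..1::real} x * (LINT x|lborel. \<bar>h' x\<bar>))" by simp
    ultimately show "integrable lborel (%x. \<integral>y. norm (case_prod f (x, y)) \<partial>lborel)" by simp
    show "AE x in lborel. integrable lborel (%y. case_prod f (x, y))"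
      using hs(1) by (auto simp: f_def)
  qed
  have "(\<integral>x. \<integral>t. f t x \<partial>lborel \<partial>lborel) = (\<integral>t. \<integral>x. f t x \<partial>lborel \<partial>lborel)"
    by (rule lborel_pair.Fubini_integral[OF I])
  moreover have "(LINT t|lborel. f t x) = h (1 + x) - h (0 + x)" for x
  proof -
    have "(LINT t|lborel. indicator {0..1} t *\<^sub>R h' (t + x)) = h (1 + x) - h (0 + x)"
    proof (rule integral_FTC_atLeastAtMost)
      fix t :: real
      have "((%t. h (t + x)) has_real_derivative h' (t + x)) (at t within {0..1})"
        using has_field_derivative_at_within[OF d[of "t + x"]] DERIV_shift[of h "h' (t + x)" t x]
        by (simp add: d has_field_derivative_at_within)
      then show "((%t. h (t + x)) has_vector_derivative h' (t + x)) (at t within {0..1})"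
        by (simp add: has_real_derivative_iff_has_vector_derivative)
      show "continuous_on {0..1} (%t. h' (t + x))"
        by (rule continuous_on_compose2[OF c]) (auto intro!: continuous_intros)
    qed simp
    then show ?thesis by (simp add: f_def)
  qed
  moreover have "(LINT x|lborel. h (1 + x) - h (0 + x)) = 0"
    using lborel_integrable_real_affine[OF h, of 1 1] lborel_integral_real_affine[of 1 h 1] h by simp
  moreover have "(\<integral>t. \<integral>x. f t x \<partial>lborel \<partial>lborel) = (LINT x|lborel. h' x)"
    using hs(2) by (simp add: f_def)
  ultimately show ?thesis by simp
qed

text \<open>Fubini's theorem singles out coordinate j. Almost every line in that direction carries
  integrable restrictions of G and G', which is what \<open>integral_deriv_zero\<close> asks
  for.\<close>

lemma integral_partial_deriv_zero:
  assumes j: "j < m" and G: "integrable (lebesgue_prod m) G" and G': "integrable (lebesgue_prod m) G'"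
    and d: "!!e v. e : errs m ==> ((%v. G (e(j := v))) has_real_derivative G' (e(j := v))) (at v)"
    and c: "!!e. e : errs m ==> continuous_on UNIV (%v. G' (e(j := v)))"
  shows "(LINT e|lebesgue_prod m. G' e) = 0"
proof -
  define I where "I = {..<m} - {j}"
  have I: "finite I" "j \<notin> I" "insert j I = {..<m}" using j by (auto simp: I_def)
  let ?PI = "Pi\<^sub>M I (%_. lborel :: real measure)"
  have ae: "AE x in ?PI. integrable lborel (%v. X (x(j := v)))" if X: "integrable (lebesgue_prod m) X" for X :: "(nat => real) => real"
  proof -
    have [measurable]: "X : bm (Pi\<^sub>M (insert j I) (%_. lborel))"
      using borel_measurable_integrable[OF X] by (simp add: I(3) lebesgue_prod_def)
    have "(\<integral>\<^sup>+x. \<integral>\<^sup>+v. ennreal (norm (X (x(j := v)))) \<partial>lborel \<partial>?PI) = (\<integral>\<^sup>+x. ennreal (norm (X x)) \<partial>lebesgue_prod m)"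
      unfolding lebesgue_prod_def I(3)[symmetric] by (rule lebesgue_product.product_nn_integral_insert[symmetric, OF I(1,2)]) measurable
    also have "... < \<infinity>" using X by (simp add: integrable_iff_bounded)
    finally have fin: "(\<integral>\<^sup>+x. \<integral>\<^sup>+v. ennreal (norm (X (x(j := v)))) \<partial>lborel \<partial>?PI) ~= \<infinity>" by simp
    have "(%z. X ((fst z)(j := snd z))) : bm (?PI \<Otimes>\<^sub>M lborel)"
      using measurable_compose[OF measurable_add_dim[of j I "%_. lborel"] \<open>X : bm (Pi\<^sub>M (insert j I) (%_. lborel))\<close>]
      by (simp add: case_prod_unfold)
    then have "(%(x, v). ennreal (norm (X (x(j := v))))) : bm (?PI \<Otimes>\<^sub>M lborel)"
      by (simp add: case_prod_unfold)
    from lborel.borel_measurable_nn_integral[OF this]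
    have "AE x in ?PI. (\<integral>\<^sup>+v. ennreal (norm (X (x(j := v)))) \<partial>lborel) ~= \<infinity>"
      using fin by (intro nn_integral_PInf_AE)
    then show ?thesis
    proof (rule AE_mp, intro AE_I2 impI)
      fix x assume x: "x : space ?PI" and fin: "(\<integral>\<^sup>+v. ennreal (norm (X (x(j := v)))) \<partial>lborel) ~= \<infinity>"
      have "(%v. X (x(j := v))) : bm lborel"
        using measurable_compose[OF measurable_fun_upd[of "insert j I" I j "%_. x" lborel "%_. lborel" "%v. v"], of X borel] x I by auto
      then show "integrable lborel (%v. X (x(j := v)))" using fin by (simp add: integrable_iff_bounded less_top)
    qed
  qed
  have "(LINT e|lebesgue_prod m. G' e) = (\<integral>x. \<integral>v. G' (x(j := v)) \<partial>lborel \<partial>?PI)"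
    unfolding lebesgue_prod_def I(3)[symmetric]
    by (rule lebesgue_product.product_integral_insert[OF I(1,2)]) (use G' in \<open>simp add: I(3) lebesgue_prod_def\<close>)
  also have "... = (LINT x|?PI. 0)"
  proof (rule integral_cong_AE)
    have [measurable]: "G' : bm (Pi\<^sub>M (insert j I) (%_. lborel))"
      using borel_measurable_integrable[OF G'] by (simp add: I(3) lebesgue_prod_def)
    show "(%x. \<integral>v. G' (x(j := v)) \<partial>lborel) : bm ?PI" by measurable
    show "AE x in ?PI. (LINT v|lborel. G' (x(j := v))) = 0"
      using ae[OF G] ae[OF G'] AE_space
    proof eventually_elim
      case (elim x)
      have sp: "x(j := 0) : errs m"
        using elim(3) j by (auto simp: space_lebesgue_prod space_PiM PiE_def extensional_def I_def)
      show ?case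
        by (rule integral_deriv_zero[OF _ _ elim(1,2)]) (use d[OF sp] c[OF sp] in simp_all)
    qed
  qed simp
  finally show ?thesis by simp
qed

text \<open>Difference quotients along a sequence are bounded by G, by the mean value theorem, and
  dominated convergence passes to the limit. Measurability of the derivative comes from the same
  pointwise limit.\<close>

lemma integral_constant_imp_deriv_zero:
  assumes e: "0 < ep" and G: "integrable M G"
    and d: "!!s x. \<bar>s\<bar> < ep ==> x : space M ==> (%r. F r x) differentiable (at s) & \<bar>deriv (%r. F r x) s\<bar> <= G x"
    and I: "!!s. \<bar>s\<bar> < ep ==> integrable M (F s)" and c: "!!s. \<bar>s\<bar> < ep ==> (LINT x|M. F s x) = (k::real)"
  shows "integrable M (%x. deriv (%r. F r x) 0)" "(LINT x|M. deriv (%r. F r x) 0) = 0"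
proof -
  \<comment> \<open>The summand 2 keeps \<open>s n\<close> strictly below \<open>ep\<close>, also
    for n = 0.\<close>
  define s where "s n = ep / real (n + 2)" for n :: nat
  have s: "0 < s n" "\<bar>s n\<bar> < ep" for n using e by (auto simp: s_def field_simps add_pos_nonneg)
  have "(%n. ep * (1 / real (n + 2))) \<longlonglongrightarrow> ep * 0"
    by (intro tendsto_mult_left LIMSEQ_ignore_initial_segment[OF lim_1_over_n])
  then have sl: "s \<longlonglongrightarrow> 0" by (simp add: s_def[abs_def])
  define D where "D n x = (F (s n) x - F 0 x) / s n" for n x
  have Di: "integrable M (D n)" for n unfolding D_def using I[of "s n"] I[of 0] s e by auto
  have dd: "((%r. F r x) has_real_derivative deriv (%r. F r x) u) (at u)" if "\<bar>u\<bar> < ep" "x : space M" for u x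
    using d[OF that] by (simp add: DERIV_deriv_iff_real_differentiable)
  have Dl: "(%n. D n x) \<longlonglongrightarrow> deriv (%r. F r x) 0" if x: "x : space M" for x
  proof -
    have "((%h. (F h x - F 0 x) / h) \<longlongrightarrow> deriv (%r. F r x) 0) (at 0)"
      using dd[of 0 x] x e by (simp add: has_field_derivative_iff)
    moreover have "filterlim s (at 0) sequentially"
      unfolding filterlim_at using sl less_imp_neq[OF s(1), symmetric] by (auto intro!: always_eventually)
    ultimately show ?thesis unfolding D_def by (rule filterlim_compose)
  qed
  have Db: "\<bar>D n x\<bar> <= G x" if x: "x : space M" for n x
  proof -
    have "EX z>0. z < s n & F (s n) x - F 0 x = (s n - 0) * deriv (%r. F r x) z"
      by (rule MVT2[OF s(1)]) (use s(2)[of n] x in \<open>auto intro!: dd\<close>)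
    then obtain z where z: "0 < z" "z < s n" "F (s n) x - F 0 x = s n * deriv (%r. F r x) z" by auto
    have "D n x = deriv (%r. F r x) z" unfolding D_def z(3) using s(1)[of n] by simp
    then show ?thesis using d[of z x] z s(2)[of n] x by auto
  qed
  have dm: "(%x. deriv (%r. F r x) 0) : bm M"
    by (rule borel_measurable_LIMSEQ_real[OF Dl borel_measurable_integrable[OF Di]])
  have Dla: "AE x in M. (%n. D n x) \<longlonglongrightarrow> deriv (%r. F r x) 0" using Dl by (rule AE_I2)
  have Dba: "AE x in M. norm (D n x) <= G x" for n by (rule AE_I2) (simp add: Db)
  show "integrable M (%x. deriv (%r. F r x) 0)"
    by (rule integrable_dominated_convergence[OF dm borel_measurable_integrable[OF Di] G Dla Dba])
  have "(%n. \<integral>x. D n x \<partial>M) \<longlonglongrightarrow> (LINT x|M. deriv (%r. F r x) 0)"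
    by (rule integral_dominated_convergence[OF dm borel_measurable_integrable[OF Di] G Dla Dba])
  moreover have "(LINT x|M. D n x) = 0" for n
    unfolding D_def using I[of "s n"] I[of 0] s[of n] e c[of "s n"] c[of 0] by simp
  ultimately show "(LINT x|M. deriv (%r. F r x) 0) = 0" by (simp add: LIMSEQ_const_iff)
qed

section \<open>The law of one cluster in terms of covariates and errors\<close>

lemma AE_pair_fst:
  assumes "AE c in N. R c" shows "AE z in N \<Otimes>\<^sub>M lebesgue_prod m. R (fst z)"
proof -
  obtain X where X: "X : sets N" "emeasure N X = 0" "{c : space N. \<not> R c} \<subseteq> X"
    using AE_E[OF assms] by metis
  have "emeasure (N \<Otimes>\<^sub>M lebesgue_prod m) (X \<times> errs m) = 0"
    using lebesgue_prod.emeasure_pair_measure_Times[OF X(1) sets.top] X(2) by simp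
  then show ?thesis
    using X by (intro AE_I[of _ _ "X \<times> errs m"]) (auto simp: space_pair_measure)
qed

text \<open>Neither the parameters nor the error density are fixed here, because submodels change
  them while the dominating measure and the link stay the same.\<close>

locale cluster_base =
  fixes nu :: "('k::finite, 'd::finite) covs measure" and m :: nat and \<mu> :: "real => real"
  assumes sf: "sigma_finite_measure nu" and sets_nu: "sets nu = sets (cov_space m)"
    and mu_m [measurable]: "\<mu> : bm borel"
begin

sublocale pair_sigma_finite nu "lebesgue_prod m"
  unfolding pair_sigma_finite_def using sf sigma_finite_lebesgue_prod by auto

abbreviation "N \<equiv> nu \<Otimes>\<^sub>M lebesgue_prod m"

definition lin_pred :: "real ^ 'k => ('d => real => real) => ('k, 'd) covs => nat => real" where
  "lin_pred \<beta> \<theta> c j = inner (fst c j) \<beta> + additive \<theta> (snd c j)"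

lemma predictor_lin_pred: "predictor \<beta> \<theta> j z = lin_pred \<beta> \<theta> (fst z) j"
  by (simp add: predictor_def lin_pred_def obs_X_def)

lemma space_nu: "space nu = space (cov_space m)"
  using sets_nu by (rule sets_eq_imp_space_eq)

lemma X_measurable: "j < m ==> (%c. fst c j) : bm nu"
  and T_measurable: "j < m ==> (%c. snd c j) : bm nu"
  by (subst measurable_cong_sets[OF sets_nu refl], unfold cov_space_def,
      rule measurable_compose[OF measurable_fst measurable_component_singleton] measurable_compose[OF measurable_snd measurable_component_singleton], simp)+

lemma component_measurable: "(%x::real^'n::finite. x $ i) : bm borel"
  by (intro borel_measurable_continuous_onI continuous_intros)

lemma additive_measurable:
  assumes "!!d. psi d : bm borel" "j < m"
  shows "(%c. additive psi (snd c j)) : bm nu"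
  unfolding additive_def
  by (intro borel_measurable_sum measurable_compose[OF measurable_compose[OF T_measurable component_measurable] assms(1)] assms)

lemma lin_pred_measurable:
  assumes "!!d. \<theta> d : bm borel" "j < m"
  shows "(%c. lin_pred \<beta> \<theta> c j) : bm nu"
  unfolding lin_pred_def
  by (intro borel_measurable_add borel_measurable_inner X_measurable additive_measurable borel_measurable_const assms)

lemma mu_lin_pred_measurable:
  assumes "!!d. \<theta> d : bm borel" "j < m"
  shows "(%c. \<mu> (lin_pred \<beta> \<theta> c j)) : bm nu"
  by (rule measurable_compose[OF lin_pred_measurable[OF assms] mu_m])

definition to_err :: "real ^ 'k => ('d => real => real) => ('k, 'd) obs => ('k, 'd) covs \<times> (nat => real)" where
  "to_err \<beta> \<theta> z = (fst z, resid m \<mu> \<beta> \<theta> z)"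

lemma to_err_alt: "to_err \<beta> \<theta> = (%z. (fst z, \<lambda>j\<in>{..<m}. snd z j - \<mu> (lin_pred \<beta> \<theta> (fst z) j)))"
  by (auto simp: to_err_def resid_def obs_Y_def predictor_lin_pred fun_eq_iff)

lemma fst_to_err [simp]: "fst (to_err \<beta> \<theta> z) = fst z" by (simp add: to_err_def)

lemma snd_to_err: "j < m ==> snd (to_err \<beta> \<theta> z) j = snd z j - \<mu> (lin_pred \<beta> \<theta> (fst z) j)"
  by (simp add: to_err_alt)

definition err_law :: "('k, 'd) err_density => (('k, 'd) covs \<times> (nat => real)) measure" where
  "err_law f = density N (%z. ennreal (f (fst z) (snd z)))"

lemma err_law_simps [simp, measurable_cong]: "space (err_law f) = space N" "sets (err_law f) = sets N"
  by (simp_all add: err_law_def)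

lemma cluster_law_simps [simp, measurable_cong]:
  "space (cluster_law nu m \<mu> \<beta> \<theta> f) = space N" "sets (cluster_law nu m \<mu> \<beta> \<theta> f) = sets N"
  by (simp_all add: cluster_law_def)

lemma to_err_measurable:
  assumes "!!d. \<theta> d : bm borel"
  shows "to_err \<beta> \<theta> : measurable N N" "to_err \<beta> \<theta> : measurable (cluster_law nu m \<mu> \<beta> \<theta>' f) N"
proof -
  show *: "to_err \<beta> \<theta> : measurable N N"
    unfolding to_err_alt by (rule pair_shift_measurable) (rule mu_lin_pred_measurable[OF assms])
  then show "to_err \<beta> \<theta> : measurable (cluster_law nu m \<mu> \<beta> \<theta>' f) N"
    by (subst measurable_cong_sets[OF cluster_law_simps(2) refl])
qed

lemma distr_to_err_N:
  assumes "!!d. \<theta> d : bm borel" shows "distr N N (to_err \<beta> \<theta>) = N"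
  unfolding to_err_alt by (rule pair_shift) (rule mu_lin_pred_measurable[OF assms])

text \<open>The map to errors shifts the responses by a vector depending on the covariates only and
  so preserves the dominating measure. In the new coordinates neither beta nor theta appears in the
  law.\<close>

lemma distr_cluster_law:
  assumes th: "!!d. \<theta> d : bm borel" and fm: "(%z. f (fst z) (snd z)) : bm N"
  shows "distr (cluster_law nu m \<mu> \<beta> \<theta> f) N (to_err \<beta> \<theta>) = err_law f"
proof (rule measure_eqI)
  note [measurable] = fm to_err_measurable(1)[OF th]
  let ?S = "to_err \<beta> \<theta>" and ?g = "%z. ennreal (f (fst z) (snd z))"
  fix A assume "A : sets (distr (cluster_law nu m \<mu> \<beta> \<theta> f) N ?S)"
  then have A[measurable]: "A : sets N" by simp
  have cl: "cluster_law nu m \<mu> \<beta> \<theta> f = density N (%z. ?g (?S z))"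
    by (simp add: cluster_law_def lik_def to_err_def)
  have gm: "(%z. ?g (?S z)) : bm N" by measurable
  have "emeasure (distr (cluster_law nu m \<mu> \<beta> \<theta> f) N ?S) A = emeasure (cluster_law nu m \<mu> \<beta> \<theta> f) (?S -` A Int space N)"
    by (subst emeasure_distr[OF to_err_measurable(2)[OF th] A]) simp
  also have "... = (\<integral>\<^sup>+z. ?g (?S z) * indicator (?S -` A Int space N) z \<partial>N)"
    unfolding cl by (rule emeasure_density[OF gm]) (rule measurable_sets[OF to_err_measurable(1)[OF th] A])
  also have "... = (\<integral>\<^sup>+z. ?g (?S z) * indicator A (?S z) \<partial>N)"
    by (intro nn_integral_cong) (auto split: split_indicator)
  also have "... = (\<integral>\<^sup>+z. ?g z * indicator A z \<partial>distr N N ?S)" by (subst nn_integral_distr) auto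
  also have "... = emeasure (err_law f) A"
    unfolding distr_to_err_N[OF th] err_law_def by (subst emeasure_density) auto
  finally show "emeasure (distr (cluster_law nu m \<mu> \<beta> \<theta> f) N ?S) A = emeasure (err_law f) A" .
qed simp

lemma cluster_law_integral:
  fixes X :: "_ => real"
  assumes th: "!!d. \<theta> d : bm borel" and fm: "(%z. f (fst z) (snd z)) : bm N"
    and X: "X : bm N"
  shows "integrable (cluster_law nu m \<mu> \<beta> \<theta> f) (%z. X (to_err \<beta> \<theta> z)) \<longleftrightarrow> integrable (err_law f) X"
    and "(\<integral>z. X (to_err \<beta> \<theta> z) \<partial>cluster_law nu m \<mu> \<beta> \<theta> f) = (LINT z|err_law f. X z)"
  unfolding distr_cluster_law[of \<theta> f \<beta>, OF th fm, symmetric]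
  by (simp_all add: integrable_distr_eq[OF to_err_measurable(2)[OF th] X] integral_distr[OF to_err_measurable(2)[OF th] X])

lemma cluster_law_AE:
  assumes th: "!!d. \<theta> d : bm borel" and fm: "(%z. f (fst z) (snd z)) : bm N"
    and R: "AE z in err_law f. R z"
  shows "AE z in cluster_law nu m \<mu> \<beta> \<theta> f. R (to_err \<beta> \<theta> z)"
  by (rule AE_distrD[OF to_err_measurable(2)[OF th]]) (unfold distr_cluster_law[of \<theta> f \<beta>, OF th fm], rule R)

lemma cov_algebra_subalgebra: "subalgebra (cluster_law nu m \<mu> \<beta> \<theta> f) (cov_algebra m (cluster_law nu m \<mu> \<beta> \<theta> f))"
proof -
  have "fst : space N \<rightarrow> space (cov_space m)" by (auto simp: space_pair_measure space_nu)
  then have "sets (cov_algebra m (cluster_law nu m \<mu> \<beta> \<theta> f)) = {fst -` A Int space N |A. A : sets (cov_space m)}"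
    unfolding cov_algebra_def by (simp add: sets_vimage_algebra2)
  moreover have "fst -` A Int space N : sets N" if "A : sets (cov_space m)" for A
    using measurable_sets[OF measurable_fst, of A nu "lebesgue_prod m"] that sets_nu by simp
  ultimately show ?thesis unfolding subalgebra_def by (auto simp: cov_algebra_def)
qed

lemma cov_algebra_measurable:
  assumes "h : bm nu" shows "(%z. h (fst z)) : bm (cov_algebra m (cluster_law nu m \<mu> \<beta> \<theta> f))"
proof -
  have "fst : space N \<rightarrow> space (cov_space m)" by (auto simp: space_pair_measure space_nu)
  then have "fst : measurable (cov_algebra m (cluster_law nu m \<mu> \<beta> \<theta> f)) (cov_space m)"
    unfolding cov_algebra_def by (auto intro: measurable_vimage_algebra1)
  moreover have "h : bm (cov_space m)" using assms by (simp add: measurable_cong_sets[OF sets_nu refl])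
  ultimately show ?thesis by (rule measurable_compose)
qed

lemma cov_algebra_sets:
  assumes "A : sets (cov_algebra m (cluster_law nu m \<mu> \<beta> \<theta> f))"
  obtains B where "B : sets nu" "A = fst -` B Int space N"
proof -
  have "fst : space N \<rightarrow> space (cov_space m)" by (auto simp: space_pair_measure space_nu)
  then have "sets (cov_algebra m (cluster_law nu m \<mu> \<beta> \<theta> f)) = {fst -` A Int space N |A. A : sets (cov_space m)}"
    unfolding cov_algebra_def by (simp add: sets_vimage_algebra2)
  then show ?thesis using that assms sets_nu by auto
qed

lemma in_modelD:
  assumes "in_model nu m \<mu> \<beta> \<theta> f"
  shows "(%z. f (fst z) (snd z)) : bm N"
    and "!!c e. c : space nu ==> e : errs m ==> 0 <= f c e"
    and "!!c. c : space nu ==> C1_fun m (f c)"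
    and "EX B. ALL c:space nu. ALL e:errs m. f c e <= B"
    and "!!c e j. c : space nu ==> e : errs m ==> j < m ==> ((%v. f c (e(j := v))) \<longlongrightarrow> 0) at_infinity"
  using assms unfolding in_model_def smooth_vanishing_def C1_fun_def by (simp_all add: case_prod_unfold)

text \<open>The conditional mean restriction in integrated form. The last claim is the defining
  property of the conditional expectation, tested with bounded functions of the covariates so that
  products with the responses stay integrable.\<close>

lemma in_model_errors:
  assumes th: "!!d. \<theta> d : bm borel" and model: "in_model nu m \<mu> \<beta> \<theta> f"
  shows "prob_space (err_law f)"
    and "!!j. j < m ==> integrable (err_law f) (%z. snd z j)"
    and "!!j. j < m ==> integrable (err_law f) (%z. \<mu> (lin_pred \<beta> \<theta> (fst z) j))"
    and "!!j h B. j < m ==> h : bm nu ==> (!!c. \<bar>h c\<bar> <= B) ==> (LINT z|err_law f. h (fst z) * snd z j) = 0"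
proof -
  let ?P = "cluster_law nu m \<mu> \<beta> \<theta> f" and ?F = "cov_algebra m (cluster_law nu m \<mu> \<beta> \<theta> f)"
  note fm = in_modelD(1)[OF model]
  have P: "prob_space ?P" using model by (simp add: in_model_def)
  interpret P: prob_space ?P by (rule P)
  interpret A: finite_measure_subalgebra ?P ?F
    by unfold_locales (rule cov_algebra_subalgebra)
  show "prob_space (err_law f)"
    unfolding distr_cluster_law[of \<theta> f \<beta>, OF th fm, symmetric] by (rule P.prob_space_distr[OF to_err_measurable(2)[OF th]])
  have Yi: "integrable ?P (obs_Y j)" and Ec: "AE z in ?P. real_cond_exp ?P ?F (obs_Y j) z = \<mu> (predictor \<beta> \<theta> j z)" if "j < m" for j
    using model that by (auto simp: in_model_def)
  have mm[measurable]: "(%z. \<mu> (lin_pred \<beta> \<theta> (fst z) j)) : bm N" if "j < m" for j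
    by (rule measurable_compose[OF measurable_fst mu_lin_pred_measurable[OF th that]])
  have em[measurable]: "(%z. snd z j) : bm N" if "j < m" for j
    by (rule measurable_compose[OF measurable_snd measurable_lebesgue_prod_component[OF that]])
  have mi: "integrable ?P (%z. \<mu> (lin_pred \<beta> \<theta> (fst z) j))" if j: "j < m" for j
  proof -
    have "integrable ?P (real_cond_exp ?P ?F (obs_Y j))" by (rule A.real_cond_exp_int(1)[OF Yi[OF j]])
    moreover have "integrable ?P (real_cond_exp ?P ?F (obs_Y j)) = integrable ?P (%z. \<mu> (lin_pred \<beta> \<theta> (fst z) j))"
      using Ec[OF j] mm[OF j] unfolding predictor_lin_pred
      by (intro integrable_cong_AE) (auto simp: measurable_cong_sets[OF cluster_law_simps(2) refl])
    ultimately show ?thesis by simp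
  qed
  show "integrable (err_law f) (%z. \<mu> (lin_pred \<beta> \<theta> (fst z) j))" if j: "j < m" for j
    using cluster_law_integral(1)[of \<theta> f, OF th fm mm[OF j]] mi[OF j] by simp
  have ei: "integrable ?P (%z. snd (to_err \<beta> \<theta> z) j)" if j: "j < m" for j
    unfolding snd_to_err[OF j] using Yi[OF j] mi[OF j] by (intro bi_integrable_diff) (simp_all add: obs_Y_def[abs_def])
  show "integrable (err_law f) (%z. snd z j)" if j: "j < m" for j
    using cluster_law_integral(1)[of \<theta> f, OF th fm em[OF j]] ei[OF j] by simp
  fix j and h :: "('k, 'd) covs => real" and B :: real assume j: "j < m" and h[measurable]: "h : bm nu" and hB: "!!c. \<bar>h c\<bar> <= B"
  have hi: "integrable ?P (%z. h (fst z) * X z)" if X: "integrable ?P X" for X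
  proof (rule bi_integrable_bound[OF integrable_mult_right[OF X, of B]])
    have "(%z. h (fst z)) : bm ?P" using measurable_compose[OF measurable_fst h] by simp
    then show "(%z. h (fst z) * X z) : bm ?P" using borel_measurable_integrable[OF X] by measurable
    show "AE z in ?P. norm (h (fst z) * X z) <= norm (B * X z)"
      using hB order_trans[OF hB abs_ge_self] by (auto simp: abs_mult intro!: mult_right_mono)
  qed
  have "(LINT z|?P. h (fst z) * real_cond_exp ?P ?F (obs_Y j) z) = (LINT z|?P. h (fst z) * obs_Y j z)"
    by (rule A.real_cond_exp_intg(2)[OF hi[OF Yi[OF j]] cov_algebra_measurable[OF h] borel_measurable_integrable[OF Yi[OF j]]])
  moreover have "(LINT z|?P. h (fst z) * real_cond_exp ?P ?F (obs_Y j) z) = (LINT z|?P. h (fst z) * \<mu> (lin_pred \<beta> \<theta> (fst z) j))"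
    using Ec[OF j] borel_measurable_integrable[OF hi[OF mi[OF j]]]
      borel_measurable_integrable[OF hi[OF A.real_cond_exp_int(1)[OF Yi[OF j]]]]
    unfolding predictor_lin_pred by (intro integral_cong_AE) auto
  ultimately have "(LINT z|?P. h (fst z) * snd (to_err \<beta> \<theta> z) j) = 0"
    unfolding snd_to_err[OF j] using hi[OF Yi[OF j]] hi[OF mi[OF j]]
    by (simp add: right_diff_distrib obs_Y_def)
  moreover have "(%z. h (fst z) * snd z j) : bm N"
    by (intro borel_measurable_times em[OF j] measurable_compose[OF measurable_fst h])
  ultimately show "(LINT z|err_law f. h (fst z) * snd z j) = 0"
    using cluster_law_integral(2)[of \<theta> f "%z. h (fst z) * snd z j" \<beta>, OF th fm] by simp
qed

text \<open>The converse of \<open>in_model_errors\<close>: indicators of covariate sets already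
  characterise a conditional expectation, so moment equations against them recover the mean
  restriction.\<close>

lemma in_modelI:
  assumes th: "!!d. \<theta> d : bm borel" and fm: "(%z. f (fst z) (snd z)) : bm N"
    and f0: "!!c e. c : space nu ==> e : errs m ==> 0 <= f c e"
    and C1: "!!c. c : space nu ==> C1_fun m (f c)"
    and bd: "EX B. ALL c:space nu. ALL e:errs m. f c e <= B"
    and van: "!!c e j. c : space nu ==> e : errs m ==> j < m ==> ((%v. f c (e(j := v))) \<longlongrightarrow> 0) at_infinity"
    and pr: "prob_space (err_law f)" and ei: "!!j. j < m ==> integrable (err_law f) (%z. snd z j)"
    and mi: "!!j. j < m ==> integrable (err_law f) (%z. \<mu> (lin_pred \<beta> \<theta> (fst z) j))"
    and e0: "!!j A. j < m ==> A : sets nu ==> (LINT z|err_law f. indicator A (fst z) * snd z j) = 0"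
  shows "in_model nu m \<mu> \<beta> \<theta> f"
proof -
  let ?P = "cluster_law nu m \<mu> \<beta> \<theta> f" and ?F = "cov_algebra m (cluster_law nu m \<mu> \<beta> \<theta> f)"
  have P: "prob_space ?P"
  proof (rule prob_spaceI)
    have "emeasure ?P (space ?P) = emeasure (distr ?P N (to_err \<beta> \<theta>)) (space N)"
      using measurable_space[OF to_err_measurable(1)[OF th, of \<beta>]]
      by (subst emeasure_distr[OF to_err_measurable(2)[OF th] sets.top]) (auto intro!: arg_cong[where f="emeasure ?P"])
    then show "emeasure ?P (space ?P) = 1"
      unfolding distr_cluster_law[of \<theta> f \<beta>, OF th fm] using prob_space.emeasure_space_1[OF pr] by simp
  qed
  interpret P: prob_space ?P by (rule P)
  interpret A: finite_measure_subalgebra ?P ?F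
    by unfold_locales (rule cov_algebra_subalgebra)
  have mm: "(%z. \<mu> (lin_pred \<beta> \<theta> (fst z) j)) : bm N" if "j < m" for j
    by (rule measurable_compose[OF measurable_fst mu_lin_pred_measurable[OF th that]])
  have em: "(%z. snd z j) : bm N" if "j < m" for j
    by (rule measurable_compose[OF measurable_snd measurable_lebesgue_prod_component[OF that]])
  have miP: "integrable ?P (%z. \<mu> (lin_pred \<beta> \<theta> (fst z) j))" if j: "j < m" for j
    using cluster_law_integral(1)[of \<theta> f, OF th fm mm[OF j], of \<beta>] mi[OF j] by simp
  have eiP: "integrable ?P (%z. snd (to_err \<beta> \<theta> z) j)" if j: "j < m" for j
    using cluster_law_integral(1)[of \<theta> f, OF th fm em[OF j], of \<beta>] ei[OF j] by simp
  have Yeq: "obs_Y j z = snd (to_err \<beta> \<theta> z) j + \<mu> (lin_pred \<beta> \<theta> (fst z) j)" if "j < m" for j z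
    by (simp add: snd_to_err[OF that] obs_Y_def)
  have Yi: "integrable ?P (obs_Y j)" if j: "j < m" for j
  proof -
    have "integrable ?P (%z. snd (to_err \<beta> \<theta> z) j + \<mu> (lin_pred \<beta> \<theta> (fst z) j))" using eiP[OF j] miP[OF j] by simp
    then show ?thesis by (subst (asm) Yeq[OF j, symmetric])
  qed
  have "AE z in ?P. real_cond_exp ?P ?F (obs_Y j) z = \<mu> (lin_pred \<beta> \<theta> (fst z) j)" if j: "j < m" for j
  proof (rule A.real_cond_exp_charact[OF _ Yi[OF j] miP[OF j] cov_algebra_measurable[OF mu_lin_pred_measurable[OF th j]]])
    fix A assume "A : sets ?F"
    then obtain B where B: "B : sets nu" "A = fst -` B Int space N" by (rule cov_algebra_sets)
    have bm: "(%z. indicator B (fst z) * snd z j) : bm N"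
      using B(1) by (intro borel_measurable_times em[OF j] measurable_compose[OF measurable_fst, of _ nu]) auto
    have A: "A : sets ?P" using B measurable_sets[OF measurable_fst B(1), of "lebesgue_prod m"] by simp
    have "(LINT z|?P. indicator A z *\<^sub>R snd (to_err \<beta> \<theta> z) j) = (LINT z|?P. indicator B (fst z) * snd (to_err \<beta> \<theta> z) j)"
      by (intro bi_integral_cong refl) (auto simp: B(2) split: split_indicator)
    also have "... = 0" using cluster_law_integral(2)[of \<theta> f, OF th fm bm, of \<beta>] e0[OF j B(1)] by simp
    finally have z: "(LINT z|?P. indicator A z *\<^sub>R snd (to_err \<beta> \<theta> z) j) = 0" .
    have "(\<integral>z\<in>A. obs_Y j z \<partial>?P) = (LINT z|?P. indicator A z *\<^sub>R snd (to_err \<beta> \<theta> z) j) + (LINT z|?P. indicator A z *\<^sub>R \<mu> (lin_pred \<beta> \<theta> (fst z) j))"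
      unfolding set_lebesgue_integral_def Yeq[OF j] scaleR_add_right
      by (rule bi_integral_add[OF integrable_mult_indicator[OF A eiP[OF j]] integrable_mult_indicator[OF A miP[OF j]]])
    then show "(\<integral>z\<in>A. obs_Y j z \<partial>?P) = (\<integral>z\<in>A. \<mu> (lin_pred \<beta> \<theta> (fst z) j) \<partial>?P)"
      unfolding z by (simp add: set_lebesgue_integral_def)
  qed
  then show ?thesis
    unfolding in_model_def smooth_vanishing_def
    using fm f0 C1[unfolded C1_fun_def] bd van P Yi by (simp add: case_prod_unfold predictor_lin_pred)
qed

text \<open>Unnormalised conditional expectation given the covariates.\<close>

definition cond_int :: "('k, 'd) err_density => (('k, 'd) covs \<times> (nat => real) => real) => ('k, 'd) covs => real" where
  "cond_int f X c = (LINT e|lebesgue_prod m. X (c, e) * f c e)"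

lemma err_law_integral:
  assumes fm: "(%z. f (fst z) (snd z)) : bm N"
    and f0: "!!c e. c : space nu ==> e : errs m ==> 0 <= f c e" and X: "X : bm N"
  shows "integrable (err_law f) X \<longleftrightarrow> integrable N (%z. X z * f (fst z) (snd z))"
    and "(LINT z|err_law f. X z) = (LINT z|N. X z * f (fst z) (snd z))"
proof -
  have "AE z in N. 0 <= f (fst z) (snd z)" using f0 by (intro AE_I2) (auto simp: space_pair_measure)
  note d = integrable_density[OF X fm this] integral_density[OF X fm this]
  show "integrable (err_law f) X \<longleftrightarrow> integrable N (%z. X z * f (fst z) (snd z))"
    "(LINT z|err_law f. X z) = (LINT z|N. X z * f (fst z) (snd z))"
    unfolding err_law_def d by (simp_all add: mult.commute)
qed

lemma cond_int_facts:
  assumes fm: "(%z. f (fst z) (snd z)) : bm N"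
    and f0: "!!c e. c : space nu ==> e : errs m ==> 0 <= f c e" and I: "integrable (err_law f) X"
  shows "AE c in nu. integrable (lebesgue_prod m) (%e. X (c, e) * f c e)"
    and "integrable nu (cond_int f X)" and "(LINT z|err_law f. X z) = (\<integral>c. cond_int f X c \<partial>nu)"
proof -
  have X: "X : bm N" using borel_measurable_integrable[OF I] by simp
  have J: "integrable N (%z. X z * f (fst z) (snd z))" using I err_law_integral(1)[of f, OF fm f0 X] by simp
  show "AE c in nu. integrable (lebesgue_prod m) (%e. X (c, e) * f c e)" using AE_integrable_fst'[OF J] by simp
  show "integrable nu (cond_int f X)" using integrable_fst'[OF J] by (simp add: cond_int_def[abs_def])
  show "(LINT z|err_law f. X z) = (\<integral>c. cond_int f X c \<partial>nu)"
    using integral_fst'[OF J] err_law_integral(2)[of f, OF fm f0 X] by (simp add: cond_int_def[abs_def])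
qed

lemma cond_int_mult: "cond_int f (%z. h (fst z) * X z) c = h c * cond_int f X c"
  unfolding cond_int_def by (simp add: mult.assoc)

lemma cond_int_zero:
  assumes fm: "(%z. f (fst z) (snd z)) : bm N"
    and f0: "!!c e. c : space nu ==> e : errs m ==> 0 <= f c e" and I: "integrable (err_law f) X"
    and z: "!!A. A : sets nu ==> (LINT z|err_law f. indicator A (fst z) * X z) = 0"
  shows "AE c in nu. cond_int f X c = 0"
proof (rule density_unique_real)
  show "integrable nu (cond_int f X)" by (rule cond_int_facts(2)[of f, OF fm f0 I])
  fix A assume A: "A : sets nu"
  have B: "fst -` A Int space N : sets (err_law f)" using measurable_sets[OF measurable_fst A, of "lebesgue_prod m"] by simp
  have "integrable (err_law f) (%z. indicator (fst -` A Int space N) z *\<^sub>R X z)" by (rule integrable_mult_indicator[OF B I])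
  moreover have "integrable (err_law f) (%z. indicator (fst -` A Int space N) z *\<^sub>R X z) = integrable (err_law f) (%z. indicator A (fst z) * X z)"
    by (intro bi_integrable_cong refl) (auto split: split_indicator)
  ultimately have J: "integrable (err_law f) (%z. indicator A (fst z) * X z)" by simp
  have "(\<integral>c. indicator A c * cond_int f X c \<partial>nu) = 0"
    using cond_int_facts(3)[of f, OF fm f0 J] z[OF A] unfolding cond_int_mult by simp
  then show "(\<integral>c\<in>A. cond_int f X c \<partial>nu) = (\<integral>c\<in>A. 0 \<partial>nu)" by (simp add: set_lebesgue_integral_def)
qed simp

text \<open>Once the conditional integral vanishes almost everywhere, any covariate factor can be
  pulled out. The factor h may be unbounded, as the weights r' Sigma^-1 are in general.\<close>

lemma cond_int_zeroD:
  assumes fm: "(%z. f (fst z) (snd z)) : bm N"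
    and f0: "!!c e. c : space nu ==> e : errs m ==> 0 <= f c e"
    and z: "AE c in nu. cond_int f X c = 0" and I: "integrable (err_law f) (%z. h (fst z) * X z)"
  shows "(LINT z|err_law f. h (fst z) * X z) = 0"
proof -
  have "(LINT z|err_law f. h (fst z) * X z) = (\<integral>c. h c * cond_int f X c \<partial>nu)"
    using cond_int_facts(3)[of f, OF fm f0 I] unfolding cond_int_mult .
  also have "... = 0" using z by (intro integral_eq_zero_AE) auto
  finally show ?thesis .
qed

lemma err_law_AE_fst: "AE c in nu. R c ==> (%z. f (fst z) (snd z)) : bm N ==> AE z in err_law f. R (fst z)"
  unfolding err_law_def using AE_pair_fst[where N=nu and R=R and m=m] by (subst AE_density) (auto elim: eventually_mono)

end

section \<open>Regular submodels for the error densities\<close>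

locale cluster = cluster_base nu m \<mu> for nu :: "('k::finite, 'd::finite) covs measure" and m \<mu> +
  fixes \<beta> :: "real ^ 'k" and \<theta> :: "'d => real => real" and f :: "('k, 'd) err_density"
  assumes theta_m: "!!d. \<theta> d : bm borel" and model: "in_model nu m \<mu> \<beta> \<theta> f"
begin

abbreviation "Q \<equiv> err_law f"
abbreviation "P \<equiv> cluster_law nu m \<mu> \<beta> \<theta> f"
abbreviation "E \<equiv> to_err \<beta> \<theta>"

lemmas fm = in_modelD(1)[OF model] and f_nonneg = in_modelD(2)[OF model] and f_C1 = in_modelD(3)[OF model]
lemmas P_integral = cluster_law_integral[of \<theta> f _ \<beta>, OF theta_m fm] and P_AE = cluster_law_AE[of \<theta> f, OF theta_m fm]
  and E_measurable = to_err_measurable[of \<theta> \<beta>, OF theta_m]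

lemma Q_integral:
  assumes "X : bm N"
  shows "integrable Q X \<longleftrightarrow> integrable N (%z. X z * f (fst z) (snd z))"
    and "(LINT z|Q. X z) = (LINT z|N. X z * f (fst z) (snd z))"
  using err_law_integral[of f X, OF fm f_nonneg] assms by auto

lemma cond_int_integrable:
  assumes "integrable Q X"
  shows "AE c in nu. integrable (lebesgue_prod m) (%e. X (c, e) * f c e)" "integrable nu (cond_int f X)"
    "(LINT z|Q. X z) = (\<integral>c. cond_int f X c \<partial>nu)"
  using cond_int_facts[of f X, OF fm f_nonneg] assms by auto

lemma cond_int_eq_0:
  assumes "integrable Q X" "!!A. A : sets nu ==> (LINT z|Q. indicator A (fst z) * X z) = 0"
  shows "AE c in nu. cond_int f X c = 0"
  using cond_int_zero[of f X, OF fm f_nonneg] assms by auto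

lemma cond_int_eq_0D:
  assumes "AE c in nu. cond_int f X c = 0" "integrable Q (%z. h (fst z) * X z)"
  shows "(LINT z|Q. h (fst z) * X z) = 0"
  using cond_int_zeroD[of f X h, OF fm f_nonneg] assms by auto

sublocale Q: prob_space Q by (rule in_model_errors(1)[OF theta_m model])
sublocale P: prob_space P using model by (simp add: in_model_def)

lemma e_measurable: "j < m ==> (%z. snd z j) : bm N"
  by (rule measurable_compose[OF measurable_snd measurable_lebesgue_prod_component])

lemma e_integrable: "j < m ==> integrable Q (%z. snd z j)"
  and mu_integrable: "j < m ==> integrable Q (%z. \<mu> (lin_pred \<beta> \<theta> (fst z) j))"
  by (rule in_model_errors[OF theta_m model], assumption)+

lemma e_mean_zero: "j < m ==> AE c in nu. cond_int f (%z. snd z j) c = 0"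
  by (rule cond_int_eq_0[OF e_integrable]) (auto intro!: in_model_errors(4)[OF theta_m model, of _ _ 1] split: split_indicator)

lemma Q_pos: "AE z in Q. 0 < f (fst z) (snd z)"
  unfolding err_law_def using fm by (subst AE_density) auto

text \<open>The constraints on total mass and conditional mean hold along the whole path, and G
  permits differentiation under the integral sign, so the derivative integrates to 0 against 1 and
  against h e_j. Dividing by f turns integrals over the dominating measure into integrals over the
  error law.\<close>

lemma path_score:
  assumes eps: "0 < ep" and F0: "F 0 = f" and Fm: "!!s. \<bar>s\<bar> < ep ==> in_model nu m \<mu> \<beta> \<theta> (F s)"
    and Fd: "!!s c e. \<bar>s\<bar> < ep ==> c : space nu ==> e : errs m ==>
      (%r. F r c e) differentiable (at s) & \<bar>deriv (%r. F r c e) s\<bar> <= G c e"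
    and G: "integrable N (%(c, e). (1 + (SUM j<m. \<bar>e j\<bar>)) * G c e)"
  defines "g \<equiv> %z. deriv (%r. F r (fst z) (snd z)) 0 / f (fst z) (snd z)"
  shows "integrable Q g" "(LINT z|Q. g z) = 0"
    and "!!j h B. j < m ==> h : bm nu ==> (!!c. \<bar>h c\<bar> <= B) ==>
      integrable Q (%z. h (fst z) * snd z j * g z) & (LINT z|Q. h (fst z) * snd z j * g z) = 0"
proof -
  define D where "D z = deriv (%r. F r (fst z) (snd z)) 0" for z
  have sp: "fst z : space nu" "snd z : errs m" if "z : space N" for z
    using that by (auto simp: space_pair_measure)
  have FI: "integrable N (%z. X z * F s (fst z) (snd z))" "(LINT z|N. X z * F s (fst z) (snd z)) = (\<integral>z. X z \<partial>err_law (F s))"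
    if s: "\<bar>s\<bar> < ep" and X: "integrable (err_law (F s)) X" for X s
    using err_law_integral[of "F s", OF in_modelD(1,2)[OF Fm[OF s]]] X borel_measurable_integrable[OF X] by auto
  have G0: "0 <= G c e" if "c : space nu" "e : errs m" for c e
    using Fd[of 0 c e] that eps by auto
  have Gm: "(%z. (1 + (SUM j<m. \<bar>snd z j\<bar>)) * G (fst z) (snd z)) : bm N"
    using borel_measurable_integrable[OF G] by (simp add: case_prod_unfold)
  \<comment> \<open>X will be 1 or h e_j; both are bounded by a multiple of 1 + sum |e_j|, the
    factor of G in the integrability condition.\<close>
  have key: "integrable N (%z. X z * D z) & (LINT z|N. X z * D z) = 0"
    if Xm: "X : bm N" and Xb: "!!z. z : space N ==> \<bar>X z\<bar> <= B * (1 + (SUM j<m. \<bar>snd z j\<bar>))"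
      and XI: "!!s. \<bar>s\<bar> < ep ==> integrable (err_law (F s)) X" and Xc: "!!s. \<bar>s\<bar> < ep ==> (\<integral>z. X z \<partial>err_law (F s)) = k" for X B k
  proof -
    have GI: "integrable N (%z. B * ((1 + (SUM j<m. \<bar>snd z j\<bar>)) * G (fst z) (snd z)))"
      using integrable_mult_right[OF G, of B] by (simp add: case_prod_unfold)
    have dd: "((%r. X z * F r (fst z) (snd z)) has_real_derivative X z * deriv (%r. F r (fst z) (snd z)) s) (at s)"
      if "\<bar>s\<bar> < ep" "z : space N" for s z
      using Fd[OF that(1) sp[OF that(2)]] by (intro DERIV_cmult) (simp add: DERIV_deriv_iff_real_differentiable)
    have dd': "(%r. X z * F r (fst z) (snd z)) differentiable (at s) &
        \<bar>deriv (%r. X z * F r (fst z) (snd z)) s\<bar> <= B * ((1 + (SUM j<m. \<bar>snd z j\<bar>)) * G (fst z) (snd z))"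
      if s: "\<bar>s\<bar> < ep" and z: "z : space N" for s z
    proof
      show "(%r. X z * F r (fst z) (snd z)) differentiable (at s)" using dd[OF s z] real_differentiable_def by blast
      have "\<bar>X z * deriv (%r. F r (fst z) (snd z)) s\<bar> <= (B * (1 + (SUM j<m. \<bar>snd z j\<bar>))) * G (fst z) (snd z)"
        unfolding abs_mult using Fd[OF s sp[OF z]] by (intro mult_mono Xb z) (auto intro: order_trans[OF abs_ge_zero Xb[OF z]])
      then show "\<bar>deriv (%r. X z * F r (fst z) (snd z)) s\<bar> <= B * ((1 + (SUM j<m. \<bar>snd z j\<bar>)) * G (fst z) (snd z))"
        unfolding DERIV_imp_deriv[OF dd[OF s z]] by (simp add: mult.assoc)
    qed
    note * = integral_constant_imp_deriv_zero[OF eps GI dd', of k]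
    have eq: "deriv (%r. X z * F r (fst z) (snd z)) 0 = X z * D z" if "z : space N" for z
      unfolding D_def using DERIV_imp_deriv[OF dd[of 0 z]] that eps by simp
    have "integrable N (%z. deriv (%r. X z * F r (fst z) (snd z)) 0)" "(LINT z|N. deriv (%r. X z * F r (fst z) (snd z)) 0) = 0"
      by (rule *; use FI XI Xc in simp)+
    moreover have "integrable N (%z. deriv (%r. X z * F r (fst z) (snd z)) 0) = integrable N (%z. X z * D z)"
      by (rule bi_integrable_cong[OF refl eq])
    moreover have "(LINT z|N. deriv (%r. X z * F r (fst z) (snd z)) 0) = (LINT z|N. X z * D z)"
      by (rule bi_integral_cong[OF refl eq])
    ultimately show ?thesis by simp
  qed
  have DI: "integrable N D & (LINT z|N. D z) = 0"
  proof -
    have pr: "prob_space (err_law (F s))" if "\<bar>s\<bar> < ep" for s by (rule in_model_errors(1)[OF theta_m Fm[OF that]])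
    have one: "integrable (err_law (F s)) (%_. 1 :: real) & (\<integral>z. 1 \<partial>err_law (F s)) = (1 :: real)" if "\<bar>s\<bar> < ep" for s
    proof -
      interpret X: prob_space "err_law (F s)" by (rule pr[OF that])
      show ?thesis using X.prob_space by simp
    qed
    have "\<bar>1::real\<bar> <= 1 * (1 + (SUM j<m. \<bar>snd z j\<bar>))" for z :: "('k, 'd) covs \<times> (nat => real)" by (simp add: sum_nonneg)
    from key[of "%_. 1" 1 1, OF _ this] one show ?thesis by simp
  qed
  \<comment> \<open>A zero of f is a minimum of the nonnegative path at s = 0, so the derivative
    vanishes there and division by f loses nothing.\<close>
  have Dz: "D z = g z * f (fst z) (snd z)" if z: "z : space N" for z
  proof (cases "f (fst z) (snd z) = 0")
    case True
    have "D z = 0"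
      unfolding D_def
    proof (rule DERIV_local_min[OF _ eps])
      show "((%r. F r (fst z) (snd z)) has_real_derivative deriv (%r. F r (fst z) (snd z)) 0) (at 0)"
        using Fd[of 0, OF _ sp[OF z]] eps by (simp add: DERIV_deriv_iff_real_differentiable)
      show "ALL y. \<bar>0 - y\<bar> < ep --> F 0 (fst z) (snd z) <= F y (fst z) (snd z)"
        using in_modelD(2)[OF Fm sp[OF z]] True by (simp add: F0)
    qed
    then show ?thesis using True by simp
  qed (simp add: g_def D_def)
  have gm: "g : bm N"
    unfolding g_def using borel_measurable_integrable[OF DI[THEN conjunct1]] fm by (simp add: D_def[abs_def])
  have tr: "integrable Q (%z. X z * g z) & (LINT z|Q. X z * g z) = 0"
    if X: "X : bm N" and XD: "integrable N (%z. X z * D z) & (LINT z|N. X z * D z) = 0" for X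
  proof -
    have m: "(%z. X z * g z) : bm N" using X gm by measurable
    have "integrable N (%z. X z * D z) = integrable N (%z. X z * g z * f (fst z) (snd z))"
      by (rule bi_integrable_cong[OF refl]) (simp add: Dz)
    moreover have "(LINT z|N. X z * D z) = (LINT z|N. X z * g z * f (fst z) (snd z))"
      by (rule bi_integral_cong[OF refl]) (simp add: Dz)
    ultimately show ?thesis using XD Q_integral[OF m] by simp
  qed
  show "integrable Q g" "(LINT z|Q. g z) = 0" using tr[of "%_. 1"] DI by auto
  fix j and h :: "('k, 'd) covs => real" and B :: real assume j: "j < m" and h: "h : bm nu" and hB: "!!c. \<bar>h c\<bar> <= B"
  have B0: "0 <= B" using hB[of undefined] by linarith
  have Xm: "(%z. h (fst z) * snd z j) : bm N"
    by (intro borel_measurable_times e_measurable[OF j] measurable_compose[OF measurable_fst h])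
  have "integrable N (%z. h (fst z) * snd z j * D z) & (LINT z|N. h (fst z) * snd z j * D z) = 0"
  proof (rule key[OF Xm, of B 0])
    fix z :: "('k, 'd) covs \<times> (nat => real)"
    have "\<bar>snd z j\<bar> <= (SUM j<m. \<bar>snd z j\<bar>)" using j by (intro member_le_sum) auto
    then show "\<bar>h (fst z) * snd z j\<bar> <= B * (1 + (SUM j<m. \<bar>snd z j\<bar>))"
      unfolding abs_mult using B0 hB by (intro mult_mono) auto
  next
    fix s assume s: "\<bar>s\<bar> < ep"
    note ie = in_model_errors[OF theta_m Fm[OF s]]
    show "integrable (err_law (F s)) (%z. h (fst z) * snd z j)"
      by (rule bi_integrable_bound[OF integrable_mult_right[OF ie(2)[OF j], of B]])
        (use Xm hB B0 in \<open>auto simp: abs_mult measurable_cong_sets[OF err_law_simps(2) refl] intro!: mult_right_mono\<close>)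
    show "(\<integral>z. h (fst z) * snd z j \<partial>err_law (F s)) = 0" by (rule ie(4)[OF j h hB])
  qed
  from tr[OF Xm this] show "integrable Q (%z. h (fst z) * snd z j * g z) & (LINT z|Q. h (fst z) * snd z j * g z) = 0" .
qed

text \<open>Integrals under the tilted law are affine in s, with slope the integral against g, so
  the constraints on g keep mass and conditional mean exactly. Since |s g| <= 1, the tilt lies
  between 0 and 2 f, which preserves boundedness and decay.\<close>

lemma tilt_in_model:
  assumes gm: "(%z. g (fst z) (snd z)) : bm N" and gC1: "!!c. c : space nu ==> C1_fun m (g c)"
    and gB: "!!c e. c : space nu ==> e : errs m ==> \<bar>g c e\<bar> <= B"
    and g0: "(LINT z|Q. g (fst z) (snd z)) = 0"
    and ge: "!!j A. j < m ==> A : sets nu ==> (LINT z|Q. indicator A (fst z) * snd z j * g (fst z) (snd z)) = 0"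
    and s: "\<bar>s\<bar> * B <= 1"
  shows "in_model nu m \<mu> \<beta> \<theta> (%c e. f c e * (1 + s * g c e))"
proof -
  define f' where "f' = (%c e. f c e * (1 + s * g c e))"
  have sp: "fst z : space nu" "snd z : errs m" if "z : space N" for z
    using that by (auto simp: space_pair_measure)
  have sg: "\<bar>s * g c e\<bar> <= 1" if "c : space nu" "e : errs m" for c e
    unfolding abs_mult using mult_left_mono[OF gB[OF that], of "\<bar>s\<bar>"] s by simp
  have lb: "0 <= 1 + s * g c e" "1 + s * g c e <= 2" if "c : space nu" "e : errs m" for c e
    using sg[OF that] by (simp_all add: abs_le_iff)
  have f'm: "(%z. f' (fst z) (snd z)) : bm N" unfolding f'_def using fm gm by measurable
  have f'0: "0 <= f' c e" if "c : space nu" "e : errs m" for c e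
    unfolding f'_def using lb(1)[OF that] f_nonneg[OF that] by simp
  have f'2: "f' c e <= 2 * f c e" if "c : space nu" "e : errs m" for c e
    unfolding f'_def using mult_left_mono[OF lb(2)[OF that] f_nonneg[OF that]] by simp
  have tr: "integrable (err_law f') X & (LINT z|err_law f'. X z) = (LINT z|Q. X z) + s * (LINT z|Q. X z * g (fst z) (snd z))"
    if X: "integrable Q X" for X
  proof -
    have Xm: "X : bm N" using borel_measurable_integrable[OF X] by simp
    have Xg: "integrable Q (%z. X z * g (fst z) (snd z))"
      by (rule bi_integrable_bound[OF integrable_mult_right[OF X, of B]])
        (use Xm gm gB sp in \<open>auto simp: abs_mult mult.commute[of "\<bar>X _\<bar>"] measurable_cong_sets[OF err_law_simps(2) refl]
          intro!: AE_I2 mult_right_mono order_trans[OF gB abs_ge_self]\<close>)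
    then have I: "integrable Q (%z. X z + s * (X z * g (fst z) (snd z)))" using X by simp
    have eq: "X z * f' (fst z) (snd z) = (X z + s * (X z * g (fst z) (snd z))) * f (fst z) (snd z)" for z
      by (simp add: f'_def algebra_simps)
    have mm: "(%z. X z + s * (X z * g (fst z) (snd z))) : bm N" using Xm gm by measurable
    have "integrable (err_law f') X" "(LINT z|err_law f'. X z) = (LINT z|Q. X z + s * (X z * g (fst z) (snd z)))"
      using err_law_integral[of f', OF f'm f'0 Xm] Q_integral[OF mm] I unfolding eq by auto
    then show ?thesis using X Xg by simp
  qed
  have "in_model nu m \<mu> \<beta> \<theta> f'"
  proof (rule in_modelI[of \<theta> f', OF theta_m f'm f'0])
    show "C1_fun m (f' c)" if "c : space nu" for c
      unfolding f'_def by (intro C1_fun_mult C1_fun_add C1_fun_const f_C1 gC1 that)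
    obtain K where K: "!!c e. c : space nu ==> e : errs m ==> f c e <= K" using in_modelD(4)[OF model] by blast
    then show "EX B. ALL c:space nu. ALL e:errs m. f' c e <= B"
      using f'2 by (intro exI[of _ "2 * K"]) (meson mult_left_mono order_trans zero_le_numeral)
    show "((%v. f' c (e(j := v))) \<longlongrightarrow> 0) at_infinity" if "c : space nu" "e : errs m" "j < m" for c e j
    proof (rule tendsto_sandwich[of "%_. 0" _ _ "%v. 2 * f c (e(j := v))"])
      show "((%v. 2 * f c (e(j := v))) \<longlongrightarrow> 0) at_infinity" using tendsto_mult_left[OF in_modelD(5)[OF model that], of 2] by simp
    qed (use f'0 f'2 space_lebesgue_prod_upd that in \<open>auto intro!: always_eventually\<close>)
    show "prob_space (err_law f')"
    proof (rule prob_spaceI)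
      have "integrable (err_law f') (%_. 1 :: real)" and "(LINT z|err_law f'. 1) = (1 :: real)"
        using tr[of "%_. 1"] g0 Q.prob_space by auto
      then have m1: "measure (err_law f') (space (err_law f')) = 1" by simp
      then have "emeasure (err_law f') (space (err_law f')) ~= \<top>" using measure_zero_top by force
      then show "emeasure (err_law f') (space (err_law f')) = 1" using m1 by (simp add: emeasure_eq_ennreal_measure)
    qed
    show "integrable (err_law f') (%z. snd z j)" if "j < m" for j using tr[OF e_integrable[OF that]] by blast
    show "integrable (err_law f') (%z. \<mu> (lin_pred \<beta> \<theta> (fst z) j))" if "j < m" for j using tr[OF mu_integrable[OF that]] by blast
    show "(LINT z|err_law f'. indicator A (fst z) * snd z j) = 0" if j: "j < m" and A: "A : sets nu" for j A
    proof -
      have h: "(indicator A :: _ => real) : bm nu" using A by simp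
      have I: "integrable Q (%z. indicator A (fst z) * snd z j)"
        by (rule bi_integrable_bound[OF e_integrable[OF j]])
          (use borel_measurable_times[OF measurable_compose[OF measurable_fst h] e_measurable[OF j]] in
            \<open>auto simp: abs_mult measurable_cong_sets[OF err_law_simps(2) refl] split: split_indicator\<close>)
      have "(LINT z|Q. indicator A (fst z) * snd z j) = 0"
        by (rule in_model_errors(4)[OF theta_m model j h, of 1]) (auto split: split_indicator)
      then show ?thesis using tr[OF I] ge[OF j A] by simp
    qed
  qed
  then show ?thesis by (simp add: f'_def)
qed

end

section \<open>Density of smooth functions satisfying the moment constraints\<close>

text \<open>A logistic curve with slope parameter n^2 centred at 1 / n. The offset makes the value
  at 0 tend to 0, so that the pointwise limit is the indicator of the open half-line
  everywhere.\<close>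

definition step :: "nat => real => real" where
  "step n v = inverse (1 + exp (real n - (real n)^2 * v))"

lemma step_bounds: "0 <= step n v" "step n v <= 1"
  unfolding step_def by (auto simp: add_pos_pos less_imp_le intro!: inverse_le_1_iff[THEN iffD2])

lemma step_tendsto: "(%n. step n v) \<longlonglongrightarrow> indicator {0<..} v"
proof (cases "v > 0")
  case True
  have "(%n. step n v - 1) \<longlonglongrightarrow> 0"
  proof (rule Lim_null_comparison)
    show "(%n. 1 / real (Suc n)) \<longlonglongrightarrow> 0" using LIMSEQ_inverse_real_of_nat by (simp add: inverse_eq_divide)
    \<comment> \<open>Beyond this index n v > 2, so the exponent n - n^2 v is at most -n.\<close>
    obtain n0 :: nat where n0: "2 / v < real n0" using reals_Archimedean2 by blast
    show "\<forall>\<^sub>F n in sequentially. norm (step n v - 1) <= 1 / real (Suc n)"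
    proof (rule eventually_sequentiallyI[of n0])
      fix n assume "n0 <= n"
      then have "2 / v < real n" using n0 by linarith
      then have "2 < real n * v" using True by (simp add: pos_divide_less_eq)
      then have "real n * (1 - real n * v) <= real n * (-1)" by (intro mult_left_mono) auto
      then have "real n - (real n)^2 * v <= - real n" by (simp add: power2_eq_square algebra_simps)
      then have ee: "exp (real n - (real n)^2 * v) <= exp (- real n)" by simp
      have "1 + real n <= exp (real n)" by (rule exp_ge_add_one_self)
      then have "exp (- real n) <= 1 / real (Suc n)" by (simp add: exp_minus field_simps)
      moreover have "norm (step n v - 1) <= exp (real n - (real n)^2 * v)"
      proof -
        define x where "x = exp (real n - (real n)^2 * v)"
        have x: "0 < x" by (simp add: x_def)
        have "step n v - 1 = - (x / (1 + x))" unfolding step_def x_def[symmetric] using x by (simp add: field_simps)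
        moreover have "x / (1 + x) <= x" using x by (simp add: field_simps)
        ultimately show ?thesis using x by (simp add: x_def)
      qed
      ultimately show "norm (step n v - 1) <= 1 / real (Suc n)" using ee by linarith
    qed
  qed
  then show ?thesis using True by (simp add: LIM_zero_iff)
next
  case False
  have "(%n. step n v) \<longlonglongrightarrow> 0"
  proof (rule Lim_null_comparison)
    show "(%n. 1 / real (Suc n)) \<longlonglongrightarrow> 0" using LIMSEQ_inverse_real_of_nat by (simp add: inverse_eq_divide)
    show "\<forall>\<^sub>F n in sequentially. norm (step n v) <= 1 / real (Suc n)"
    proof (rule always_eventually, rule allI)
      fix n
      have "real n <= real n - (real n)^2 * v" using False by (simp add: mult_nonneg_nonpos)
      then have "exp (real n) <= exp (real n - (real n)^2 * v)" by simp
      moreover have "1 + real n <= exp (real n)" by (rule exp_ge_add_one_self)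
      ultimately have "1 + real n <= exp (real n - (real n)^2 * v)" by linarith
      then have "real (Suc n) <= 1 + exp (real n - (real n)^2 * v)" by simp
      then have "step n v <= 1 / real (Suc n)" unfolding step_def inverse_eq_divide by (intro divide_left_mono) (auto simp: add_pos_pos)
      then show "norm (step n v) <= 1 / real (Suc n)" using step_bounds(1)[of n v] by simp
    qed
  qed
  then show ?thesis using False by simp
qed

lemma C1_fun_step: "C1_fun m (%e. step n (e i - x))"
proof (rule C1_fun_coordinate[of "%v. step n (v - x)"
    "%v. (real n)^2 * exp (real n - (real n)^2 * (v - x)) * (step n (v - x))^2"])
  have nz: "1 + exp (real n - (real n)^2 * (v - x)) ~= 0" for v
    using exp_gt_zero[of "real n - (real n)^2 * (v - x)"] by linarith
  then show "((%v. step n (v - x)) has_real_derivative (real n)^2 * exp (real n - (real n)^2 * (v - x)) * (step n (v - x))^2) (at v)" for v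
    unfolding step_def by (auto intro!: derivative_eq_intros simp: power2_eq_square)
  show "continuous_on UNIV (%v. (real n)^2 * exp (real n - (real n)^2 * (v - x)) * (step n (v - x))^2)"
    unfolding step_def by (intro continuous_intros) (use nz in auto)
qed

lemma step_measurable [measurable]: "step n : bm borel"
  unfolding step_def by measurable

text \<open>Multiplied by this weight, the errors and their pairwise products become bounded and
  stay continuously differentiable. The damped errors are the correctors in
  \<open>constrained_test_fun_dense\<close>.\<close>

definition sq_weight :: "nat => (nat => real) => real" where
  "sq_weight m e = inverse (1 + (SUM j<m. (e j)^2))"

lemma sq_weight_bounds:
  assumes "j < m" "k < m"
  shows "0 < sq_weight m e" "\<bar>e j * sq_weight m e\<bar> <= 1" "\<bar>e j * e k * sq_weight m e\<bar> <= 1"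
proof -
  let ?s = "SUM j<m. (e j)^2"
  have s0: "0 <= ?s" by (intro sum_nonneg) auto
  then have s: "0 < 1 + ?s" by linarith
  show "0 < sq_weight m e" using s by (simp add: sq_weight_def)
  have jk: "(e j)^2 <= ?s" "(e k)^2 <= ?s" using assms by (auto intro!: member_le_sum)
  have ab: "\<bar>a * b\<bar> <= t" if "a^2 <= t" "b^2 <= t" for a b t :: real
  proof -
    have "0 <= (\<bar>a\<bar> - \<bar>b\<bar>)^2" by simp
    then have "2 * \<bar>a * b\<bar> <= a^2 + b^2" by (simp add: power2_diff abs_mult)
    then show ?thesis using that by linarith
  qed
  have w: "\<bar>y * sq_weight m e\<bar> <= 1" if "\<bar>y\<bar> <= 1 + ?s" for y
  proof -
    have "\<bar>y * sq_weight m e\<bar> = \<bar>y\<bar> / (1 + ?s)" unfolding sq_weight_def abs_mult using s by (simp add: divide_inverse)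
    also have "... <= 1" using that s by (simp add: divide_le_eq_1)
    finally show ?thesis .
  qed
  have "\<bar>e j * 1\<bar> <= 1 + ?s" by (rule ab) (use jk(1) s0 in auto)
  then show "\<bar>e j * sq_weight m e\<bar> <= 1" using w by simp
  show "\<bar>e j * e k * sq_weight m e\<bar> <= 1" using w[of "e j * e k"] ab[OF jk] by linarith
qed

lemma C1_fun_sq_weight: "C1_fun m (sq_weight m)"
  unfolding sq_weight_def[abs_def] power2_eq_square
proof (rule C1_fun_inverse)
  show "C1_fun m (%e. 1 + (SUM j<m. e j * e j))"
    by (intro C1_fun_add C1_fun_const C1_fun_sum C1_fun_mult C1_fun_proj)
  show "1 + (SUM j<m. e j * e j) ~= 0" for e :: "nat => real"
    using sum_nonneg[of "{..<m}" "%j. e j * e j"] by auto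
qed

lemma sq_weight_measurable: "sq_weight m : bm (lebesgue_prod m)"
  unfolding sq_weight_def[abs_def]
  by (intro borel_measurable_inverse borel_measurable_add borel_measurable_sum borel_measurable_power borel_measurable_const) auto

context cluster
begin

text \<open>These are the tilts that \<open>tilt_in_model\<close> accepts, apart from the moment
  constraints. Smoothness is asked in the errors only, so indicators of covariate sets
  qualify.\<close>

definition test_fun :: "(('k, 'd) covs => (nat => real) => real) => bool" where
  "test_fun phi \<longleftrightarrow> (%z. phi (fst z) (snd z)) : bm N &
     (EX B. ALL c:space nu. ALL e:errs m. \<bar>phi c e\<bar> <= B) & (ALL c:space nu. C1_fun m (phi c))"

lemma test_funI:
  assumes "(%z. phi (fst z) (snd z)) : bm N"
    and "!!c e. c : space nu ==> e : errs m ==> \<bar>phi c e\<bar> <= B" and "!!c. c : space nu ==> C1_fun m (phi c)"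
  shows "test_fun phi"
  unfolding test_fun_def using assms by (intro conjI exI[of _ B] ballI)

lemma test_funD:
  assumes "test_fun phi"
  shows "(%z. phi (fst z) (snd z)) : bm N" "!!c. c : space nu ==> C1_fun m (phi c)"
  using assms by (simp_all add: test_fun_def)

lemma test_fun_bound:
  assumes "test_fun phi"
  obtains B where "0 <= B" "!!c e. c : space nu ==> e : errs m ==> \<bar>phi c e\<bar> <= B"
proof -
  obtain B where B: "!!c e. c : space nu ==> e : errs m ==> \<bar>phi c e\<bar> <= B"
    using assms unfolding test_fun_def by blast
  have "\<bar>phi c e\<bar> <= max 0 B" if "c : space nu" "e : errs m" for c e
    using B[OF that] by linarith
  then show ?thesis using that[of "max 0 B"] by auto
qed

lemma test_fun_add: assumes "test_fun phi" "test_fun psi" shows "test_fun (%c e. phi c e + psi c e)"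
proof -
  obtain A B where A: "!!c e. c : space nu ==> e : errs m ==> \<bar>phi c e\<bar> <= A"
    and B: "!!c e. c : space nu ==> e : errs m ==> \<bar>psi c e\<bar> <= B"
    using test_fun_bound[OF assms(1)] test_fun_bound[OF assms(2)] by metis
  have b: "\<bar>phi c e + psi c e\<bar> <= A + B" if "c : space nu" "e : errs m" for c e
    using A[OF that] B[OF that] by linarith
  show ?thesis
  proof (rule test_funI[where B="A + B"])
    show "(%z. phi (fst z) (snd z) + psi (fst z) (snd z)) : bm N" by (intro borel_measurable_add test_funD assms)
    show "C1_fun m (%e. phi c e + psi c e)" if "c : space nu" for c by (intro C1_fun_add test_funD(2) assms that)
  qed (rule b)
qed

lemma test_fun_mult: assumes "test_fun phi" "test_fun psi" shows "test_fun (%c e. phi c e * psi c e)"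
proof -
  obtain A B where A: "0 <= A" "!!c e. c : space nu ==> e : errs m ==> \<bar>phi c e\<bar> <= A"
    and B: "!!c e. c : space nu ==> e : errs m ==> \<bar>psi c e\<bar> <= B"
    using test_fun_bound[OF assms(1)] test_fun_bound[OF assms(2)] by metis
  have b: "\<bar>phi c e * psi c e\<bar> <= A * B" if "c : space nu" "e : errs m" for c e
    unfolding abs_mult using A(2)[OF that] B[OF that] A(1) by (intro mult_mono) auto
  show ?thesis
  proof (rule test_funI[where B="A * B"])
    show "(%z. phi (fst z) (snd z) * psi (fst z) (snd z)) : bm N" by (intro borel_measurable_times test_funD assms)
    show "C1_fun m (%e. phi c e * psi c e)" if "c : space nu" for c by (intro C1_fun_mult test_funD(2) assms that)
  qed (rule b)
qed

lemma test_fun_cov: assumes "h : bm nu" "!!c. c : space nu ==> \<bar>h c\<bar> <= B" shows "test_fun (%c e. h c)"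
  by (rule test_funI[OF measurable_compose[OF measurable_fst assms(1)]]) (use assms(2) in auto)

lemma test_fun_err:
  assumes "w : bm (lebesgue_prod m)" "!!e. e : errs m ==> \<bar>w e\<bar> <= B" "C1_fun m w"
  shows "test_fun (%c e. w e)"
  by (rule test_funI[OF measurable_compose[OF measurable_snd assms(1)]]) (use assms(2,3) in auto)

lemma test_fun_const: "test_fun (%c e. a)" by (rule test_fun_cov[of "%_. a" "\<bar>a\<bar>"]) auto

lemma test_fun_sum: "(!!i. i : I ==> test_fun (phi i)) ==> test_fun (%c e. SUM i:I. phi i c e)"
  by (induction I rule: infinite_finite_induct) (auto intro: test_fun_add test_fun_const)

lemma test_fun_L2: assumes "test_fun phi" shows "(%z. phi (fst z) (snd z)) : L2 Q"
proof -
  obtain B where B: "!!c e. c : space nu ==> e : errs m ==> \<bar>phi c e\<bar> <= B"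
    using test_fun_bound[OF assms] by metis
  show ?thesis
  proof (rule Q.L2_bounded[of _ B])
    show "(%z. phi (fst z) (snd z)) : bm Q" using test_funD(1)[OF assms] by simp
    show "AE z in Q. \<bar>phi (fst z) (snd z)\<bar> <= B" by (intro AE_I2 B) (auto simp: space_pair_measure)
  qed
qed

text \<open>Products of a covariate set with an open orthant are stable under intersection, and
  their indicators are limits of test functions. Corners tending to minus infinity exhaust the error
  space, which recovers the covariate sets and the single coordinates.\<close>

lemma sets_Q_generator:
  "sets Q = sigma_sets (space Q) {A \<times> {e : errs m. ALL j<m. x j < e j} |A x. A : sets nu}"
    (is "_ = sigma_sets _ ?G")
proof -
  let ?L = "lebesgue_prod m"
  have GP: "?G \<subseteq> Pow (space N)" using sets.sets_into_space by (fastforce simp: space_pair_measure)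
  define Z where "Z = sigma (space N) ?G"
  have sZ: "space Z = space N" "sets Z = sigma_sets (space N) ?G" unfolding Z_def using GP by (simp_all add: sets_measure_of)
  have box: "A \<times> {e : space ?L. ALL j<m. x j < e j} : sets Z" if "A : sets nu" for A x
    unfolding sZ using that by (intro sigma_sets.Basic) blast
  have big: "EX n::nat. ALL j<m. - real n < e j" for e :: "nat => real"
  proof -
    obtain n where n: "(SUM j<m. \<bar>e j\<bar>) < real n" using reals_Archimedean2 by blast
    have "- real n < e j" if "j < m" for j
      using member_le_sum[of j "{..<m}" "%j. \<bar>e j\<bar>"] that n by auto
    then show ?thesis by blast
  qed
  have "fst : measurable Z nu"
  proof (rule measurableI)
    fix A assume A: "A : sets nu"
    have "fst -` A Int space Z = (\<Union>n::nat. A \<times> {e : space ?L. ALL j<m. - real n < e j})"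
      using sets.sets_into_space[OF A] big by (auto simp: sZ space_pair_measure)
    moreover have "(\<Union>n::nat. A \<times> {e : space ?L. ALL j<m. - real n < e j}) : sets Z"
      using box[OF A, of "%_. - real _"] by (intro sets.countable_UN) auto
    ultimately show "fst -` A Int space Z : sets Z" by simp
  qed (auto simp: sZ space_pair_measure)
  moreover have "(%z. \<lambda>j\<in>{..<m}. snd z j) : measurable Z ?L"
  proof (rule measurable_into_lebesgue_prod)
    fix j assume j: "j < m"
    show "(%z. snd z j) : bm Z"
      unfolding borel_measurable_iff_greater
    proof
      fix a :: real
      \<comment> \<open>A half-space in coordinate j is exhausted by orthants whose other corners
        are -n.\<close>
      let ?U = "%n. space nu \<times> {e : space ?L. ALL i<m. (if i = j then a else - real n) < e i}"
      have "z : (\<Union>n. ?U n)" if z: "z : space Z" "a < snd z j" for z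
      proof -
        obtain n where "ALL i<m. - real n < snd z i" using big by blast
        then have "z : ?U n" using z by (cases z) (auto simp: sZ space_pair_measure)
        then show ?thesis by blast
      qed
      moreover have "z : space Z & a < snd z j" if "z : ?U n" for z n
        using that j by (auto simp: sZ space_pair_measure dest: spec[of _ j])
      ultimately have "{z : space Z. a < snd z j} = (\<Union>n. ?U n)" by blast
      moreover have "?U n : sets Z" for n by (rule box[OF sets.top])
      then have "(\<Union>n. ?U n) : sets Z" by (intro sets.countable_nat_UN) blast
      ultimately show "{z : space Z. a < snd z j} : sets Z" by simp
    qed
  qed
  ultimately have pm: "(%z. (fst z, \<lambda>j\<in>{..<m}. snd z j)) : measurable Z N" by (rule measurable_Pair)
  have "(\<lambda>j\<in>{..<m}. snd z j) = snd z" if "z : space Z" for z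
    using that by (auto simp: sZ space_pair_measure space_lebesgue_prod fun_eq_iff restrict_def)
  then have "(%z. z) : measurable Z N \<longleftrightarrow> (%z. (fst z, \<lambda>j\<in>{..<m}. snd z j)) : measurable Z N"
    by (intro measurable_cong) auto
  then have id: "(%z. z) : measurable Z N" using pm by simp
  have "sets N \<subseteq> sets Z"
  proof
    fix A assume A: "A : sets N"
    have "(%z. z) -` A Int space Z = A" using sets.sets_into_space[OF A] by (auto simp: sZ)
    then show "A : sets Z" using measurable_sets[OF id A] by simp
  qed
  moreover have "?G \<subseteq> sets N"
  proof
    fix Y assume "Y : ?G"
    then obtain A x where Y: "A : sets nu" "Y = A \<times> {e : space ?L. ALL j<m. x j < e j}" by blast
    have "{e : space ?L. ALL j:{..<m}. x j < e j} : sets ?L"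
      by (intro sets.sets_Collect_finite_All borel_measurable_less) (auto intro!: borel_measurable_less)
    then show "Y : sets N" using Y by (auto simp: Ball_def)
  qed
  then have "sigma_sets (space N) ?G \<subseteq> sets N" by (rule sets.sigma_sets_subset)
  ultimately show ?thesis using sZ by auto
qed

text \<open>By \<open>L2_closure_dense\<close> it is enough to approximate the indicators of the
  generator. The covariate factor is kept, and the orthant is replaced by a product of steps,
  bounded by 1 for dominated convergence.\<close>

theorem test_fun_dense:
  assumes R: "R : L2 Q" and e: "0 < ep"
  obtains phi where "test_fun phi" "l2norm Q (%z. R z - phi (fst z) (snd z)) < ep"
proof -
  let ?L = "lebesgue_prod m"
  define S where "S = {%z. phi (fst z) (snd z) |phi. test_fun phi}"
  have SI: "test_fun phi ==> (%z. phi (fst z) (snd z)) : S" for phi by (auto simp: S_def)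
  have lS: "lin S"
    unfolding lin_def
  proof (intro conjI ballI allI)
    show "(%_. 0) : S" using SI[OF test_fun_const[of 0]] .
    fix f g c assume "f : S" "g : S"
    then obtain phi psi where p: "test_fun phi" "f = (%z. phi (fst z) (snd z))" "test_fun psi" "g = (%z. psi (fst z) (snd z))"
      by (auto simp: S_def)
    show "(%x. f x + c * g x) : S" unfolding p(2,4)
      using SI[OF test_fun_add[OF p(1) test_fun_mult[OF test_fun_const p(3)], of c]] .
  qed
  have SL: "S \<subseteq> L2 Q" using test_fun_L2 by (auto simp: S_def)
  have "L2 Q \<subseteq> L2_closure Q S"
  proof (rule Q.L2_closure_dense[OF _ _ sets_Q_generator lS])
    let ?G = "{A \<times> {e : space ?L. ALL j<m. x j < e j} |A x. A : sets nu}"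
    show "Int_stable ?G"
    proof (rule Int_stableI)
      fix a b assume "a : ?G" "b : ?G"
      then obtain A x B y where ab: "A : sets nu" "a = A \<times> {e : space ?L. ALL j<m. x j < e j}"
        "B : sets nu" "b = B \<times> {e : space ?L. ALL j<m. y j < e j}" by blast
      have "a Int b = (A Int B) \<times> {e : space ?L. ALL j<m. max (x j) (y j) < e j}" unfolding ab by auto
      moreover have "A Int B : sets nu" using ab by auto
      ultimately show "a Int b : ?G" by (intro CollectI exI[of _ "A Int B"] exI[of _ "%j. max (x j) (y j)"]) simp
    qed
    show "?G \<subseteq> Pow (space Q)" using sets.sets_into_space by (fastforce simp: space_pair_measure)
    show "(%_. 1) : L2_closure Q S" by (rule L2_closure_superset) (use SI[OF test_fun_const[of 1]] SL in auto)
    fix Y assume "Y : ?G"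
    then obtain A x where Y: "A : sets nu" "Y = A \<times> {e : space ?L. ALL j<m. x j < e j}" by blast
    have Ym: "Y : sets Q" unfolding sets_Q_generator using \<open>Y : ?G\<close> by (rule sigma_sets.Basic)
    define phi where "phi n c e = indicator A c * (\<Prod>j<m. step n (e j - x j))" for n and c :: "('k, 'd) covs" and e :: "nat => real"
    have pb: "\<bar>\<Prod>j<m. step n (e j - x j)\<bar> <= 1" for n e
      unfolding abs_prod using step_bounds by (intro prod_le_1) auto
    have tf: "test_fun (phi n)" for n
      unfolding phi_def
    proof (rule test_fun_mult)
      show "test_fun (%c e. indicator A c)" using Y(1) by (intro test_fun_cov[of _ 1]) (auto split: split_indicator)
      show "test_fun (%c e. \<Prod>j<m. step n (e j - x j))"
      proof (rule test_fun_err[OF _ pb])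
        show "(%e. \<Prod>j<m. step n (e j - x j)) : bm ?L"
          by (intro borel_measurable_prod measurable_compose[OF _ step_measurable] borel_measurable_diff) auto
        show "C1_fun m (%e. \<Prod>j<m. step n (e j - x j))" by (intro C1_fun_prod C1_fun_step)
      qed
    qed
    have lim: "(%n. phi n (fst z) (snd z)) \<longlonglongrightarrow> indicator Y z" if z: "z : space Q" for z
    proof -
      have "(%n. phi n (fst z) (snd z)) \<longlonglongrightarrow> indicator A (fst z) * (\<Prod>j<m. indicator {0<..} (snd z j - x j))"
        unfolding phi_def by (intro tendsto_intros step_tendsto)
      moreover have "indicator A (fst z) * (\<Prod>j<m. indicator {0<..} (snd z j - x j)) = (indicator Y z :: real)"
      proof (cases "ALL j<m. x j < snd z j")
        case True
        then have "(\<Prod>j<m. indicator {0<..} (snd z j - x j)) = (1::real)" by (intro prod.neutral) auto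
        then show ?thesis using True z unfolding Y(2) by (cases z) (auto simp: space_pair_measure split: split_indicator)
      next
        case False
        then have "(\<Prod>j<m. indicator {0<..} (snd z j - x j)) = (0::real)" by (intro prod_zero) (auto simp: indicator_def)
        then show ?thesis using False unfolding Y(2) by (cases z) (auto split: split_indicator)
      qed
      ultimately show ?thesis by simp
    qed
    have b: "\<bar>phi n (fst z) (snd z)\<bar> <= \<bar>1\<bar>" for n z using pb unfolding phi_def by (auto split: split_indicator)
    have one: "(%_. 1) : L2 Q" by (rule Q.L2_bounded[of _ 1]) auto
    have im: "indicator Y : bm Q" using Ym by (rule borel_measurable_indicator)
    have limA: "AE z in Q. (%n. phi n (fst z) (snd z)) \<longlonglongrightarrow> indicator Y z" using lim by (rule AE_I2)
    have bA: "AE z in Q. \<bar>phi n (fst z) (snd z)\<bar> <= \<bar>1\<bar>" for n using b by (intro AE_I2)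
    note dt = L2_dominated_tendsto[OF one L2D(1)[OF test_fun_L2[OF tf]] im limA bA]
    show "indicator Y : L2_closure Q S"
      by (rule L2_closure_lim[OF dt(1) L2_closure_superset[OF SI[OF tf] test_fun_L2[OF tf]] dt(3)])
  qed
  then have "R : L2_closure Q S" using R by auto
  then obtain h where "h : S" "l2norm Q (%z. R z - h z) < ep" using e unfolding L2_closure_iff by (metis IntE)
  then show ?thesis using that by (auto simp: S_def)
qed

end

lemma det_gmat_eq_0:
  assumes "i < m" "v i ~= 0" "!!j. j < m ==> (SUM k<m. G j k * v k) = 0"
  shows "Determinant.det (gmat m G) = 0"
proof -
  have "gmat m G *\<^sub>v Matrix.vec m v = 0\<^sub>v m" unfolding gmat_mult_vec using assms(3) by (intro eq_vecI) auto
  moreover have "Matrix.vec m v ~= 0\<^sub>v m"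
  proof
    assume "Matrix.vec m v = 0\<^sub>v m"
    from arg_cong[OF this, of "%w. vec_index w i"] show False using assms by simp
  qed
  ultimately show ?thesis using det_0_iff_vec_prod_zero[OF gmat_carrier, of m G] by (metis vec_carrier)
qed

section \<open>Conditional expectations given the covariates, as integrals over the errors\<close>

context cluster
begin

text \<open>The map to errors has an inverse that fixes the covariates and carries Q back to P, so a
  property of the covariates alone passes from one law to the other.\<close>

lemma Q_AE_fst: assumes "AE z in P. R (fst z)" shows "AE z in Q. R (fst z)"
proof -
  define D where "D = (%z. (fst z, \<lambda>j\<in>{..<m}. snd z j - (- \<mu> (lin_pred \<beta> \<theta> (fst z) j))))"
  have Dm: "D : measurable N N"
    unfolding D_def by (rule pair_shift_measurable) (intro borel_measurable_uminus mu_lin_pred_measurable theta_m)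
  have DE: "D (E z) = z" if "z : space N" for z
    using that by (cases z) (auto simp: D_def to_err_alt space_pair_measure space_lebesgue_prod fun_eq_iff restrict_def)
  have "distr Q N D = distr (distr P N E) N D" using distr_cluster_law[of \<theta> f \<beta>, OF theta_m fm] by simp
  also have "... = distr P N (D \<circ> E)" by (rule distr_distr[OF Dm E_measurable(2)])
  also have "... = distr P N (%z. z)" by (rule distr_cong) (auto simp: DE)
  also have "... = P" by (rule distr_id2) simp
  finally have "distr Q N D = P" .
  from assms[folded this] have "AE z in distr Q N D. R (fst z)" .
  moreover have "D : measurable Q N" using Dm by (simp add: measurable_cong_sets[OF err_law_simps(2) refl])
  ultimately have "AE z in Q. R (fst (D z))" by (rule AE_distrD[rotated])
  then show ?thesis by (simp add: D_def)
qed

lemma f_section_measurable: "c : space nu ==> f c : bm (lebesgue_prod m)"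
  using measurable_compose[OF measurable_Pair1' fm, of c] by simp

lemma section_measurable: "X : bm N ==> c : space nu ==> (%e. X (c, e)) : bm (lebesgue_prod m)"
  using measurable_compose[OF measurable_Pair1', of c nu X borel] by simp

lemma cov_measurable: "h : bm nu ==> (%z. h (fst z)) : bm Q"
  using measurable_compose[OF measurable_fst, of h nu borel "lebesgue_prod m"] by (simp add: measurable_cong_sets[OF err_law_simps(2) refl])

lemma cov_indicator_measurable: "A : sets nu ==> (%z. indicator A (fst z) :: real) : bm Q"
  by (rule cov_measurable) simp

lemma l2norm_one: "l2norm Q (%_. 1) = 1"
  using Q.prob_space by (simp add: l2norm_def)

text \<open>The density of the covariate law with respect to nu. Dividing \<open>cond_int\<close> by
  it gives the conditional expectation.\<close>

definition mass :: "('k, 'd) covs => real" where "mass = cond_int f (%_. 1)"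

lemma mass_facts:
  "AE c in nu. integrable (lebesgue_prod m) (f c)" "integrable nu mass" "c : space nu ==> 0 <= mass c"
proof -
  have "integrable Q (%_. 1 :: real)" by simp
  note ci = cond_int_integrable[OF this]
  show "AE c in nu. integrable (lebesgue_prod m) (f c)" "integrable nu mass" using ci by (simp_all add: mass_def)
  show "0 <= mass c" if "c : space nu"
    unfolding mass_def cond_int_def using f_nonneg[OF that] by (intro integral_nonneg_AE AE_I2) auto
qed

lemma cov_integral:
  assumes "integrable Q (%z. h (fst z))" shows "(LINT z|Q. h (fst z)) = (\<integral>c. h c * mass c \<partial>nu)" "integrable nu (%c. h c * mass c)"
proof -
  have I: "integrable Q (%z. h (fst z) * (%_. 1) z)" using assms by simp
  have cm: "cond_int f (%z. h (fst z) * (%_. 1) z) = (%c. h c * cond_int f (%_. 1) c)" by (rule ext) (rule cond_int_mult)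
  show "(LINT z|Q. h (fst z)) = (\<integral>c. h c * mass c \<partial>nu)" "integrable nu (%c. h c * mass c)"
    using cond_int_integrable(2,3)[OF I] unfolding cm mass_def[symmetric] by simp_all
qed

text \<open>A nonnegative function with integral 0 is null, so f c vanishes almost everywhere and
  with it every conditional integral. Quotients by \<open>mass\<close> may therefore take the
  default value 0.\<close>

lemma mass_zero: "AE c in nu. mass c = 0 --> (ALL X. cond_int f X c = 0)"
  using mass_facts(1) AE_space
proof eventually_elim
  case (elim c)
  show ?case
  proof (intro impI allI)
    fix X assume "mass c = 0"
    then have "AE e in lebesgue_prod m. f c e = 0"
      using integral_nonneg_eq_0_iff_AE[OF elim(1)] f_nonneg[OF elim(2)] by (auto simp: mass_def cond_int_def)
    then show "cond_int f X c = 0" unfolding cond_int_def by (intro integral_eq_zero_AE) auto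
  qed
qed

text \<open>For almost every c this is the Cauchy-Schwarz inequality for the measure with density f
  c.\<close>

lemma cond_int_Cauchy_Schwarz:
  assumes U: "U : L2 Q" and W: "W : L2 Q"
  shows "AE c in nu. (cond_int f (%z. U z * W z) c)^2 <= cond_int f (%z. (U z)^2) c * cond_int f (%z. (W z)^2) c"
  using cond_int_integrable(1)[OF L2D(2)[OF U]] cond_int_integrable(1)[OF L2D(2)[OF W]] AE_space
proof eventually_elim
  case (elim c)
  let ?L = "lebesgue_prod m"
  define D where "D = density ?L (%e. ennreal (f c e))"
  note fc = f_section_measurable[OF elim(3)]
  have f0: "AE e in ?L. 0 <= f c e" using f_nonneg[OF elim(3)] by (rule AE_I2)
  have Um: "(%e. U (c, e)) : bm ?L" and Wm: "(%e. W (c, e)) : bm ?L"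
    using L2D(1)[OF U] L2D(1)[OF W] by (auto intro!: section_measurable elim(3))
  have d: "integrable D X \<longleftrightarrow> integrable ?L (%e. X e * f c e)" "(LINT e|D. X e) = (LINT e|?L. X e * f c e)"
    if "X : bm ?L" for X :: "_ => real"
    unfolding D_def integrable_density[OF that fc f0] integral_density[OF that fc f0] by (simp_all add: mult.commute)
  have UL: "(%e. U (c, e)) : L2 D" and WL: "(%e. W (c, e)) : L2 D"
    using elim(1,2) Um Wm d(1)[of "%e. (U (c, e))^2"] d(1)[of "%e. (W (c, e))^2"] by (auto intro!: L2I simp: D_def)
  have "\<bar>\<integral>e. U (c, e) * W (c, e) \<partial>D\<bar>^2 <= (l2norm D (%e. U (c, e)) * l2norm D (%e. W (c, e)))^2"
    using L2_Cauchy_Schwarz[OF UL WL] by (intro power_mono) auto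
  then show ?case
    using Um Wm d(2)[of "%e. U (c, e) * W (c, e)"] d(2)[of "%e. (U (c, e))^2"] d(2)[of "%e. (W (c, e))^2"]
    by (simp add: power_mult_distrib l2norm_sq cond_int_def)
qed

text \<open>At a fixed c the coefficients are constants, so integrability is asked of the X i and
  not of their products with the h i.\<close>

lemma cond_int_sum:
  assumes I: "finite I" "!!i. i : I ==> integrable Q (X i)"
  shows "AE c in nu. cond_int f (%z. SUM i:I. h i (fst z) * X i z) c = (SUM i:I. h i c * cond_int f (X i) c)"
proof -
  have "AE c in nu. ALL i:I. integrable (lebesgue_prod m) (%e. X i (c, e) * f c e)"
    using cond_int_integrable(1)[OF I(2)] by (intro AE_finite_allI I(1)) auto
  then show ?thesis
  proof eventually_elim
    case (elim c)
    have "cond_int f (%z. SUM i:I. h i (fst z) * X i z) c = (LINT e|lebesgue_prod m. (SUM i:I. h i c * (X i (c, e) * f c e)))"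
      by (simp add: cond_int_def sum_distrib_right mult.assoc)
    also have "... = (SUM i:I. \<integral>e. h i c * (X i (c, e) * f c e) \<partial>lebesgue_prod m)"
      using elim by (intro bi_integral_sum integrable_mult_right) auto
    finally show ?case by (simp add: cond_int_def)
  qed
qed

end

section \<open>Conditional second moments of the errors\<close>

locale cluster_moments = cluster nu m \<mu> \<beta> \<theta> f
  for nu :: "('k::finite, 'd::finite) covs measure" and m \<mu> \<beta> and \<theta> :: "'d => real => real" and f +
  assumes e_L2: "!!j. j < m ==> (%z. snd z j) : L2 Q"
begin

definition moment2 :: "('k, 'd) covs => nat => nat => real" where
  "moment2 c j k = cond_int f (%z. snd z j * snd z k) c"

text \<open>Dividing by the mass normalises the conditional law. The result is an explicit function
  of the covariates, in contrast to the version of the conditional expectation inside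
  \<open>Sigma_mat\<close>.\<close>

definition sig :: "('k, 'd) covs => nat => nat => real" where
  "sig c j k = moment2 c j k / mass c"

lemma ee_integrable: "j < m ==> k < m ==> integrable Q (%z. snd z j * snd z k)"
  by (intro L2_mult_integrable e_L2)

lemma moment2_integrable: "j < m ==> k < m ==> integrable nu (%c. moment2 c j k)"
  unfolding moment2_def using cond_int_integrable(2)[OF ee_integrable] by simp

lemma sig_measurable: "j < m ==> k < m ==> (%c. sig c j k) : bm nu"
  unfolding sig_def
  by (intro borel_measurable_divide borel_measurable_integrable[OF moment2_integrable] borel_measurable_integrable[OF mass_facts(2)])

lemma sig_sym: "sig c j k = sig c k j"
  by (simp add: sig_def moment2_def mult.commute)

text \<open>In weak form, \<open>sig\<close> is the conditional expectation of the product of two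
  errors, with a covariate factor that may be unbounded. Integrability of the right-hand side is
  established first, by Fubini's theorem applied to its absolute value.\<close>

lemma moment_swap:
  assumes jk: "j < m" "k < m" and h: "h : bm nu" and I: "integrable Q (%z. h (fst z) * (snd z j * snd z k))"
  shows "integrable Q (%z. h (fst z) * sig (fst z) j k)"
    and "(LINT z|Q. h (fst z) * (snd z j * snd z k)) = (LINT z|Q. h (fst z) * sig (fst z) j k)"
proof -
  let ?L = "lebesgue_prod m"
  define s where "s c = h c * sig c j k" for c
  have sm: "s : bm nu" unfolding s_def[abs_def] using h sig_measurable[OF jk] by measurable
  have smN: "(%z. s (fst z)) : bm N" by (rule measurable_compose[OF measurable_fst sm])
  have cm: "cond_int f (%z. h (fst z) * (snd z j * snd z k)) = (%c. h c * moment2 c j k)"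
    unfolding moment2_def by (rule ext) (rule cond_int_mult)
  have hV: "integrable nu (%c. h c * moment2 c j k)"
    using cond_int_integrable(2)[OF I] unfolding cm .
  have ae: "AE c in nu. s c * mass c = h c * moment2 c j k"
    using mass_zero by eventually_elim (auto simp: s_def sig_def moment2_def)
  have sk: "integrable nu (%c. s c * mass c)"
    using integrable_cong_AE[OF _ _ ae] hV sm borel_measurable_integrable[OF mass_facts(2)] by auto
  have "integrable N (%z. s (fst z) * f (fst z) (snd z))"
  proof (rule Fubini_integrable)
    show "(%z. s (fst z) * f (fst z) (snd z)) : bm N" using smN fm by measurable
    have eq: "(LINT y|?L. norm (s (fst (c, y)) * f (fst (c, y)) (snd (c, y)))) = \<bar>s c * mass c\<bar>" if c: "c : space nu" for c
    proof -
      have "(LINT y|?L. norm (s (fst (c, y)) * f (fst (c, y)) (snd (c, y)))) = (LINT y|?L. \<bar>s c\<bar> * f c y)"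
        using f_nonneg[OF c] by (intro bi_integral_cong) (auto simp: abs_mult)
      also have "... = \<bar>s c\<bar> * mass c" by (simp add: mass_def cond_int_def)
      finally show ?thesis using mass_facts(3)[OF c] by (simp add: abs_mult)
    qed
    have "integrable nu (%c. \<bar>s c * mass c\<bar>)" using sk by simp
    then show "integrable nu (%c. \<integral>y. norm (s (fst (c, y)) * f (fst (c, y)) (snd (c, y))) \<partial>?L)"
      by (subst bi_integrable_cong[OF refl eq]) auto
    show "AE c in nu. integrable ?L (%y. s (fst (c, y)) * f (fst (c, y)) (snd (c, y)))"
      using mass_facts(1) by eventually_elim simp
  qed
  then have sI: "integrable Q (%z. s (fst z))" using Q_integral(1)[OF smN] by simp
  then show "integrable Q (%z. h (fst z) * sig (fst z) j k)" by (simp add: s_def)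
  have "(LINT z|Q. h (fst z) * (snd z j * snd z k)) = (\<integral>c. h c * moment2 c j k \<partial>nu)"
    using cond_int_integrable(3)[OF I] unfolding cm .
  also have "... = (\<integral>c. s c * mass c \<partial>nu)"
    using borel_measurable_integrable[OF hV] borel_measurable_integrable[OF sk] ae by (intro integral_cong_AE) auto
  also have "... = (LINT z|Q. s (fst z))" using cov_integral(1)[OF sI] by simp
  finally show "(LINT z|Q. h (fst z) * (snd z j * snd z k)) = (LINT z|Q. h (fst z) * sig (fst z) j k)" by (simp add: s_def)
qed

text \<open>The responses centred at their conditional means agree almost surely with the errors,
  and \<open>sig\<close> satisfies the integral equations that characterise the conditional
  expectations of the error products.\<close>

lemma Sigma_mat_sig: "AE z in P. Sigma_mat m P z = gmat m (sig (fst z))"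
proof -
  let ?F = "cov_algebra m P"
  interpret A: finite_measure_subalgebra P ?F
    by unfold_locales (rule cov_algebra_subalgebra)
  let ?X = "real_cond_exp P ?F"
  have Yi: "integrable P (obs_Y j)" and Ec: "AE z in P. ?X (obs_Y j) z = \<mu> (lin_pred \<beta> \<theta> (fst z) j)" if "j < m" for j
    using model that by (auto simp: in_model_def predictor_lin_pred)
  have main: "AE z in P. ?X (%z'. (obs_Y j z' - ?X (obs_Y j) z') * (obs_Y l z' - ?X (obs_Y l) z')) z = sig (fst z) j l"
    if jl: "j < m" "l < m" for j l
  proof -
    have em: "(%z. snd z j * snd z l) : bm N" by (intro borel_measurable_times e_measurable jl)
    have XI: "integrable P (%z. snd (E z) j * snd (E z) l)" using P_integral(1)[OF em] ee_integrable[OF jl] by simp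
    have sN: "(%z. sig (fst z) j l) : bm N" by (rule measurable_compose[OF measurable_fst sig_measurable[OF jl]])
    have sI: "integrable Q (%z. sig (fst z) j l)" using moment_swap(1)[OF jl, of "%_. 1"] ee_integrable[OF jl] by simp
    have sIP: "integrable P (%z. sig (fst z) j l)" using P_integral(1)[OF sN] sI by simp
    have "AE z in P. (obs_Y j z - ?X (obs_Y j) z) * (obs_Y l z - ?X (obs_Y l) z) = snd (E z) j * snd (E z) l"
      using Ec[OF jl(1)] Ec[OF jl(2)] by eventually_elim (simp add: snd_to_err[OF jl(1)] snd_to_err[OF jl(2)] obs_Y_def)
    then have "AE z in P. ?X (%z'. (obs_Y j z' - ?X (obs_Y j) z') * (obs_Y l z' - ?X (obs_Y l) z')) z = ?X (%z. snd (E z) j * snd (E z) l) z"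
      using borel_measurable_integrable[OF Yi[OF jl(1)]] borel_measurable_integrable[OF Yi[OF jl(2)]]
        borel_measurable_integrable[OF A.real_cond_exp_int(1)[OF Yi[OF jl(1)]]]
        borel_measurable_integrable[OF A.real_cond_exp_int(1)[OF Yi[OF jl(2)]]]
      by (intro A.real_cond_exp_cong borel_measurable_integrable[OF XI] borel_measurable_times borel_measurable_diff)
    moreover have "AE z in P. ?X (%z. snd (E z) j * snd (E z) l) z = sig (fst z) j l"
    proof (rule A.real_cond_exp_charact[OF _ XI sIP cov_algebra_measurable[OF sig_measurable[OF jl]]])
      fix A assume "A : sets ?F"
      then obtain B where B: "B : sets nu" "A = fst -` B Int space N" by (rule cov_algebra_sets)
      have Bm: "(indicator B :: _ => real) : bm nu" using B(1) by simp
      have iB: "(%z. indicator B (fst z) :: real) : bm N" by (rule measurable_compose[OF measurable_fst Bm])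
      have ii: "(\<integral>z\<in>A. Y z \<partial>P) = (LINT z|P. indicator B (fst z) * Y z)" for Y :: "_ => real"
        unfolding set_lebesgue_integral_def by (intro bi_integral_cong refl) (auto simp: B(2) split: split_indicator)
      have I: "integrable Q (%z. indicator B (fst z) * (snd z j * snd z l))"
        by (rule bi_integrable_bound[OF ee_integrable[OF jl]])
          (use iB em in \<open>auto simp: abs_mult measurable_cong_sets[OF err_law_simps(2) refl] split: split_indicator\<close>)
      have "(LINT z|P. indicator B (fst z) * (snd (E z) j * snd (E z) l)) = (LINT z|Q. indicator B (fst z) * (snd z j * snd z l))"
        using P_integral(2)[of "%z. indicator B (fst z) * (snd z j * snd z l)"] iB em by simp
      also have "... = (LINT z|Q. indicator B (fst z) * sig (fst z) j l)" by (rule moment_swap(2)[OF jl Bm I])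
      also have "... = (LINT z|P. indicator B (fst z) * sig (fst z) j l)"
        using P_integral(2)[of "%z. indicator B (fst z) * sig (fst z) j l"] iB sN by simp
      finally show "(\<integral>z\<in>A. snd (E z) j * snd (E z) l \<partial>P) = (\<integral>z\<in>A. sig (fst z) j l \<partial>P)" unfolding ii .
    qed
    ultimately show ?thesis by eventually_elim simp
  qed
  have "AE z in P. ALL j:{..<m}. ALL l:{..<m}. ?X (%z'. (obs_Y j z' - ?X (obs_Y j) z') * (obs_Y l z' - ?X (obs_Y l) z')) z = sig (fst z) j l"
    using main by (intro AE_finite_allI) auto
  then show ?thesis
    by eventually_elim (auto simp: Sigma_mat_def gmat_def Let_def intro!: eq_matI)
qed

text \<open>Weighting the second moments makes them bounded without destroying invertibility.\<close>

definition wmoment :: "('k, 'd) covs => nat => nat => real" where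
  "wmoment c j k = cond_int f (%z. snd z j * snd z k * sq_weight m (snd z)) c"

lemma w_measurable: "(%z. sq_weight m (snd z)) : bm N"
  by (rule measurable_compose[OF measurable_snd sq_weight_measurable])

lemma eew_integrable: "j < m ==> k < m ==> integrable Q (%z. snd z j * snd z k * sq_weight m (snd z))"
  by (rule Q.integrable_const_bound[of _ 1])
    (auto intro!: AE_I2 borel_measurable_times e_measurable w_measurable sq_weight_bounds(3) simp: measurable_cong_sets[OF err_law_simps(2) refl])

lemma wmoment_measurable: "j < m ==> k < m ==> (%c. wmoment c j k) : bm nu"
  unfolding wmoment_def using borel_measurable_integrable[OF cond_int_integrable(2)[OF eew_integrable]] by simp

text \<open>A kernel vector v of the weighted matrix gives a zero integral of (v' e)^2 w f. As the
  weight w is positive, (v' e) f vanishes almost everywhere, so v is also in the kernel of the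
  matrix of second moments.\<close>

lemma wmoment_invertible:
  "AE c in nu. Determinant.det (gmat m (moment2 c)) ~= 0 --> Determinant.det (gmat m (wmoment c)) ~= 0"
proof -
  let ?L = "lebesgue_prod m"
  have "AE c in nu. ALL j:{..<m}. ALL k:{..<m}. integrable ?L (%e. e j * e k * f c e) & integrable ?L (%e. e j * e k * sq_weight m e * f c e)"
    using cond_int_integrable(1)[OF ee_integrable] cond_int_integrable(1)[OF eew_integrable]
    by (intro AE_finite_allI AE_conjI) auto
  then show ?thesis
    using AE_space
  proof eventually_elim
    case (elim c)
    have I: "integrable ?L (%e. e j * e k * f c e)" "integrable ?L (%e. e j * e k * sq_weight m e * f c e)"
      if "j < m" "k < m" for j k using elim(1) that by auto
    show ?case
    proof (rule impI, rule notI)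
      assume nz: "Determinant.det (gmat m (moment2 c)) ~= 0" and z: "Determinant.det (gmat m (wmoment c)) = 0"
      obtain v where v: "EX i<m. v i ~= 0" "!!j. j < m ==> (SUM k<m. wmoment c j k * v k) = 0"
        using singular_gmat[OF z] by metis
      define u where "u e = (SUM j<m. v j * e j)" for e :: "nat => real"
      have u2: "(u e)^2 * sq_weight m e * f c e = (SUM j<m. SUM k<m. v j * v k * (e j * e k * sq_weight m e * f c e))" for e
        unfolding u_def power2_eq_square sum_product by (simp add: sum_distrib_left sum_distrib_right mult_ac)
      have uI: "integrable ?L (%e. (u e)^2 * sq_weight m e * f c e)"
        unfolding u2 using I(2) by (intro bi_integrable_sum integrable_mult_right) auto
      have "(LINT e|?L. (u e)^2 * sq_weight m e * f c e) = (SUM j<m. SUM k<m. v j * v k * wmoment c j k)"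
        unfolding u2 wmoment_def cond_int_def using I(2)
        by (subst bi_integral_sum, intro bi_integrable_sum integrable_mult_right, simp)
          (auto intro!: sum.cong simp: bi_integral_sum)
      also have "... = (SUM j<m. v j * (SUM k<m. wmoment c j k * v k))" by (simp add: sum_distrib_left mult_ac)
      also have "... = 0" using v(2) by simp
      finally have "AE e in ?L. (u e)^2 * sq_weight m e * f c e = 0"
        using integral_nonneg_eq_0_iff_AE[OF uI] f_nonneg[OF elim(2)]
        by (auto intro!: AE_I2 mult_nonneg_nonneg simp: sq_weight_def sum_nonneg)
      then have uf: "AE e in ?L. u e * f c e = 0"
      proof eventually_elim
        case (elim e)
        have "0 < 1 + (SUM j<m. (e j)^2)" by (simp add: add_pos_nonneg sum_nonneg)
        then show ?case using elim by (auto simp: sq_weight_def)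
      qed
      have "(SUM k<m. moment2 c j k * v k) = 0" if j: "j < m" for j
      proof -
        have "(SUM k<m. moment2 c j k * v k) = (SUM k<m. \<integral>e. v k * (e j * e k * f c e) \<partial>?L)"
          unfolding moment2_def cond_int_def by (simp add: mult.commute)
        also have "... = (LINT e|?L. (SUM k<m. v k * (e j * e k * f c e)))"
          using I(1)[OF j] by (subst bi_integral_sum) auto
        also have "... = (LINT e|?L. e j * (u e * f c e))"
          by (intro bi_integral_cong refl) (simp add: u_def sum_distrib_left sum_distrib_right mult_ac)
        also have "... = 0" using uf by (intro integral_eq_zero_AE) auto
        finally show ?thesis .
      qed
      then show False using det_gmat_eq_0 v(1) nz by blast
    qed
  qed
qed

text \<open>The test function g is corrected by a combination of the weighted errors with bounded
  coefficients, which solve a linear system with matrix wmoment.  They are small since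
  the moments of g against the errors are those of g - R.\<close>

theorem constrained_test_fun_dense:
  assumes R: "R : L2 Q" and R0: "(LINT z|Q. R z) = 0"
    and Re: "!!l. l < m ==> AE c in nu. cond_int f (%z. R z * snd z l) c = 0"
    and det: "AE z in Q. Determinant.det (gmat m (moment2 (fst z))) ~= 0" and e: "0 < ep"
  obtains g where "test_fun g" "(LINT z|Q. g (fst z) (snd z)) = 0"
    "!!j A. j < m ==> A : sets nu ==> (LINT z|Q. indicator A (fst z) * snd z j * g (fst z) (snd z)) = 0"
    "l2norm Q (%z. R z - g (fst z) (snd z)) < ep"
proof -
  \<comment> \<open>Covariates with uniformly controlled inverse, second moments and mass. These
    sets increase to almost the whole space because the weighted matrix is almost surely
    invertible.\<close>
  define CN where "CN n = {c : space nu. 1 / real (Suc n) <= \<bar>Determinant.det (gmat m (wmoment c))\<bar> &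
    (ALL j:{..<m}. ALL k:{..<m}. \<bar>wmoment c j k\<bar> <= real (Suc n)) & (ALL k:{..<m}. moment2 c k k <= real (Suc n)) & mass c <= real (Suc n)}" for n
  have massm: "mass : bm nu" by (rule borel_measurable_integrable[OF mass_facts(2)])
  have detm: "(%c. Determinant.det (gmat m (wmoment c))) : bm nu"
    by (rule det_gmat_measurable) (rule wmoment_measurable)
  have m2m: "(%c. moment2 c k k) : bm nu" if "k < m" for k
    using borel_measurable_integrable[OF moment2_integrable[OF that that]] .
  have CNm: "CN n : sets nu" for n
    unfolding CN_def
    by (intro sets.sets_Collect_conj sets.sets_Collect_finite_All finite_lessThan borel_measurable_le borel_measurable_const
        borel_measurable_abs detm massm)
      (auto intro!: borel_measurable_le borel_measurable_abs wmoment_measurable m2m)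
  have indm: "(%z. indicator (CN n) (fst z) :: real) : bm Q" for n
    by (rule cov_indicator_measurable[OF CNm])
  have lim: "(%n. l2norm Q (%z. indicator (CN n) (fst z) * R z - R z)) \<longlonglongrightarrow> 0"
  proof (rule L2_dominated_tendsto(3)[OF R])
    show "(%z. indicator (CN n) (fst z) * R z) : bm Q" for n
      using indm L2D(1)[OF R] by (intro borel_measurable_times)
    show "R : bm Q" by (rule L2D(1)[OF R])
    show "AE z in Q. \<bar>indicator (CN n) (fst z) * R z\<bar> <= \<bar>R z\<bar>" for n
      by (intro AE_I2) (auto split: split_indicator)
    show "AE z in Q. (%n. indicator (CN n) (fst z) * R z) \<longlonglongrightarrow> R z"
      using err_law_AE_fst[OF wmoment_invertible fm] det AE_space
    proof eventually_elim
      case (elim z)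
      let ?c = "fst z"
      have c: "?c : space nu" using elim(3) by (auto simp: space_pair_measure)
      have d: "Determinant.det (gmat m (wmoment ?c)) ~= 0" using elim by blast
      have ev: "\<forall>\<^sub>F n in sequentially. x <= real (Suc n)" for x
        using eventually_compose_filterlim[OF eventually_ge_at_top[of x] filterlim_compose[OF filterlim_real_sequentially filterlim_Suc]] .
      have "\<forall>\<^sub>F n in sequentially. 1 / real (Suc n) <= \<bar>Determinant.det (gmat m (wmoment ?c))\<bar>"
        using ev[of "1 / \<bar>Determinant.det (gmat m (wmoment ?c))\<bar>"] by eventually_elim (use d in \<open>simp add: field_simps\<close>)
      then have "\<forall>\<^sub>F n in sequentially. ?c : CN n"
        unfolding CN_def mem_Collect_eq using c by (intro eventually_conj eventually_ball_finite ballI ev) auto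
      then have "\<forall>\<^sub>F n in sequentially. indicator (CN n) ?c * R z = R z" by eventually_elim simp
      then show ?case by (rule tendsto_eventually)
    qed
  qed
  obtain n where n: "l2norm Q (%z. indicator (CN n) (fst z) * R z - R z) < ep / 6"
    using LIMSEQ_D[OF lim, of "ep / 6"] e by auto
  define N' where "N' = real (Suc n)"
  have N1: "1 <= N'" by (simp add: N'_def)
  define G where "G = fact (m - 1) * N' ^ (m - 1) * N'"
  have G0: "0 <= G" using N1 by (simp add: G_def)
  \<comment> \<open>The approximation error of phi enters once directly and m^2 G N' times through
    the corrections; with this M the two together stay below ep / 6, as does the truncation
    error.\<close>
  define M where "M = 6 * (1 + real m * (real m * (G * N')))"
  have M0: "0 < M" using G0 N1 by (simp add: M_def add_pos_nonneg)
  obtain phi where ph: "test_fun phi" and close: "l2norm Q (%z. R z - phi (fst z) (snd z)) < ep / M"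
    using test_fun_dense[OF R, of "ep / M"] e M0 by auto
  let ?p = "%z. phi (fst z) (snd z)"
  obtain B where B: "0 <= B" "!!c e. c : space nu ==> e : errs m ==> \<bar>phi c e\<bar> <= B"
    using test_fun_bound[OF ph] by metis
  have pL: "?p : L2 Q" by (rule test_fun_L2[OF ph])
  have pRL: "(%z. R z - ?p z) : L2 Q" by (rule L2_diff[OF R pL])
  define \<kappa> where "\<kappa> k c = cond_int f (%z. ?p z * snd z k) c" for k c
  have pe: "integrable Q (%z. ?p z * snd z k)" if "k < m" for k by (rule L2_mult_integrable[OF pL e_L2[OF that]])
  have km: "\<kappa> k : bm nu" if "k < m" for k
    using borel_measurable_integrable[OF cond_int_integrable(2)[OF pe[OF that]]] unfolding \<kappa>_def[abs_def] .
  define D where "D c = cond_int f (%z. (R z - ?p z)^2) c" for c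
  have kD: "AE c in nu. (\<kappa> k c)^2 <= D c * moment2 c k k" if k: "k < m" for k
  proof -
    have Rk: "integrable Q (%z. R z * snd z k)" by (rule L2_mult_integrable[OF R e_L2[OF k]])
    \<comment> \<open>The difference of R and phi is written as a sum over two indices in order to
      apply \<open>cond_int_sum\<close>. As the moments of R vanish, the moment of phi is minus that
      of R - phi.\<close>
    have "AE c in nu. cond_int f (%z. SUM i<2::nat. (if i = 0 then 1 else - 1) * (if i = 0 then R z * snd z k else ?p z * snd z k)) c
        = (SUM i<2::nat. (if i = 0 then 1 else - 1) * cond_int f (if i = 0 then (%z. R z * snd z k) else (%z. ?p z * snd z k)) c)"
      using cond_int_sum[of "{..<2::nat}" "%i. if i = 0 then (%z. R z * snd z k) else (%z. ?p z * snd z k)" "%i _. if i = 0 then 1 else - 1"] Rk pe[OF k]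
      by (simp add: if_distrib[of "%F. F _"] cong: if_cong)
    then show ?thesis
      using Re[OF k] cond_int_Cauchy_Schwarz[OF pRL e_L2[OF k]]
      by eventually_elim (simp add: numeral_2_eq_2 \<kappa>_def D_def moment2_def left_diff_distrib power2_eq_square)
  qed
  \<comment> \<open>This bound is not small, but it makes the coefficients of the correction
    bounded, as test functions require.\<close>
  have kB: "AE c in nu. c : CN n --> \<bar>\<kappa> k c\<bar> <= B * N'" if k: "k < m" for k
    using cond_int_Cauchy_Schwarz[OF pL e_L2[OF k]] cond_int_integrable(1)[OF L2D(2)[OF pL]] mass_facts(1) AE_space
  proof eventually_elim
    case (elim c)
    show ?case
    proof
      assume c: "c : CN n"
      have le: "(?p (c, x))^2 * f c x <= B^2 * f c x" if x: "x : errs m" for x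
        using power_mono[OF B(2)[OF elim(4) x], of 2] f_nonneg[OF elim(4) x] by (intro mult_right_mono) auto
      have "cond_int f (%z. (?p z)^2) c <= (LINT x|lebesgue_prod m. B^2 * f c x)"
        unfolding cond_int_def using elim(2,3) le by (intro integral_mono) auto
      also have "... = B^2 * mass c" by (simp add: mass_def cond_int_def)
      also have "... <= B^2 * N'" using c by (intro mult_left_mono) (auto simp: CN_def N'_def)
      finally have "cond_int f (%z. (?p z)^2) c * moment2 c k k <= (B^2 * N') * moment2 c k k"
        using f_nonneg[OF elim(4)] by (intro mult_right_mono)
          (auto simp: moment2_def cond_int_def intro!: integral_nonneg_AE AE_I2)
      also have "... <= (B^2 * N') * N'" using c N1 k by (intro mult_left_mono) (auto simp: CN_def N'_def)
      finally have "(\<kappa> k c)^2 <= (B * N')^2"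
        using elim(1) unfolding \<kappa>_def moment2_def by (simp add: power2_eq_square mult_ac)
      then show "\<bar>\<kappa> k c\<bar> <= B * N'" using B(1) N1 abs_le_square_iff[of "\<kappa> k c" "B * N'"] by simp
    qed
  qed
  \<comment> \<open>The bound \<open>kB\<close> holds almost everywhere only. Removing the
    exceptional covariates makes it hold on all of C, as the boundedness of a test function
    demands.\<close>
  define C where "C = {c : CN n. ALL k:{..<m}. \<bar>\<kappa> k c\<bar> <= B * N'}"
  have Cm: "C : sets nu"
  proof -
    have "{c : space nu. ALL k:{..<m}. \<bar>\<kappa> k c\<bar> <= B * N'} : sets nu"
      using km by (intro sets.sets_Collect_finite_All borel_measurable_le borel_measurable_abs) auto
    from sets.Int[OF CNm[of n] this] show ?thesis
      by (rule back_subst[of "%S. S : sets nu"]) (auto simp: C_def CN_def)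
  qed
  have CAE: "AE c in nu. c : CN n \<longleftrightarrow> c : C"
  proof -
    have "AE c in nu. ALL k:{..<m}. c : CN n --> \<bar>\<kappa> k c\<bar> <= B * N'" using kB by (intro AE_finite_allI) auto
    then show ?thesis by eventually_elim (auto simp: C_def)
  qed
  have Cs: "c : space nu" if "c : C" for c using that by (auto simp: C_def CN_def)
  have Gb: "\<bar>ginv m (wmoment c) l k\<bar> <= G" if "c : C" "l < m" "k < m" for c l k
    unfolding G_def using that by (intro ginv_bounded N1) (auto simp: C_def CN_def N'_def)
  have dC: "Determinant.det (gmat m (wmoment c)) ~= 0" if "c : C" for c
  proof -
    have "0 < 1 / N'" using N1 by simp
    also have "... <= \<bar>Determinant.det (gmat m (wmoment c))\<bar>" using that by (auto simp: C_def CN_def N'_def)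
    finally show ?thesis by auto
  qed
  \<comment> \<open>Summed over k, these are the solutions b of the linear system
    \<open>wmoment\<close> b = \<kappa> on C, so subtracting the combination of damped errors with
    coefficients b cancels the moments of phi against the errors.\<close>
  define q where "q l k c = indicator C c * (ginv m (wmoment c) l k * \<kappa> k c)" for l k c
  have qm: "q l k : bm nu" if "l < m" "k < m" for l k
    unfolding q_def[abs_def]
    by (intro borel_measurable_times borel_measurable_indicator Cm ginv_measurable wmoment_measurable km that)
  have qB: "\<bar>q l k c\<bar> <= G * (B * N')" if "l < m" "k < m" for l k c
  proof (cases "c : C")
    case True
    then show ?thesis using Gb[OF True that] that unfolding q_def by (auto simp: abs_mult C_def intro!: mult_mono G0)
  qed (use G0 B(1) N1 in \<open>simp add: q_def\<close>)
  define b where "b l c = (SUM k<m. q l k c)" for l c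
  have bt: "test_fun (%c e. q l k c)" if "l < m" "k < m" for l k
    by (rule test_fun_cov[OF qm[OF that] qB[OF that]])
  define ew where "ew l x = x l * sq_weight m x" for l and x :: "nat => real"
  have ewt: "test_fun (%c. ew l)" if "l < m" for l
    unfolding ew_def[abs_def]
  proof (rule test_fun_err)
    show "(%x. x l * sq_weight m x) : bm (lebesgue_prod m)"
      by (intro borel_measurable_times measurable_lebesgue_prod_component that sq_weight_measurable)
    show "\<bar>x l * sq_weight m x\<bar> <= 1" for x using sq_weight_bounds(2)[OF that that] .
    show "C1_fun m (%x. x l * sq_weight m x)" by (intro C1_fun_mult C1_fun_proj C1_fun_sq_weight)
  qed
  have iC: "test_fun (%c e. indicator C c)"
    by (rule test_fun_cov[of _ 1, OF borel_measurable_indicator[OF Cm]]) (auto split: split_indicator)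
  define g0 where "g0 c x = indicator C c * phi c x + (SUM l<m. SUM k<m. - 1 * (q l k c * ew l x))" for c x
  have g0t: "test_fun g0"
    unfolding g0_def[abs_def]
    by (intro test_fun_add test_fun_mult test_fun_sum test_fun_const iC ph) (auto intro: bt ewt)
  let ?g0 = "%z. g0 (fst z) (snd z)"
  have g0L: "?g0 : L2 Q" by (rule test_fun_L2[OF g0t])
  have orth: "(LINT z|Q. indicator A (fst z) * snd z j * ?g0 z) = 0" if j: "j < m" and A: "A : sets nu" for j A
  proof -
    define X where "X l z = (if l < m then snd z j * snd z l * sq_weight m (snd z) else ?p z * snd z j)" for l :: nat and z :: "('k, 'd) covs \<times> (nat => real)"
    define h where "h l c = (if l < m then - b l c else indicator C c)" for l c
    have eq: "snd z j * ?g0 z = (SUM l<Suc m. h l (fst z) * X l z)" for z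
    proof -
      have "(SUM l<Suc m. h l (fst z) * X l z) = (SUM l<m. - b l (fst z) * (snd z j * snd z l * sq_weight m (snd z))) + indicator C (fst z) * (?p z * snd z j)"
        unfolding sum.lessThan_Suc by (simp add: h_def X_def)
      then show ?thesis
        unfolding g0_def b_def ew_def by (simp add: algebra_simps sum_distrib_left sum_distrib_right sum_negf)
    qed
    have "integrable Q (X l)" if "l < Suc m" for l
      unfolding X_def[abs_def] using eew_integrable[OF j] pe[OF j] by (cases "l < m") auto
    then have "AE c in nu. cond_int f (%z. SUM l<Suc m. h l (fst z) * X l z) c = (SUM l<Suc m. h l c * cond_int f (X l) c)"
      by (intro cond_int_sum) auto
    then have "AE c in nu. cond_int f (%z. snd z j * ?g0 z) c = 0"
    proof eventually_elim
      case (elim c)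
      have "(SUM l<Suc m. h l c * cond_int f (X l) c) = (SUM l<m. - b l c * wmoment c j l) + indicator C c * \<kappa> j c"
        unfolding sum.lessThan_Suc by (simp add: h_def X_def[abs_def] wmoment_def \<kappa>_def)
      also have "(SUM l<m. - b l c * wmoment c j l) = - (SUM l<m. SUM k<m. wmoment c j l * q l k c)"
        by (simp add: b_def sum_distrib_left sum_negf mult.commute)
      also have "(SUM l<m. SUM k<m. wmoment c j l * q l k c) = (SUM k<m. SUM l<m. wmoment c j l * q l k c)" by (rule sum.swap)
      also have "... = (SUM k<m. indicator C c * ((SUM l<m. wmoment c j l * ginv m (wmoment c) l k) * \<kappa> k c))"
        by (simp add: q_def sum_distrib_left sum_distrib_right mult_ac)
      also have "... = (SUM k<m. indicator C c * ((if j = k then 1 else 0) * \<kappa> k c))"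
        using ginv_mult(1)[OF dC j] by (intro sum.cong refl) (auto simp: indicator_def)
      also have "... = indicator C c * \<kappa> j c" using sum_unit_vector(2)[OF j, of "%k. \<kappa> k c"] by (simp add: sum_distrib_left[symmetric])
      finally show ?case using elim by (simp add: eq)
    qed
    moreover have "integrable Q (%z. indicator A (fst z) * (snd z j * ?g0 z))"
    proof (rule bi_integrable_bound[OF L2_mult_integrable[OF e_L2[OF j] g0L]])
      show "(%z. indicator A (fst z) * (snd z j * ?g0 z)) : bm Q"
        by (intro borel_measurable_times L2D(1)[OF e_L2[OF j]] L2D(1)[OF g0L] cov_indicator_measurable[OF A])
    qed (auto split: split_indicator)
    ultimately show ?thesis using cond_int_eq_0D[of "%z. snd z j * ?g0 z" "indicator A"] by (simp add: mult.assoc)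
  qed
  \<comment> \<open>The damped error is at most 1 in modulus, and by \<open>kD\<close> the
    coefficient is controlled by the conditional norm of R - phi. This is where the corrections
    become small.\<close>
  have "l2norm Q (%z. q l k (fst z) * ew l (snd z)) <= G * N' * l2norm Q (%z. R z - ?p z)" if lk: "l < m" "k < m" for l k
  proof -
    have qL: "(%z. q l k (fst z)) : L2 Q" using test_fun_L2[OF bt[OF lk]] .
    have "l2norm Q (%z. q l k (fst z) * ew l (snd z)) <= l2norm Q (%z. q l k (fst z))"
    proof (rule l2norm_mono_AE[OF qL])
      show "(%z. q l k (fst z) * ew l (snd z)) : bm Q"
        by (intro borel_measurable_times L2D(1)[OF qL] L2D(1)[OF test_fun_L2[OF ewt[OF lk(1)]]])
      show "AE z in Q. \<bar>q l k (fst z) * ew l (snd z)\<bar> <= \<bar>q l k (fst z)\<bar>"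
        using sq_weight_bounds(2)[OF lk(1) lk(1)] by (intro AE_I2) (auto simp: abs_mult ew_def intro!: mult_left_le)
    qed
    also have "... <= G * N' * l2norm Q (%z. R z - ?p z)"
    proof (rule power2_le_imp_le)
      have I: "integrable Q (%z. (%c. (q l k c)^2) (fst z))" using L2D(2)[OF qL] by simp
      have "(l2norm Q (%z. q l k (fst z)))^2 = (\<integral>c. (q l k c)^2 * mass c \<partial>nu)"
        unfolding l2norm_sq using cov_integral(1)[OF I] by simp
      also have "... <= (\<integral>c. (G * N')^2 * D c \<partial>nu)"
      proof (rule integral_mono_AE)
        show "integrable nu (%c. (q l k c)^2 * mass c)" using cov_integral(2)[OF I] by simp
        show "integrable nu (%c. (G * N')^2 * D c)"
          using cond_int_integrable(2)[OF L2D(2)[OF pRL]] unfolding D_def[abs_def] by (intro integrable_mult_right) simp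
        show "AE c in nu. (q l k c)^2 * mass c <= (G * N')^2 * D c"
          using kD[OF lk(2)] AE_space
        proof eventually_elim
          case (elim c)
          have D0: "0 <= D c" unfolding D_def cond_int_def using f_nonneg[OF elim(2)] by (intro integral_nonneg_AE AE_I2) auto
          show ?case
          proof (cases "c : C")
            case True
            then have b: "moment2 c k k <= N'" "mass c <= N'" using lk by (auto simp: C_def CN_def N'_def)
            have "(q l k c)^2 = (ginv m (wmoment c) l k)^2 * (\<kappa> k c)^2" using True by (simp add: q_def power_mult_distrib)
            also have "... <= G^2 * (D c * N')"
              using elim(1) mult_left_mono[OF b(1) D0] Gb[OF True lk] G0
              by (intro mult_mono) (auto simp: abs_le_square_iff[symmetric])
            finally have "(q l k c)^2 * mass c <= (G^2 * (D c * N')) * N'"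
              using b(2) mass_facts(3)[OF elim(2)] D0 N1 by (intro mult_mono) auto
            then show ?thesis by (simp add: power2_eq_square mult_ac)
          qed (use D0 in \<open>simp add: q_def\<close>)
        qed
      qed
      also have "... = (G * N')^2 * (LINT z|Q. (R z - ?p z)^2)"
        using cond_int_integrable(3)[OF L2D(2)[OF pRL]] by (simp add: D_def[abs_def])
      also have "... = (G * N' * l2norm Q (%z. R z - ?p z))^2" by (simp add: power_mult_distrib l2norm_sq)
      finally show "(l2norm Q (%z. q l k (fst z)))^2 <= (G * N' * l2norm Q (%z. R z - ?p z))^2" .
    qed (use G0 N1 in auto)
    finally show ?thesis .
  qed
  note qn = this
  have qeL: "(%z. q l k (fst z) * ew l (snd z)) : L2 Q" if "l < m" "k < m" for l k
    by (rule test_fun_L2[OF test_fun_mult[OF bt[OF that] ewt[OF that(1)]]])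
  define t where "t = l2norm Q (%z. R z - ?p z)"
  let ?S = "%z. SUM l<m. SUM k<m. q l k (fst z) * ew l (snd z)"
  have SL: "?S : L2 Q" by (intro L2_sum qeL) auto
  have "l2norm Q ?S <= (SUM l<m. l2norm Q (%z. SUM k<m. q l k (fst z) * ew l (snd z)))"
    by (intro l2norm_sum_le L2_sum qeL) auto
  also have "... <= (SUM l<m. SUM k<m. l2norm Q (%z. q l k (fst z) * ew l (snd z)))"
    by (intro sum_mono l2norm_sum_le qeL) auto
  also have "... <= (SUM l<m. SUM k<m. G * N' * t)" unfolding t_def by (intro sum_mono qn) auto
  finally have S: "l2norm Q ?S <= real m * (real m * (G * N')) * t" by simp
  have iCm: "(%z. indicator C (fst z) :: real) : bm Q" by (rule L2D(1)[OF test_fun_L2[OF iC]])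
  have cRp: "l2norm Q (%z. indicator C (fst z) * (R z - ?p z)) <= t" unfolding t_def
    using iCm L2D(1)[OF pRL] by (intro l2norm_mono_AE[OF pRL] AE_I2) (auto split: split_indicator)
  have cRpL: "(%z. indicator C (fst z) * (R z - ?p z)) : L2 Q"
    using iCm L2D(1)[OF pRL] by (intro L2_bound[OF pRL] AE_I2) (auto split: split_indicator)
  have CRL: "(%z. indicator C (fst z) * R z - R z) : L2 Q"
    using iCm L2D(1)[OF R] by (intro L2_bound[OF R] AE_I2) (auto split: split_indicator)
  have CR: "l2norm Q (%z. indicator C (fst z) * R z - R z) < ep / 6"
  proof -
    have "AE z in Q. indicator C (fst z) * R z - R z = indicator (CN n) (fst z) * R z - R z"
      using err_law_AE_fst[OF CAE fm] by eventually_elim (auto simp: indicator_def)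
    then have "l2norm Q (%z. indicator C (fst z) * R z - R z) = l2norm Q (%z. indicator (CN n) (fst z) * R z - R z)"
      by (intro l2norm_cong_AE borel_measurable_diff borel_measurable_times L2D(1)[OF R] iCm indm)
    then show ?thesis using n by simp
  qed
  define d where "d = l2norm Q (%z. ?g0 z - R z)"
  have "(%z. ?g0 z - R z) = (%z. (indicator C (fst z) * R z - R z) + ((- 1) * (indicator C (fst z) * (R z - ?p z)) + (- 1) * ?S z))"
    by (auto simp: fun_eq_iff g0_def sum_negf algebra_simps)
  then have "d <= l2norm Q (%z. indicator C (fst z) * R z - R z) + l2norm Q (%z. (- 1) * (indicator C (fst z) * (R z - ?p z)) + (- 1) * ?S z)"
    unfolding d_def by (simp only:) (intro l2norm_triangle L2_add L2_cmult CRL cRpL SL)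
  also have "... <= l2norm Q (%z. indicator C (fst z) * R z - R z) + (l2norm Q (%z. (- 1) * (indicator C (fst z) * (R z - ?p z))) + l2norm Q (%z. (- 1) * ?S z))"
    by (intro add_left_mono l2norm_triangle L2_cmult cRpL SL)
  also have "... <= ep / 6 + (t + real m * (real m * (G * N')) * t)"
    unfolding l2norm_cmult using CR cRp S by simp
  also have "t + real m * (real m * (G * N')) * t = M / 6 * t" by (simp add: M_def algebra_simps)
  also have "... < M / 6 * (ep / M)" using close M0 unfolding t_def by (intro mult_strict_left_mono) auto
  finally have d: "d < ep / 3" using M0 by simp
  \<comment> \<open>The mean of g0 is removed by subtracting a constant. Its size is at most the
    distance of g0 from R, whose mean is 0, and a constant leaves the error moments at 0 because the
    errors have conditional mean 0.\<close>
  define \<gamma> where "\<gamma> = (LINT z|Q. ?g0 z)"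
  have one: "(%_. 1) : L2 Q" by (rule Q.L2_bounded[of _ 1]) auto
  have g0RL: "(%z. ?g0 z - R z) : L2 Q" by (rule L2_diff[OF g0L R])
  have "\<bar>\<gamma>\<bar> = \<bar>\<integral>z. (?g0 z - R z) * 1 \<partial>Q\<bar>"
    using Q.L2_integrable[OF g0L] Q.L2_integrable[OF R] R0 by (simp add: \<gamma>_def)
  also have "... <= d * l2norm Q (%_. 1)" unfolding d_def by (rule L2_Cauchy_Schwarz[OF g0RL one])
  also have "... = d" by (simp add: l2norm_one)
  finally have gam: "\<bar>\<gamma>\<bar> <= d" .
  define g where "g c x = g0 c x + - \<gamma>" for c x
  show ?thesis
  proof
    show "test_fun g" unfolding g_def[abs_def] by (intro test_fun_add g0t test_fun_const)
    show "(LINT z|Q. g (fst z) (snd z)) = 0"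
      using Q.L2_integrable[OF g0L] Q.prob_space by (simp add: g_def \<gamma>_def)
    show "(LINT z|Q. indicator A (fst z) * snd z j * g (fst z) (snd z)) = 0" if j: "j < m" and A: "A : sets nu" for j A
    proof -
      have iA: "(%z. indicator A (fst z) :: real) : bm Q"
        by (rule cov_indicator_measurable[OF A])
      have eA: "integrable Q (%z. indicator A (fst z) * snd z j)"
        using iA L2D(1)[OF e_L2[OF j]]
        by (intro bi_integrable_bound[OF e_integrable[OF j]]) (auto split: split_indicator)
      have eAL: "(%z. indicator A (fst z) * snd z j) : L2 Q"
        using iA L2D(1)[OF e_L2[OF j]] by (intro L2_bound[OF e_L2[OF j]] AE_I2) (auto split: split_indicator)
      have "(LINT z|Q. indicator A (fst z) * snd z j * g (fst z) (snd z))
          = (LINT z|Q. indicator A (fst z) * snd z j * ?g0 z + - \<gamma> * (indicator A (fst z) * snd z j))"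
        by (simp add: g_def algebra_simps)
      also have "... = 0 + - \<gamma> * (LINT z|Q. indicator A (fst z) * snd z j)"
        using L2_mult_integrable[OF eAL g0L] eA orth[OF j A] by (subst bi_integral_add) auto
      also have "... = 0" using cond_int_eq_0D[OF e_mean_zero[OF j] eA] by simp
      finally show ?thesis .
    qed
    have "l2norm Q (%z. R z - g (fst z) (snd z)) = l2norm Q (%z. (R z - ?g0 z) + \<gamma> * 1)" by (simp add: g_def algebra_simps)
    also have "... <= l2norm Q (%z. R z - ?g0 z) + l2norm Q (%z. \<gamma> * 1)"
      by (intro l2norm_triangle L2_diff R g0L L2_cmult one)
    also have "... = d + \<bar>\<gamma>\<bar>" unfolding l2norm_cmult d_def by (simp add: l2norm_minus_commute l2norm_one)
    also have "... < ep" using d gam e by linarith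
    finally show "l2norm Q (%z. R z - g (fst z) (snd z)) < ep" .
  qed
qed

end

section \<open>The efficient part of the score of one cluster\<close>

lemma integral_double_sum:
  fixes F :: "nat => nat => 'a => real"
  assumes "!!k l. k < m ==> l < m ==> integrable M (F k l)"
  shows "(LINT x|M. (SUM k<m. SUM l<m. F k l x)) = (SUM k<m. SUM l<m. \<integral>x. F k l x \<partial>M)"
proof -
  have "(LINT x|M. (SUM k<m. SUM l<m. F k l x)) = (SUM k<m. \<integral>x. (SUM l<m. F k l x) \<partial>M)"
    using assms by (intro bi_integral_sum bi_integrable_sum) auto
  also have "... = (SUM k<m. SUM l<m. \<integral>x. F k l x \<partial>M)"
    using assms by (intro sum.cong refl bi_integral_sum) auto
  finally show ?thesis .
qed

context cluster
begin

lemma P_nn_integral: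
  assumes "X : bm N" shows "(\<integral>\<^sup>+z. X z \<partial>Q) = (\<integral>\<^sup>+z. X (E z) \<partial>P)"
  unfolding distr_cluster_law[of \<theta> f \<beta>, OF theta_m fm, symmetric] by (rule nn_integral_distr[OF E_measurable(2)]) (simp add: assms)

text \<open>From x <= exp x - 1 at x = |e|^2 / M0^2, the conditional second moment of an error is at
  most \<sigma>^2. Moving the covariate factor s^2 past the nonnegative conditional expectation
  shows that multiplication by e_j is bounded on L2 functions of the covariates.\<close>

lemma tail_bound:
  assumes M0: "0 < M0" and \<sigma>: "0 <= \<sigma>"
    and tail: "AE z in P. ennreal (M0^2) * nn_cond_exp P (cov_algebra m P)
        (%z'. ennreal (exp ((SUM j<m. (resid m \<mu> \<beta> \<theta> z' j)^2) / M0^2) - 1)) z <= ennreal (\<sigma>^2)"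
    and j: "j < m" and s: "s : bm nu" and sL: "(%z. s (fst z)) : L2 Q"
  shows "(%z. s (fst z) * snd z j) : L2 Q" "l2norm Q (%z. s (fst z) * snd z j) <= \<sigma> * l2norm Q (%z. s (fst z))"
proof -
  let ?F = "cov_algebra m P"
  interpret A: finite_measure_subalgebra P ?F by unfold_locales (rule cov_algebra_subalgebra)
  define W where "W z = ennreal (exp ((SUM j<m. (resid m \<mu> \<beta> \<theta> z j)^2) / M0^2) - 1)" for z
  have rm: "(%z. resid m \<mu> \<beta> \<theta> z j) : bm N" if "j < m" for j
    using measurable_compose[OF E_measurable(1) e_measurable[OF that]] by (simp add: to_err_def)
  have Wm: "W : bm P" unfolding W_def using rm by measurable
  have s2: "(%c. ennreal ((s c)^2)) : bm nu" using s by measurable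
  have sF: "(%z. ennreal ((s (fst z))^2)) : bm ?F"
    using cov_algebra_measurable[OF borel_measurable_power[OF s, of 2]] by measurable
  have sN: "(%z. s (fst z)) : bm N" by (rule measurable_compose[OF measurable_fst s])
  have xm: "(%z. s (fst z) * snd z j) : bm N" using sN e_measurable[OF j] by measurable
  have le: "ennreal ((s (fst z) * snd (E z) j)^2) <= ennreal (M0^2) * (ennreal ((s (fst z))^2) * W z)" for z
  proof -
    let ?q = "SUM j<m. (resid m \<mu> \<beta> \<theta> z j)^2"
    have "(snd (E z) j)^2 <= ?q"
      unfolding to_err_def using j by (simp, intro member_le_sum[of j "{..<m}" "%j. (resid m \<mu> \<beta> \<theta> z j)^2"]) auto
    also have "?q = M0^2 * (?q / M0^2)" using M0 by simp
    also have "... <= M0^2 * (exp (?q / M0^2) - 1)" using exp_ge_add_one_self[of "?q / M0^2"] by (intro mult_left_mono) (linarith, simp)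
    finally have "(s (fst z))^2 * (snd (E z) j)^2 <= (s (fst z))^2 * (M0^2 * (exp (?q / M0^2) - 1))" by (intro mult_left_mono) auto
    moreover have "0 <= exp (?q / M0^2) - 1" by (simp add: sum_nonneg)
    ultimately show ?thesis
      unfolding W_def by (simp add: ennreal_mult'[symmetric] ennreal_mult[symmetric] power_mult_distrib mult_ac ennreal_leI)
  qed
  have "(\<integral>\<^sup>+z. ennreal ((s (fst z) * snd z j)^2) \<partial>Q) = (\<integral>\<^sup>+z. ennreal ((s (fst z) * snd (E z) j)^2) \<partial>P)"
    using P_nn_integral[of "%z. ennreal ((s (fst z) * snd z j)^2)"] xm by simp
  also have "... <= (\<integral>\<^sup>+z. ennreal (M0^2) * (ennreal ((s (fst z))^2) * W z) \<partial>P)" by (intro nn_integral_mono le)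
  also have "... = ennreal (M0^2) * (\<integral>\<^sup>+z. ennreal ((s (fst z))^2) * W z \<partial>P)"
    using Wm measurable_compose[OF sN, of "%x. ennreal (x^2)" borel] by (intro nn_integral_cmult borel_measurable_times_ennreal) auto
  also have "(\<integral>\<^sup>+z. ennreal ((s (fst z))^2) * W z \<partial>P) = (\<integral>\<^sup>+z. ennreal ((s (fst z))^2) * nn_cond_exp P ?F W z \<partial>P)"
    by (rule A.nn_cond_exp_intg[OF sF Wm, symmetric])
  also have "ennreal (M0^2) * ... = (\<integral>\<^sup>+z. ennreal (M0^2) * (ennreal ((s (fst z))^2) * nn_cond_exp P ?F W z) \<partial>P)"
    using measurable_compose[OF sN, of "%x. ennreal (x^2)" borel]
    by (intro nn_integral_cmult[symmetric] borel_measurable_times_ennreal borel_measurable_nn_cond_exp2) auto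
  also have "... <= (\<integral>\<^sup>+z. ennreal (\<sigma>^2) * ennreal ((s (fst z))^2) \<partial>P)"
  proof (rule nn_integral_mono_AE)
    show "AE z in P. ennreal (M0^2) * (ennreal ((s (fst z))^2) * nn_cond_exp P ?F W z) <= ennreal (\<sigma>^2) * ennreal ((s (fst z))^2)"
      using tail
    proof eventually_elim
      case (elim z)
      then have "ennreal (M0^2) * nn_cond_exp P ?F W z <= ennreal (\<sigma>^2)" by (simp add: W_def[abs_def])
      from mult_right_mono[OF this, of "ennreal ((s (fst z))^2)"] show ?case by (simp add: mult_ac)
    qed
  qed
  also have "... = (\<integral>\<^sup>+z. ennreal (\<sigma>^2) * ennreal ((s (fst z))^2) \<partial>Q)"
    using P_nn_integral[of "%z. ennreal (\<sigma>^2) * ennreal ((s (fst z))^2)"] sN by simp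
  also have "... = ennreal (LINT z|Q. (\<sigma> * s (fst z))^2)"
    using nn_integral_eq_integral[OF L2D(2)[OF L2_cmult[OF sL, of \<sigma>]]] by (simp add: ennreal_mult power_mult_distrib)
  finally have fin: "(\<integral>\<^sup>+z. ennreal ((s (fst z) * snd z j)^2) \<partial>Q) <= ennreal ((\<sigma> * l2norm Q (%z. s (fst z)))^2)"
    using l2norm_cmult[of Q \<sigma> "%z. s (fst z)"] l2norm_sq[of Q "%z. \<sigma> * s (fst z)"] \<sigma> by simp
  have xQ: "(%z. s (fst z) * snd z j) : bm Q" using xm by (simp add: measurable_cong_sets[OF err_law_simps(2) refl])
  have I: "integrable Q (%z. (s (fst z) * snd z j)^2)"
    using xQ fin by (intro integrableI_nonneg) (auto intro: order_le_less_trans)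
  then show "(%z. s (fst z) * snd z j) : L2 Q" using xQ by (intro L2I)
  have "ennreal (LINT z|Q. (s (fst z) * snd z j)^2) <= ennreal ((\<sigma> * l2norm Q (%z. s (fst z)))^2)"
    using fin nn_integral_eq_integral[OF I] by simp
  then have "(l2norm Q (%z. s (fst z) * snd z j))^2 <= (\<sigma> * l2norm Q (%z. s (fst z)))^2"
    unfolding l2norm_sq by (simp add: ennreal_le_iff)
  then show "l2norm Q (%z. s (fst z) * snd z j) <= \<sigma> * l2norm Q (%z. s (fst z))"
    by (rule power2_le_imp_le) (use \<sigma> in simp)
qed

text \<open>Minus the logarithmic derivative of the density in e_j. The quotient is 0 where f
  vanishes, and there the partial derivative vanishes too.\<close>

definition err_score :: "nat => ('k, 'd) covs \<times> (nat => real) => real" where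
  "err_score j z = - (partial_deriv (f (fst z)) j (snd z) / f (fst z) (snd z))"

text \<open>The partial derivative is the limit of difference quotients with step 1 / (n + 1), each
  obtained from f by a measurable shift of the errors. This gives measurability jointly in
  covariates and errors.\<close>

lemma part_measurable:
  assumes j: "j < m" shows "(%z. partial_deriv (f (fst z)) j (snd z)) : bm N"
proof (rule borel_measurable_LIMSEQ_real)
  define sh where "sh n z = (fst z, \<lambda>i\<in>{..<m}. snd z i - (if i = j then - inverse (real (Suc n)) else 0))"
    for n and z :: "('k, 'd) covs \<times> (nat => real)"
  have shm: "sh n : measurable N N" for n
    unfolding sh_def by (rule pair_shift_measurable[where a="%c i. if i = j then - inverse (real (Suc n)) else 0"]) simp
  show "(%z. real (Suc n) * (f (fst (sh n z)) (snd (sh n z)) - f (fst z) (snd z))) : bm N" for n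
    using measurable_compose[OF shm fm] fm by measurable
  show "(%n. real (Suc n) * (f (fst (sh n z)) (snd (sh n z)) - f (fst z) (snd z))) \<longlonglongrightarrow> partial_deriv (f (fst z)) j (snd z)"
    if z: "z : space N" for z
  proof -
    obtain c e where [simp]: "z = (c, e)" and c: "c : space nu" and e: "e : errs m"
      using z by (cases z) (auto simp: space_pair_measure)
    have "((%v. f c (e(j := v))) has_real_derivative partial_deriv (f c) j e) (at (e j))"
      by (rule C1_fun_deriv'[OF f_C1[OF c] j e])
    then have "((%h. (f c (e(j := e j + h)) - f c (e(j := e j))) / h) \<longlongrightarrow> partial_deriv (f c) j e) (at 0)"
      by (simp add: DERIV_def)
    moreover have "filterlim (%n. inverse (real (Suc n))) (at 0) sequentially"
      using LIMSEQ_inverse_real_of_nat by (auto simp: filterlim_at)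
    ultimately have "(%n. (f c (e(j := e j + inverse (real (Suc n)))) - f c (e(j := e j))) / inverse (real (Suc n))) \<longlonglongrightarrow> partial_deriv (f c) j e"
      by (rule filterlim_compose)
    moreover have "snd (sh n z) = e(j := e j + inverse (real (Suc n)))" for n
      using e j by (auto simp: sh_def fun_eq_iff space_lebesgue_prod)
    ultimately show ?thesis by (simp add: sh_def field_simps)
  qed
qed

lemma err_score_measurable: "j < m ==> err_score j : bm N"
  unfolding err_score_def[abs_def] by (intro borel_measurable_uminus borel_measurable_divide part_measurable fm)

text \<open>A zero of the nonnegative density is a minimum along every coordinate line.\<close>

lemma part_eq_0:
  assumes c: "c : space nu" and e: "e : errs m" and j: "j < m" and 0: "f c e = 0"
  shows "partial_deriv (f c) j e = 0"
proof (rule DERIV_local_min[OF C1_fun_deriv'[OF f_C1[OF c] j e]])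
  show "ALL y. \<bar>e j - y\<bar> < 1 --> f c (e(j := e j)) <= f c (e(j := y))"
    using 0 f_nonneg[OF c space_lebesgue_prod_upd[OF e j]] by simp
qed simp

lemma err_score_mult:
  "c : space nu ==> e : errs m ==> j < m ==> err_score j (c, e) * f c e = - partial_deriv (f c) j e"
  by (cases "f c e = 0") (auto simp: err_score_def part_eq_0)

end

text \<open>The regularity conditions of one cluster in the form in which they enter: a and b bound
  the spectrum of the covariance, and K bounds multiplication by an error as an operator on L2
  functions of the covariates.\<close>

locale cluster_regular = cluster_moments nu m \<mu> \<beta> \<theta> f
  for nu :: "('k::finite, 'd::finite) covs measure" and m \<mu> \<beta> and \<theta> :: "'d => real => real" and f +
  fixes a b K :: real
  assumes ev: "AE z in P. ALL r. eigenvalue (Sigma_mat m P z) r --> a <= r & r <= b" and a: "0 < a" and b: "0 <= b"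
    and se: "!!s j. j < m ==> s : bm nu ==> (%z. s (fst z)) : L2 Q ==> (%z. s (fst z) * snd z j) : L2 Q"
      "!!s j. j < m ==> s : bm nu ==> (%z. s (fst z)) : L2 Q ==>
         l2norm Q (%z. s (fst z) * snd z j) <= K * l2norm Q (%z. s (fst z))"
    and K: "0 <= K"
    and information: "!!j. j < m ==> integrable P (%z. (partial_deriv (f (fst z)) j (resid m \<mu> \<beta> \<theta> z) / lik m \<mu> \<beta> \<theta> f z)^2)"
begin

lemma err_score_L2: assumes j: "j < m" shows "err_score j : L2 Q"
proof (rule L2I)
  show "err_score j : bm Q" using err_score_measurable[OF j] by (simp add: measurable_cong_sets[OF err_law_simps(2) refl])
  have "(%z. (err_score j z)^2) : bm N" using err_score_measurable[OF j] by measurable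
  from P_integral(1)[OF this] information[OF j] show "integrable Q (%z. (err_score j z)^2)"
    by (simp add: err_score_def to_err_def lik_def)
qed

lemma sig_pos_def: "AE z in Q. ALL r. eigenvalue (gmat m (sig (fst z))) r --> a <= r & r <= b"
proof -
  have "AE z in P. ALL r. eigenvalue (gmat m (sig (fst z))) r --> a <= r & r <= b"
    using ev Sigma_mat_sig by eventually_elim simp
  then show ?thesis by (rule Q_AE_fst[of "%c. ALL r. eigenvalue (gmat m (sig c)) r --> a <= r & r <= b"])
qed

definition H :: "('k, 'd) covs => nat => nat => real" where "H c = ginv m (sig c)"

lemma H_facts:
  "AE z in Q. Determinant.det (gmat m (sig (fst z))) ~= 0 & (ALL j<m. ALL k<m. H (fst z) j k = H (fst z) k j & \<bar>H (fst z) j k\<bar> <= 1 / a) &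
     (ALL v. (SUM j<m. (v j)^2) <= b * bform m (H (fst z)) v v)"
  using sig_pos_def
proof eventually_elim
  case (elim z)
  have "!!r. eigenvalue (gmat m (sig (fst z))) r ==> a <= r & r <= b" using elim by blast
  from pos_def_inverse[OF sig_sym this a] show ?case unfolding H_def by simp
qed

lemma H_measurable: "j < m ==> k < m ==> (%c. H c j k) : bm nu"
  unfolding H_def by (intro ginv_measurable sig_measurable)

lemma Sigma_inv_H: "AE z in P. Sigma_inv m P z = gmat m (H (fst z))"
  using Sigma_mat_sig by eventually_elim (simp add: Sigma_inv_def mat_inverse_gmat H_def)

lemma det_moment2: "AE z in Q. Determinant.det (gmat m (moment2 (fst z))) ~= 0"
  using H_facts
proof eventually_elim
  case (elim z)
  show ?case
  proof
    assume z: "Determinant.det (gmat m (moment2 (fst z))) = 0"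
    obtain v where v: "EX i<m. v i ~= 0" "!!j. j < m ==> (SUM k<m. moment2 (fst z) j k * v k) = 0"
      using singular_gmat[OF z] by metis
    have "(SUM k<m. sig (fst z) j k * v k) = 0" if "j < m" for j
      using v(2)[OF that] by (simp add: sig_def sum_divide_distrib[symmetric] times_divide_eq_left)
    then show False using det_gmat_eq_0 v(1) elim by blast
  qed
qed

text \<open>The covariate law has density \<open>mass\<close> with respect to nu, so its null sets
  are nu-null where the mass is nonzero.\<close>

lemma Q_AE_covD:
  assumes "AE z in Q. R (fst z)" shows "AE c in nu. mass c ~= 0 --> R c"
proof -
  have "AE z in N. 0 < f (fst z) (snd z) --> R (fst z)"
    using assms fm unfolding err_law_def by (subst (asm) AE_density) auto
  from AE_pair[OF this] show ?thesis using AE_space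
  proof eventually_elim
    case (elim c)
    show ?case
    proof (rule impI, rule ccontr)
      assume m: "mass c ~= 0" and n: "\<not> R c"
      have "AE e in lebesgue_prod m. f c e = 0"
        using elim(1) AE_space
      proof eventually_elim
        case (elim e)
        then show ?case using n f_nonneg[OF \<open>c : space nu\<close>, of e] by auto
      qed
      then have "mass c = 0" unfolding mass_def cond_int_def by (intro integral_eq_zero_AE) auto
      then show False using m by simp
    qed
  qed
qed

text \<open>The derivatives of f and of f e_l in direction e_j integrate to 0. The product rule
  contributes the term f exactly when j = l, and its integral is the mass.\<close>

lemma score_by_parts:
  assumes j: "j < m"
  shows "AE c in nu. cond_int f (err_score j) c = 0"
    and "!!l. l < m ==> AE c in nu. cond_int f (%z. err_score j z * snd z l) c = (if j = l then mass c else 0)"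
proof -
  let ?L = "lebesgue_prod m"
  have d: "((%v. f c (e(j := v))) has_real_derivative partial_deriv (f c) j (e(j := v))) (at v)"
    if "c : space nu" "e : space ?L" for c e v by (rule C1_fun_deriv[OF f_C1[OF that(1)] j that(2)])
  have upd: "continuous_on UNIV (%v. e(j := v))" for e :: "nat => real"
  proof (rule continuous_on_coordinatewise_then_product)
    show "continuous_on UNIV (%v. (e(j := v)) i)" for i by (cases "i = j") (auto intro!: continuous_intros)
  qed
  have dc: "continuous_on UNIV (%v. partial_deriv (f c) j (e(j := v)))" if "c : space nu" "e : space ?L" for c e
    using C1_fun_continuous(2)[OF f_C1[OF that(1)] j] upd by (rule continuous_on_compose2) (use space_lebesgue_prod_upd[OF that(2) j] in auto)
  have Si: "AE c in nu. integrable ?L (partial_deriv (f c) j)"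
    using cond_int_integrable(1)[OF Q.L2_integrable[OF err_score_L2[OF j]]] AE_space
  proof eventually_elim
    case (elim c)
    have "integrable ?L (%e. - partial_deriv (f c) j e)"
      using elim(1) by (rule bi_integrable_cong[THEN iffD1, rotated 2]) (simp_all add: err_score_mult elim(2) j)
    then show ?case by simp
  qed
  show "AE c in nu. cond_int f (err_score j) c = 0"
    using Si mass_facts(1) AE_space
  proof eventually_elim
    case (elim c)
    have "cond_int f (err_score j) c = (LINT e|?L. - partial_deriv (f c) j e)"
      unfolding cond_int_def using err_score_mult[OF elim(3) _ j] by (intro bi_integral_cong) auto
    also have "... = 0"
      using integral_partial_deriv_zero[OF j elim(2,1) d[OF elim(3)] dc[OF elim(3)]] by simp
    finally show ?case .
  qed
  show "AE c in nu. cond_int f (%z. err_score j z * snd z l) c = (if j = l then mass c else 0)" if l: "l < m" for l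
    using cond_int_integrable(1)[OF L2_mult_integrable[OF err_score_L2[OF j] e_L2[OF l]]] cond_int_integrable(1)[OF e_integrable[OF l]] mass_facts(1) AE_space
  proof eventually_elim
    case (elim c)
    have es: "err_score j (c, e) * snd (c, e) l * f c e = - (partial_deriv (f c) j e * e l)" if "e : space ?L" for e
    proof -
      have "err_score j (c, e) * snd (c, e) l * f c e = (err_score j (c, e) * f c e) * e l" by simp
      then show ?thesis unfolding err_score_mult[OF elim(4) that j] by simp
    qed
    have I0: "integrable ?L (%e. - (partial_deriv (f c) j e * e l))"
      using elim(1) by (rule bi_integrable_cong[THEN iffD1, rotated 2]) (simp, rule es)
    have I1: "integrable ?L (%e. partial_deriv (f c) j e * e l)" using I0 by simp
    let ?\<delta> = "if j = l then 1 else 0 :: real"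
    have I2: "integrable ?L (%e. ?\<delta> * f c e)" using elim(3) by simp
    have "(LINT e|?L. partial_deriv (f c) j e * e l + ?\<delta> * f c e) = 0"
    proof (rule integral_partial_deriv_zero[OF j, where G="%e. f c e * e l"])
      show "integrable ?L (%e. f c e * e l)" using elim(2) by (simp add: mult.commute)
      show "integrable ?L (%e. partial_deriv (f c) j e * e l + ?\<delta> * f c e)" using I1 I2 by simp
      fix e assume e: "e : space ?L"
      show "((%v. f c (e(j := v)) * (e(j := v)) l) has_real_derivative
          partial_deriv (f c) j (e(j := v)) * (e(j := v)) l + ?\<delta> * f c (e(j := v))) (at v)" for v
        using d[OF elim(4) e, of v] by (cases "j = l") (auto intro!: derivative_eq_intros)
      have fc: "continuous_on UNIV (%v. f c (e(j := v)))"
        using d[OF elim(4) e] by (meson DERIV_isCont continuous_at_imp_continuous_on)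
      have "continuous_on UNIV (%v. (e(j := v)) l)" by (cases "j = l") (auto intro!: continuous_intros)
      then show "continuous_on UNIV (%v. partial_deriv (f c) j (e(j := v)) * (e(j := v)) l + ?\<delta> * f c (e(j := v)))"
        using dc[OF elim(4) e] fc by (intro continuous_intros)
    qed
    then have eq: "(LINT e|?L. partial_deriv (f c) j e * e l) = - (?\<delta> * mass c)"
      using I1 I2 by (simp add: mass_def cond_int_def)
    have "cond_int f (%z. err_score j z * snd z l) c = (LINT e|?L. - (partial_deriv (f c) j e * e l))"
      unfolding cond_int_def by (intro bi_integral_cong refl es)
    then show ?case using eq by simp
  qed
qed

section \<open>Efficient parts of the directions of one cluster\<close>

definition cov_vec :: "(nat => ('k, 'd) covs => real) => bool" where
  "cov_vec r \<longleftrightarrow> (ALL j<m. r j : bm nu & (%z. r j (fst z)) : L2 Q)"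

text \<open>The k-th entry of the row vector r' Sigma^-1.\<close>

definition weight :: "(nat => ('k, 'd) covs => real) => nat => ('k, 'd) covs => real" where
  "weight r k c = (SUM j<m. r j c * H c j k)"

definition eff :: "(nat => ('k, 'd) covs => real) => ('k, 'd) covs \<times> (nat => real) => real" where
  "eff r z = (SUM k<m. weight r k (fst z) * snd z k)"

lemma weight_measurable: "cov_vec r ==> k < m ==> weight r k : bm nu"
  unfolding weight_def[abs_def] by (intro borel_measurable_sum borel_measurable_times H_measurable) (auto simp: cov_vec_def)

lemma rH_L2:
  assumes r: "cov_vec r" and jk: "j < m" "k < m"
  shows "(%z. r j (fst z) * H (fst z) j k) : L2 Q" "l2norm Q (%z. r j (fst z) * H (fst z) j k) <= 1 / a * l2norm Q (%z. r j (fst z))"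
proof -
  have rL: "(%z. r j (fst z)) : L2 Q" using r jk by (simp add: cov_vec_def)
  have m: "(%z. r j (fst z) * H (fst z) j k) : bm Q"
    by (intro borel_measurable_times L2D(1)[OF rL] cov_measurable[OF H_measurable[OF jk]])
  have ae: "AE z in Q. \<bar>r j (fst z) * H (fst z) j k\<bar> <= \<bar>1 / a * r j (fst z)\<bar>"
    using H_facts
  proof eventually_elim
    case (elim z)
    have "\<bar>r j (fst z)\<bar> * \<bar>H (fst z) j k\<bar> <= \<bar>r j (fst z)\<bar> * (1 / a)" using elim jk by (intro mult_left_mono) auto
    then show ?case using a by (simp add: abs_mult mult.commute)
  qed
  show "(%z. r j (fst z) * H (fst z) j k) : L2 Q" by (rule L2_bound[OF L2_cmult[OF rL] m ae])
  show "l2norm Q (%z. r j (fst z) * H (fst z) j k) <= 1 / a * l2norm Q (%z. r j (fst z))"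
    using l2norm_mono_AE[OF L2_cmult[OF rL] m ae] l2norm_cmult[of Q "1 / a" "%z. r j (fst z)"] a by simp
qed

lemma weight_L2:
  assumes "cov_vec r" "k < m"
  shows "(%z. weight r k (fst z)) : L2 Q" "l2norm Q (%z. weight r k (fst z)) <= 1 / a * (SUM j<m. l2norm Q (%z. r j (fst z)))"
proof -
  show "(%z. weight r k (fst z)) : L2 Q" unfolding weight_def by (intro L2_sum rH_L2 assms) auto
  have "l2norm Q (%z. weight r k (fst z)) <= (SUM j<m. l2norm Q (%z. r j (fst z) * H (fst z) j k))"
    unfolding weight_def by (intro l2norm_sum_le rH_L2 assms) auto
  also have "... <= (SUM j<m. 1 / a * l2norm Q (%z. r j (fst z)))" by (intro sum_mono rH_L2 assms) auto
  finally show "l2norm Q (%z. weight r k (fst z)) <= 1 / a * (SUM j<m. l2norm Q (%z. r j (fst z)))" by (simp add: sum_distrib_left)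
qed

lemma weight_e_L2: "cov_vec r ==> k < m ==> (%z. weight r k (fst z) * snd z k) : L2 Q"
  by (intro se weight_measurable weight_L2)

lemma eff_L2:
  assumes r: "cov_vec r"
  shows "eff r : L2 Q" "l2norm Q (eff r) <= real m * (K * (1 / a)) * (SUM j<m. l2norm Q (%z. r j (fst z)))"
proof -
  show "eff r : L2 Q" unfolding eff_def[abs_def] by (intro L2_sum weight_e_L2 r) auto
  have "l2norm Q (eff r) <= (SUM k<m. l2norm Q (%z. weight r k (fst z) * snd z k))"
    unfolding eff_def[abs_def] by (intro l2norm_sum_le weight_e_L2 r) auto
  also have "... <= (SUM k<m. K * (1 / a * (SUM j<m. l2norm Q (%z. r j (fst z)))))"
  proof (rule sum_mono)
    fix k assume "k : {..<m}"
    then have k: "k < m" by simp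
    have "l2norm Q (%z. weight r k (fst z) * snd z k) <= K * l2norm Q (%z. weight r k (fst z))"
      by (intro se weight_measurable weight_L2 r k)
    also have "... <= K * (1 / a * (SUM j<m. l2norm Q (%z. r j (fst z))))" by (intro mult_left_mono weight_L2 r k K)
    finally show "l2norm Q (%z. weight r k (fst z) * snd z k) <= K * (1 / a * (SUM j<m. l2norm Q (%z. r j (fst z))))" .
  qed
  finally show "l2norm Q (eff r) <= real m * (K * (1 / a)) * (SUM j<m. l2norm Q (%z. r j (fst z)))" by (simp add: mult_ac)
qed

lemma eff_linear: "eff (%j c. r j c + t * s j c) z = eff r z + t * eff s z"
  unfolding eff_def weight_def by (simp add: sum_distrib_left sum_distrib_right sum.distrib algebra_simps)

lemma cov_vec_lin: "cov_vec r ==> cov_vec s ==> cov_vec (%j c. r j c + t * s j c)"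
  unfolding cov_vec_def by (auto intro!: L2_add L2_cmult borel_measurable_add borel_measurable_times)

lemma eff_mean: assumes "cov_vec r" shows "(LINT z|Q. eff r z) = 0"
proof -
  have "(LINT z|Q. eff r z) = (SUM k<m. \<integral>z. weight r k (fst z) * snd z k \<partial>Q)"
    unfolding eff_def using weight_e_L2[OF assms] by (intro bi_integral_sum Q.L2_integrable) auto
  also have "... = 0"
    using cond_int_eq_0D[OF e_mean_zero Q.L2_integrable[OF weight_e_L2[OF assms]]] by (intro sum.neutral) auto
  finally show ?thesis .
qed

lemma weight_inner:
  assumes "Determinant.det (gmat m (sig c)) ~= 0" "!!j k. j < m ==> k < m ==> H c j k = H c k j"
  shows "(SUM k<m. SUM l<m. weight r k c * weight s l c * sig c k l) = bform m (H c) (%j. r j c) (%j. s j c)"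
    and "l < m ==> (SUM k<m. weight r k c * sig c k l) = r l c"
proof -
  have r: "(SUM k<m. weight r k c * sig c k l) = r l c" if l: "l < m" for l
  proof -
    have "(SUM k<m. weight r k c * sig c k l) = (SUM k<m. SUM j<m. r j c * (H c j k * sig c k l))"
      by (simp add: weight_def sum_distrib_right mult.assoc)
    also have "... = (SUM j<m. r j c * (SUM k<m. H c j k * sig c k l))"
      by (subst sum.swap) (simp add: sum_distrib_left)
    also have "... = (SUM j<m. r j c * (if j = l then 1 else 0))"
      using ginv_mult(2)[OF assms(1) _ l] by (intro sum.cong refl) (simp add: H_def)
    finally show ?thesis using sum_unit_vector(3)[OF l, of "%j. r j c"] by simp
  qed
  show "l < m ==> (SUM k<m. weight r k c * sig c k l) = r l c" by (rule r)
  have "(SUM k<m. SUM l<m. weight r k c * weight s l c * sig c k l) = (SUM l<m. weight s l c * (SUM k<m. weight r k c * sig c k l))"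
    by (subst sum.swap) (simp add: sum_distrib_left mult_ac)
  also have "... = (SUM l<m. weight s l c * r l c)" using r by (intro sum.cong refl) auto
  also have "... = (SUM l<m. r l c * (SUM j<m. H c l j * s j c))"
    using assms(2) by (intro sum.cong refl) (simp add: weight_def mult.commute)
  finally show "(SUM k<m. SUM l<m. weight r k c * weight s l c * sig c k l) = bform m (H c) (%j. r j c) (%j. s j c)"
    by (simp add: bform_apply)
qed

text \<open>Under the integral, e_k e_l may be replaced by the entry of Sigma, which leaves r'
  Sigma^-1 Sigma Sigma^-1 s.\<close>

lemma eff_inner:
  assumes r: "cov_vec r" and s: "cov_vec s"
  shows "integrable Q (%z. bform m (H (fst z)) (%j. r j (fst z)) (%j. s j (fst z)))"
    and "(LINT z|Q. eff r z * eff s z) = (LINT z|Q. bform m (H (fst z)) (%j. r j (fst z)) (%j. s j (fst z)))"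
proof -
  let ?h = "%k l c. weight r k c * weight s l c"
  have hm: "?h k l : bm nu" if "k < m" "l < m" for k l
    using weight_measurable[OF r that(1)] weight_measurable[OF s that(2)] by measurable
  have I: "integrable Q (%z. ?h k l (fst z) * (snd z k * snd z l))" if "k < m" "l < m" for k l
    using L2_mult_integrable[OF weight_e_L2[OF r that(1)] weight_e_L2[OF s that(2)]] by (simp add: mult_ac)
  have J: "integrable Q (%z. ?h k l (fst z) * sig (fst z) k l)" if "k < m" "l < m" for k l
    by (rule moment_swap(1)[OF that hm[OF that] I[OF that]])
  have ae: "AE z in Q. (SUM k<m. SUM l<m. ?h k l (fst z) * sig (fst z) k l) = bform m (H (fst z)) (%j. r j (fst z)) (%j. s j (fst z))"
    using H_facts by eventually_elim (rule weight_inner(1), auto)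
  have SI: "integrable Q (%z. SUM k<m. SUM l<m. ?h k l (fst z) * sig (fst z) k l)"
    using J by (intro bi_integrable_sum) auto
  have rm: "r j : bm nu" "s j : bm nu" if "j < m" for j using r s that by (auto simp: cov_vec_def)
  have bm: "(%z. bform m (H (fst z)) (%j. r j (fst z)) (%j. s j (fst z))) : bm Q"
    unfolding bform_def by (intro borel_measurable_sum borel_measurable_times cov_measurable H_measurable rm) auto
  show "integrable Q (%z. bform m (H (fst z)) (%j. r j (fst z)) (%j. s j (fst z)))"
    using SI ae bm integrable_cong_AE[OF borel_measurable_integrable[OF SI] bm ae] by simp
  have "(LINT z|Q. eff r z * eff s z) = (LINT z|Q. (SUM k<m. SUM l<m. ?h k l (fst z) * (snd z k * snd z l)))"
    unfolding eff_def sum_product by (intro bi_integral_cong refl sum.cong) (simp add: mult_ac)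
  also have "... = (SUM k<m. SUM l<m. \<integral>z. ?h k l (fst z) * (snd z k * snd z l) \<partial>Q)"
    by (rule integral_double_sum[OF I])
  also have "... = (SUM k<m. SUM l<m. \<integral>z. ?h k l (fst z) * sig (fst z) k l \<partial>Q)"
    using moment_swap(2)[OF _ _ hm I] by (intro sum.cong refl) auto
  also have "... = (LINT z|Q. (SUM k<m. SUM l<m. ?h k l (fst z) * sig (fst z) k l))"
    by (rule integral_double_sum[OF J, symmetric])
  also have "... = (LINT z|Q. bform m (H (fst z)) (%j. r j (fst z)) (%j. s j (fst z)))"
    by (rule integral_cong_AE[OF borel_measurable_integrable[OF SI] bm ae])
  finally show "(LINT z|Q. eff r z * eff s z) = (LINT z|Q. bform m (H (fst z)) (%j. r j (fst z)) (%j. s j (fst z)))" .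
qed

text \<open>The spectrum of Sigma is at most b, so |r|^2 <= b r' Sigma^-1 r, and the expectation of
  the form on the right is the squared norm of the efficient part. That a direction is controlled by
  its efficient part is the source of coercivity later on.\<close>

lemma eff_lower:
  assumes r: "cov_vec r" and j: "j < m"
  shows "l2norm Q (%z. r j (fst z)) <= sqrt b * l2norm Q (eff r)"
proof (rule power2_le_imp_le)
  have rL: "(%z. r j (fst z)) : L2 Q" using r j by (simp add: cov_vec_def)
  have "(LINT z|Q. (r j (fst z))^2) <= (LINT z|Q. b * bform m (H (fst z)) (%j. r j (fst z)) (%j. r j (fst z)))"
  proof (rule integral_mono_AE[OF L2D(2)[OF rL]])
    show "integrable Q (%z. b * bform m (H (fst z)) (%j. r j (fst z)) (%j. r j (fst z)))"
      using eff_inner(1)[OF r r] by simp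
    show "AE z in Q. (r j (fst z))^2 <= b * bform m (H (fst z)) (%j. r j (fst z)) (%j. r j (fst z))"
      using H_facts
    proof eventually_elim
      case (elim z)
      have "(r j (fst z))^2 <= (SUM j<m. (r j (fst z))^2)" using j by (intro member_le_sum) auto
      also have "... <= b * bform m (H (fst z)) (%j. r j (fst z)) (%j. r j (fst z))"
        using elim by (elim conjE) (rule spec[of _ "%j. r j (fst z)"])
      finally show ?case .
    qed
  qed
  also have "... = b * (l2norm Q (eff r))^2"
    unfolding l2norm_sq using eff_inner(2)[OF r r] by (simp add: power2_eq_square)
  finally show "(l2norm Q (%z. r j (fst z)))^2 <= (sqrt b * l2norm Q (eff r))^2"
    using b by (simp add: l2norm_sq power_mult_distrib)
qed (simp add: b)

text \<open>An error score and the error itself have covariance the identity, so subtracting the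
  efficient part leaves a function satisfying the constraints of the tangent space.\<close>

theorem residual_in_closure:
  assumes r: "cov_vec r" and L: "(%z. SUM j<m. r j (fst z) * err_score j z) : L2 Q" and e: "0 < ep"
  obtains g where "test_fun g" "(LINT z|Q. g (fst z) (snd z)) = 0"
    "!!j A. j < m ==> A : sets nu ==> (LINT z|Q. indicator A (fst z) * snd z j * g (fst z) (snd z)) = 0"
    "l2norm Q (%z. ((SUM j<m. r j (fst z) * err_score j z) - eff r z) - g (fst z) (snd z)) < ep"
proof (rule constrained_test_fun_dense[OF _ _ _ det_moment2 e])
  let ?R = "%z. (SUM j<m. r j (fst z) * err_score j z) - eff r z"
  show RL: "?R : L2 Q" by (rule L2_diff[OF L eff_L2(1)[OF r]])
  \<comment> \<open>Error scores and errors are placed in one list, indices from m on being the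
    errors, so that one application of \<open>cond_int_sum\<close> treats the whole
    remainder.\<close>
  define h where "h i c = (if i < m then r i c else - weight r (i - m) c)" for i c
  define X where "X i z = (if i < m then err_score i z else snd z (i - m))" for i and z :: "('k, 'd) covs \<times> (nat => real)"
  have split: "(SUM i<m + m. F i) = (SUM i<m. F i) + (SUM i<m. F (i + m))" for F :: "nat => real"
    using sum.atLeastLessThan_concat[of 0 m "m + m" F] sum.shift_bounds_nat_ivl[of F 0 m m] by (simp add: atLeast0LessThan)
  have RX: "?R z = (SUM i<m + m. h i (fst z) * X i z)" for z
    unfolding split by (simp add: h_def X_def eff_def sum_negf)
  have Xi: "integrable Q (X i)" if "i < m + m" for i
    unfolding X_def[abs_def] using Q.L2_integrable[OF err_score_L2[of i]] e_integrable[of "i - m"] that by (cases "i < m") auto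
  have "AE c in nu. cond_int f ?R c = (SUM i<m + m. h i c * cond_int f (X i) c)"
    unfolding RX using Xi by (intro cond_int_sum) auto
  moreover have "AE c in nu. ALL i:{..<m}. cond_int f (err_score i) c = 0 & cond_int f (%z. snd z i) c = 0"
    using score_by_parts(1) e_mean_zero by (intro AE_finite_allI AE_conjI) auto
  ultimately have R0: "AE c in nu. cond_int f ?R c = 0"
    by eventually_elim (auto simp: split X_def[abs_def] intro!: sum.neutral)
  show "(LINT z|Q. ?R z) = 0"
    using cond_int_integrable(3)[OF Q.L2_integrable[OF RL]] integral_eq_zero_AE[OF R0] by simp
  fix l assume l: "l < m"
  have Xl: "integrable Q (%z. X i z * snd z l)" if "i < m + m" for i
    unfolding X_def using L2_mult_integrable[OF err_score_L2[of i] e_L2[OF l]] ee_integrable[of "i - m" l] that l by (cases "i < m") auto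
  have "AE c in nu. cond_int f (%z. SUM i<m + m. h i (fst z) * (X i z * snd z l)) c = (SUM i<m + m. h i c * cond_int f (%z. X i z * snd z l) c)"
    using Xl by (intro cond_int_sum) auto
  moreover have "AE c in nu. ALL i:{..<m}. cond_int f (%z. err_score i z * snd z l) c = (if i = l then mass c else 0)"
    using score_by_parts(2)[OF _ l] by (intro AE_finite_allI) auto
  \<comment> \<open>Invertibility of Sigma is known almost surely under the covariate law only;
    covariates of zero mass are covered by \<open>mass_zero\<close>.\<close>
  moreover have "AE c in nu. mass c ~= 0 --> Determinant.det (gmat m (sig c)) ~= 0 & (ALL j<m. ALL k<m. H c j k = H c k j)"
  proof (rule Q_AE_covD)
    show "AE z in Q. Determinant.det (gmat m (sig (fst z))) ~= 0 & (ALL j<m. ALL k<m. H (fst z) j k = H (fst z) k j)"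
      using H_facts by eventually_elim blast
  qed
  ultimately show "AE c in nu. cond_int f (%z. ?R z * snd z l) c = 0"
    using mass_zero
  proof eventually_elim
    case (elim c)
    show ?case
    proof (cases "mass c = 0")
      case False
      have "(%z. ?R z * snd z l) = (%z. SUM i<m + m. h i (fst z) * (X i z * snd z l))"
        by (rule ext) (simp add: RX sum_distrib_right mult.assoc)
      then have "cond_int f (%z. ?R z * snd z l) c = (SUM i<m + m. h i c * cond_int f (%z. X i z * snd z l) c)"
        using elim(1) by simp
      also have "... = (SUM i<m. r i c * (if i = l then mass c else 0)) - (SUM k<m. weight r k c * moment2 c k l)"
        unfolding split using elim(2) by (simp add: h_def X_def moment2_def sum_negf)
      also have "(SUM i<m. r i c * (if i = l then mass c else 0)) = r l c * mass c"
        using l by (simp add: if_distrib cong: if_cong)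
      also have "(SUM k<m. weight r k c * moment2 c k l) = (SUM k<m. weight r k c * sig c k l) * mass c"
        unfolding sum_distrib_right using False by (intro sum.cong refl) (simp add: sig_def)
      also have "(SUM k<m. weight r k c * sig c k l) = r l c"
        using elim(3) False l by (intro weight_inner(2)) auto
      finally show ?thesis by simp
    qed (use elim(4) in auto)
  qed
qed (rule that)

text \<open>The efficient part is a combination of errors with covariate coefficients, and g has
  vanishing conditional moments against every error.\<close>

lemma eff_orth:
  assumes r: "cov_vec r" and g: "g : L2 Q"
    and ge: "!!j A. j < m ==> A : sets nu ==> (LINT z|Q. indicator A (fst z) * snd z j * g z) = 0"
  shows "(LINT z|Q. eff r z * g z) = 0"
proof -
  have "(LINT z|Q. weight r k (fst z) * snd z k * g z) = 0" if k: "k < m" for k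
  proof -
    have "AE c in nu. cond_int f (%z. snd z k * g z) c = 0"
      using ge[OF k] by (intro cond_int_eq_0 L2_mult_integrable[OF e_L2[OF k] g]) (simp add: mult.assoc)
    from cond_int_eq_0D[OF this, of "weight r k"] L2_mult_integrable[OF weight_e_L2[OF r k] g]
    show ?thesis by (simp add: mult.assoc)
  qed
  moreover have "(LINT z|Q. eff r z * g z) = (SUM k<m. \<integral>z. weight r k (fst z) * snd z k * g z \<partial>Q)"
    unfolding eff_def sum_distrib_right
    using L2_mult_integrable[OF weight_e_L2[OF r] g] by (intro bi_integral_sum) auto
  ultimately show ?thesis by simp
qed

end

section \<open>Independent clusters\<close>

text \<open>Common constants a, b and K express the uniformity over clusters in the regularity
  conditions.\<close>

locale clusters =
  fixes n :: nat and m :: "nat => nat" and nu :: "nat => ('k::finite, 'd::finite) covs measure" and \<mu> :: "real => real"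
    and \<beta> :: "real ^ 'k" and \<theta> :: "'d => real => real" and f :: "nat => ('k, 'd) err_density" and a b K :: real
  assumes reg: "!!i. i < n ==> cluster_regular (nu i) (m i) \<mu> \<beta> \<theta> (f i) a b K"
begin

abbreviation "D \<equiv> data_law n m nu \<mu> \<beta> \<theta> f"
abbreviation "Pl i \<equiv> cluster_law (nu i) (m i) \<mu> \<beta> \<theta> (f i)"
abbreviation "Ql i \<equiv> cluster_base.err_law (nu i) (m i) (f i)"
abbreviation "El i \<equiv> cluster_base.to_err (m i) \<mu> \<beta> \<theta>"
abbreviation "eff i \<equiv> cluster_regular.eff (m i) (f i)"

lemma Pl_prob: assumes i: "i < n" shows "prob_space (Pl i)" "prob_space (Ql i)"
proof -
  interpret C: cluster_regular "nu i" "m i" \<mu> \<beta> \<theta> "f i" a b K by (rule reg[OF i])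
  show "prob_space (Pl i)" "prob_space (Ql i)" by unfold_locales
qed

sublocale D: prob_space D
  unfolding data_law_def by (rule prob_space_PiM) (use Pl_prob in auto)

lemma comp_measurable: assumes i: "i < n" shows "(%om. El i (om i)) : measurable D (Ql i)"
proof -
  interpret C: cluster_regular "nu i" "m i" \<mu> \<beta> \<theta> "f i" a b K by (rule reg[OF i])
  have "(%om. om i) : measurable D (Pl i)" unfolding data_law_def using i by (intro measurable_component_singleton) auto
  from measurable_compose[OF this C.E_measurable(2)[where f="f i"]] show ?thesis
    by (simp add: measurable_cong_sets[OF refl C.err_law_simps(2)])
qed

lemma comp_distr: assumes i: "i < n" shows "distr D (Ql i) (%om. El i (om i)) = Ql i"
proof -
  interpret C: cluster_regular "nu i" "m i" \<mu> \<beta> \<theta> "f i" a b K by (rule reg[OF i])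
  have m1: "(%om. om i) : measurable D (Pl i)" unfolding data_law_def using i by (intro measurable_component_singleton) auto
  have m2: "El i : measurable (Pl i) (Ql i)" using C.E_measurable(2)[where f="f i"] by (simp add: measurable_cong_sets[OF refl C.err_law_simps(2)])
  have "distr D (Ql i) (%om. El i (om i)) = distr (distr D (Pl i) (%om. om i)) (Ql i) (El i)"
    using distr_distr[OF m2 m1] by (simp add: comp_def)
  also have "distr D (Pl i) (%om. om i) = Pl i"
    unfolding data_law_def using i Pl_prob by (intro distr_PiM_component) auto
  also have "distr (Pl i) (Ql i) (El i) = distr (Pl i) C.N (El i)" by (rule distr_cong) auto
  also have "... = Ql i" by (rule C.distr_cluster_law[OF C.theta_m C.fm])
  finally show ?thesis .
qed

lemma comp_integral:
  fixes X :: "_ => real"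
  assumes i: "i < n" and X: "X : bm (Ql i)"
  shows "integrable D (%om. X (El i (om i))) \<longleftrightarrow> integrable (Ql i) X" "(LINT om|D. X (El i (om i))) = (LINT z|Ql i. X z)"
  using integrable_distr_eq[OF comp_measurable[OF i] X] integral_distr[OF comp_measurable[OF i] X] comp_distr[OF i] by auto

lemma comp_AE: assumes i: "i < n" and R: "AE z in Ql i. R z" shows "AE om in D. R (El i (om i))"
  by (rule AE_distrD[OF comp_measurable[OF i]]) (subst comp_distr[OF i], rule R)

lemma comp_L2:
  assumes i: "i < n" and X: "X : L2 (Ql i)"
  shows "(%om. X (El i (om i))) : L2 D" "l2norm D (%om. X (El i (om i))) = l2norm (Ql i) X"
proof -
  have m: "(%z. (X z)^2) : bm (Ql i)" using L2D(1)[OF X] by measurable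
  show "(%om. X (El i (om i))) : L2 D"
    using measurable_compose[OF comp_measurable[OF i] L2D(1)[OF X]] comp_integral(1)[OF i m] L2D(2)[OF X] by (intro L2I) auto
  show "l2norm D (%om. X (El i (om i))) = l2norm (Ql i) X" using comp_integral(2)[OF i m] by (simp add: l2norm_def)
qed

text \<open>Indices outside the data get an arbitrary probability measure, as the product measure
  lemmas are stated for families of sigma-finite measures.\<close>

definition Pl' :: "nat => ('k, 'd) obs measure" where
  "Pl' i = (if i < n then Pl i else return (count_space UNIV) undefined)"

sublocale Pl': product_sigma_finite Pl'
proof -
  have "prob_space (Pl' i)" for i using Pl_prob(1)[of i] by (auto simp: Pl'_def intro: prob_space_return)
  then show "product_sigma_finite Pl'" by (intro product_sigma_finite.intro prob_space_imp_sigma_finite)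
qed

lemma D_eq: "D = PiM {..<n} Pl'" unfolding data_law_def by (rule PiM_cong) (auto simp: Pl'_def)

lemma comp_indep:
  fixes X Y :: "_ => real"
  assumes i: "i < n" "l < n" "i ~= l" and X: "integrable (Ql i) X" and Y: "integrable (Ql l) Y"
  shows "(LINT om|D. X (El i (om i)) * Y (El l (om l))) = (LINT z|Ql i. X z) * (LINT z|Ql l. Y z)"
proof -
  have PQ: "integrable (Pl k) (%z. Z (El k z))" "(LINT z|Pl k. Z (El k z)) = (LINT z|Ql k. Z z)"
    if "k < n" "integrable (Ql k) Z" for k and Z :: "_ => real"
  proof -
    interpret C: cluster_regular "nu k" "m k" \<mu> \<beta> \<theta> "f k" a b K by (rule reg[OF that(1)])
    have "Z : bm C.N" using borel_measurable_integrable[OF that(2)] by (simp add: measurable_cong_sets[OF C.err_law_simps(2) refl])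
    from C.P_integral[OF this] that(2) show "integrable (Pl k) (%z. Z (El k z))" "(LINT z|Pl k. Z (El k z)) = (LINT z|Ql k. Z z)" by auto
  qed
  \<comment> \<open>The product of these factors over all clusters is X times Y, so the integral
    over the product measure factorises.\<close>
  define F where "F k z = (if k = i then X (El i z) else 1) * (if k = l then Y (El l z) else 1)" for k z
  have I: "integrable (Pl' k) (F k)" if k: "k : {..<n}" for k
  proof -
    have "prob_space (Pl k)" using k Pl_prob by auto
    then interpret prob_space "Pl k" .
    show ?thesis using k PQ(1)[OF i(1) X] PQ(1)[OF i(2) Y] i(3) by (cases "k = i"; cases "k = l") (auto simp: F_def[abs_def] Pl'_def)
  qed
  have J: "(LINT z|Pl' k. F k z) = (if k = i then \<integral>z. X z \<partial>Ql i else 1) * (if k = l then \<integral>z. Y z \<partial>Ql l else 1)" if k: "k : {..<n}" for k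
  proof -
    have "prob_space (Pl k)" using k Pl_prob by auto
    then interpret prob_space "Pl k" .
    show ?thesis using k PQ(2)[OF i(1) X] PQ(2)[OF i(2) Y] i(3) prob_space by (cases "k = i"; cases "k = l") (auto simp: F_def[abs_def] Pl'_def)
  qed
  have pF: "(\<Prod>k<n. F k (om k)) = X (El i (om i)) * Y (El l (om l))" for om
    using i unfolding F_def prod.distrib by (simp add: prod.delta)
  have "(LINT om|D. (\<Prod>k<n. F k (om k))) = (\<Prod>k<n. \<integral>z. F k z \<partial>Pl' k)"
    unfolding D_eq using I by (intro Pl'.product_integral_prod) auto
  also have "... = (\<Prod>k<n. (if k = i then \<integral>z. X z \<partial>Ql i else 1) * (if k = l then \<integral>z. Y z \<partial>Ql l else 1))"
    by (rule prod.cong[OF refl J])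
  also have "... = (LINT z|Ql i. X z) * (LINT z|Ql l. Y z)" using i unfolding prod.distrib by (simp add: prod.delta)
  finally show ?thesis unfolding pF .
qed

section \<open>Sums of contributions of independent clusters\<close>

definition lift :: "(nat => ('k, 'd) covs \<times> (nat => real) => real) => (nat => ('k, 'd) obs) => real" where
  "lift U om = (SUM i<n. U i (El i (om i)))"

lemma lift_L2: assumes "!!i. i < n ==> U i : L2 (Ql i)" shows "lift U : L2 D" "l2norm D (lift U) <= (SUM i<n. l2norm (Ql i) (U i))"
proof -
  show "lift U : L2 D" unfolding lift_def[abs_def] by (intro L2_sum comp_L2 assms) auto
  have "l2norm D (lift U) <= (SUM i<n. l2norm D (%om. U i (El i (om i))))"
    unfolding lift_def[abs_def] by (intro l2norm_sum_le comp_L2 assms) auto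
  also have "... = (SUM i<n. l2norm (Ql i) (U i))" by (intro sum.cong refl comp_L2 assms) auto
  finally show "l2norm D (lift U) <= (SUM i<n. l2norm (Ql i) (U i))" .
qed

text \<open>Cross terms factorise by independence and vanish because U is centred; W may have any
  mean.\<close>

lemma lift_inner:
  assumes U: "!!i. i < n ==> U i : L2 (Ql i)" and W: "!!i. i < n ==> W i : L2 (Ql i)" and z: "!!i. i < n ==> (LINT z|Ql i. U i z) = 0"
  shows "(LINT om|D. lift U om * lift W om) = (SUM i<n. \<integral>z. U i z * W i z \<partial>Ql i)"
proof -
  have "(LINT om|D. lift U om * lift W om) = (SUM i<n. SUM l<n. \<integral>om. U i (El i (om i)) * W l (El l (om l)) \<partial>D)"
    unfolding lift_def sum_product by (intro integral_double_sum L2_mult_integrable comp_L2 U W)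
  also have "... = (SUM i<n. SUM l<n. if l = i then \<integral>z. U i z * W i z \<partial>Ql i else 0)"
  proof (intro sum.cong refl)
    fix i l assume "i : {..<n}" "l : {..<n}"
    then have il: "i < n" "l < n" by auto
    have m: "(%z. U i z * W i z) : bm (Ql i)" by (rule borel_measurable_integrable[OF L2_mult_integrable[OF U[OF il(1)] W[OF il(1)]]])
    interpret Qi: prob_space "Ql i" by (rule Pl_prob[OF il(1)])
    interpret Qlp: prob_space "Ql l" by (rule Pl_prob[OF il(2)])
    show "(LINT om|D. U i (El i (om i)) * W l (El l (om l))) = (if l = i then \<integral>z. U i z * W i z \<partial>Ql i else 0)"
      using comp_integral(2)[OF il(1) m] comp_indep[OF il _ Qi.L2_integrable[OF U[OF il(1)]] Qlp.L2_integrable[OF W[OF il(2)]]] z[OF il(1)]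
      by auto
  qed
  also have "... = (SUM i<n. \<integral>z. U i z * W i z \<partial>Ql i)" by (simp add: sum.delta)
  finally show ?thesis .
qed

text \<open>By Fubini's theorem some section in the i-th coordinate is square integrable.\<close>

lemma lift_L2D:
  assumes U: "!!i. i < n ==> U i : bm (Ql i)" and L: "lift U : L2 D" and i: "i < n"
  shows "U i : L2 (Ql i)"
proof -
  interpret C: cluster_regular "nu i" "m i" \<mu> \<beta> \<theta> "f i" a b K by (rule reg[OF i])
  define I where "I = {..<n} - {i}"
  have ins: "insert i I = {..<n}" and I: "finite I" "i \<notin> I" using i by (auto simp: I_def)
  define F where "F om = ennreal ((lift U om)^2)" for om
  have Fm: "F : bm (PiM (insert i I) Pl')"
    unfolding ins D_eq[symmetric] F_def[abs_def] using L2D(1)[OF L] by measurable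
  have "(\<integral>\<^sup>+om. F om \<partial>D) < \<infinity>"
    using nn_integral_eq_integral[OF L2D(2)[OF L]] by (simp add: F_def)
  then have fin: "(\<integral>\<^sup>+x. (\<integral>\<^sup>+y. F (x(i := y)) \<partial>Pl' i) \<partial>PiM I Pl') < \<infinity>"
    using Pl'.product_nn_integral_insert[OF I Fm] by (simp add: ins D_eq)
  have im: "(%x. \<integral>\<^sup>+y. F (x(i := y)) \<partial>Pl' i) : bm (PiM I Pl')"
    using measurable_compose[OF measurable_add_dim Fm] by (intro sigma_finite_measure.borel_measurable_nn_integral Pl'.sigma_finite_measures) (simp add: split_beta')
  have ae: "AE x in PiM I Pl'. (\<integral>\<^sup>+y. F (x(i := y)) \<partial>Pl' i) ~= \<infinity>"
    using nn_integral_noteq_infinite[OF im] fin by auto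
  have "prob_space (PiM I Pl')" by (rule prob_space_PiM) (use Pl_prob in \<open>auto simp: I_def Pl'_def\<close>)
  then interpret I: prob_space "PiM I Pl'" .
  have "EX x. (\<integral>\<^sup>+y. F (x(i := y)) \<partial>Pl' i) ~= \<infinity>"
  proof (rule ccontr)
    assume "\<not> ?thesis"
    with ae have "AE x in PiM I Pl'. False" by simp
    then show False by simp
  qed
  then obtain x where x: "(\<integral>\<^sup>+y. F (x(i := y)) \<partial>Pl' i) < \<infinity>" by (auto simp: less_top)
  define k where "k = (SUM l:I. U l (El l (x l)))"
  have lx: "lift U (x(i := y)) = U i (El i y) + k" for y
  proof -
    have "lift U (x(i := y)) = (SUM l:insert i I. U l (El l ((x(i := y)) l)))" by (simp add: lift_def ins)
    also have "... = U i (El i y) + (SUM l:I. U l (El l ((x(i := y)) l)))" using I by simp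
    also have "(SUM l:I. U l (El l ((x(i := y)) l))) = k" unfolding k_def using I(2) by (intro sum.cong refl) auto
    finally show ?thesis .
  qed
  have UN: "U i : bm C.N" using U[OF i] by (simp add: measurable_cong_sets[OF C.err_law_simps(2) refl])
  have Um: "(%y. U i (El i y)) : bm (Pl i)" by (rule measurable_compose[OF C.E_measurable(2) UN])
  have "integrable (Pl i) (%y. (U i (El i y) + k)^2)"
    using x Um i by (intro integrableI_nonneg) (auto simp: F_def lx Pl'_def)
  then have "(%y. U i (El i y) + k) : L2 (Pl i)" using Um by (intro L2I) auto
  moreover have "(%_. k) : L2 (Pl i)" by (rule C.P.L2_bounded[of _ "\<bar>k\<bar>"]) auto
  ultimately have "(%y. (U i (El i y) + k) - k) : L2 (Pl i)" by (rule L2_diff)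
  then have "integrable (Pl i) (%y. (U i (El i y))^2)" by (auto dest: L2D(2))
  moreover have "(%z. (U i z)^2) : bm C.N" using UN by measurable
  ultimately show ?thesis using C.P_integral(1)[of "%z. (U i z)^2"] U[OF i] by (intro L2I) auto
qed

text \<open>A direction assigns to observation j of cluster i the derivative of its conditional mean
  along a path, as a square integrable function of the covariates.\<close>

definition dirs :: "(nat => nat => ('k, 'd) covs => real) => bool" where
  "dirs r \<longleftrightarrow> (ALL i<n. cluster_regular.cov_vec (nu i) (m i) (f i) (r i))"

definition eff_score :: "(nat => nat => ('k, 'd) covs => real) => (nat => ('k, 'd) obs) => real" where
  "eff_score r = lift (%i. eff i (r i))"

definition dir_term :: "(nat => nat => ('k, 'd) covs => real) => nat => ('k, 'd) covs \<times> (nat => real) => real" where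
  "dir_term r i z = (SUM j<m i. r i j (fst z) * cluster.err_score (f i) j z)"

definition dir_score :: "(nat => nat => ('k, 'd) covs => real) => (nat => ('k, 'd) obs) => real" where
  "dir_score r = lift (dir_term r)"

lemma eff_L2:
  assumes "dirs r" "i < n"
  shows "eff i (r i) : L2 (Ql i)" "(LINT z|Ql i. eff i (r i) z) = 0"
    "l2norm (Ql i) (eff i (r i)) <= real (m i) * (K * (1 / a)) * (SUM j<m i. l2norm (Ql i) (%z. r i j (fst z)))"
proof -
  interpret C: cluster_regular "nu i" "m i" \<mu> \<beta> \<theta> "f i" a b K by (rule reg[OF assms(2)])
  have "C.cov_vec (r i)" using assms by (simp add: dirs_def)
  from C.eff_L2(1)[OF this] C.eff_mean[OF this] C.eff_L2(2)[OF this]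
  show "eff i (r i) : L2 (Ql i)" "(LINT z|Ql i. eff i (r i) z) = 0"
    "l2norm (Ql i) (eff i (r i)) <= real (m i) * (K * (1 / a)) * (SUM j<m i. l2norm (Ql i) (%z. r i j (fst z)))" .
qed

lemma eff_score_L2: "dirs r ==> eff_score r : L2 D"
  unfolding eff_score_def by (intro lift_L2 eff_L2)

lemma dirs_lin: assumes "dirs r" "dirs s" shows "dirs (%i j c. r i j c + t * s i j c)"
  unfolding dirs_def
proof (intro allI impI)
  fix i assume i: "i < n"
  interpret C: cluster_regular "nu i" "m i" \<mu> \<beta> \<theta> "f i" a b K by (rule reg[OF i])
  show "C.cov_vec (%j c. r i j c + t * s i j c)" using assms i by (intro C.cov_vec_lin) (auto simp: dirs_def)
qed

lemma eff_score_lin: "eff_score (%i j c. r i j c + t * s i j c) om = eff_score r om + t * eff_score s om"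
proof -
  have "eff i (%j c. r i j c + t * s i j c) z = eff i (r i) z + t * eff i (s i) z" if i: "i < n" for i z
  proof -
    interpret C: cluster_regular "nu i" "m i" \<mu> \<beta> \<theta> "f i" a b K by (rule reg[OF i])
    show ?thesis by (rule C.eff_linear)
  qed
  then show ?thesis unfolding eff_score_def lift_def by (simp add: sum.distrib sum_distrib_left)
qed

lemma dir_score_lin: "dir_score (%i j c. r i j c + t * s i j c) om = dir_score r om + t * dir_score s om"
  unfolding dir_score_def lift_def dir_term_def by (simp add: sum.distrib sum_distrib_left distrib_right mult.assoc)

lemma eff_score_inner:
  assumes r: "dirs r" and s: "dirs s"
  shows "(LINT om|D. eff_score r om * eff_score s om)
    = (SUM i<n. \<integral>z. bform (m i) (cluster_regular.H (m i) (f i) (fst z)) (%j. r i j (fst z)) (%j. s i j (fst z)) \<partial>Ql i)"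
proof -
  have "(LINT om|D. eff_score r om * eff_score s om) = (SUM i<n. \<integral>z. eff i (r i) z * eff i (s i) z \<partial>Ql i)"
    unfolding eff_score_def by (intro lift_inner eff_L2 r s)
  also have "... = (SUM i<n. \<integral>z. bform (m i) (cluster_regular.H (m i) (f i) (fst z)) (%j. r i j (fst z)) (%j. s i j (fst z)) \<partial>Ql i)"
  proof (intro sum.cong refl)
    fix i assume "i : {..<n}"
    then have i: "i < n" by simp
    interpret C: cluster_regular "nu i" "m i" \<mu> \<beta> \<theta> "f i" a b K by (rule reg[OF i])
    show "(LINT z|Ql i. eff i (r i) z * eff i (s i) z) = (LINT z|Ql i. bform (m i) (C.H (fst z)) (%j. r i j (fst z)) (%j. s i j (fst z)))"
      using r s i by (intro C.eff_inner(2)) (auto simp: dirs_def)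
  qed
  finally show ?thesis .
qed

text \<open>Centred contributions of independent clusters are orthogonal, so the norm of one is at
  most that of the sum.\<close>

lemma eff_score_lower:
  assumes r: "dirs r" and i: "i < n" and j: "j < m i"
  shows "l2norm (Ql i) (%z. r i j (fst z)) <= sqrt b * l2norm D (eff_score r)"
proof -
  interpret C: cluster_regular "nu i" "m i" \<mu> \<beta> \<theta> "f i" a b K by (rule reg[OF i])
  have sq: "(l2norm M g)^2 = (LINT x|M. g x * g x)" for M :: "'w measure" and g
    unfolding l2norm_sq by (simp only: power2_eq_square)
  have "(l2norm (Ql i) (eff i (r i)))^2 <= (SUM i<n. \<integral>z. eff i (r i) z * eff i (r i) z \<partial>Ql i)"
    unfolding sq using i by (intro member_le_sum[of i "{..<n}" "%i. \<integral>z. eff i (r i) z * eff i (r i) z \<partial>Ql i"] integral_nonneg_AE) auto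
  also have "... = (LINT om|D. eff_score r om * eff_score r om)"
    unfolding eff_score_def by (intro lift_inner[symmetric] eff_L2 r)
  also have "... = (l2norm D (eff_score r))^2" by (rule sq[symmetric])
  finally have le: "l2norm (Ql i) (eff i (r i)) <= l2norm D (eff_score r)" by (rule power2_le_imp_le) simp
  have "l2norm (Ql i) (%z. r i j (fst z)) <= sqrt b * l2norm (Ql i) (eff i (r i))"
    using r i j by (intro C.eff_lower) (auto simp: dirs_def)
  also have "... <= sqrt b * l2norm D (eff_score r)" using C.b by (intro mult_left_mono le) auto
  finally show ?thesis .
qed

section \<open>Derivatives of the log-likelihood along paths of error densities\<close>

lemma AE_positive: "AE om in D. ALL i<n. 0 < f i (fst (El i (om i))) (snd (El i (om i))) &
    fst (El i (om i)) : space (nu i) & snd (El i (om i)) : errs (m i)"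
proof -
  have "AE om in D. ALL i:{..<n}. 0 < f i (fst (El i (om i))) (snd (El i (om i))) &
    fst (El i (om i)) : space (nu i) & snd (El i (om i)) : errs (m i)"
  proof (intro AE_finite_allI finite_lessThan)
    fix i assume "i : {..<n}"
    then have i: "i < n" by simp
    interpret C: cluster_regular "nu i" "m i" \<mu> \<beta> \<theta> "f i" a b K by (rule reg[OF i])
    have "AE z in Ql i. 0 < f i (fst z) (snd z) & fst z : space (nu i) & snd z : errs (m i)"
      using C.Q_pos AE_space by eventually_elim (auto simp: space_pair_measure)
    from comp_AE[OF i this] show "AE om in D. 0 < f i (fst (El i (om i))) (snd (El i (om i))) &
      fst (El i (om i)) : space (nu i) & snd (El i (om i)) : errs (m i)" .
  qed
  then show ?thesis by eventually_elim auto
qed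

lemma lik_to_err: "i < n ==> lik (m i) \<mu> \<beta> \<theta> g z = g (fst (El i z)) (snd (El i z))"
proof -
  assume i: "i < n"
  interpret C: cluster_regular "nu i" "m i" \<mu> \<beta> \<theta> "f i" a b K by (rule reg[OF i])
  show ?thesis by (simp add: lik_def C.to_err_def)
qed

lemma score_along_unique:
  assumes "score_along D L g" "AE om in D. ((%s. L s om) has_real_derivative g' om) (at 0)"
  shows "AE om in D. g om = g' om"
proof -
  have "AE om in D. ((%s. L s om) has_real_derivative g om) (at 0)" using assms(1) by (simp add: score_along_def)
  with assms(2) show ?thesis by eventually_elim (rule DERIV_unique)
qed

lemma path_derivative:
  assumes F0: "F 0 = f"
    and d: "!!i c e. i < n ==> c : space (nu i) ==> e : errs (m i) ==> ((%r. F r i c e) has_real_derivative F' i c e) (at 0)"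
  shows "AE om in D. ((%s. loglik n m \<mu> \<beta> \<theta> (F s) om) has_real_derivative lift (%i z. F' i (fst z) (snd z) / f i (fst z) (snd z)) om) (at 0)"
  using AE_positive
proof eventually_elim
  case (elim om)
  have "((%s. ln (lik (m i) \<mu> \<beta> \<theta> (F s i) (om i))) has_real_derivative
      F' i (fst (El i (om i))) (snd (El i (om i))) / f i (fst (El i (om i))) (snd (El i (om i)))) (at 0)" if i: "i : {..<n}" for i
  proof -
    have "((%r. F r i (fst (El i (om i))) (snd (El i (om i)))) has_real_derivative F' i (fst (El i (om i))) (snd (El i (om i)))) (at 0)"
      using elim i by (intro d) auto
    from DERIV_chain2[OF DERIV_ln_divide this] show ?thesis
      using elim i by (simp add: lik_to_err F0)
  qed
  then show ?case unfolding loglik_def lift_def by (intro DERIV_sum) auto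
qed

text \<open>The score of a path is a sum over clusters whose terms inherit the differentiated
  constraints. Only the sum is assumed square integrable; \<open>lift_L2D\<close> passes this on to
  the terms.\<close>

lemma f_score_components:
  assumes "g : f_scores n m nu \<mu> \<beta> \<theta> f"
  shows "EX U. (ALL i<n. U i : L2 (Ql i) &
      (ALL j<m i. ALL A:sets (nu i). (LINT z|Ql i. indicator A (fst z) * snd z j * U i z) = 0)) & (AE om in D. g om = lift U om)"
proof -
  obtain F G ep where e: "ep > 0" and F0: "F 0 = f"
    and F: "!!s i. \<bar>s\<bar> < ep ==> i < n ==> in_model (nu i) (m i) \<mu> \<beta> \<theta> (F s i) &
        (ALL c:space (nu i). ALL e:errs (m i). (%r. F r i c e) differentiable (at s) & \<bar>deriv (%r. F r i c e) s\<bar> <= G i c e)"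
    and G: "!!i. i < n ==> integrable (nu i \<Otimes>\<^sub>M lebesgue_prod (m i)) (%(c, e). (1 + (SUM j<m i. \<bar>e j\<bar>)) * G i c e)"
    and s: "score_along D (%s. loglik n m \<mu> \<beta> \<theta> (F s)) g"
    using assms unfolding f_scores_def mem_Collect_eq by (elim exE conjE) blast
  define U where "U i z = deriv (%r. F r i (fst z) (snd z)) 0 / f i (fst z) (snd z)" for i z
  have Ui: "integrable (Ql i) (U i)"
    and Uo: "!!j A. j < m i ==> A : sets (nu i) ==> (LINT z|Ql i. indicator A (fst z) * snd z j * U i z) = 0" if i: "i < n" for i
  proof -
    interpret C: cluster_regular "nu i" "m i" \<mu> \<beta> \<theta> "f i" a b K by (rule reg[OF i])
    note ps = C.path_score[where F="%s. F s i" and G="G i", OF e _ _ _ G[OF i]]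
    show "integrable (Ql i) (U i)" unfolding U_def[abs_def] by (rule ps(1)) (use F0 F i in auto)
    show "(LINT z|Ql i. indicator A (fst z) * snd z j * U i z) = 0" if "j < m i" "A : sets (nu i)" for j A
      unfolding U_def by (rule conjunct2[OF ps(3)[where h="indicator A" and B=1]]) (use F0 F i that in \<open>auto split: split_indicator\<close>)
  qed
  have "AE om in D. ((%s. loglik n m \<mu> \<beta> \<theta> (F s) om) has_real_derivative
      lift (%i z. deriv (%r. F r i (fst z) (snd z)) 0 / f i (fst z) (snd z)) om) (at 0)"
  proof (rule path_derivative[where F=F and F'="%i c e. deriv (%r. F r i c e) 0", OF F0])
    fix i c e assume "i < n" "c : space (nu i)" "e : errs (m i)"
    then have "(%r. F r i c e) differentiable (at 0)" using F[of 0 i] \<open>ep > 0\<close> by auto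
    then show "((%r. F r i c e) has_real_derivative deriv (%r. F r i c e) 0) (at 0)"
      by (simp add: DERIV_deriv_iff_real_differentiable)
  qed
  then have ae: "AE om in D. g om = lift U om" using score_along_unique[OF s] by (simp add: U_def[abs_def])
  have gL: "g : L2 D" using s by (simp add: score_along_def)
  have Um: "U i : bm (Ql i)" if "i < n" for i by (rule borel_measurable_integrable[OF Ui[OF that]])
  have "lift U : bm D"
    unfolding lift_def[abs_def] by (intro borel_measurable_sum measurable_compose[OF comp_measurable Um]) auto
  then have "lift U : L2 D" by (rule L2_cong_AE[OF gL _ ae])
  then have "U i : L2 (Ql i)" if "i < n" for i using that by (intro lift_L2D[where U=U] Um)
  then have "ALL i<n. U i : L2 (Ql i) & (ALL j<m i. ALL A:sets (nu i). (LINT z|Ql i. indicator A (fst z) * snd z j * U i z) = 0)"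
    using Uo by simp
  then show ?thesis using ae by (intro exI[of _ U] conjI)
qed

section \<open>Projection onto the orthocomplement of the tangent space of the error
  densities\<close>

abbreviation "Tf \<equiv> tangent_space D (f_scores n m nu \<mu> \<beta> \<theta> f)"

lemma f_scores_L2: "f_scores n m nu \<mu> \<beta> \<theta> f \<subseteq> L2 D"
  by (auto simp: f_scores_def score_along_def)

text \<open>By independence it suffices to argue cluster by cluster, where the error moments of the
  components vanish. Linear combinations and limits follow by linearity and continuity of the inner
  product.\<close>

lemma eff_score_orth:
  assumes r: "dirs r" shows "eff_score r : orth D Tf"
proof -
  have "(LINT om|D. eff_score r om * g om) = 0" if gs: "g : f_scores n m nu \<mu> \<beta> \<theta> f" for g
  proof -
    obtain U where U': "ALL i<n. U i : L2 (Ql i) &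
        (ALL j<m i. ALL A:sets (nu i). (LINT z|Ql i. indicator A (fst z) * snd z j * U i z) = 0)" and U2: "AE om in D. g om = lift U om"
      using f_score_components[OF gs] by (elim exE conjE) (rule that, assumption+)
    then have U: "!!i. i < n ==> U i : L2 (Ql i)"
      "!!i j A. i < n ==> j < m i ==> A : sets (nu i) ==> (LINT z|Ql i. indicator A (fst z) * snd z j * U i z) = 0"
      by simp_all
    have "(LINT om|D. eff_score r om * g om) = (LINT om|D. eff_score r om * lift U om)"
      using U2 L2D(1)[OF eff_score_L2[OF r]] L2D(1)[OF subsetD[OF f_scores_L2 gs]] L2D(1)[OF lift_L2(1)[OF U(1)]]
      by (intro integral_cong_AE borel_measurable_times) auto
    also have "... = (SUM i<n. \<integral>z. eff i (r i) z * U i z \<partial>Ql i)"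
      unfolding eff_score_def by (intro lift_inner eff_L2 r U(1))
    also have "... = 0"
    proof (intro sum.neutral ballI)
      fix i assume "i : {..<n}"
      then have i: "i < n" by simp
      interpret C: cluster_regular "nu i" "m i" \<mu> \<beta> \<theta> "f i" a b K by (rule reg[OF i])
      show "(LINT z|Ql i. eff i (r i) z * U i z) = 0"
        using r i by (intro C.eff_orth U) (auto simp: dirs_def)
    qed
    finally show ?thesis .
  qed
  note z = this
  have "(LINT om|D. eff_score r om * h om) = 0" if hs: "h : lin_span (f_scores n m nu \<mu> \<beta> \<theta> f)" for h
  proof -
    obtain F c where F: "finite F" "F \<subseteq> f_scores n m nu \<mu> \<beta> \<theta> f" and h: "h = (%om. SUM g:F. c g * g om)"
      using hs unfolding lin_span_def by blast
    have I: "integrable D (%om. eff_score r om * g om)" if "g : F" for g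
      using that F f_scores_L2 by (intro L2_mult_integrable eff_score_L2[OF r]) auto
    have "(LINT om|D. eff_score r om * h om) = (LINT om|D. (SUM g:F. c g * (eff_score r om * g om)))"
      unfolding h sum_distrib_left by (simp add: mult_ac)
    also have "... = (SUM g:F. c g * (LINT om|D. eff_score r om * g om))"
      using I by (subst bi_integral_sum) auto
    also have "... = 0" using z F by (intro sum.neutral) auto
    finally show ?thesis .
  qed
  then show ?thesis
    unfolding orth_def tangent_space_def using eff_score_L2[OF r] orth_L2_closure[OF eff_score_L2[OF r]] by auto
qed

text \<open>The path of tilts f (1 + s g) is affine in s and stays in the model for small s; its
  score is g wherever f is positive.\<close>

lemma test_fun_score:
  assumes g: "!!i. i < n ==> cluster.test_fun (nu i) (m i) (g i)" and g0: "!!i. i < n ==> (LINT z|Ql i. g i (fst z) (snd z)) = 0"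
    and ge: "!!i j A. i < n ==> j < m i ==> A : sets (nu i) ==> (LINT z|Ql i. indicator A (fst z) * snd z j * g i (fst z) (snd z)) = 0"
  shows "lift (%i z. g i (fst z) (snd z)) : f_scores n m nu \<mu> \<beta> \<theta> f"
proof -
  have "EX B. i < n --> 0 <= B & (ALL c:space (nu i). ALL e:errs (m i). \<bar>g i c e\<bar> <= B)" for i
  proof (cases "i < n")
    case True
    interpret C: cluster_regular "nu i" "m i" \<mu> \<beta> \<theta> "f i" a b K by (rule reg[OF True])
    show ?thesis using C.test_fun_bound[OF g[OF True]] by metis
  qed simp
  then obtain B where B: "!!i. i < n ==> 0 <= B i"
    "!!i c e. i < n ==> c : space (nu i) ==> e : errs (m i) ==> \<bar>g i c e\<bar> <= B i" by metis
  \<comment> \<open>One interval of s has to serve all clusters, so the bounds are summed; the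
    summand 1 avoids division by zero.\<close>
  define ep where "ep = 1 / (1 + (SUM i<n. B i))"
  have S0: "0 <= (SUM i<n. B i)" using B(1) by (intro sum_nonneg) auto
  have e: "0 < ep" using S0 by (simp add: ep_def)
  have sB: "\<bar>s\<bar> * B i <= 1" if "\<bar>s\<bar> < ep" "i < n" for s i
  proof -
    have "B i <= (SUM i<n. B i)" using that B(1) by (intro member_le_sum) auto
    then have "\<bar>s\<bar> * B i <= ep * (1 + (SUM i<n. B i))" using that B(1)[OF that(2)] e by (intro mult_mono) auto
    also have "... = 1" using S0 by (simp add: ep_def)
    finally show ?thesis .
  qed
  define F where "F s i = (if i < n then (%c e. f i c e * (1 + s * g i c e)) else f i)" for s i
  \<comment> \<open>The derivative of the affine path is f g for every s. The factor 1 + sum |e_j|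
    is integrable against f because the errors are integrable.\<close>
  define G where "G i c e = f i c e * B i" for i c e
  have d: "((%r. F r i c e) has_real_derivative f i c e * g i c e) (at s)" if "i < n" for i c e s
    using that by (auto simp: F_def intro!: derivative_eq_intros)
  have gL: "(%z. g i (fst z) (snd z)) : L2 (Ql i)" if i: "i < n" for i
  proof -
    interpret C: cluster_regular "nu i" "m i" \<mu> \<beta> \<theta> "f i" a b K by (rule reg[OF i])
    show ?thesis by (rule C.test_fun_L2[OF g[OF i]])
  qed
  have F0: "F 0 = f" by (auto simp: F_def fun_eq_iff)
  have 1: "in_model (nu i) (m i) \<mu> \<beta> \<theta> (F s i) &
        (ALL c:space (nu i). ALL e:errs (m i). (%r. F r i c e) differentiable (at s) & \<bar>deriv (%r. F r i c e) s\<bar> <= G i c e)"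
    if s: "\<bar>s\<bar> < ep" and i: "i < n" for s i
  proof (intro conjI ballI)
    interpret C: cluster_regular "nu i" "m i" \<mu> \<beta> \<theta> "f i" a b K by (rule reg[OF i])
    have "in_model (nu i) (m i) \<mu> \<beta> \<theta> (%c e. f i c e * (1 + s * g i c e))"
      using C.test_funD[OF g[OF i]] B(2)[OF i] g0[OF i] ge[OF i] sB[OF s i] by (intro C.tilt_in_model[where B="B i"])
    then show "in_model (nu i) (m i) \<mu> \<beta> \<theta> (F s i)" using i by (simp add: F_def)
    fix c e assume ce: "c : space (nu i)" "e : errs (m i)"
    show "(%r. F r i c e) differentiable (at s)" using d[OF i, of c e s] unfolding real_differentiable_def by blast
    show "\<bar>deriv (%r. F r i c e) s\<bar> <= G i c e"
      unfolding DERIV_imp_deriv[OF d[OF i]] G_def using B(2)[OF i ce] C.f_nonneg[OF ce] by (auto simp: abs_mult intro!: mult_left_mono)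
  qed
  have 2: "integrable (nu i \<Otimes>\<^sub>M lebesgue_prod (m i)) (%(c, e). (1 + (SUM j<m i. \<bar>e j\<bar>)) * G i c e)" if i: "i < n" for i
  proof -
    interpret C: cluster_regular "nu i" "m i" \<mu> \<beta> \<theta> "f i" a b K by (rule reg[OF i])
    have I: "integrable (Ql i) (%z. (1 + (SUM j<m i. \<bar>snd z j\<bar>)) * B i)"
      using C.e_integrable by (intro integrable_mult_left bi_integrable_add bi_integrable_sum integrable_abs) auto
    have M: "(%z. (1 + (SUM j<m i. \<bar>snd z j\<bar>)) * B i) : bm C.N"
      using borel_measurable_integrable[OF I] by (simp add: measurable_cong_sets[OF C.err_law_simps(2) refl])
    show ?thesis using C.Q_integral(1)[OF M] I by (simp add: G_def split_beta' mult_ac)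
  qed
  have pd: "AE om in D. ((%s. loglik n m \<mu> \<beta> \<theta> (F s) om) has_real_derivative
      lift (%i z. f i (fst z) (snd z) * g i (fst z) (snd z) / f i (fst z) (snd z)) om) (at 0)"
    using d by (intro path_derivative[where F=F and F'="%i c e. f i c e * g i c e", OF F0])
  have 3: "score_along D (%s. loglik n m \<mu> \<beta> \<theta> (F s)) (lift (%i z. g i (fst z) (snd z)))"
    unfolding score_along_def
  proof
    show "lift (%i z. g i (fst z) (snd z)) : L2 D" by (rule lift_L2(1)[OF gL])
    show "AE om in D. ((%s. loglik n m \<mu> \<beta> \<theta> (F s) om) has_real_derivative lift (%i z. g i (fst z) (snd z)) om) (at 0)"
      using pd AE_positive
    proof eventually_elim
      case (elim om)
      have "lift (%i z. f i (fst z) (snd z) * g i (fst z) (snd z) / f i (fst z) (snd z)) om = lift (%i z. g i (fst z) (snd z)) om"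
        unfolding lift_def using elim(2) by (intro sum.cong refl) auto
      then show ?case using elim(1) by simp
    qed
  qed
  show ?thesis unfolding f_scores_def mem_Collect_eq
    by (rule exI[of _ F], rule exI[of _ G], rule exI[of _ ep], rule conjI[OF e], rule conjI[OF F0], rule conjI,
        intro allI impI, rule 1, assumption, assumption, rule conjI, intro allI impI, rule 2, assumption, rule 3)
qed

lemma residual_tangent:
  assumes r: "dirs r" and L: "!!i. i < n ==> dir_term r i : L2 (Ql i)"
  shows "(%om. dir_score r om - eff_score r om) : Tf"
proof -
  let ?R = "%i z. dir_term r i z - eff i (r i) z"
  have R: "(%om. dir_score r om - eff_score r om) = lift ?R"
    by (simp add: dir_score_def eff_score_def lift_def sum_subtractf fun_eq_iff)
  have RL: "?R i : L2 (Ql i)" if "i < n" for i by (intro L2_diff L that eff_L2 r)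
  show ?thesis
    unfolding R tangent_space_def L2_closure_iff
  proof (intro conjI allI impI)
    show "lift ?R : L2 D" by (rule lift_L2(1)[OF RL])
    fix ep :: real assume e: "0 < ep"
    \<comment> \<open>The error is shared among the n clusters; n + 1 covers the case of no
      clusters.\<close>
    define \<delta> where "\<delta> = ep / (1 + real n)"
    have d: "0 < \<delta>" using e by (simp add: \<delta>_def)
    define Pr where "Pr i g \<longleftrightarrow> cluster.test_fun (nu i) (m i) g & (LINT z|Ql i. g (fst z) (snd z)) = 0 &
        (ALL j A. j < m i --> A : sets (nu i) --> (LINT z|Ql i. indicator A (fst z) * snd z j * g (fst z) (snd z)) = 0) &
        l2norm (Ql i) (%z. ?R i z - g (fst z) (snd z)) < \<delta>" for i g
    have "EX g. i < n --> Pr i g" for i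
    proof (cases "i < n")
      case True
      interpret C: cluster_regular "nu i" "m i" \<mu> \<beta> \<theta> "f i" a b K by (rule reg[OF True])
      have cv: "C.cov_vec (r i)" using r True by (simp add: dirs_def)
      have "(%z. SUM j<m i. r i j (fst z) * C.err_score j z) : L2 (Ql i)" using L[OF True] by (simp add: dir_term_def[abs_def])
      then show ?thesis
      proof (rule C.residual_in_closure[OF cv _ d])
        fix g
        assume "C.test_fun g" "(LINT z|Ql i. g (fst z) (snd z)) = 0"
          "!!j A. j < m i ==> A : sets (nu i) ==> (LINT z|Ql i. indicator A (fst z) * snd z j * g (fst z) (snd z)) = 0"
          "l2norm (Ql i) (%z. ((SUM j<m i. r i j (fst z) * C.err_score j z) - C.eff (r i) z) - g (fst z) (snd z)) < \<delta>"
        then have "Pr i g" unfolding Pr_def by (simp add: dir_term_def)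
        then show ?thesis by blast
      qed
    qed simp
    then obtain g where g': "!!i. i < n ==> Pr i (g i)" by metis
    have g: "!!i. i < n ==> cluster.test_fun (nu i) (m i) (g i)" "!!i. i < n ==> (LINT z|Ql i. g i (fst z) (snd z)) = 0"
      "!!i j A. i < n ==> j < m i ==> A : sets (nu i) ==> (LINT z|Ql i. indicator A (fst z) * snd z j * g i (fst z) (snd z)) = 0"
      "!!i. i < n ==> l2norm (Ql i) (%z. ?R i z - g i (fst z) (snd z)) < \<delta>"
      using g' unfolding Pr_def by simp_all
    let ?g = "lift (%i z. g i (fst z) (snd z))"
    have gs: "?g : f_scores n m nu \<mu> \<beta> \<theta> f" by (rule test_fun_score[OF g(1-3)])
    have gL: "(%z. g i (fst z) (snd z)) : L2 (Ql i)" if i: "i < n" for i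
    proof -
      interpret C: cluster_regular "nu i" "m i" \<mu> \<beta> \<theta> "f i" a b K by (rule reg[OF i])
      show ?thesis by (rule C.test_fun_L2[OF g(1)[OF i]])
    qed
    have "l2norm D (%om. lift ?R om - ?g om) = l2norm D (lift (%i z. ?R i z - g i (fst z) (snd z)))"
      by (simp add: lift_def[abs_def] sum_subtractf)
    also have "... <= (SUM i<n. l2norm (Ql i) (%z. ?R i z - g i (fst z) (snd z)))" by (intro lift_L2 L2_diff RL gL)
    also have "... <= (SUM i<n. \<delta>)" using g(4) by (intro sum_mono) (auto intro: less_imp_le)
    also have "... < ep" using e by (simp add: \<delta>_def field_simps)
    finally show "EX h:lin_span (f_scores n m nu \<mu> \<beta> \<theta> f) Int L2 D. l2norm D (%om. lift ?R om - h om) < ep"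
      using lin_span_superset[OF gs] subsetD[OF f_scores_L2 gs] by blast
  qed
qed

text \<open>The difference lies in the tangent space, hence is orthogonal to everything orthogonal
  to that space, while the efficient score lies in the orthocomplement; these two facts identify the
  projection. It is enough that h agrees with the score almost everywhere, as chosen versions
  do.\<close>

lemma score_projection:
  assumes r: "dirs r" and L: "!!i. i < n ==> dir_term r i : L2 (Ql i)" and h: "h : L2 D" "AE om in D. h om = dir_score r om"
  shows "(%om. h om - eff_score r om) : Tf" "is_proj D (orth D Tf) h (eff_score r)"
proof -
  have hm: "(%om. h om - eff_score r om) : L2 D" by (rule L2_diff[OF h(1) eff_score_L2[OF r]])
  show T: "(%om. h om - eff_score r om) : Tf"
    using h(2) residual_tangent[OF r L] unfolding tangent_space_def
    by (intro L2_closure_cong_AE[OF _ L2D(1)[OF hm]]) auto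
  show "is_proj D (orth D Tf) h (eff_score r)"
    unfolding is_proj_def
  proof
    show "eff_score r : L2_closure D (orth D Tf)" by (intro L2_closure_superset eff_score_orth eff_score_L2 r)
    show "(%om. h om - eff_score r om) : orth D (orth D Tf)"
      using hm T by (auto simp: orth_def mult.commute)
  qed
qed

text \<open>A score is assumed square integrable as a whole; independence of the clusters makes each
  of its terms so.\<close>

lemma dir_term_L2D:
  assumes r: "dirs r" and h: "h : L2 D" "AE om in D. h om = dir_score r om" and i: "i < n"
  shows "dir_term r i : L2 (Ql i)"
proof -
  have m: "dir_term r i : bm (Ql i)" if i: "i < n" for i
  proof -
    interpret C: cluster_regular "nu i" "m i" \<mu> \<beta> \<theta> "f i" a b K by (rule reg[OF i])
    have "C.cov_vec (r i)" using r i by (simp add: dirs_def)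
    then show ?thesis unfolding dir_term_def[abs_def]
      by (intro borel_measurable_sum borel_measurable_times L2D(1)[OF C.err_score_L2]) (auto simp: C.cov_vec_def dest: L2D(1))
  qed
  have "dir_score r : bm D"
    unfolding dir_score_def lift_def[abs_def] by (intro borel_measurable_sum measurable_compose[OF comp_measurable m]) auto
  then have "lift (dir_term r) : L2 D" using L2_cong_AE[OF h(1) _ h(2)] by (simp add: dir_score_def)
  from lift_L2D[OF m this i] show ?thesis .
qed

text \<open>Along a path whose predictors move linearly, each residual has derivative -\<mu>' x, and
  the chain rule turns the logarithmic derivative of f into a combination of error scores. One
  computation covers paths in beta and in theta.\<close>

lemma dir_score_derivative:
  assumes mu: "!!t. (\<mu> has_real_derivative \<mu>' t) (at t)"
    and p: "!!s i j z. i < n ==> j < m i ==> predictor (\<beta>' s) (\<theta>' s) j z = predictor \<beta> \<theta> j z + s * x i j (fst z)"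
  shows "AE om in D. ((%s. loglik n m \<mu> (\<beta>' s) (\<theta>' s) f om) has_real_derivative
     dir_score (%i j c. \<mu>' (cluster_base.lin_pred \<beta> \<theta> c j) * x i j c) om) (at 0)"
  using AE_positive
proof eventually_elim
  case (elim om)
  let ?r = "%i j c. \<mu>' (cluster_base.lin_pred \<beta> \<theta> c j) * x i j c"
  have "((%s. ln (lik (m i) \<mu> (\<beta>' s) (\<theta>' s) (f i) (om i))) has_real_derivative dir_term ?r i (El i (om i))) (at 0)" if i': "i : {..<n}" for i
  proof -
    have i: "i < n" using i' by simp
    interpret C: cluster_regular "nu i" "m i" \<mu> \<beta> \<theta> "f i" a b K by (rule reg[OF i])
    let ?z = "om i" and ?c = "fst (om i)"
    have c: "?c : space (nu i)" and pos: "0 < f i ?c (resid (m i) \<mu> \<beta> \<theta> ?z)" using elim i by (auto simp: C.to_err_def)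
    define \<gamma> where "\<gamma> s j = obs_Y j ?z - \<mu> (predictor \<beta> \<theta> j ?z + s * x i j ?c)" for s j
    have "((%s. \<gamma> s j) has_real_derivative - ?r i j ?c) (at 0)" for j
    proof -
      have "((%s. predictor \<beta> \<theta> j ?z + s * x i j ?c) has_real_derivative x i j ?c) (at 0)" by (auto intro!: derivative_eq_intros)
      from DERIV_chain2[where g="%s. predictor \<beta> \<theta> j ?z + s * x i j ?c", OF mu this]
      show ?thesis unfolding \<gamma>_def by (auto intro!: derivative_eq_intros simp: C.predictor_lin_pred)
    qed
    from C1_fun_chain[OF C.f_C1[OF c], of \<gamma>, OF this]
    have "((%s. f i ?c (\<lambda>j\<in>{..<m i}. \<gamma> s j)) has_real_derivative
        (SUM j<m i. partial_deriv (f i ?c) j (\<lambda>j\<in>{..<m i}. \<gamma> 0 j) * - ?r i j ?c)) (at 0)" .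
    moreover have "(\<lambda>j\<in>{..<m i}. \<gamma> 0 j) = resid (m i) \<mu> \<beta> \<theta> ?z" by (simp add: \<gamma>_def resid_def)
    moreover have "f i ?c (\<lambda>j\<in>{..<m i}. \<gamma> s j) = lik (m i) \<mu> (\<beta>' s) (\<theta>' s) (f i) ?z" for s
      unfolding lik_def resid_def \<gamma>_def using p[OF i] by (intro arg_cong[where f="f i ?c"]) (auto simp: fun_eq_iff restrict_def)
    ultimately have d: "((%s. lik (m i) \<mu> (\<beta>' s) (\<theta>' s) (f i) ?z) has_real_derivative
        (SUM j<m i. partial_deriv (f i ?c) j (resid (m i) \<mu> \<beta> \<theta> ?z) * - ?r i j ?c)) (at 0)" by simp
    have l0: "lik (m i) \<mu> (\<beta>' 0) (\<theta>' 0) (f i) ?z = f i ?c (resid (m i) \<mu> \<beta> \<theta> ?z)"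
      unfolding lik_def resid_def using p[OF i, of _ 0] by (intro arg_cong[where f="f i ?c"]) (auto simp: fun_eq_iff restrict_def)
    have eq: "dir_term ?r i (El i ?z)
        = 1 / lik (m i) \<mu> (\<beta>' 0) (\<theta>' 0) (f i) ?z * (SUM j<m i. partial_deriv (f i ?c) j (resid (m i) \<mu> \<beta> \<theta> ?z) * - ?r i j ?c)"
      unfolding l0 by (simp add: dir_term_def C.err_score_def C.to_err_def sum_distrib_left sum_negf mult_ac)
    show ?thesis unfolding eq using pos l0 by (intro DERIV_chain2[OF DERIV_ln_divide d]) simp
  qed
  then show ?case unfolding loglik_def dir_score_def lift_def by (intro DERIV_sum) auto
qed

end

section \<open>Scores of the additive component\<close>

lemma additive_lin: "additive (%d t. psi d t + s * \<eta> d t) x = additive psi x + s * additive \<eta> x"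
  by (simp add: additive_def sum.distrib sum_distrib_left)

lemma (in cluster) cov_L2:
  assumes h: "h : bm nu"
  shows "(%z. h (fst z)) : L2 P \<longleftrightarrow> (%z. h (fst z)) : L2 Q" "l2norm P (%z. h (fst z)) = l2norm Q (%z. h (fst z))"
proof -
  have m: "(%z. (h (fst z))^2) : bm N" "(%z. h (fst z)) : bm N"
    using measurable_compose[OF measurable_fst h] by measurable
  show "(%z. h (fst z)) : L2 P \<longleftrightarrow> (%z. h (fst z)) : L2 Q"
    using P_integral(1)[OF m(1)] m(2) by (simp add: L2_def)
  show "l2norm P (%z. h (fst z)) = l2norm Q (%z. h (fst z))"
    using P_integral(2)[OF m(1)] by (simp add: l2norm_def)
qed

text \<open>Both remainders are orthogonal to the closure, which contains the two projections;
  expanding the squared distance of these shows that it is 0.\<close>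

lemma is_proj_AE_unique:
  assumes g: "is_proj M S a g" and g': "is_proj M S a g'" and S: "S \<subseteq> L2 M"
  shows "AE x in M. g x = g' x"
proof -
  have gc: "g : L2_closure M S" "g' : L2_closure M S"
    and o: "(%x. a x - g x) : orth M S" "(%x. a x - g' x) : orth M S"
    using g g' by (auto simp: is_proj_def)
  have L: "(%x. a x - g x) : L2 M" "(%x. a x - g' x) : L2 M" using o by (auto simp: orth_def)
  have gL: "g : L2 M" "g' : L2 M" using gc L2_closure_L2 by auto
  have oc: "(LINT x|M. (a x - k x) * w x) = 0" if "(%x. a x - k x) : orth M S" "w : L2_closure M S" for k w
    by (rule orth_L2_closure[OF _ _ that(2)]) (use that in \<open>auto simp: orth_def\<close>)
  have I: "integrable M (%x. (a x - k x) * w x)" if "(%x. a x - k x) : L2 M" "w : L2 M" for k w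
    using L2_mult_integrable[OF that] .
  have "(LINT x|M. (g x - g' x)^2)
      = (LINT x|M. ((a x - g' x) * g x - (a x - g x) * g x) - ((a x - g' x) * g' x - (a x - g x) * g' x))"
    by (intro bi_integral_cong refl) (simp add: power2_eq_square algebra_simps)
  also have "... = 0" using oc o gc I L gL by simp
  finally have "l2norm M (%x. g x - g' x) = 0" by (simp add: l2norm_def)
  then show ?thesis using l2norm_eq_0[OF L2_diff[OF gL]] by simp
qed

text \<open>The two choices of V are treated together. What the argument takes from V is that it is
  linear, closed in L2 and has a dense set of bounded members.\<close>

locale additive_clusters = clusters n m nu \<mu> \<beta> \<theta> f a b K
  for n m and nu :: "nat => ('k::finite, 'd::finite) covs measure" and \<mu> \<beta> \<theta> f a b K +
  fixes \<T> :: "'d => real set" and V :: "'d => (real => real) set" and cl cu c\<mu> C\<mu> \<delta> BX :: real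
  assumes cT: "!!d. compact (\<T> d)" and V: "V = (%d. L2_on (\<T> d)) \<or> V = (%d. L2_centred (\<T> d))"
    and carr: "!!i j d. i < n ==> j < m i ==> AE z in Pl i. obs_T j d z : \<T> d"
    and cl: "0 < cl" and cu: "cl <= cu"
    and single: "!!i j d. i < n ==> j < m i ==> EX p. distributed (Pl i) lborel (obs_T j d) p &
           (AE t in lborel. t : \<T> d --> ennreal cl <= p t & p t <= ennreal cu)"
    and pair: "!!i j d d'. i < n ==> j < m i ==> d ~= d' ==>
           EX p. distributed (Pl i) (lborel2) (%z. (obs_T j d z, obs_T j d' z)) p &
             (AE q in lborel2. q : \<T> d \<times> \<T> d' --> p q <= ennreal cu)"
    and mu: "!!t. (\<mu> has_real_derivative deriv \<mu> t) (at t)" and mu_cont: "continuous_on UNIV (deriv \<mu>)"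
    and c\<mu>: "0 < c\<mu>" and mu_lower: "!!t. c\<mu> <= deriv \<mu> t" and C\<mu>: "0 <= C\<mu>" and \<delta>: "0 < \<delta>"
    and mu_upper: "!!i j. i < n ==> j < m i ==> AE z in Pl i. ALL s. \<bar>s - predictor \<beta> \<theta> j z\<bar> <= \<delta> --> \<bar>deriv \<mu> s\<bar> <= C\<mu>"
    and X_bound: "!!i j k. i < n ==> j < m i ==> AE z in Pl i. \<bar>obs_X j z $ k\<bar> <= BX"
begin

definition psi_dir :: "('d => real => real) => nat => nat => ('k, 'd) covs => real" where
  "psi_dir psi i j c = deriv \<mu> (cluster_base.lin_pred \<beta> \<theta> c j) * additive psi (snd c j)"

definition X_dir :: "'k => nat => nat => ('k, 'd) covs => real" where
  "X_dir k i j c = deriv \<mu> (cluster_base.lin_pred \<beta> \<theta> c j) * fst c j $ k"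

lemma psi_dir_lin: "psi_dir (%d t. psi d t + s * \<eta> d t) = (%i j c. psi_dir psi i j c + s * psi_dir \<eta> i j c)"
  by (simp add: psi_dir_def additive_lin algebra_simps fun_eq_iff)

lemma T_borel: "\<T> d : sets borel" using compact_imp_closed[OF cT] by (rule borel_closed)

lemma leb_finite: "finite_measure (leb_on (\<T> d))" by (rule finite_leb_on[OF cT])

section \<open>The spaces of admissible perturbations\<close>

lemma V_L2: "psi : V d ==> psi : L2 (leb_on (\<T> d))"
  using V L2_leb_on[OF T_borel] L2_centred_eq[OF cT] by auto

lemma V_iff: "psi : V d \<longleftrightarrow> psi : L2 (leb_on (\<T> d)) & (V = (%d. L2_on (\<T> d)) \<or> (\<integral>x. psi x \<partial>leb_on (\<T> d)) = 0)"
proof (cases "V = (%d. L2_on (\<T> d))")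
  case True
  then show ?thesis by (simp add: L2_leb_on[OF T_borel])
next
  case False
  then have "V = (%d. L2_centred (\<T> d))" using V by blast
  then have "V d = L2_centred (\<T> d)" by simp
  then show ?thesis using False L2_centred_eq[OF cT] by simp
qed

lemma lin_V: "lin (V d)"
proof -
  interpret finite_measure "leb_on (\<T> d)" by (rule leb_finite)
  show ?thesis
    unfolding lin_def using L2_integrable by (auto simp: V_iff intro!: L2_add L2_cmult)
qed

lemma V_closed:
  assumes s: "!!n. s n : V d" and g: "g : L2 (leb_on (\<T> d))" and l: "(%n. l2norm (leb_on (\<T> d)) (%x. s n x - g x)) \<longlonglongrightarrow> 0"
  shows "g : V d"
proof -
  let ?M = "leb_on (\<T> d)"
  interpret finite_measure ?M by (rule leb_finite)
  have one: "(%_. 1) : L2 ?M" by (rule L2_bounded[of _ 1]) auto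
  have sL: "s n : L2 ?M" for n using V_L2[OF s] .
  have "(LINT x|?M. g x) = 0" if z: "!!n. (LINT x|?M. s n x) = 0"
  proof -
    have "\<bar>\<integral>x. g x \<partial>?M\<bar> <= l2norm ?M (%x. s n x - g x) * l2norm ?M (%_. 1)" for n
      using L2_Cauchy_Schwarz[OF L2_diff[OF sL g] one, of n] z[of n] L2_integrable[OF sL] L2_integrable[OF g] by simp
    moreover have "(%n. l2norm ?M (%x. s n x - g x) * l2norm ?M (%_. 1)) \<longlonglongrightarrow> 0 * l2norm ?M (%_. 1)"
      by (intro tendsto_mult l tendsto_const)
    ultimately have "\<bar>\<integral>x. g x \<partial>?M\<bar> <= 0" by (intro LIMSEQ_le_const[of _ 0]) auto
    then show ?thesis by simp
  qed
  then show ?thesis using s g unfolding V_iff by blast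
qed

text \<open>Truncation approximates psi by bounded functions. In the centred case the truncated
  function has a small mean, since psi has mean 0, and subtracting that mean returns to V.\<close>

lemma V_bounded_dense:
  assumes psi: "psi : V d" and e: "0 < ep"
  obtains \<eta> B where "\<eta> : V d" "!!t. \<bar>\<eta> t\<bar> <= B" "l2norm (leb_on (\<T> d)) (%t. psi t - \<eta> t) < ep"
proof -
  let ?M = "leb_on (\<T> d)"
  interpret finite_measure ?M by (rule leb_finite)
  have pL: "psi : L2 ?M" by (rule V_L2[OF psi])
  have pm [measurable]: "psi : bm borel" using L2D(1)[OF pL] by simp
  define tr where "tr n t = (if \<bar>psi t\<bar> <= real n then psi t else 0)" for n t
  have trm: "tr n : bm ?M" for n
  proof -
    have "(%x::real. if \<bar>x\<bar> <= real n then x else 0) : bm borel" by simp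
    from measurable_compose[OF L2D(1)[OF pL] this] show ?thesis unfolding tr_def .
  qed
  have trb: "\<bar>tr n t\<bar> <= real n" for n t by (simp add: tr_def)
  have trL: "tr n : L2 ?M" for n using trm trb by (intro L2_bounded[of _ "real n"]) auto
  have lim: "(%n. l2norm ?M (%t. tr n t - psi t)) \<longlonglongrightarrow> 0"
  proof (rule L2_dominated_tendsto(3)[OF pL trm])
    show "psi : bm ?M" by (rule L2D(1)[OF pL])
    show "AE t in ?M. (%n. tr n t) \<longlonglongrightarrow> psi t"
    proof (rule AE_I2)
      fix t
      obtain k :: nat where k: "\<bar>psi t\<bar> <= real k" using real_arch_simple by blast
      have "\<forall>\<^sub>F n in sequentially. tr n t = psi t" unfolding eventually_sequentially
        using k by (intro exI[of _ k]) (auto simp: tr_def)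
      then show "(%n. tr n t) \<longlonglongrightarrow> psi t" by (rule tendsto_eventually)
    qed
    show "AE t in ?M. \<bar>tr n t\<bar> <= \<bar>psi t\<bar>" for n by (intro AE_I2) (simp add: tr_def)
  qed
  define M where "M = measure ?M UNIV"
  define av where "av n = (if V = (%d. L2_on (\<T> d)) then 0 else (LINT t|?M. tr n t) / M)" for n
  have one: "(%_. 1) : L2 ?M" by (rule L2_bounded[of _ 1]) auto
  have int_const: "(LINT t|?M. x) = x * M" for x :: real by (simp add: M_def)
  have in_V: "(%t. tr n t - av n) : V d" for n
  proof -
    have "(LINT t|?M. tr n t - av n) = 0" if "V ~= (%d. L2_on (\<T> d))"
    \<comment> \<open>If the support is a Lebesgue null set, every integral over it is 0; otherwise
      \<open>av n\<close> is the mean of the truncated function.\<close>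
    proof (cases "M = 0")
      case True
      have "emeasure ?M (space ?M) = 0" using True by (simp add: M_def emeasure_eq_measure)
      then have "AE t in ?M. tr n t - av n = 0" by (intro AE_I[of _ _ "space ?M"]) auto
      then show ?thesis by (rule integral_eq_zero_AE)
    next
      case False
      then show ?thesis using that L2_integrable[OF trL] by (simp add: av_def M_def)
    qed
    moreover have "(%t. tr n t - av n) : L2 ?M" using L2_diff[OF trL L2_cmult[OF one, of "av n"]] by simp
    ultimately show ?thesis unfolding V_iff by blast
  qed
  have avn: "\<bar>av n\<bar> <= 1 / M * l2norm ?M (%_. 1) * l2norm ?M (%t. tr n t - psi t)" for n
  proof (cases "V = (%d. L2_on (\<T> d))")
    case False
    then have "(LINT t|?M. psi t) = 0" using psi unfolding V_iff by blast
    then have "(LINT t|?M. tr n t) = (LINT t|?M. (tr n t - psi t) * 1)"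
      using L2_integrable[OF trL] L2_integrable[OF pL] by simp
    then have "\<bar>\<integral>t. tr n t \<partial>?M\<bar> <= l2norm ?M (%t. tr n t - psi t) * l2norm ?M (%_. 1)"
      using L2_Cauchy_Schwarz[OF L2_diff[OF trL pL] one] by simp
    then have "\<bar>\<integral>t. tr n t \<partial>?M\<bar> / M <= (l2norm ?M (%t. tr n t - psi t) * l2norm ?M (%_. 1)) / M"
      by (intro divide_right_mono) (auto simp: M_def)
    then show ?thesis using False by (simp add: av_def M_def mult_ac)
  qed (simp add: av_def M_def)
  have le: "l2norm ?M (%t. psi t - (tr n t - av n)) <= (1 + 1 / M * l2norm ?M (%_. 1) * l2norm ?M (%_. 1)) * l2norm ?M (%t. tr n t - psi t)" for n
  proof -
    have "l2norm ?M (%t. psi t - (tr n t - av n)) = l2norm ?M (%t. (psi t - tr n t) + av n * 1)" by (simp add: algebra_simps)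
    also have "... <= l2norm ?M (%t. psi t - tr n t) + l2norm ?M (%t. av n * 1)"
      by (intro l2norm_triangle L2_diff pL trL L2_cmult one)
    also have "l2norm ?M (%t. psi t - tr n t) = l2norm ?M (%t. tr n t - psi t)" by (rule l2norm_minus_commute)
    also have "l2norm ?M (%t. av n * 1) = \<bar>av n\<bar> * l2norm ?M (%_. 1)" by (rule l2norm_cmult)
    also have "... <= (1 / M * l2norm ?M (%_. 1) * l2norm ?M (%t. tr n t - psi t)) * l2norm ?M (%_. 1)"
      by (intro mult_right_mono avn) simp
    finally show ?thesis by (simp add: algebra_simps)
  qed
  have "(%n. (1 + 1 / M * l2norm ?M (%_. 1) * l2norm ?M (%_. 1)) * l2norm ?M (%t. tr n t - psi t)) \<longlonglongrightarrow> 0"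
    using tendsto_mult[OF tendsto_const lim] by simp
  from LIMSEQ_D[OF this e] obtain k where "norm ((1 + 1 / M * l2norm ?M (%_. 1) * l2norm ?M (%_. 1)) * l2norm ?M (%t. tr k t - psi t) - 0) < ep" by blast
  then have "l2norm ?M (%t. psi t - (tr k t - av k)) < ep" using le[of k] by (simp only: diff_zero real_norm_def)
  moreover have "\<bar>tr k t - av k\<bar> <= real k + \<bar>av k\<bar>" for t using trb[of k t] by linarith
  ultimately show ?thesis using in_V that by blast
qed

section \<open>Square integrability of the directions in X and psi\<close>

lemma component_L2:
  assumes i: "i < n" "j < m i" and psi: "psi : L2 (leb_on (\<T> d))"
  shows "(%z. psi (snd (fst z) j $ d)) : L2 (Ql i)"
    "l2norm (Ql i) (%z. psi (snd (fst z) j $ d)) <= sqrt cu * l2norm (leb_on (\<T> d)) psi"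
    "(%c. psi (snd c j $ d)) : bm (nu i)"
proof -
  interpret C: cluster_regular "nu i" "m i" \<mu> \<beta> \<theta> "f i" a b K by (rule reg[OF i(1)])
  have "psi : bm borel" using L2D(1)[OF psi] by simp
  from measurable_compose[OF measurable_compose[OF C.T_measurable[OF i(2)] C.component_measurable] this]
  show M: "(%c. psi (snd c j $ d)) : bm (nu i)" .
  have Tm: "obs_T j d : bm (Pl i)" for d
    using single[OF i, of d] by (auto simp: distributed_def)
  note gar = additive_Garding[where T="obs_T j", OF C.P.prob_space_axioms cT Tm carr[OF i] cl cu single[OF i] pair[OF i]]
  have "(%z. psi (obs_T j d z)) : L2 (Pl i)" by (rule gar(1)[OF _ psi])
  then show "(%z. psi (snd (fst z) j $ d)) : L2 (Ql i)" using C.cov_L2(1)[OF M] by (simp add: obs_T_def)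
  have "l2norm (Pl i) (%z. psi (obs_T j d z)) <= sqrt cu * l2norm (leb_on (\<T> d)) psi" by (rule gar(2)[OF _ psi])
  then show "l2norm (Ql i) (%z. psi (snd (fst z) j $ d)) <= sqrt cu * l2norm (leb_on (\<T> d)) psi" using C.cov_L2(2)[OF M] by (simp add: obs_T_def)
qed

lemma deriv_mu_measurable:
  assumes i: "i < n" "j < m i" shows "(%c. deriv \<mu> (cluster_base.lin_pred \<beta> \<theta> c j)) : bm (nu i)"
proof -
  interpret C: cluster_regular "nu i" "m i" \<mu> \<beta> \<theta> "f i" a b K by (rule reg[OF i(1)])
  show ?thesis
    by (rule measurable_compose[OF C.lin_pred_measurable[OF C.theta_m i(2)] borel_measurable_continuous_onI[OF mu_cont]])
qed

lemma deriv_mu_bound: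
  assumes i: "i < n" "j < m i" shows "AE z in Ql i. \<bar>deriv \<mu> (cluster_base.lin_pred \<beta> \<theta> (fst z) j)\<bar> <= C\<mu>"
proof -
  interpret C: cluster_regular "nu i" "m i" \<mu> \<beta> \<theta> "f i" a b K by (rule reg[OF i(1)])
  have "AE z in Pl i. \<bar>deriv \<mu> (C.lin_pred \<beta> \<theta> (fst z) j)\<bar> <= C\<mu>"
    using mu_upper[OF i] by eventually_elim (use \<delta> in \<open>auto simp: C.predictor_lin_pred\<close>)
  then show ?thesis by (rule C.Q_AE_fst[of "%c. \<bar>deriv \<mu> (C.lin_pred \<beta> \<theta> c j)\<bar> <= C\<mu>"])
qed

text \<open>The derivative of the link lies between \<open>c\<mu>\<close> and \<open>C\<mu>\<close>
  at the true predictor, so multiplication by it is bounded above and below.\<close>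

lemma dir_L2:
  assumes i: "i < n" "j < m i" and h: "h : bm (nu i)" "(%z. h (fst z)) : L2 (Ql i)"
  defines "r \<equiv> %c. deriv \<mu> (cluster_base.lin_pred \<beta> \<theta> c j) * h c"
  shows "r : bm (nu i)" "(%z. r (fst z)) : L2 (Ql i)"
    "l2norm (Ql i) (%z. r (fst z)) <= C\<mu> * l2norm (Ql i) (%z. h (fst z))"
    "c\<mu> * l2norm (Ql i) (%z. h (fst z)) <= l2norm (Ql i) (%z. r (fst z))"
proof -
  interpret C: cluster_regular "nu i" "m i" \<mu> \<beta> \<theta> "f i" a b K by (rule reg[OF i(1)])
  show rm: "r : bm (nu i)" unfolding r_def by (intro borel_measurable_times deriv_mu_measurable i h)
  have rQ: "(%z. r (fst z)) : bm (Ql i)" by (rule C.cov_measurable[OF rm])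
  have ae: "AE z in Ql i. \<bar>r (fst z)\<bar> <= \<bar>C\<mu> * h (fst z)\<bar>"
    using deriv_mu_bound[OF i] by eventually_elim (auto simp: r_def abs_mult intro!: mult_right_mono)
  show rL: "(%z. r (fst z)) : L2 (Ql i)" by (rule L2_bound[OF L2_cmult[OF h(2)] rQ ae])
  show "l2norm (Ql i) (%z. r (fst z)) <= C\<mu> * l2norm (Ql i) (%z. h (fst z))"
    using l2norm_mono_AE[OF L2_cmult[OF h(2)] rQ ae] l2norm_cmult[of "Ql i" C\<mu> "%z. h (fst z)"] C\<mu> by simp
  have "AE z in Ql i. \<bar>c\<mu> * h (fst z)\<bar> <= \<bar>r (fst z)\<bar>"
  proof (rule AE_I2)
    fix z
    have "c\<mu> <= \<bar>deriv \<mu> (C.lin_pred \<beta> \<theta> (fst z) j)\<bar>" using mu_lower by (meson abs_ge_self order_trans)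
    then show "\<bar>c\<mu> * h (fst z)\<bar> <= \<bar>r (fst z)\<bar>" using c\<mu> by (auto simp: r_def abs_mult intro!: mult_right_mono)
  qed
  from l2norm_mono_AE[OF rL L2D(1)[OF L2_cmult[OF h(2)]] this]
  show "c\<mu> * l2norm (Ql i) (%z. h (fst z)) <= l2norm (Ql i) (%z. r (fst z))"
    using l2norm_cmult[of "Ql i" c\<mu> "%z. h (fst z)"] c\<mu> by simp
qed

lemma additive_L2:
  assumes i: "i < n" "j < m i" and psi: "!!d. psi d : L2 (leb_on (\<T> d))"
  shows "(%c. additive psi (snd c j)) : bm (nu i)" "(%z. additive psi (snd (fst z) j)) : L2 (Ql i)"
    "l2norm (Ql i) (%z. additive psi (snd (fst z) j)) <= sqrt cu * (SUM d:UNIV. l2norm (leb_on (\<T> d)) (psi d))"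
proof -
  note cl = component_L2[OF i psi]
  show "(%c. additive psi (snd c j)) : bm (nu i)" unfolding additive_def using cl(3) by (intro borel_measurable_sum) auto
  show "(%z. additive psi (snd (fst z) j)) : L2 (Ql i)" unfolding additive_def using cl(1) by (intro L2_sum) auto
  have "l2norm (Ql i) (%z. additive psi (snd (fst z) j)) <= (SUM d:UNIV. l2norm (Ql i) (%z. psi d (snd (fst z) j $ d)))"
    unfolding additive_def using cl(1) by (intro l2norm_sum_le) auto
  also have "... <= (SUM d:UNIV. sqrt cu * l2norm (leb_on (\<T> d)) (psi d))" using cl(2) by (intro sum_mono) auto
  finally show "l2norm (Ql i) (%z. additive psi (snd (fst z) j)) <= sqrt cu * (SUM d:UNIV. l2norm (leb_on (\<T> d)) (psi d))"
    by (simp add: sum_distrib_left)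
qed

lemma psi_dir_dirs: assumes psi: "!!d. psi d : L2 (leb_on (\<T> d))" shows "dirs (psi_dir psi)"
  unfolding dirs_def
proof (intro allI impI)
  fix i assume i: "i < n"
  interpret C: cluster_regular "nu i" "m i" \<mu> \<beta> \<theta> "f i" a b K by (rule reg[OF i])
  show "C.cov_vec (psi_dir psi i)"
    unfolding C.cov_vec_def psi_dir_def[abs_def] using dir_L2(1,2)[OF i _ additive_L2(1,2)[OF i _ psi]] by simp
qed

lemma X_dir_facts:
  assumes i: "i < n" "j < m i"
  shows "X_dir k i j : bm (nu i)" "(%z. X_dir k i j (fst z)) : L2 (Ql i)"
    "AE z in Ql i. \<bar>X_dir k i j (fst z)\<bar> <= C\<mu> * \<bar>BX\<bar>"
proof -
  interpret C: cluster_regular "nu i" "m i" \<mu> \<beta> \<theta> "f i" a b K by (rule reg[OF i(1)])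
  have Xm: "(%c. fst c j $ k) : bm (nu i)" by (rule measurable_compose[OF C.X_measurable[OF i(2)] C.component_measurable])
  have "AE z in Pl i. \<bar>fst (fst z) j $ k\<bar> <= BX" using X_bound[OF i, of k] by (simp add: obs_X_def)
  then have ae: "AE z in Ql i. \<bar>fst (fst z) j $ k\<bar> <= BX" by (rule C.Q_AE_fst[of "%c. \<bar>fst c j $ k\<bar> <= BX"])
  have XL: "(%z. fst (fst z) j $ k) : L2 (Ql i)"
    by (rule C.Q.L2_bounded[OF C.cov_measurable[OF Xm] ae])
  note d = dir_L2[OF i, where h="%c. fst c j $ k", OF Xm XL]
  show "X_dir k i j : bm (nu i)" "(%z. X_dir k i j (fst z)) : L2 (Ql i)"
    using d(1,2) by (simp_all add: X_dir_def[abs_def])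
  show "AE z in Ql i. \<bar>X_dir k i j (fst z)\<bar> <= C\<mu> * \<bar>BX\<bar>"
    using ae deriv_mu_bound[OF i] by eventually_elim (auto simp: X_dir_def abs_mult intro!: mult_mono C\<mu>)
qed

lemma X_dir_dirs: "dirs (X_dir k)"
  unfolding dirs_def
proof (intro allI impI)
  fix i assume i: "i < n"
  interpret C: cluster_regular "nu i" "m i" \<mu> \<beta> \<theta> "f i" a b K by (rule reg[OF i])
  show "C.cov_vec (X_dir k i)" unfolding C.cov_vec_def using X_dir_facts(1,2)[OF i] by simp
qed

text \<open>An error score is only known to be square integrable, so its product with an unbounded
  covariate factor may leave L2; boundedness of the direction prevents this.\<close>

lemma bounded_dir_term:
  assumes r: "dirs r" and bd: "!!j. j < m i ==> AE z in Ql i. \<bar>r i j (fst z)\<bar> <= M" and i: "i < n"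
  shows "dir_term r i : L2 (Ql i)"
proof -
  interpret C: cluster_regular "nu i" "m i" \<mu> \<beta> \<theta> "f i" a b K by (rule reg[OF i])
  have cv: "C.cov_vec (r i)" using r i by (simp add: dirs_def)
  have "(%z. r i j (fst z) * C.err_score j z) : L2 (Ql i)" if j: "j < m i" for j
  proof (rule L2_bound[OF L2_cmult[OF C.err_score_L2[OF j], of M]])
    show "(%z. r i j (fst z) * C.err_score j z) : bm (Ql i)"
      using cv j by (intro borel_measurable_times L2D(1)[OF C.err_score_L2[OF j]] C.cov_measurable) (simp add: C.cov_vec_def)
    show "AE z in Ql i. \<bar>r i j (fst z) * C.err_score j z\<bar> <= \<bar>M * C.err_score j z\<bar>"
      using bd[OF j] by eventually_elim (auto simp: abs_mult intro!: mult_right_mono)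
  qed
  then show ?thesis unfolding dir_term_def[abs_def] by (intro L2_sum) auto
qed

text \<open>The regressors are bounded, so the derivative of the log-likelihood is square integrable
  and the choice in \<open>beta_score\<close> has a witness. Scores along the same path agree almost
  everywhere.\<close>

lemma beta_score:
  "beta_score n m nu \<mu> \<beta> \<theta> f k : L2 D" "AE om in D. beta_score n m nu \<mu> \<beta> \<theta> f k om = dir_score (X_dir k) om"
proof -
  let ?L = "%s. loglik n m \<mu> (\<beta> + s *\<^sub>R axis k 1) \<theta> f"
  have L: "dir_term (X_dir k) i : L2 (Ql i)" if "i < n" for i
    using bounded_dir_term[OF X_dir_dirs X_dir_facts(3)[OF that] that] by blast
  have "predictor (\<beta> + s *\<^sub>R axis k 1) \<theta> j z = predictor \<beta> \<theta> j z + s * fst (fst z) j $ k" for s j z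
    by (simp add: predictor_def obs_X_def inner_add_right inner_axis)
  from dir_score_derivative[OF mu, where \<beta>'="%s. \<beta> + s *\<^sub>R axis k 1" and \<theta>'="%_. \<theta>" and x="%i j c. fst c j $ k", OF this]
  have d: "AE om in D. ((%s. ?L s om) has_real_derivative dir_score (X_dir k) om) (at 0)"
    by (simp add: X_dir_def[abs_def])
  have "score_along D ?L (dir_score (X_dir k))"
    unfolding score_along_def using d lift_L2(1)[OF L] by (simp add: dir_score_def)
  then have s: "score_along D ?L (beta_score n m nu \<mu> \<beta> \<theta> f k)"
    unfolding beta_score_def by (rule someI[of "score_along D ?L"])
  then show "beta_score n m nu \<mu> \<beta> \<theta> f k : L2 D" by (simp add: score_along_def)
  show "AE om in D. beta_score n m nu \<mu> \<beta> \<theta> f k om = dir_score (X_dir k) om" by (rule score_along_unique[OF s d])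
qed

lemma theta_derivative:
  "AE om in D. ((%s. loglik n m \<mu> \<beta> (%d t. \<theta> d t + s * psi d t) f om) has_real_derivative dir_score (psi_dir psi) om) (at 0)"
proof -
  have "predictor \<beta> (%d t. \<theta> d t + s * psi d t) j z = predictor \<beta> \<theta> j z + s * additive psi (snd (fst z) j)" for s j z
    by (simp add: predictor_def additive_lin)
  from dir_score_derivative[OF mu, where \<beta>'="%_. \<beta>" and \<theta>'="%s d t. \<theta> d t + s * psi d t" and x="%i j c. additive psi (snd c j)", OF this]
  show ?thesis by (simp add: psi_dir_def[abs_def])
qed

lemma theta_scores_subset:
  assumes "g : theta_scores n m nu \<mu> \<beta> \<theta> f V"
  shows "g : L2 D & (EX psi. (ALL d. psi d : V d) & (AE om in D. g om = dir_score (psi_dir psi) om))"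
proof -
  obtain psi where psi: "ALL d. psi d : V d" and s: "score_along D (%s. loglik n m \<mu> \<beta> (%d t. \<theta> d t + s * psi d t) f) g"
    using assms unfolding theta_scores_def by blast
  have "AE om in D. g om = dir_score (psi_dir psi) om" by (rule score_along_unique[OF s theta_derivative])
  then show ?thesis using psi s by (auto simp: score_along_def)
qed

text \<open>The error law does not change along theta + s psi, so most of the model conditions
  persist. What has to be checked is that \<mu> of the moved predictor stays integrable; for bounded
  psi and small s the predictor moves by at most \<delta>, where the derivative of \<mu> is
  bounded.\<close>

lemma bounded_theta_score:
  assumes psi: "!!d. psi d : V d" and bd: "!!d t. \<bar>psi d t\<bar> <= M"
  shows "dir_score (psi_dir psi) : theta_scores n m nu \<mu> \<beta> \<theta> f V" "dir_score (psi_dir psi) : L2 D"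
    "!!i. i < n ==> dir_term (psi_dir psi) i : L2 (Ql i)"
proof -
  have pL: "psi d : L2 (leb_on (\<T> d))" for d by (rule V_L2[OF psi])
  define S where "S = real CARD('d) * M"
  have M0: "0 <= M" using bd[of undefined 0] by linarith
  have S0: "0 <= S" using M0 by (simp add: S_def)
  have aS: "\<bar>additive psi x\<bar> <= S" for x
  proof -
    have "\<bar>additive psi x\<bar> <= (SUM d:UNIV. \<bar>psi d (x $ d)\<bar>)" unfolding additive_def by (rule sum_abs)
    also have "... <= (SUM d:(UNIV :: 'd set). M)" by (intro sum_mono bd)
    finally show ?thesis by (simp add: S_def)
  qed
  show L: "dir_term (psi_dir psi) i : L2 (Ql i)" if i: "i < n" for i
  proof (rule bounded_dir_term[OF psi_dir_dirs[OF pL] _ i, where M="C\<mu> * S"])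
    fix j assume j: "j < m i"
    show "AE z in Ql i. \<bar>psi_dir psi i j (fst z)\<bar> <= C\<mu> * S"
      using deriv_mu_bound[OF i j] by eventually_elim (auto simp: psi_dir_def abs_mult intro!: mult_mono C\<mu> aS)
  qed
  show dL: "dir_score (psi_dir psi) : L2 D" unfolding dir_score_def by (rule lift_L2(1)[OF L])
  \<comment> \<open>The additive function is at most S in modulus, so |s| < ep moves every predictor
    by at most \<delta>; the summand 1 avoids division by zero.\<close>
  define ep where "ep = \<delta> / (S + 1)"
  have e: "0 < ep" using \<delta> S0 by (simp add: ep_def)
  have model: "in_model (nu i) (m i) \<mu> \<beta> (%d t. \<theta> d t + s * psi d t) (f i)" if s: "\<bar>s\<bar> < ep" and i: "i < n" for s i
  proof -
    interpret C: cluster_regular "nu i" "m i" \<mu> \<beta> \<theta> "f i" a b K by (rule reg[OF i])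
    have pm: "psi d : bm borel" for d using L2D(1)[OF pL] by simp
    have thM: "(%t. \<theta> d t + s * psi d t) : bm borel" for d
      by (intro borel_measurable_add borel_measurable_times C.theta_m pm) simp
    have sS: "\<bar>s\<bar> * S <= \<delta>"
    proof -
      have "\<bar>s\<bar> * S <= ep * (S + 1)" using s S0 by (intro mult_mono) auto
      also have "... = \<delta>" using S0 by (simp add: ep_def)
      finally show ?thesis .
    qed
    show ?thesis
    proof (rule C.in_modelI[OF thM C.fm C.f_nonneg C.f_C1])
      show "EX B. ALL c:space (nu i). ALL e:errs (m i). f i c e <= B" by (rule C.in_modelD(4)[OF C.model])
      show "((%v. f i c (e(j := v))) \<longlongrightarrow> 0) at_infinity" if "c : space (nu i)" "e : errs (m i)" "j < m i" for c e j
        by (rule C.in_modelD(5)[OF C.model that])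
      show "prob_space (Ql i)" by unfold_locales
      show "integrable (Ql i) (%z. snd z j)" if "j < m i" for j by (rule C.e_integrable[OF that])
      show "(LINT z|Ql i. indicator A (fst z) * snd z j) = 0" if "j < m i" "A : sets (nu i)" for j A
        by (rule C.in_model_errors(4)[OF C.theta_m C.model that(1), of _ 1]) (use that in \<open>auto split: split_indicator\<close>)
      fix j assume j: "j < m i"
      have eq: "C.lin_pred \<beta> (%d t. \<theta> d t + s * psi d t) c j = C.lin_pred \<beta> \<theta> c j + s * additive psi (snd c j)" for c
        by (simp add: C.lin_pred_def additive_lin)
      have "AE z in Pl i. ALL t. \<bar>t - C.lin_pred \<beta> \<theta> (fst z) j\<bar> <= \<delta> --> \<bar>deriv \<mu> t\<bar> <= C\<mu>"
        using mu_upper[OF i j] by (simp add: C.predictor_lin_pred)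
      then have ae: "AE z in Ql i. ALL t. \<bar>t - C.lin_pred \<beta> \<theta> (fst z) j\<bar> <= \<delta> --> \<bar>deriv \<mu> t\<bar> <= C\<mu>"
        by (rule C.Q_AE_fst[of "%c. ALL t. \<bar>t - C.lin_pred \<beta> \<theta> c j\<bar> <= \<delta> --> \<bar>deriv \<mu> t\<bar> <= C\<mu>"])
      show "integrable (Ql i) (%z. \<mu> (C.lin_pred \<beta> (%d t. \<theta> d t + s * psi d t) (fst z) j))"
      proof (rule bi_integrable_bound)
        show "integrable (Ql i) (%z. \<bar>\<mu> (C.lin_pred \<beta> \<theta> (fst z) j)\<bar> + C\<mu> * \<delta>)"
          using C.mu_integrable[OF j] by simp
        show "(%z. \<mu> (C.lin_pred \<beta> (%d t. \<theta> d t + s * psi d t) (fst z) j)) : bm (Ql i)"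
          by (rule C.cov_measurable[OF C.mu_lin_pred_measurable[OF thM j]])
        show "AE z in Ql i. norm (\<mu> (C.lin_pred \<beta> (%d t. \<theta> d t + s * psi d t) (fst z) j)) <= norm (\<bar>\<mu> (C.lin_pred \<beta> \<theta> (fst z) j)\<bar> + C\<mu> * \<delta>)"
          using ae
        proof eventually_elim
          case (elim z)
          let ?x = "C.lin_pred \<beta> \<theta> (fst z) j" and ?y = "C.lin_pred \<beta> (%d t. \<theta> d t + s * psi d t) (fst z) j"
          have "\<bar>?y - ?x\<bar> <= \<bar>s\<bar> * S" unfolding eq using aS by (auto simp: abs_mult intro!: mult_left_mono)
          then have yx: "\<bar>?y - ?x\<bar> <= \<delta>" using sS by linarith
          have "norm (\<mu> ?y - \<mu> ?x) <= C\<mu> * norm (?y - ?x)"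
          proof (rule field_differentiable_bound[of "cball ?x \<delta>"])
            show "(\<mu> has_field_derivative deriv \<mu> t) (at t within cball ?x \<delta>)" for t
              using mu[of t] by (rule has_field_derivative_at_within)
            show "norm (deriv \<mu> t) <= C\<mu>" if "t : cball ?x \<delta>" for t
              using elim that by (simp add: dist_real_def abs_minus_commute)
          qed (use yx \<delta> in \<open>auto simp: dist_real_def abs_minus_commute\<close>)
          also have "... <= C\<mu> * \<delta>" using yx C\<mu> by (intro mult_left_mono) auto
          finally have "\<bar>\<mu> ?y\<bar> <= \<bar>\<mu> ?x\<bar> + C\<mu> * \<delta>" by (simp only: real_norm_def)
          moreover have "0 <= C\<mu> * \<delta>" using C\<mu> \<delta> by simp
          ultimately show ?case by simp
        qed
      qed
    qed
  qed
  have "score_along D (%s. loglik n m \<mu> \<beta> (%d t. \<theta> d t + s * psi d t) f) (dir_score (psi_dir psi))"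
    unfolding score_along_def using dL theta_derivative by blast
  then show "dir_score (psi_dir psi) : theta_scores n m nu \<mu> \<beta> \<theta> f V"
    unfolding theta_scores_def mem_Collect_eq using e model psi by (intro exI[of _ psi] exI[of _ ep] conjI) auto
qed

end

lemma mat_diag_vec:
  fixes w :: "nat => real"
  shows "mat_diag m D *\<^sub>v Matrix.vec m w = Matrix.vec m (%j. D j * w j)"
proof (rule eq_vecI)
  show "vec_index (mat_diag m D *\<^sub>v Matrix.vec m w) j = vec_index (Matrix.vec m (%j. D j * w j)) j"
    if "j < dim_vec (Matrix.vec m (%j. D j * w j))" for j
    using that by (simp add: scalar_prod_def mat_diag_def if_distrib[of "%x. x * _"] sum.delta' cong: if_cong)
qed (simp add: mat_diag_def)

lemma scalar_prod_mat_diag: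
  "scalar_prod (Matrix.vec m x) (mat_diag m D *\<^sub>v (gmat m G *\<^sub>v Matrix.vec m e)) = bform m G (%j. x j * D j) e"
  unfolding gmat_mult_vec mat_diag_vec bform_apply by (simp add: scalar_prod_def atLeast0LessThan mult.assoc)

text \<open>Off the support every point has an open null neighbourhood, and by the Lindelof property
  countably many of these cover the complement.\<close>

lemma measure_support_AE:
  assumes M: "sets M = sets borel" shows "AE x in M. x : measure_support M"
proof -
  define F where "F = {U :: real set. open U & emeasure M U = 0}"
  obtain F' where F': "F' \<subseteq> F" "countable F'" "\<Union>F' = \<Union>F" using Lindelof[of F] by (auto simp: F_def)
  have "(\<Union>U\<in>F'. U) : null_sets M"
    using F' M by (intro null_sets_UN') (auto simp: F_def null_sets_def)
  then have "AE x in M. x \<notin> \<Union>F" using F'(3) AE_not_in by force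
  then show ?thesis by eventually_elim (auto simp: measure_support_def F_def)
qed

section \<open>The operator from additive functions to efficient scores\<close>

context additive_clusters
begin

text \<open>A tuple of component functions is encoded as one function on pairs, so that the results
  on seminorms of function spaces apply.\<close>

definition H :: "('d \<times> real => real) set" where "H = {phi. ALL d. curry phi d : V d}"

definition A :: "('d \<times> real => real) => (nat => ('k, 'd) obs) => real" where "A phi = eff_score (psi_dir (curry phi))"

definition pen :: "('d \<times> real => real) => real" where "pen phi = (SUM d:UNIV. l2norm (leb_on (\<T> d)) (curry phi d))"

lemma curry_lin: "curry (%x. phi x + s * \<eta> x) = (%d t. curry phi d t + s * curry \<eta> d t)"
  by (simp add: curry_def)

lemma H_L2: "phi : H ==> curry phi d : L2 (leb_on (\<T> d))" using V_L2 by (auto simp: H_def)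

lemma H_D: "phi : H ==> curry phi d : V d" unfolding H_def by blast

lemma lin_H: "lin H"
  unfolding lin_def
proof (intro conjI ballI allI)
  show "(%_. 0) : H" using linD(1)[OF lin_V] by (auto simp: H_def curry_def)
  fix phi \<eta> s assume "phi : H" "\<eta> : H"
  then have "(%t. curry phi d t + s * curry \<eta> d t) : V d" for d by (intro linD(2)[OF lin_V] H_D)
  then show "(%x. phi x + s * \<eta> x) : H" unfolding H_def mem_Collect_eq curry_lin by blast
qed

lemma A_lin: "A (%x. phi x + s * \<eta> x) = (%om. A phi om + s * A \<eta> om)"
  unfolding A_def curry_lin psi_dir_lin by (rule ext) (rule eff_score_lin)

lemma A_diff: "A (%x. phi x - \<eta> x) = (%om. A phi om - A \<eta> om)"
  using A_lin[of phi "- 1" \<eta>] by simp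

lemma A_dirs: "phi : H ==> dirs (psi_dir (curry phi))" by (intro psi_dir_dirs H_L2)

lemma A_L2: "phi : H ==> A phi : L2 D" unfolding A_def by (intro eff_score_L2 A_dirs)

lemma A_bound: "EX M>=0. ALL phi:H. l2norm D (A phi) <= M * pen phi"
proof -
  define M where "M = (SUM i<n. real (m i) * (K * (1 / a)) * (real (m i) * (C\<mu> * sqrt cu)))"
  have cu0: "0 <= sqrt cu" using cl cu by simp
  have nn: "0 <= real (m i) * (K * (1 / a))" if i: "i < n" for i
  proof -
    interpret C: cluster_regular "nu i" "m i" \<mu> \<beta> \<theta> "f i" a b K by (rule reg[OF i])
    show ?thesis using C.K C.a by simp
  qed
  have "0 <= M" unfolding M_def using cu0 C\<mu> by (intro sum_nonneg mult_nonneg_nonneg[OF nn] mult_nonneg_nonneg) auto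
  moreover have "l2norm D (A phi) <= M * pen phi" if phi: "phi : H" for phi
  proof -
    note r = A_dirs[OF phi]
    have "l2norm D (A phi) <= (SUM i<n. l2norm (Ql i) (eff i (psi_dir (curry phi) i)))"
      unfolding A_def eff_score_def by (intro lift_L2 eff_L2 r)
    also have "... <= (SUM i<n. real (m i) * (K * (1 / a)) * (real (m i) * (C\<mu> * sqrt cu)) * pen phi)"
    proof (rule sum_mono)
      fix i assume "i : {..<n}"
      then have i: "i < n" by simp
      have j: "l2norm (Ql i) (%z. psi_dir (curry phi) i j (fst z)) <= C\<mu> * sqrt cu * pen phi" if j: "j < m i" for j
      proof -
        have "l2norm (Ql i) (%z. psi_dir (curry phi) i j (fst z)) <= C\<mu> * l2norm (Ql i) (%z. additive (curry phi) (snd (fst z) j))"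
          unfolding psi_dir_def by (rule dir_L2(3)[OF i j additive_L2(1,2)[OF i j H_L2[OF phi]]])
        also have "... <= C\<mu> * (sqrt cu * pen phi)"
          unfolding pen_def by (intro mult_left_mono C\<mu> additive_L2(3)[OF i j H_L2[OF phi]])
        finally show ?thesis by simp
      qed
      have "l2norm (Ql i) (eff i (psi_dir (curry phi) i)) <= real (m i) * (K * (1 / a)) * (SUM j<m i. l2norm (Ql i) (%z. psi_dir (curry phi) i j (fst z)))"
        by (rule eff_L2(3)[OF r i])
      also have "... <= real (m i) * (K * (1 / a)) * (SUM j<m i. C\<mu> * sqrt cu * pen phi)"
        by (intro mult_left_mono sum_mono j nn i) auto
      finally show "l2norm (Ql i) (eff i (psi_dir (curry phi) i)) <= real (m i) * (K * (1 / a)) * (real (m i) * (C\<mu> * sqrt cu)) * pen phi"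
        by (simp add: mult_ac)
    qed
    finally show ?thesis by (simp add: M_def sum_distrib_right)
  qed
  ultimately show ?thesis by blast
qed

lemma pen_seminorm: "seminorm_on H pen"
  unfolding seminorm_on_def
proof (intro conjI ballI allI)
  show "0 <= pen phi" for phi unfolding pen_def by (intro sum_nonneg) auto
  show "pen (%x. phi x + \<eta> x) <= pen phi + pen \<eta>" if "phi : H" "\<eta> : H" for phi \<eta>
    unfolding pen_def sum.distrib[symmetric] using l2norm_triangle[OF H_L2[OF that(1)] H_L2[OF that(2)]]
    by (intro sum_mono) (simp add: curry_def)
  show "pen (%x. s * phi x) = \<bar>s\<bar> * pen phi" for phi s
    unfolding pen_def sum_distrib_left by (intro sum.cong refl) (simp add: curry_def l2norm_cmult)
qed

lemma A_seminorm: "seminorm_on H (%phi. l2norm D (A phi))"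
  unfolding seminorm_on_def
proof (intro conjI ballI allI)
  show "l2norm D (A (%x. phi x + \<eta> x)) <= l2norm D (A phi) + l2norm D (A \<eta>)" if "phi : H" "\<eta> : H" for phi \<eta>
    using A_lin[of phi 1 \<eta>] l2norm_triangle[OF A_L2[OF that(1)] A_L2[OF that(2)]] by simp
  show "l2norm D (A (%x. s * phi x)) = \<bar>s\<bar> * l2norm D (A phi)" for phi s
  proof -
    have "A (%x. 0) = (%om. 0)" using A_lin[of phi "- 1" phi] by simp
    then have "A (%x. s * phi x) = (%om. s * A phi om)" using A_lin[of "%x. 0" s phi] by simp
    then show ?thesis by (simp add: l2norm_cmult)
  qed
qed simp

lemma pen_complete: "complete_for H pen"
  unfolding complete_for_def
proof (intro allI impI)
  fix u assume u: "ALL n. u n : H" and cau: "cauchy_for pen u"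
  have uL: "curry (u n) d : L2 (leb_on (\<T> d))" for n d using u H_L2 by blast
  define Pr where "Pr d g \<longleftrightarrow> g : L2 (leb_on (\<T> d)) & (%n. l2norm (leb_on (\<T> d)) (%x. curry (u n) d x - g x)) \<longlonglongrightarrow> 0" for d g
  have "EX g. Pr d g" for d
  proof -
    have "EX N. ALL m>=N. ALL n>=N. l2norm (leb_on (\<T> d)) (%x. curry (u m) d x - curry (u n) d x) < ep" if e: "ep > 0" for ep
    proof -
      obtain N where N: "ALL m>=N. ALL n>=N. pen (%x. u m x - u n x) < ep" using cau e unfolding cauchy_for_def by blast
      have le: "l2norm (leb_on (\<T> d)) (%x. curry (u m) d x - curry (u n) d x) <= pen (%x. u m x - u n x)" for m n
        unfolding pen_def curry_def by (intro member_le_sum[of d UNIV "%d. l2norm (leb_on (\<T> d)) (%x. u m (d, x) - u n (d, x))"]) auto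
      show ?thesis
      proof (intro exI allI impI)
        show "l2norm (leb_on (\<T> d)) (%x. curry (u m) d x - curry (u n) d x) < ep" if "N <= m" "N <= n" for m n
          using le[of m n] N[rule_format, OF that] by linarith
      qed
    qed
    from L2_complete[of "%n. curry (u n) d" "leb_on (\<T> d)", OF uL this] show ?thesis unfolding Pr_def by blast
  qed
  then obtain g where "!!d. Pr d (g d)" by metis
  then have g: "!!d. g d : L2 (leb_on (\<T> d))" "!!d. (%n. l2norm (leb_on (\<T> d)) (%x. curry (u n) d x - g d x)) \<longlonglongrightarrow> 0"
    unfolding Pr_def by blast+
  have uV: "curry (u n) d : V d" for n d using u by (simp add: H_def)
  have "g d : V d" for d by (rule V_closed[OF uV g(1) g(2)])
  then have "case_prod g : H" by (simp add: H_def)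
  moreover have "(%n. pen (%x. u n x - case_prod g x)) \<longlonglongrightarrow> 0"
    using tendsto_sum[of UNIV, OF g(2)] by (simp add: pen_def curry_def)
  ultimately show "EX g:H. (%n. pen (%x. u n x - g x)) \<longlonglongrightarrow> 0" by blast
qed

text \<open>One observation of one cluster is enough. By \<open>eff_score_lower\<close> and the
  lower bound on the link derivative, the efficient score controls the additive function of its
  covariates, and \<open>additive_Garding\<close> then controls the components up to finitely many
  integrals.\<close>

lemma A_coercive:
  assumes i: "i < n" "j < m i"
  shows "EX F M. finite F & F \<subseteq> UNIV \<times> sets borel & 0 <= M & (ALL phi:H.
    pen phi <= M * (l2norm D (A phi) + (\<Sum>(d, B)\<in>F. aint (leb_on (\<T> d)) B (%x. phi (d, x)))))"
proof -
  interpret C: cluster_regular "nu i" "m i" \<mu> \<beta> \<theta> "f i" a b K by (rule reg[OF i(1)])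
  have Tm: "obs_T j d : bm (Pl i)" for d
    using single[OF i, of d] by (auto simp: distributed_def)
  note gar = additive_Garding(3)[where T="obs_T j", OF C.P.prob_space_axioms cT Tm carr[OF i] cl cu single[OF i] pair[OF i]]
  then obtain F M where F: "finite F" "F \<subseteq> UNIV \<times> sets borel" "0 <= M"
    and G: "ALL psi. (ALL d. psi d : L2 (leb_on (\<T> d))) --> (SUM d:UNIV. l2norm (leb_on (\<T> d)) (psi d)) <= M * (l2norm (Pl i) (%z. SUM d:UNIV. psi d (obs_T j d z))
          + (\<Sum>(d, B)\<in>F. aint (leb_on (\<T> d)) B (psi d)))" by auto
  \<comment> \<open>At least 1, so that the factor can be put in front of the integrals over sets as
    well.\<close>
  define M' where "M' = max 1 (sqrt b / c\<mu>)"
  have "pen phi <= M * M' * (l2norm D (A phi) + (\<Sum>(d, B)\<in>F. aint (leb_on (\<T> d)) B (%x. phi (d, x))))" if phi: "phi : H" for phi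
  proof -
    let ?S = "\<Sum>(d, B)\<in>F. aint (leb_on (\<T> d)) B (%x. phi (d, x))"
    note al = additive_L2[OF i H_L2[OF phi]]
    have "c\<mu> * l2norm (Ql i) (%z. additive (curry phi) (snd (fst z) j)) <= l2norm (Ql i) (%z. psi_dir (curry phi) i j (fst z))"
      unfolding psi_dir_def by (rule dir_L2(4)[OF i al(1,2)])
    also have "... <= sqrt b * l2norm D (A phi)" unfolding A_def by (rule eff_score_lower[OF A_dirs[OF phi] i])
    finally have "l2norm (Ql i) (%z. additive (curry phi) (snd (fst z) j)) <= sqrt b / c\<mu> * l2norm D (A phi)"
      using c\<mu> by (simp add: field_simps)
    also have "... <= M' * l2norm D (A phi)" by (intro mult_right_mono) (auto simp: M'_def)
    finally have le: "l2norm (Pl i) (%z. SUM d:UNIV. curry phi d (obs_T j d z)) <= M' * l2norm D (A phi)"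
      using C.cov_L2(2)[OF al(1)] by (simp add: additive_def obs_T_def)
    have S0: "0 <= ?S" by (intro sum_nonneg) auto
    have "pen phi <= M * (l2norm (Pl i) (%z. SUM d:UNIV. curry phi d (obs_T j d z)) + ?S)"
      using G[THEN spec, of "curry phi"] H_L2[OF phi] by (simp add: pen_def curry_def)
    also have "... <= M * (M' * l2norm D (A phi) + M' * ?S)"
      using le mult_right_mono[of 1 M' ?S] S0 F(3) by (intro mult_left_mono add_mono) (auto simp: M'_def)
    finally show ?thesis by (simp add: algebra_simps)
  qed
  moreover have "0 <= M * M'" using F(3) by (simp add: M'_def)
  ultimately show ?thesis using F(1,2) by (intro exI[of _ F] exI[of _ "M * M'"] conjI ballI)
qed

text \<open>The coercivity bound holds modulo integrals over finitely many sets, and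
  \<open>complete_mod_functionals\<close> removes these. Completeness in the seminorm given by the
  norm of A phi amounts to closedness of the range, whether or not A is injective.\<close>

theorem A_complete: "complete_for H (%phi. l2norm D (A phi))"
proof (cases "EX i<n. 0 < m i")
  \<comment> \<open>Without observations A is 0, and every sequence converges in the
    seminorm.\<close>
  case False
  have "A phi = (%om. 0)" for phi
  proof
    fix om
    have "eff i r z = 0" if i: "i < n" for i r z
    proof -
      interpret C: cluster_regular "nu i" "m i" \<mu> \<beta> \<theta> "f i" a b K by (rule reg[OF i])
      have "m i = 0" using False i by simp
      then show ?thesis unfolding C.eff_def by simp
    qed
    then show "A phi om = 0" by (simp add: A_def eff_score_def lift_def)
  qed
  then show ?thesis using linD(1)[OF lin_H] by (auto simp: complete_for_def)
next
  case True
  then obtain i where i: "i < n" "0 < m i" by blast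
  obtain F M where F: "finite F" "F \<subseteq> UNIV \<times> sets borel" "0 <= M"
    and co: "ALL phi:H. pen phi <= M * (l2norm D (A phi) + (\<Sum>(d, B)\<in>F. aint (leb_on (\<T> d)) B (%x. phi (d, x))))"
    using A_coercive[OF i] by (elim exE conjE) (rule that, assumption+)
  obtain Fs where Fs: "set Fs = F" "distinct Fs" using finite_distinct_list[OF F(1)] by blast
  define fn where "fn = (%(d, B) (phi :: 'd \<times> real => real). \<integral>x. indicator B x * phi (d, x) \<partial>leb_on (\<T> d))"
  obtain Mq where Mq: "0 <= Mq" "ALL phi:H. l2norm D (A phi) <= Mq * pen phi" using A_bound by blast
  \<comment> \<open>This bounds the norm of an indicator in any component, hence by Cauchy-Schwarz
    every functional in terms of \<open>pen\<close>.\<close>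
  define M1 where "M1 = (SUM d:UNIV. l2norm (leb_on (\<T> d)) (%_. 1))"
  have M1: "0 <= M1" unfolding M1_def by (intro sum_nonneg) auto
  have pen0: "0 <= pen phi" for phi unfolding pen_def by (intro sum_nonneg) auto
  have ind: "(indicator B :: real => real) : L2 (leb_on (\<T> d))" if "B : sets borel" for B d
    using that by (intro finite_measure.L2_bounded[OF leb_finite, where B=1] borel_measurable_indicator AE_I2) (auto split: split_indicator)
  have fn_lin: "linear_on H l" and fn_bound: "!!phi. phi : H ==> \<bar>l phi\<bar> <= (Mq + M1) * pen phi" if l: "l : set (map fn Fs)" for l
  proof -
    obtain d B where dB: "l = fn (d, B)" "B : sets borel" using l Fs F by auto
    let ?M = "leb_on (\<T> d)"
    have I: "integrable ?M (%x. indicator B x * phi (d, x))" if "phi : H" for phi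
      using L2_mult_integrable[OF ind[OF dB(2)] H_L2[OF that, of d]] by (simp add: curry_def)
    show "linear_on H l"
      unfolding linear_on_def dB(1) fn_def
      using I by (auto simp: distrib_left mult.left_commute[of "indicator B _"])
    show "\<bar>l phi\<bar> <= (Mq + M1) * pen phi" if phi: "phi : H" for phi
    proof -
      have one: "(%_. 1) : L2 ?M" by (rule finite_measure.L2_bounded[OF leb_finite, of _ _ 1]) auto
      have "\<bar>l phi\<bar> <= l2norm ?M (indicator B) * l2norm ?M (curry phi d)"
        unfolding dB(1) fn_def using L2_Cauchy_Schwarz[OF ind[OF dB(2)] H_L2[OF phi, of d]] by (simp add: curry_def)
      also have "... <= M1 * pen phi"
      proof (rule mult_mono)
        have "l2norm ?M (indicator B) <= l2norm ?M (%_. 1)"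
          using dB(2) by (intro l2norm_mono_AE[OF one] borel_measurable_indicator AE_I2) (auto split: split_indicator)
        also have "... <= M1" unfolding M1_def by (intro member_le_sum[of d UNIV "%d. l2norm (leb_on (\<T> d)) (%_. 1)"]) auto
        finally show "l2norm ?M (indicator B) <= M1" .
        show "l2norm ?M (curry phi d) <= pen phi"
          unfolding pen_def by (intro member_le_sum[of d UNIV "%d. l2norm (leb_on (\<T> d)) (curry phi d)"]) auto
      qed (use M1 in auto)
      also have "... <= (Mq + M1) * pen phi" using Mq(1) pen0 by (intro mult_right_mono) auto
      finally show ?thesis .
    qed
  qed
  show ?thesis
  proof (rule complete_mod_functionals[where p=pen and L="map fn Fs" and C="Mq + M1" and K=M, OF lin_H pen_seminorm A_seminorm])
    show "l2norm D (A phi) <= (Mq + M1) * pen phi" if "phi : H" for phi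
    proof -
      have "l2norm D (A phi) <= Mq * pen phi" using Mq(2) that by blast
      also have "... <= (Mq + M1) * pen phi" using M1 pen0 by (intro mult_right_mono) auto
      finally show ?thesis .
    qed
    show "complete_for H pen" by (rule pen_complete)
    show "pen phi <= M * (l2norm D (A phi) + (\<Sum>l\<leftarrow>map fn Fs. \<bar>l phi\<bar>))" if "phi : H" for phi
    proof -
      have "(\<Sum>l\<leftarrow>map fn Fs. \<bar>l phi\<bar>) = (\<Sum>x\<leftarrow>Fs. \<bar>fn x phi\<bar>)" by (simp add: comp_def)
      also have "... = (SUM x:F. \<bar>fn x phi\<bar>)" using sum_list_distinct_conv_sum_set[OF Fs(2)] Fs(1) by simp
      also have "... = (\<Sum>(d, B)\<in>F. aint (leb_on (\<T> d)) B (%x. phi (d, x)))"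
        by (intro sum.cong refl) (auto simp: fn_def)
      finally show ?thesis using co that by simp
    qed
  qed (use Mq(1) M1 F(3) fn_lin fn_bound in auto)
qed

section \<open>The least favourable direction and its normal equations\<close>

definition resid_dir :: "'k => ('d \<times> real => real) => nat => nat => ('k, 'd) covs => real" where
  "resid_dir k phi = (%i j c. X_dir k i j c + (- 1) * psi_dir (curry phi) i j c)"

lemma resid_dir_dirs: "phi : H ==> dirs (resid_dir k phi)"
  unfolding resid_dir_def by (intro dirs_lin X_dir_dirs A_dirs)

lemma resid_dir_score: "eff_score (resid_dir k phi) om = eff_score (X_dir k) om - A phi om"
  unfolding resid_dir_def eff_score_lin A_def by simp

text \<open>As the range of A is closed, the projection of the efficient part of the beta direction
  onto its closure is attained, up to a null set, at some phi. Orthogonality of the remainder to the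
  range is the system of normal equations.\<close>

lemma least_favourable:
  "EX phi:H. ALL \<eta>:H. (LINT om|D. eff_score (resid_dir k phi) om * A \<eta> om) = 0"
proof -
  have XL: "eff_score (X_dir k) : L2 D" by (rule eff_score_L2[OF X_dir_dirs])
  have lA: "lin (A ` H)"
    unfolding lin_def
  proof (intro conjI ballI allI)
    have "A (%_. 0) = (%_. 0)" using A_lin[of "%_. 0" "- 1" "%_. 0"] by simp
    then show "(%_. 0) : A ` H" using imageI[OF linD(1)[OF lin_H], of A] by simp
    fix u v s assume "u : A ` H" "v : A ` H"
    then obtain phi \<eta> where uv: "u = A phi" "v = A \<eta>" and H: "phi : H" "\<eta> : H" by blast
    from imageI[OF linD(2)[OF lin_H H], of A] show "(%x. u x + s * v x) : A ` H" unfolding A_lin uv .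
  qed
  have AL: "A ` H \<subseteq> L2 D" using A_L2 by auto
  obtain x0 where x0: "is_proj D (A ` H) (eff_score (X_dir k)) x0" using is_proj_exists[OF lA AL XL] by blast
  then have xc: "x0 : L2_closure D (A ` H)" and xo: "(%om. eff_score (X_dir k) om - x0 om) : orth D (A ` H)"
    by (auto simp: is_proj_def)
  have xL: "x0 : L2 D" by (rule L2_closure_L2[OF xc])
  define Pr where "Pr k phi \<longleftrightarrow> phi : H & l2norm D (%om. x0 om - A phi om) < inverse (real (Suc k))" for k phi
  have "EX phi. Pr k phi" for k
  proof -
    have "0 < inverse (real (Suc k))" by simp
    then have "EX h:A ` H Int L2 D. l2norm D (%x. x0 x - h x) < inverse (real (Suc k))"
      using xc unfolding L2_closure_iff by blast
    then show ?thesis unfolding Pr_def by blast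
  qed
  then obtain u where "!!k. Pr k (u k)" by metis
  then have u: "!!k. u k : H" "!!k. l2norm D (%om. x0 om - A (u k) om) < inverse (real (Suc k))"
    unfolding Pr_def by blast+
  have s: "(%n. l2norm D (%x. x0 x - A (u n) x)) \<longlonglongrightarrow> 0"
    by (rule tendsto_sandwich[OF _ _ tendsto_const LIMSEQ_inverse_real_of_nat]) (auto intro!: always_eventually less_imp_le u(2) simp del: of_nat_Suc)
  \<comment> \<open>Convergence of the images is the Cauchy property of the preimages in the
    seminorm that A induces.\<close>
  have cau: "cauchy_for (%phi. l2norm D (A phi)) u"
    unfolding cauchy_for_def
  proof (intro allI impI)
    fix ep :: real assume "0 < ep"
    then obtain N where N: "!!n. n >= N ==> norm (l2norm D (%x. x0 x - A (u n) x) - 0) < ep / 2"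
      using LIMSEQ_D[OF s, of "ep / 2"] by auto
    have "l2norm D (A (%x. u p x - u q x)) < ep" if "N <= p" "N <= q" for p q
    proof -
      have "l2norm D (A (%x. u p x - u q x)) = l2norm D (%om. A (u p) om - A (u q) om)" by (simp add: A_diff)
      also have "... <= l2norm D (%om. A (u p) om - x0 om) + l2norm D (%om. x0 om - A (u q) om)"
        using A_L2[OF u(1)] xL by (intro l2norm_triangle3) auto
      also have "... < ep" using N[OF that(1)] N[OF that(2)] by (simp add: l2norm_minus_commute[of D "A (u p)"])
      finally show ?thesis .
    qed
    then show "EX N. ALL m>=N. ALL n>=N. l2norm D (A (%x. u m x - u n x)) < ep" by blast
  qed
  obtain phi where phi: "phi : H" "(%n. l2norm D (A (%x. u n x - phi x))) \<longlonglongrightarrow> 0"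
    using A_complete[unfolded complete_for_def, rule_format, OF u(1) cau] by blast
  have "l2norm D (%om. x0 om - A phi om) <= l2norm D (%x. x0 x - A (u n) x) + l2norm D (A (%x. u n x - phi x))" for n
    unfolding A_diff using A_L2[OF u(1)] by (intro l2norm_triangle3 xL A_L2 phi u)
  moreover have "(%n. l2norm D (%x. x0 x - A (u n) x) + l2norm D (A (%x. u n x - phi x))) \<longlonglongrightarrow> 0 + 0"
    by (intro tendsto_add s phi(2))
  ultimately have "l2norm D (%om. x0 om - A phi om) <= 0" by (intro LIMSEQ_le_const[of _ 0]) auto
  then have z: "AE om in D. x0 om - A phi om = 0"
    by (intro l2norm_eq_0 L2_diff xL A_L2 phi) (simp add: antisym)
  have "(LINT om|D. eff_score (resid_dir k phi) om * A \<eta> om) = 0" if eta: "\<eta> : H" for \<eta>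
  proof -
    have "(LINT om|D. eff_score (resid_dir k phi) om * A \<eta> om) = (LINT om|D. (eff_score (X_dir k) om - x0 om) * A \<eta> om)"
    proof (rule integral_cong_AE)
      show "(%om. eff_score (resid_dir k phi) om * A \<eta> om) : bm D" "(%om. (eff_score (X_dir k) om - x0 om) * A \<eta> om) : bm D"
        by (intro borel_measurable_times borel_measurable_diff L2D(1) eff_score_L2 resid_dir_dirs phi A_L2 eta XL xL)+
      show "AE om in D. eff_score (resid_dir k phi) om * A \<eta> om = (eff_score (X_dir k) om - x0 om) * A \<eta> om"
        using z by eventually_elim (simp add: resid_dir_score)
    qed
    also have "... = 0" using xo eta by (auto simp: orth_def)
    finally show ?thesis .
  qed
  then show ?thesis using phi(1) by blast
qed

section \<open>Evaluation of the nested projections\<close>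

abbreviation "Pf_orth \<equiv> orth D Tf"
abbreviation "Tth \<equiv> tangent_space D (theta_scores n m nu \<mu> \<beta> \<theta> f V)"

lemma Pf_orth_lin: "lin Pf_orth" "Pf_orth \<subseteq> L2 D"
  by (auto simp: orth_def tangent_space_def intro!: lin_orth[unfolded orth_def] dest: L2_closure_L2)

lemma proj_Pf_orth: assumes "g : L2 D" shows "is_proj D Pf_orth g (proj D g Pf_orth)"
proof -
  obtain w where "is_proj D Pf_orth g w" using is_proj_exists[OF Pf_orth_lin assms] by blast
  then show ?thesis by (rule is_proj_proj)
qed

text \<open>The score is linear in the direction psi, so a linear combination again has this form.
  Whether the combined path stays in the model is left open; only the form of the function and its
  square integrability are retained.\<close>

lemma theta_span:
  assumes "h : lin_span (theta_scores n m nu \<mu> \<beta> \<theta> f V)"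
  shows "h : L2 D & (EX phi:H. AE om in D. h om = dir_score (psi_dir (curry phi)) om)"
proof -
  let ?S = "{h : L2 D. EX phi:H. AE om in D. h om = dir_score (psi_dir (curry phi)) om}"
  have "lin ?S"
    unfolding lin_def
  proof (intro conjI ballI allI)
    have "dir_score (psi_dir (curry (%_. 0))) om = 0" for om
      by (simp add: dir_score_def lift_def dir_term_def psi_dir_def additive_def curry_def)
    then show "(%_. 0) : ?S" using linD(1)[OF lin_H] by auto
    fix g h s assume "g : ?S" "h : ?S"
    then obtain phi \<eta> where L: "g : L2 D" "h : L2 D" and H: "phi : H" "\<eta> : H"
      and ae: "AE om in D. g om = dir_score (psi_dir (curry phi)) om" "AE om in D. h om = dir_score (psi_dir (curry \<eta>)) om" by blast
    have "AE om in D. g om + s * h om = dir_score (psi_dir (curry (%x. phi x + s * \<eta> x))) om"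
      using ae unfolding curry_lin psi_dir_lin dir_score_lin by eventually_elim simp
    then show "(%x. g x + s * h x) : ?S" using L2_add[OF L(1) L2_cmult[OF L(2)]] linD(2)[OF lin_H H] by blast
  qed
  note lin_S = this
  have "theta_scores n m nu \<mu> \<beta> \<theta> f V \<subseteq> ?S"
  proof
    fix g assume "g : theta_scores n m nu \<mu> \<beta> \<theta> f V"
    then obtain psi where g: "g : L2 D" "ALL d. psi d : V d" "AE om in D. g om = dir_score (psi_dir psi) om"
      using theta_scores_subset by blast
    then have "case_prod psi : H" by (simp add: H_def)
    moreover have "curry (case_prod psi) = psi" by simp
    ultimately show "g : ?S" using g by (intro CollectI conjI bexI[of _ "case_prod psi"]) simp_all
  qed
  from subsetD[OF lin_span_subset[OF lin_S this] assms] show ?thesis by blast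
qed

text \<open>The candidate y is orthogonal to the tangent spaces of f and theta. Hence subtracting A
  phi from the first projection leaves a remainder orthogonal to the projected tangent space of
  theta, while A phi is a limit of members of that space; uniqueness of projections does the
  rest.\<close>

theorem efficient_score_eq:
  "EX phi:H. (AE om in D. efficient_score n m nu \<mu> \<beta> \<theta> f V k om = eff_score (resid_dir k phi) om) &
     (ALL \<eta>:H. (LINT om|D. eff_score (resid_dir k phi) om * A \<eta> om) = 0)"
proof -
  obtain phi where phi: "phi : H" and o': "ALL \<eta>:H. (LINT om|D. eff_score (resid_dir k phi) om * A \<eta> om) = 0"
    using least_favourable[of k] by (elim bexE) (rule that, assumption+)
  note o = o'[rule_format]
  let ?y = "eff_score (resid_dir k phi)" and ?X = "eff_score (X_dir k)"
  have yP: "?y : Pf_orth" by (rule eff_score_orth[OF resid_dir_dirs[OF phi]])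
  have yL: "?y : L2 D" by (rule eff_score_L2[OF resid_dir_dirs[OF phi]])
  \<comment> \<open>The score h differs from its efficient part A \<eta> by a member of the tangent
    space of f, to which y is orthogonal; against A \<eta> the normal equations apply.\<close>
  have yh: "(LINT om|D. ?y om * h om) = 0" if h: "h : lin_span (theta_scores n m nu \<mu> \<beta> \<theta> f V)" for h
  proof -
    obtain \<eta> where hL: "h : L2 D" and eta: "\<eta> : H" and ae: "AE om in D. h om = dir_score (psi_dir (curry \<eta>)) om"
      using theta_span[OF h] by (elim conjE bexE) (rule that, assumption+)
    note r = A_dirs[OF eta]
    have "(%om. h om - A \<eta> om) : Tf"
      unfolding A_def by (rule score_projection(1)[OF r dir_term_L2D[OF r hL ae] hL ae])
    then have "(LINT om|D. ?y om * (h om - A \<eta> om)) = 0" using yP by (simp add: orth_def)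
    then have "(LINT om|D. ?y om * h om) - (LINT om|D. ?y om * A \<eta> om) = 0"
      using L2_mult_integrable[OF yL hL] L2_mult_integrable[OF yL A_L2[OF eta]] by (simp add: right_diff_distrib)
    then show ?thesis using o[OF eta] by simp
  qed
  have yT: "(LINT om|D. ?y om * g om) = 0" if "g : Tth" for g
    by (rule orth_L2_closure[OF yL _ that[unfolded tangent_space_def]]) (rule yh)
  define a0 where "a0 = proj D (beta_score n m nu \<mu> \<beta> \<theta> f k) Pf_orth"
  define S where "S = (%g. proj D g Pf_orth) ` Tth"
  have p0: "is_proj D Pf_orth (beta_score n m nu \<mu> \<beta> \<theta> f k) a0" unfolding a0_def by (rule proj_Pf_orth[OF beta_score(1)])
  have aX: "AE om in D. a0 om = ?X om"
    by (rule is_proj_AE_unique[OF p0 score_projection(2)[OF X_dir_dirs dir_term_L2D[OF X_dir_dirs beta_score] beta_score] Pf_orth_lin(2)])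
  have aL: "a0 : L2 D" using p0 L2_closure_L2 by (auto simp: is_proj_def)
  have TL: "g : L2 D" if "g : Tth" for g using that L2_closure_L2 by (auto simp: tangent_space_def)
  \<comment> \<open>As y lies in the subspace projected onto, its inner products with g and with the
    projection w of g coincide.\<close>
  have wf: "w : L2 D & (LINT om|D. ?y om * w om) = 0" if wS: "w : S" for w
  proof -
    obtain g where g: "g : Tth" "w = proj D g Pf_orth" using wS by (auto simp: S_def)
    have p: "is_proj D Pf_orth g w" unfolding g(2) by (rule proj_Pf_orth[OF TL[OF g(1)]])
    have wL: "w : L2 D" using p L2_closure_L2 by (auto simp: is_proj_def)
    have "(LINT om|D. (g om - w om) * ?y om) = 0" using p yP by (auto simp: is_proj_def orth_def)
    then have "(LINT om|D. ?y om * g om) - (LINT om|D. ?y om * w om) = 0"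
      using L2_mult_integrable[OF yL TL[OF g(1)]] L2_mult_integrable[OF yL wL] by (simp add: left_diff_distrib mult.commute)
    then show ?thesis using yT[OF g(1)] wL by simp
  qed
  have SL: "S \<subseteq> L2 D" using wf by blast
  have pA: "is_proj D S a0 (A phi)"
    unfolding is_proj_def
  proof
    \<comment> \<open>The components of phi are replaced by bounded ones, because for these A is
      known to be the projection of an actual score.\<close>
    show "A phi : L2_closure D S"
      unfolding L2_closure_iff
    proof (intro conjI allI impI)
      show "A phi : L2 D" by (rule A_L2[OF phi])
      fix ep :: real assume e: "0 < ep"
      obtain M where M: "0 <= M" "ALL phi:H. l2norm D (A phi) <= M * pen phi" using A_bound by blast
      \<comment> \<open>The operator bound M and the number of components are divided out; M + 1
        keeps the quotient defined and the final inequality strict.\<close>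
      define ep' where "ep' = ep / ((M + 1) * real CARD('d))"
      have e': "0 < ep'" using e M(1) by (simp add: ep'_def)
      define Pr where "Pr d \<eta> B \<longleftrightarrow> \<eta> : V d & (ALL t. \<bar>\<eta> t\<bar> <= B) & l2norm (leb_on (\<T> d)) (%t. curry phi d t - \<eta> t) < ep'" for d \<eta> B
      have "EX \<eta> B. Pr d \<eta> B" for d
      proof -
        have "curry phi d : V d" by (rule H_D[OF phi])
        then show ?thesis by (rule V_bounded_dense[OF _ e']) (auto simp: Pr_def)
      qed
      then obtain psi B where "!!d. Pr d (psi d) (B d)" by metis
      then have psi: "!!d. psi d : V d" "!!d t. \<bar>psi d t\<bar> <= B d"
        "!!d. l2norm (leb_on (\<T> d)) (%t. curry phi d t - psi d t) < ep'"
        unfolding Pr_def by blast+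
      have bd: "\<bar>psi d t\<bar> <= (SUM d:UNIV. \<bar>B d\<bar>)" for d t
      proof -
        have "\<bar>psi d t\<bar> <= \<bar>B d\<bar>" using psi(2)[of d t] by linarith
        also have "... <= (SUM d:UNIV. \<bar>B d\<bar>)" by (intro member_le_sum) auto
        finally show ?thesis .
      qed
      define \<eta> where "\<eta> = case_prod psi"
      have ce: "curry \<eta> = psi" by (simp add: \<eta>_def)
      have eta: "\<eta> : H" using psi(1) by (simp add: H_def ce)
      note bs = bounded_theta_score[OF psi(1) bd]
      let ?g = "dir_score (psi_dir psi)"
      have gT: "?g : Tth" unfolding tangent_space_def by (intro L2_closure_superset lin_span_superset bs)
      have "is_proj D Pf_orth ?g (A \<eta>)"
        unfolding A_def ce by (rule score_projection(2)[OF _ bs(3) bs(2)]) (use A_dirs[OF eta] in \<open>auto simp: ce\<close>)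
      from is_proj_AE_unique[OF proj_Pf_orth[OF bs(2)] this Pf_orth_lin(2)]
      have ae: "AE om in D. proj D ?g Pf_orth om = A \<eta> om" .
      have wS: "proj D ?g Pf_orth : S" using gT by (simp add: S_def)
      have wL: "proj D ?g Pf_orth : L2 D" using wf[OF wS] by blast
      have "l2norm D (%om. A phi om - proj D ?g Pf_orth om) = l2norm D (%om. A phi om - A \<eta> om)"
        using ae by (intro l2norm_cong_AE borel_measurable_diff L2D(1) A_L2 phi eta wL) auto
      also have "... <= M * pen (%x. phi x - \<eta> x)"
        unfolding A_diff[symmetric] using M(2) linD(4)[OF lin_H phi eta] by blast
      also have "pen (%x. phi x - \<eta> x) = (SUM d:UNIV. l2norm (leb_on (\<T> d)) (%t. curry phi d t - psi d t))"
        by (simp add: pen_def curry_def \<eta>_def)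
      also have "M * ... <= M * (SUM d:(UNIV :: 'd set). ep')" using psi(3) M(1) by (intro mult_left_mono sum_mono) (auto intro: less_imp_le)
      also have "... = M / (M + 1) * ep" using M(1) by (simp add: ep'_def)
      also have "... < ep" using M(1) e by (simp add: field_simps)
      finally show "EX h:S Int L2 D. l2norm D (%x. A phi x - h x) < ep" using wS wL by blast
    qed
    have dL: "(%om. a0 om - A phi om) : L2 D" by (rule L2_diff[OF aL A_L2[OF phi]])
    have "(LINT om|D. (a0 om - A phi om) * w om) = 0" if "w : S" for w
    proof -
      have "AE om in D. (a0 om - A phi om) * w om = ?y om * w om"
        using aX by eventually_elim (simp add: resid_dir_score)
      then have "(LINT om|D. (a0 om - A phi om) * w om) = (LINT om|D. ?y om * w om)"
        using wf[OF that] by (intro integral_cong_AE borel_measurable_times L2D(1) dL yL) auto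
      then show ?thesis using wf[OF that] by simp
    qed
    then show "(%om. a0 om - A phi om) : orth D S" using dL by (simp add: orth_def)
  qed
  define b0 where "b0 = proj D a0 S"
  have "is_proj D S a0 b0" unfolding b0_def by (rule is_proj_proj[OF pA])
  from is_proj_AE_unique[OF this pA SL] have b: "AE om in D. b0 om = A phi om" .
  have eq: "efficient_score n m nu \<mu> \<beta> \<theta> f V k = (%om. a0 om - b0 om)"
    unfolding efficient_score_def Let_def a0_def b0_def S_def ..
  have "AE om in D. efficient_score n m nu \<mu> \<beta> \<theta> f V k om = ?y om"
    unfolding eq resid_dir_score using b aX by eventually_elim simp
  then show ?thesis using phi o by (intro bexI[of _ phi] conjI ballI)
qed

section \<open>Matrix form of the efficient score and of the orthogonality conditions\<close>

lemma eff_bform: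
  assumes "i < n"
  shows "eff i r z = bform (m i) (cluster_regular.H (m i) (f i) (fst z)) (%j. r j (fst z)) (snd z)"
proof -
  interpret C: cluster_regular "nu i" "m i" \<mu> \<beta> \<theta> "f i" a b K by (rule reg[OF assms])
  show ?thesis unfolding C.eff_def C.weight_def bform_def sum_distrib_right by (rule sum.swap)
qed

lemma resid_dir_eq:
  "resid_dir k phi i j (fst z) = (obs_X j z $ k - additive (curry phi) (snd (fst z) j)) * deriv \<mu> (predictor \<beta> \<theta> j z)"
  if "i < n"
proof -
  interpret C: cluster_regular "nu i" "m i" \<mu> \<beta> \<theta> "f i" a b K by (rule reg[OF that])
  show ?thesis by (simp add: resid_dir_def X_dir_def psi_dir_def C.predictor_lin_pred obs_X_def algebra_simps)
qed

lemma eff_score_formula: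
  "AE om in D. eff_score (resid_dir k phi) om = (SUM i<n. scalar_prod (X_minus_psi (m i) k (curry phi) (om i))
     (Delta_mat (m i) \<mu> \<beta> \<theta> (om i) *\<^sub>v (Sigma_inv (m i) (Pl i) (om i) *\<^sub>v Matrix.vec (m i) (resid (m i) \<mu> \<beta> \<theta> (om i)))))"
proof -
  have "AE om in D. ALL i:{..<n}. Sigma_inv (m i) (Pl i) (om i) = gmat (m i) (cluster_regular.H (m i) (f i) (fst (om i)))"
  proof (intro AE_finite_allI finite_lessThan)
    fix i assume i': "i : {..<n}"
    then have i: "i < n" by simp
    interpret C: cluster_regular "nu i" "m i" \<mu> \<beta> \<theta> "f i" a b K by (rule reg[OF i])
    show "AE om in D. Sigma_inv (m i) (Pl i) (om i) = gmat (m i) (C.H (fst (om i)))"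
      unfolding data_law_def by (rule AE_PiM_component[where P="%z. Sigma_inv (m i) (Pl i) z = gmat (m i) (C.H (fst z))"])
        (use Pl_prob i' in \<open>auto intro: C.Sigma_inv_H\<close>)
  qed
  then show ?thesis
  proof eventually_elim
    case (elim om)
    show ?case
      unfolding eff_score_def lift_def
    proof (intro sum.cong refl)
      fix i assume i': "i : {..<n}"
      then have i: "i < n" by simp
      interpret C: cluster_regular "nu i" "m i" \<mu> \<beta> \<theta> "f i" a b K by (rule reg[OF i])
      let ?G = "C.H (fst (om i))"
      have "eff i (resid_dir k phi i) (El i (om i)) = bform (m i) ?G (%j. resid_dir k phi i j (fst (om i))) (resid (m i) \<mu> \<beta> \<theta> (om i))"
        unfolding eff_bform[OF i] by (simp add: C.to_err_def)
      also have "... = scalar_prod (X_minus_psi (m i) k (curry phi) (om i))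
          (Delta_mat (m i) \<mu> \<beta> \<theta> (om i) *\<^sub>v (gmat (m i) ?G *\<^sub>v Matrix.vec (m i) (resid (m i) \<mu> \<beta> \<theta> (om i))))"
        unfolding X_minus_psi_def Delta_mat_def scalar_prod_mat_diag resid_dir_eq[OF i] ..
      finally show "eff i (resid_dir k phi i) (El i (om i)) = scalar_prod (X_minus_psi (m i) k (curry phi) (om i))
          (Delta_mat (m i) \<mu> \<beta> \<theta> (om i) *\<^sub>v (Sigma_inv (m i) (Pl i) (om i) *\<^sub>v Matrix.vec (m i) (resid (m i) \<mu> \<beta> \<theta> (om i))))"
        using elim i' by simp
    qed
  qed
qed

definition psi_integrand :: "'k => ('d => real => real) => 'd => (real => real) => nat => ('k, 'd) obs => real" where
  "psi_integrand k psis d psi i z = scalar_prod (X_minus_psi (m i) k psis z)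
     (Delta_mat (m i) \<mu> \<beta> \<theta> z *\<^sub>v (Sigma_inv (m i) (Pl i) z *\<^sub>v (Delta_mat (m i) \<mu> \<beta> \<theta> z *\<^sub>v psi_of_T (m i) d psi z)))"

text \<open>A test function psi in component d alone is the tuple \<eta> with zeros elsewhere, so
  the integral is one term of the inner product of two efficient scores.\<close>

lemma psi_integrand_integral:
  assumes phi: "phi : H" and psi: "psi : V d" and i: "i < n"
  defines "\<eta> \<equiv> %(d', t). if d' = d then psi t else 0"
  shows "integrable (Pl i) (psi_integrand k (curry phi) d psi i)"
    and "(LINT z|Pl i. psi_integrand k (curry phi) d psi i z)
      = (LINT z|Ql i. bform (m i) (cluster_regular.H (m i) (f i) (fst z)) (%j. resid_dir k phi i j (fst z)) (%j. psi_dir (curry \<eta>) i j (fst z)))"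
    and "\<eta> : H"
proof -
  interpret C: cluster_regular "nu i" "m i" \<mu> \<beta> \<theta> "f i" a b K by (rule reg[OF i])
  have ce: "curry \<eta> d' = (if d' = d then psi else (%_. 0))" for d' by (auto simp: \<eta>_def curry_def)
  show eta: "\<eta> : H" unfolding H_def mem_Collect_eq ce using psi linD(1)[OF lin_V] by auto
  \<comment> \<open>\<open>Sigma_inv\<close> is known to agree with the inverse of
    \<open>sig\<close> almost surely only, which does not by itself give measurability of the
    integrand. The entries of \<open>Sigma_mat\<close> are measurable conditional expectations, and
    \<open>ginv\<close> preserves measurability.\<close>
  define Sg where "Sg z j l = real_cond_exp (Pl i) (cov_algebra (m i) (Pl i))
    (%z'. (obs_Y j z' - real_cond_exp (Pl i) (cov_algebra (m i) (Pl i)) (obs_Y j) z') *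
          (obs_Y l z' - real_cond_exp (Pl i) (cov_algebra (m i) (Pl i)) (obs_Y l) z')) z" for z j l
  have "Sigma_mat (m i) (Pl i) z = gmat (m i) (Sg z)" for z by (simp add: Sigma_mat_def gmat_def Sg_def Let_def)
  then have Si: "Sigma_inv (m i) (Pl i) z = gmat (m i) (ginv (m i) (Sg z))" for z
    by (simp add: Sigma_inv_def mat_inverse_gmat)
  let ?r = "%j z. resid_dir k phi i j (fst z)" and ?s = "%j z. psi_dir (curry \<eta>) i j (fst z)"
  have add: "additive (curry \<eta>) x = psi (x $ d)" for x
    by (simp add: additive_def ce if_distrib[of "%g. g _"] cong: if_cong)
  have form: "psi_integrand k (curry phi) d psi i z = bform (m i) G (%j. ?r j z) (%j. ?s j z)"
    if "Sigma_inv (m i) (Pl i) z = gmat (m i) G" for z G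
    unfolding psi_integrand_def that X_minus_psi_def Delta_mat_def psi_of_T_def mat_diag_vec scalar_prod_mat_diag resid_dir_eq[OF i]
    by (simp add: psi_dir_def add obs_T_def C.predictor_lin_pred)
  have cv: "C.cov_vec (resid_dir k phi i)" "C.cov_vec (psi_dir (curry \<eta>) i)"
    using resid_dir_dirs[OF phi] A_dirs[OF eta] i by (auto simp: dirs_def)
  have rm: "(%z. ?r j z) : bm C.N" "(%z. ?s j z) : bm C.N" if "j < m i" for j
    using cv that measurable_compose[OF measurable_fst] unfolding C.cov_vec_def by auto
  have Zm: "psi_integrand k (curry phi) d psi i : bm (Pl i)"
    unfolding form[OF Si, abs_def] bform_def
    by (intro borel_measurable_sum borel_measurable_times ginv_measurable)
      (auto simp: Sg_def measurable_cong_sets[OF C.cluster_law_simps(2) refl] rm intro!: borel_measurable_cond_exp2)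
  let ?B = "%z. bform (m i) (C.H (fst z)) (%j. ?r j z) (%j. ?s j z)"
  have Bm: "?B : bm C.N"
    unfolding bform_def
    by (intro borel_measurable_sum borel_measurable_times rm measurable_compose[OF measurable_fst C.H_measurable]) auto
  have ae: "AE z in Pl i. psi_integrand k (curry phi) d psi i z = ?B z"
    using C.Sigma_inv_H by eventually_elim (rule form)
  have I: "integrable (Pl i) ?B" using C.P_integral(1)[OF Bm] C.eff_inner(1)[OF cv] by simp
  have BP: "?B : bm (Pl i)" by (rule borel_measurable_integrable[OF I])
  show "integrable (Pl i) (psi_integrand k (curry phi) d psi i)" using integrable_cong_AE[OF Zm BP ae] I by simp
  have "(LINT z|Pl i. psi_integrand k (curry phi) d psi i z) = (LINT z|Pl i. ?B z)" by (rule integral_cong_AE[OF Zm BP ae])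
  also have "... = (LINT z|Ql i. ?B z)" using C.P_integral(2)[OF Bm] by simp
  finally show "(LINT z|Pl i. psi_integrand k (curry phi) d psi i z) = (LINT z|Ql i. ?B z)" .
qed

theorem efficient_score_formula:
  "EX psi. (ALL d. psi d : V d) &
     (AE om in D. efficient_score n m nu \<mu> \<beta> \<theta> f V k om = (SUM i<n. scalar_prod (X_minus_psi (m i) k psi (om i))
        (Delta_mat (m i) \<mu> \<beta> \<theta> (om i) *\<^sub>v (Sigma_inv (m i) (Pl i) (om i) *\<^sub>v Matrix.vec (m i) (resid (m i) \<mu> \<beta> \<theta> (om i)))))) &
     (ALL d. ALL \<eta>:V d. (ALL i<n. integrable (Pl i) (psi_integrand k psi d \<eta> i)) & (SUM i<n. \<integral>z. psi_integrand k psi d \<eta> i z \<partial>Pl i) = 0)"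
proof -
  obtain phi where phi: "phi : H" and ae: "AE om in D. efficient_score n m nu \<mu> \<beta> \<theta> f V k om = eff_score (resid_dir k phi) om"
    and o: "ALL \<eta>:H. (LINT om|D. eff_score (resid_dir k phi) om * A \<eta> om) = 0"
    using efficient_score_eq[of k] by (elim bexE conjE) (rule that, assumption+)
  have "(ALL i<n. integrable (Pl i) (psi_integrand k (curry phi) d psi i)) & (SUM i<n. \<integral>z. psi_integrand k (curry phi) d psi i z \<partial>Pl i) = 0"
    if psi: "psi : V d" for d psi
  \<comment> \<open>Membership of \<eta> in H is obtained from some cluster, so the empty sample is
    treated apart; there the integrability claim is vacuous and the sum is empty.\<close>
  proof (cases "n = 0")
    case False
    define \<eta> where "\<eta> = (%(d', t). if d' = d then psi t else 0)"
    note pi = psi_integrand_integral[OF phi psi, folded \<eta>_def]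
    have eta: "\<eta> : H" using pi(3)[of 0] False by simp
    have "(SUM i<n. \<integral>z. psi_integrand k (curry phi) d psi i z \<partial>Pl i) = (LINT om|D. eff_score (resid_dir k phi) om * A \<eta> om)"
      unfolding A_def eff_score_inner[OF resid_dir_dirs[OF phi] A_dirs[OF eta]] by (intro sum.cong refl pi(2)) simp
    then show ?thesis using o eta pi(1) by simp
  qed simp
  moreover have "AE om in D. efficient_score n m nu \<mu> \<beta> \<theta> f V k om = (SUM i<n. scalar_prod (X_minus_psi (m i) k (curry phi) (om i))
        (Delta_mat (m i) \<mu> \<beta> \<theta> (om i) *\<^sub>v (Sigma_inv (m i) (Pl i) (om i) *\<^sub>v Matrix.vec (m i) (resid (m i) \<mu> \<beta> \<theta> (om i)))))"
    using ae eff_score_formula by eventually_elim (rule trans)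
  ultimately show ?thesis using H_D[OF phi] by (intro exI[of _ "curry phi"] conjI allI ballI) auto
qed

end

theorem lemma1:
  fixes n :: nat and m :: "nat \<Rightarrow> nat"
    and \<nu> :: "nat \<Rightarrow> ('k::finite, 'd::finite) covs measure"
    and \<mu> :: "real \<Rightarrow> real"
    and \<beta>0 :: "real ^ 'k" and \<theta>0 :: "'d \<Rightarrow> real \<Rightarrow> real"
    and f :: "nat \<Rightarrow> ('k, 'd) err_density"
    and \<T> :: "'d \<Rightarrow> real set" and k1 :: 'k
    and P :: "nat \<Rightarrow> ('k, 'd) obs measure"
    and V :: "'d \<Rightarrow> (real \<Rightarrow> real) set"
  assumes P_def: "\<And>i. P i = cluster_law (\<nu> i) (m i) \<mu> \<beta>0 \<theta>0 (f i)"
    and dominating: "\<And>i. i < n \<Longrightarrow> sigma_finite_measure (\<nu> i) \<and> sets (\<nu> i) = sets (cov_space (m i))"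
    and model: "\<And>i. i < n \<Longrightarrow> in_model (\<nu> i) (m i) \<mu> \<beta>0 \<theta>0 (f i)"
    and theta0: "\<And>d. \<theta>0 d \<in> L2_centred (\<T> d)"
    and c1: "cond_T n m \<T> P"
    and c2: "cond_X n m k1 P"
    and c3: "cond_Sigma n m P"
    and c4: "cond_link n m \<mu> \<beta>0 \<theta>0 P"
    and c5: "cond_tail n m \<mu> \<beta>0 \<theta>0 P"
    and info: "finite_information n m \<mu> \<beta>0 \<theta>0 f P"
    and V: "V = (\<lambda>d. L2_on (\<T> d)) \<or> V = (\<lambda>d. L2_centred (\<T> d))"
  shows "\<exists>\<psi>s :: 'k \<Rightarrow> 'd \<Rightarrow> real \<Rightarrow> real.
     (\<forall>k d. \<psi>s k d \<in> V d) \<and>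
     (\<forall>k. AE \<omega> in data_law n m \<nu> \<mu> \<beta>0 \<theta>0 f.
        efficient_score n m \<nu> \<mu> \<beta>0 \<theta>0 f V k \<omega> =
        (\<Sum>i<n. scalar_prod (X_minus_psi (m i) k (\<psi>s k) (\<omega> i))
           (Delta_mat (m i) \<mu> \<beta>0 \<theta>0 (\<omega> i) *\<^sub>v (Sigma_inv (m i) (P i) (\<omega> i) *\<^sub>v
             Matrix.vec (m i) (resid (m i) \<mu> \<beta>0 \<theta>0 (\<omega> i)))))) \<and>
     (\<forall>k d. \<forall>\<psi>\<in>V d.
        (\<forall>i<n. integrable (P i) (\<lambda>z. scalar_prod (X_minus_psi (m i) k (\<psi>s k) z)
           (Delta_mat (m i) \<mu> \<beta>0 \<theta>0 z *\<^sub>v (Sigma_inv (m i) (P i) z *\<^sub>v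
             (Delta_mat (m i) \<mu> \<beta>0 \<theta>0 z *\<^sub>v psi_of_T (m i) d \<psi> z))))) \<and>
        (\<Sum>i<n. \<integral>z. scalar_prod (X_minus_psi (m i) k (\<psi>s k) z)
           (Delta_mat (m i) \<mu> \<beta>0 \<theta>0 z *\<^sub>v (Sigma_inv (m i) (P i) z *\<^sub>v
             (Delta_mat (m i) \<mu> \<beta>0 \<theta>0 z *\<^sub>v psi_of_T (m i) d \<psi> z))) \<partial>P i) = 0)"
proof -
  have PP: "P = (%i. cluster_law (\<nu> i) (m i) \<mu> \<beta>0 \<theta>0 (f i))" using P_def by (rule ext)
  have cT: "compact (\<T> d)" and supp: "!!i j. i < n ==> j < m i ==> measure_support (distr (P i) borel (obs_T j d)) = \<T> d" for d
    using c1 unfolding cond_T_def by simp_all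
  obtain cl C where cl: "0 < cl"
    and single: "ALL i<n. ALL j<m i. ALL d. EX p. distributed (P i) lborel (obs_T j d) p &
           (AE t in lborel. t : \<T> d --> ennreal cl <= p t & p t <= ennreal C)"
    and pair: "ALL i<n. ALL j<m i. ALL j'<m i. ALL d d'. (j, d) ~= (j', d') -->
           (EX p. distributed (P i) (lborel2) (%z. (obs_T j d z, obs_T j' d' z)) p &
             (AE q in lborel2. q : \<T> d \<times> \<T> d' --> ennreal cl <= p q & p q <= ennreal C))"
    using c1 unfolding cond_T_def by (elim conjE exE) (rule that, assumption+)
  obtain a C\<Sigma> where a: "0 < a" and ev: "!!i. i < n ==> AE z in P i. ALL r. eigenvalue (Sigma_mat (m i) (P i) z) r --> a <= r & r <= C\<Sigma>"
    using c3 unfolding cond_Sigma_def by auto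
  obtain c\<mu> \<delta> C\<mu> where diff: "ALL s. \<mu> differentiable (at s) & deriv \<mu> differentiable (at s)"
    and c\<mu>: "0 < c\<mu>" "ALL s. c\<mu> <= deriv \<mu> s" and \<delta>: "0 < \<delta>"
    and C\<mu>: "ALL i<n. ALL j<m i. AE z in P i. ALL s. \<bar>s - predictor \<beta>0 \<theta>0 j z\<bar> <= \<delta> -->
         \<bar>deriv \<mu> s\<bar> <= C\<mu> & \<bar>deriv (deriv \<mu>) s\<bar> <= C\<mu>"
    using c4 unfolding cond_link_def by (elim conjE exE) (rule that, assumption+)
  obtain BX where BX: "ALL i<n. ALL j<m i. ALL k. k ~= k1 --> (AE z in P i. \<bar>obs_X j z $ k\<bar> <= BX)"
    and X1: "ALL i<n. ALL j<m i. AE z in P i. obs_X j z $ k1 = 1"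
    using c2 unfolding cond_X_def by (elim conjE exE) (rule that, assumption+)
  obtain M0 \<sigma>0 where M0: "0 < M0" "0 < \<sigma>0"
    and tail: "ALL i<n. AE z in P i. ennreal (M0^2) * nn_cond_exp (P i) (cov_algebra (m i) (P i))
          (%z'. ennreal (exp ((SUM j<m i. (resid (m i) \<mu> \<beta>0 \<theta>0 z' j)^2) / M0^2) - 1)) z <= ennreal (\<sigma>0^2)"
    using c5 unfolding cond_tail_def by (elim exE conjE) (rule that, assumption+)
  have mu: "(\<mu> has_real_derivative deriv \<mu> s) (at s)" for s
    using diff by (simp add: DERIV_deriv_iff_real_differentiable)
  have mu_cont: "continuous_on UNIV (deriv \<mu>)"
    using diff by (intro continuous_at_imp_continuous_on ballI differentiable_imp_continuous_within) simp
  have mu_m: "\<mu> : bm borel"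
    by (intro borel_measurable_continuous_onI continuous_at_imp_continuous_on ballI DERIV_isCont[OF mu])
  have th_m: "\<theta>0 d : bm borel" for d
    using theta0[of d] by (simp add: L2_centred_def L2_on_def)
  have cluster: "cluster (\<nu> i) (m i) \<mu> \<beta>0 \<theta>0 (f i)" if "i < n" for i
    by (intro cluster.intro cluster_base.intro cluster_axioms.intro conjunct1[OF dominating[OF that]] conjunct2[OF dominating[OF that]]
        mu_m th_m model[OF that])
  \<comment> \<open>The tail constant \<sigma>0 serves as K, and the maximum with 0 makes the upper
    spectral bound nonnegative.\<close>
  have regular: "cluster_regular (\<nu> i) (m i) \<mu> \<beta>0 \<theta>0 (f i) a (max 0 C\<Sigma>) \<sigma>0" if i: "i < n" for i
  proof -
    interpret C: cluster "\<nu> i" "m i" \<mu> \<beta>0 \<theta>0 "f i" by (rule cluster[OF i])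
    note tb = C.tail_bound[OF M0(1) less_imp_le[OF M0(2)] tail[rule_format, OF i, unfolded PP]]
    \<comment> \<open>The factor s = 1 in \<open>tail_bound\<close> gives square integrability of
      the errors themselves.\<close>
    have one: "(%z. (%_. 1 :: real) (fst z)) : L2 C.Q" by (rule C.Q.L2_bounded[of _ 1]) auto
    show ?thesis
    proof unfold_locales
      show "(%z. snd z j) : L2 C.Q" if "j < m i" for j using tb(1)[OF that _ one] by simp
      show "AE z in C.P. ALL r. eigenvalue (Sigma_mat (m i) C.P z) r --> a <= r & r <= max 0 C\<Sigma>"
        using ev[OF i, unfolded PP] by eventually_elim auto
      show "integrable C.P (%z. (partial_deriv (f i (fst z)) j (resid (m i) \<mu> \<beta>0 \<theta>0 z) / lik (m i) \<mu> \<beta>0 \<theta>0 (f i) z)^2)" if "j < m i" for j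
        using info i that unfolding finite_information_def PP by simp
      show "(%z. s (fst z) * snd z j) : L2 C.Q" "l2norm C.Q (%z. s (fst z) * snd z j) <= \<sigma>0 * l2norm C.Q (%z. s (fst z))"
        if "j < m i" "s : bm (\<nu> i)" "(%z. s (fst z)) : L2 C.Q" for s j
        using tb[OF that] .
    qed (use a M0 in simp_all)
  qed
  \<comment> \<open>The regressor k1 is constant 1 and excluded from the bound on the others, hence
    the maximum with 1.\<close>
  have X_bound: "AE z in P i. \<bar>obs_X j z $ k\<bar> <= max 1 BX" if "i < n" "j < m i" for i j k
  proof (cases "k = k1")
    case True
    show ?thesis unfolding True using X1[rule_format, OF that] by eventually_elim simp
  next
    case False
    show ?thesis using BX[rule_format, OF that False] by eventually_elim simp
  qed
  \<comment> \<open>The density conditions alone do not order the two constants, for instance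
    without observations; raising the upper one to at least \<open>cl\<close> does.\<close>
  have leC: "ennreal C <= ennreal (max cl C)" by (intro ennreal_leI) simp
  interpret clusters n m \<nu> \<mu> \<beta>0 \<theta>0 f a "max 0 C\<Sigma>" \<sigma>0 by (rule clusters.intro[OF regular])
  interpret R: additive_clusters n m \<nu> \<mu> \<beta>0 \<theta>0 f a "max 0 C\<Sigma>" \<sigma>0 \<T> V cl "max cl C" c\<mu> "max 0 C\<mu>" \<delta> "max 1 BX"
  proof unfold_locales
    fix i j d assume ij: "i < n" "j < m i"
    obtain p where "distributed (P i) lborel (obs_T j d) p" using single ij by blast
    then have m: "obs_T j d : bm (P i)" by (simp add: distributed_def)
    have "AE x in distr (P i) borel (obs_T j d). x : \<T> d"
      using measure_support_AE[of "distr (P i) borel (obs_T j d)"] supp[OF ij, of d] by simp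
    from AE_distrD[OF m this] show "AE z in cluster_law (\<nu> i) (m i) \<mu> \<beta>0 \<theta>0 (f i). obs_T j d z : \<T> d" unfolding PP .
    obtain p where p: "distributed (P i) lborel (obs_T j d) p" "AE t in lborel. t : \<T> d --> ennreal cl <= p t & p t <= ennreal C"
      using single ij by blast
    have "AE t in lborel. t : \<T> d --> ennreal cl <= p t & p t <= ennreal (max cl C)"
      using p(2) by eventually_elim (auto intro: order_trans[OF _ leC])
    then show "EX p. distributed (cluster_law (\<nu> i) (m i) \<mu> \<beta>0 \<theta>0 (f i)) lborel (obs_T j d) p &
        (AE t in lborel. t : \<T> d --> ennreal cl <= p t & p t <= ennreal (max cl C))"
      using p(1) unfolding PP by blast
  next
    fix i j d d' assume ij: "i < n" "j < m i" and d: "d ~= (d' :: 'd)"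
    have "(j, d) ~= (j, d')" using d by simp
    then obtain p where p: "distributed (P i) (lborel2) (%z. (obs_T j d z, obs_T j d' z)) p"
      "AE q in lborel2. q : \<T> d \<times> \<T> d' --> ennreal cl <= p q & p q <= ennreal C"
      using pair ij by blast
    have "AE q in lborel2. q : \<T> d \<times> \<T> d' --> p q <= ennreal (max cl C)"
      using p(2) by eventually_elim (auto intro: order_trans[OF _ leC])
    then show "EX p. distributed (cluster_law (\<nu> i) (m i) \<mu> \<beta>0 \<theta>0 (f i)) (lborel2) (%z. (obs_T j d z, obs_T j d' z)) p &
        (AE q in lborel2. q : \<T> d \<times> \<T> d' --> p q <= ennreal (max cl C))"
      using p(1) unfolding PP by blast
  next
    fix i j assume "i < n" "j < m i"
    from C\<mu>[rule_format, OF this] show "AE z in cluster_law (\<nu> i) (m i) \<mu> \<beta>0 \<theta>0 (f i). ALL s. \<bar>s - predictor \<beta>0 \<theta>0 j z\<bar> <= \<delta> --> \<bar>deriv \<mu> s\<bar> <= max 0 C\<mu>"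
      unfolding PP by eventually_elim (auto simp: le_max_iff_disj)
  next
    show "AE z in cluster_law (\<nu> i) (m i) \<mu> \<beta>0 \<theta>0 (f i). \<bar>obs_X j z $ k\<bar> <= max 1 BX" if "i < n" "j < m i" for i j k
      using X_bound[OF that] unfolding PP .
    show "0 <= max 0 C\<mu>" "cl <= max cl C" by simp_all
    show "V = (%d. L2_on (\<T> d)) \<or> V = (%d. L2_centred (\<T> d))" by (rule V)
    show "(\<mu> has_real_derivative deriv \<mu> t) (at t)" "c\<mu> <= deriv \<mu> t" for t using mu c\<mu>(2) by simp_all
  qed (rule cT cl mu_cont \<delta> c\<mu>(1))+
  define Pr where "Pr k psi \<longleftrightarrow> (ALL d. psi d : V d) &
     (AE om in D. efficient_score n m \<nu> \<mu> \<beta>0 \<theta>0 f V k om = (SUM i<n. scalar_prod (X_minus_psi (m i) k psi (om i))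
        (Delta_mat (m i) \<mu> \<beta>0 \<theta>0 (om i) *\<^sub>v (Sigma_inv (m i) (Pl i) (om i) *\<^sub>v Matrix.vec (m i) (resid (m i) \<mu> \<beta>0 \<theta>0 (om i)))))) &
     (ALL d. ALL \<eta>:V d. (ALL i<n. integrable (Pl i) (R.psi_integrand k psi d \<eta> i)) & (SUM i<n. \<integral>z. R.psi_integrand k psi d \<eta> i z \<partial>Pl i) = 0)" for k psi
  have "EX psi. Pr k psi" for k unfolding Pr_def by (rule R.efficient_score_formula)
  then obtain psis where "!!k. Pr k (psis k)" by metis
  then show ?thesis
    unfolding Pr_def R.psi_integrand_def[abs_def] PP by (intro exI[of _ psis] conjI allI) simp_all
qed

end
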